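(* Let $F$ be a field, $m$ a positive integer, and let $G$ be a subgroup of $GL(m,F)$. Suppose that every element of $G$ is almost right Engel. Then $G$ is finite-by-hypercentral, i.e. $G$ has a finite normal subgroup $N$ such that $G/N$ is hypercentral.
   Context: Commutators are left-normed: $[a_1,a_2,\dots,a_r]=[\dots[[a_1,a_2],a_3],\dots,a_r]$, with $[a,b]=a^{-1}b^{-1}ab$, and $[x,{}_n\,y]$ denotes $[x,y,\dots,y]$ with $y$ repeated $n$ times. A right Engel sink of $g\in G$ is a set $\mathcal R(g)\subseteq G$ such that for every $x\in G$ there is a positive integer $n(x,g)$ with $[g,{}_n\,x]\in\mathcal R(g)$ for all $n\ge n(x,g)$. An element $g$ is almost right Engel if it has a finite right Engel sink. A group is hypercentral if it coincides with the union of all terms of its (transfinite) upper central series. *)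

theory Defs
  imports "Jordan_Normal_Form.Matrix" "HOL-Algebra.Coset"
begin

definition GL :: "nat \<Rightarrow> ('a::field) mat monoid" where
  "GL m = \<lparr> carrier = {A \<in> carrier_mat m m. invertible_mat A}, mult = (*), one = 1\<^sub>m m \<rparr>"

definition comm :: "('a, 'b) monoid_scheme \<Rightarrow> 'a \<Rightarrow> 'a \<Rightarrow> 'a" where
  "comm H a b = inv\<^bsub>H\<^esub> a \<otimes>\<^bsub>H\<^esub> inv\<^bsub>H\<^esub> b \<otimes>\<^bsub>H\<^esub> a \<otimes>\<^bsub>H\<^esub> b"

fun engel_comm :: "('a, 'b) monoid_scheme \<Rightarrow> 'a \<Rightarrow> 'a \<Rightarrow> nat \<Rightarrow> 'a" where
  "engel_comm H g x 0 = g"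
| "engel_comm H g x (Suc n) = comm H (engel_comm H g x n) x"

definition right_engel_sink :: "('a, 'b) monoid_scheme \<Rightarrow> 'a \<Rightarrow> 'a set \<Rightarrow> bool" where
  "right_engel_sink H g R \<longleftrightarrow> R \<subseteq> carrier H \<and>
     (\<forall>x \<in> carrier H. \<exists>n > 0. \<forall>k \<ge> n. engel_comm H g x k \<in> R)"

definition almost_right_engel :: "('a, 'b) monoid_scheme \<Rightarrow> 'a \<Rightarrow> bool" where
  "almost_right_engel H g \<longleftrightarrow> (\<exists>R. finite R \<and> right_engel_sink H g R)"

text \<open>The hypercentre: union of the transfinite upper central series
  Z_0 = 1, Z_(a+1) = {x. for all g, [x,g] in Z_a}, unions at limits.  This union is exactly the
  least fixed point of the monotone operator S |-> {1} u {x in G. for all g in G. [x,g] in S},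
  obtained by transfinitely iterating that operator from the empty set.\<close>
inductive_set hypercenter :: "('a, 'b) monoid_scheme \<Rightarrow> 'a set" for H where
  one: "\<one>\<^bsub>H\<^esub> \<in> hypercenter H"
| step: "x \<in> carrier H \<Longrightarrow> (\<forall>g \<in> carrier H. comm H x g \<in> hypercenter H) \<Longrightarrow> x \<in> hypercenter H"

definition hypercentral :: "('a, 'b) monoid_scheme \<Rightarrow> bool" where
  "hypercentral H \<longleftrightarrow> hypercenter H = carrier H"

end

theory Submission
  imports Defs "HOL-Algebra.Algebra" "HOL-Algebra.Algebraic_Closure_Type" "Jordan_Normal_Form.Determinant" "HOL-Library.Function_Algebras"
begin

text \<open>
  The group \<open>G\<close> acts on a finite-dimensional space of bilinear matrix coefficients; the sets cut out by linear
  forms on it satisfy the descending chain condition, so \<open>G\<close> has a normal subgroup \<open>H\<close> of finite index that is not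
  covered by finitely many closed sets unless one of them contains it.

  For \<open>x \<in> G\<close>, finiteness of the sink of \<open>x\<inverse>\<close> and irreducibility of \<open>H\<close> force \<open>[v, x, \<dots>, x]\<close> into the centre of \<open>H\<close>
  for generic \<open>v \<in> H\<close>. Take \<open>y \<in> H\<close> with the maximal number of eigenvalues, stably under powers. A generic \<open>v\<close> is then
  linked to \<open>1\<close> by an Engel chain \<open>[v, y, \<dots>, y]\<close> along which elements permute the generalised eigenspaces of
  \<open>y\<close>, hence all of \<open>H\<close> commutes with the spectral idempotents of \<open>y\<close>. On each block some fixed power
  of every \<open>w \<in> H\<close> has one eigenvalue, so the traces of conjugation by \<open>w\<close> on \<open>H\<close>-invariant sections of the
  commutant are sums of roots of unity of bounded order, thus constant on \<open>H\<close>. A Burnside-type argument makes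
  \<open>H\<close> act unipotently by conjugation, and \<open>H\<close> is nilpotent.

  Dividing out the finitely many elements of the centre of \<open>H\<close> that are periodic under \<open>b \<mapsto> [b, x]\<close>, one
  may assume that \<open>H\<close> is right Engel; it then lies in the hypercentre of \<open>G\<close>. A group whose hypercentre has
  finite index and whose elements are almost right Engel has only finitely many Engel-periodic elements, which
  generate a finite subgroup; the quotient is an Engel group, finite modulo its hypercentre, hence hypercentral.
\<close>

subsection \<open>Commutators and Engel sequences\<close>

text \<open>Finiteness of a sink enters through periodicity: an Engel sequence that ends up in a
  finite set is eventually periodic, so where no nontrivial periodic elements exist it reaches 1.
  The main obstacle is that a right sink controls a fixed first entry against all second entries,
  whereas the connectedness argument needs a variable \<open>v\<close> in the first entry of
  \<open>[v, x, ..., x]\<close>. The identity \<open>engel_comm_swap\<close> conjugates this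
  sequence into one of the form \<open>[x^-1, u, ..., u]\<close> with \<open>u = v x v^-1\<close>,
  so the single finite sink of \<open>x^-1\<close> serves all \<open>v\<close> at once. Conditions
  on \<open>v x v^-1\<close> are bilinear in the matrices of \<open>v\<close> and of its inverse;
  this dictates the choice of coordinates for the closed sets. In the linear part the difficulty is
  the unipotent part of \<open>y\<close>, which blurs the eigenvalues of \<open>w y^n\<close>. It is
  removed in characteristic 0 by separating the exponential from the polynomial dependence on
  \<open>n\<close>, and in characteristic \<open>p\<close> by taking \<open>p\<close>-power
  exponents. Eigenvalue counts are made stable under powers by minimising, over all exponents, the
  maximal count on \<open>H\<close>.\<close>

definition engel_periodic :: "('a, 'b) monoid_scheme \<Rightarrow> 'a \<Rightarrow> 'a \<Rightarrow> bool" where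
 "engel_periodic H x p \<longleftrightarrow> (\<exists>k>0. engel_comm H p x k = p)"

lemma engel_comm_add:
 "engel_comm H (engel_comm H g x i) x j = engel_comm H g x (i + j)"
 by (induction j) auto

lemma engel_comm_Suc_left: "engel_comm H g x (Suc n) = engel_comm H (comm H g x) x n"
 using engel_comm_add[of H g x 1 n] by simp

lemma engel_comm_mult_period:
 assumes "engel_comm H p x k = p"
 shows "engel_comm H p x (k * j) = p"
proof (induction j)
 case (Suc j)
 have "engel_comm H p x (k * Suc j) = engel_comm H (engel_comm H p x (k * j)) x k"
  by (simp add: engel_comm_add algebra_simps)
 then show ?case using Suc assms by simp
qed simp

lemma engel_periodic_comm:
 assumes "engel_periodic H x p"
 shows "engel_periodic H x (comm H p x)"
proof -
 obtain k where k: "k > 0" "engel_comm H p x k = p"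
  using assms by (auto simp: engel_periodic_def)
 have "engel_comm H (comm H p x) x k = comm H (engel_comm H p x k) x"
  by (metis engel_comm.simps(2) engel_comm_Suc_left)
 then show ?thesis using k by (auto simp: engel_periodic_def)
qed

lemma engel_periodic_engel_comm:
 "engel_periodic H x p \<Longrightarrow> engel_periodic H x (engel_comm H p x n)"
 by (induction n) (auto intro: engel_periodic_comm)

lemma engel_periodic_common_period:
 assumes "engel_periodic H x p" "engel_periodic H' y q"
 obtains k where "k > 0" "engel_comm H p x k = p" "engel_comm H' q y k = q"
proof -
 obtain i j where "i > 0" "engel_comm H p x i = p" "j > 0" "engel_comm H' q y j = q"
  using assms by (auto simp: engel_periodic_def)
 then have "i * j > 0" "engel_comm H p x (i * j) = p" "engel_comm H' q y (i * j) = q"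
  using engel_comm_mult_period[of H p x i j] engel_comm_mult_period[of H' q y j i]
  by (auto simp: mult.commute)
 then show ?thesis using that by blast
qed

context group
begin

lemma inv_cancel_left [simp]:
 "x \<in> carrier G \<Longrightarrow> y \<in> carrier G \<Longrightarrow> inv x \<otimes> (x \<otimes> y) = y"
 by (simp add: m_assoc[symmetric])

lemma cancel_inv_left [simp]:
 "x \<in> carrier G \<Longrightarrow> y \<in> carrier G \<Longrightarrow> x \<otimes> (inv x \<otimes> y) = y"
 by (simp add: m_assoc[symmetric])

lemmas word_simps = m_assoc inv_mult_group comm_def

lemma comm_closed [simp, intro]:
 "a \<in> carrier G \<Longrightarrow> b \<in> carrier G \<Longrightarrow> comm G a b \<in> carrier G"
 by (simp add: comm_def)

lemma engel_comm_closed [simp, intro]: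
 "a \<in> carrier G \<Longrightarrow> b \<in> carrier G \<Longrightarrow> engel_comm G a b n \<in> carrier G"
 by (induction n) auto

lemma comm_eq_one_iff:
 assumes "a \<in> carrier G" "b \<in> carrier G"
 shows "comm G a b = \<one> \<longleftrightarrow> a \<otimes> b = b \<otimes> a"
proof -
 have "comm G a b = inv (b \<otimes> a) \<otimes> (a \<otimes> b)" using assms by (simp add: word_simps)
 then show ?thesis
  using assms by (metis inv_closed inv_solve_left l_inv m_closed r_one)
qed

lemma comm_one_left [simp]: "b \<in> carrier G \<Longrightarrow> comm G \<one> b = \<one>"
 by (simp add: comm_def)

lemma comm_one_right [simp]: "b \<in> carrier G \<Longrightarrow> comm G b \<one> = \<one>"
 by (simp add: comm_def)

lemma comm_self [simp]: "b \<in> carrier G \<Longrightarrow> comm G b b = \<one>"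
 by (simp add: comm_eq_one_iff)

lemma engel_comm_one [simp]: "x \<in> carrier G \<Longrightarrow> engel_comm G \<one> x n = \<one>"
 by (induction n) auto

lemma inv_comm: "a \<in> carrier G \<Longrightarrow> b \<in> carrier G \<Longrightarrow> inv (comm G a b) = comm G b a"
 by (simp add: word_simps)

lemma conj_eq_mult_comm:
 "a \<in> carrier G \<Longrightarrow> b \<in> carrier G \<Longrightarrow> inv b \<otimes> a \<otimes> b = a \<otimes> comm G a b"
 by (simp add: word_simps)

lemma comm_mult_left:
 "\<lbrakk>a \<in> carrier G; b \<in> carrier G; c \<in> carrier G\<rbrakk>
  \<Longrightarrow> comm G (a \<otimes> b) c = inv b \<otimes> comm G a c \<otimes> b \<otimes> comm G b c"
 by (simp add: word_simps)

lemma comm_mult_right: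
 "\<lbrakk>a \<in> carrier G; b \<in> carrier G; c \<in> carrier G\<rbrakk>
  \<Longrightarrow> comm G a (b \<otimes> c) = comm G a c \<otimes> (inv c \<otimes> comm G a b \<otimes> c)"
 by (simp add: word_simps)

lemma comm_conj:
 "\<lbrakk>a \<in> carrier G; b \<in> carrier G; c \<in> carrier G\<rbrakk>
  \<Longrightarrow> comm G (inv c \<otimes> a \<otimes> c) (inv c \<otimes> b \<otimes> c) = inv c \<otimes> comm G a b \<otimes> c"
 by (simp add: word_simps)

lemma comm_inv_left:
 "\<lbrakk>a \<in> carrier G; b \<in> carrier G\<rbrakk> \<Longrightarrow> comm G (inv a) b = a \<otimes> inv (comm G a b) \<otimes> inv a"
 by (simp add: word_simps)

lemma engel_comm_conj:
 assumes "a \<in> carrier G" "b \<in> carrier G" "c \<in> carrier G"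
 shows "engel_comm G (inv c \<otimes> a \<otimes> c) (inv c \<otimes> b \<otimes> c) n = inv c \<otimes> engel_comm G a b n \<otimes> c"
 using assms by (induction n) (simp_all add: comm_conj)

lemma engel_periodic_conj:
 assumes "a \<in> carrier G" "b \<in> carrier G" "c \<in> carrier G" "engel_periodic G b a"
 shows "engel_periodic G (inv c \<otimes> b \<otimes> c) (inv c \<otimes> a \<otimes> c)"
 using assms by (auto simp: engel_periodic_def engel_comm_conj)

lemma hom_comm:
 assumes "group K" "f \<in> hom G K" "a \<in> carrier G" "b \<in> carrier G"
 shows "f (comm G a b) = comm K (f a) (f b)"
proof -
 interpret K: group K by fact
 interpret f: group_hom G K f by unfold_locales fact
 show ?thesis using assms by (simp add: comm_def)
qed

lemma hom_engel_comm:
 assumes "group K" "f \<in> hom G K" "a \<in> carrier G" "b \<in> carrier G"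
 shows "f (engel_comm G a b n) = engel_comm K (f a) (f b) n"
 using assms by (induction n) (simp_all add: hom_comm)

lemma comm_subgroup:
 assumes "subgroup H G" "a \<in> H" "b \<in> H"
 shows "comm (G\<lparr>carrier := H\<rparr>) a b = comm G a b"
 using assms by (simp add: comm_def m_inv_consistent)

lemma comm_in_subgroup:
 assumes "subgroup H G" "a \<in> H" "b \<in> H"
 shows "comm G a b \<in> H"
 using assms by (simp add: comm_def subgroup.m_closed subgroup.m_inv_closed)

lemma engel_comm_in_subgroup:
 assumes "subgroup H G" "a \<in> H" "b \<in> H"
 shows "engel_comm G a b n \<in> H"
 using assms by (induction n) (auto intro: comm_in_subgroup)

lemma engel_comm_subgroup:
 assumes "subgroup H G" "a \<in> H" "b \<in> H"
 shows "engel_comm (G\<lparr>carrier := H\<rparr>) a b n = engel_comm G a b n"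
 using assms by (induction n) (simp_all add: comm_subgroup engel_comm_in_subgroup)

text \<open>By pigeonhole some value of the sequence recurs, and since each term determines the next
  one, all terms from the first of the two occurrences onwards are periodic.\<close>

lemma almost_right_engel_eventually_periodic:
 assumes "almost_right_engel G g" "g \<in> carrier G" "x \<in> carrier G"
 obtains n where "\<And>i. i \<ge> n \<Longrightarrow> engel_periodic G x (engel_comm G g x i)"
proof -
 obtain R n where R: "finite R" "\<And>k. k \<ge> n \<Longrightarrow> engel_comm G g x k \<in> R"
  using assms unfolding almost_right_engel_def right_engel_sink_def by metis
 have "\<not> inj_on (engel_comm G g x) {n..}"
  using R finite_subset[of "engel_comm G g x ` {n..}" R] infinite_Ici[of n] finite_imageD by blast
 then obtain i j where ij: "i < j" "engel_comm G g x i = engel_comm G g x j"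
  by (metis inj_onI linorder_neqE_nat)
 have "engel_comm G (engel_comm G g x i) x (j - i) = engel_comm G g x i"
  using ij engel_comm_add[of G g x i "j - i"] by (metis le_add_diff_inverse less_imp_le)
 then have i: "engel_periodic G x (engel_comm G g x i)"
  unfolding engel_periodic_def using ij(1) by (intro exI[of _ "j - i"]) simp
 have "engel_periodic G x (engel_comm G g x k)" if "k \<ge> i" for k
  using engel_periodic_engel_comm[OF i, of "k - i"] that by (simp add: engel_comm_add)
 then show ?thesis using that by blast
qed

text \<open>The element \<open>y = x v\<close> acts on \<open>B\<close> as \<open>x\<close> does and satisfies \<open>[x, y] = p\<close>, so the
 Engel sequence of \<open>x\<close> and \<open>y\<close> runs through the cycle of \<open>p\<close>.\<close>
lemma engel_periodic_in_sink:
 assumes B: "subgroup B G" "\<And>a b. a \<in> B \<Longrightarrow> b \<in> B \<Longrightarrow> a \<otimes> b = b \<otimes> a"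
  and x: "x \<in> carrier G" "\<And>b. b \<in> B \<Longrightarrow> inv x \<otimes> b \<otimes> x \<in> B"
  and R: "right_engel_sink G x R" and p: "p \<in> B" "engel_periodic G x p"
 shows "p \<in> R"
proof -
 have BG: "b \<in> carrier G" if "b \<in> B" for b by (rule subgroup.mem_carrier[OF B(1) that])
 have cB: "comm G b x \<in> B" if "b \<in> B" for b
 proof -
  have "comm G b x = inv b \<otimes> (inv x \<otimes> b \<otimes> x)" using BG[OF that] x(1) by (simp add: word_simps)
  then show ?thesis using that x(2)[OF that] B(1) by (simp add: subgroup.m_closed subgroup.m_inv_closed)
 qed
 have eB: "engel_comm G p x n \<in> B" for n
  by (induction n) (use p(1) cB in auto)
 obtain k where k: "k > 0" "engel_comm G p x k = p" using p by (auto simp: engel_periodic_def)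
 \<comment> \<open>The predecessor of \<open>p\<close> on its cycle, so that
   \<open>[q, x] = p\<close>; the element \<open>v\<close> announced above is its inverse.\<close>
 define q where "q = engel_comm G p x (k - 1)"
 have q: "q \<in> B" "comm G q x = p"
  using eB[of "k - 1"] k engel_comm.simps(2)[of G p x "k - 1"] unfolding q_def by auto
 define y where "y = x \<otimes> inv q"
 have y: "y \<in> carrier G" using q BG x by (simp add: y_def)
 have "comm G x y = (inv x \<otimes> q \<otimes> x) \<otimes> inv q"
  using x(1) BG[OF q(1)] by (simp add: y_def word_simps)
 also have "\<dots> = inv q \<otimes> (inv x \<otimes> q \<otimes> x)"
  using B(2)[OF x(2)[OF q(1)] subgroup.m_inv_closed[OF B(1) q(1)]] .
 also have "\<dots> = comm G q x" using x(1) BG[OF q(1)] by (simp add: word_simps)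
 also have "\<dots> = p" by (rule q(2))
 finally have xy: "comm G x y = p" .
 have cy: "comm G b y = comm G b x" if "b \<in> B" for b
 proof -
  have "comm G b y = inv b \<otimes> (q \<otimes> (inv x \<otimes> b \<otimes> x) \<otimes> inv q)"
   using x(1) BG[OF q(1)] BG[OF that] by (simp add: y_def word_simps)
  also have "q \<otimes> (inv x \<otimes> b \<otimes> x) = (inv x \<otimes> b \<otimes> x) \<otimes> q" by (rule B(2)[OF q(1) x(2)[OF that]])
  finally show ?thesis using x(1) BG[OF q(1)] BG[OF that] by (simp add: word_simps)
 qed
 have py: "engel_comm G p y n = engel_comm G p x n" for n
  by (induction n) (use cy eB in auto)
 obtain n where n: "\<And>i. i \<ge> n \<Longrightarrow> engel_comm G x y i \<in> R"
  using R y unfolding right_engel_sink_def by metis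
 \<comment> \<open>One step leads from \<open>x\<close> to \<open>p\<close>, and every further
   \<open>k\<close> steps return to \<open>p\<close>; the index is such a return beyond the
   threshold \<open>n\<close> of the sink.\<close>
 have "engel_comm G x y (Suc (k * n)) = engel_comm G p x (k * n)"
  by (simp only: engel_comm_Suc_left xy py)
 then have "engel_comm G x y (Suc (k * n)) = p" using engel_comm_mult_period k by metis
 moreover have "Suc (k * n) \<ge> n" using k(1) by (simp add: le_SucI)
 ultimately show ?thesis using n by metis
qed

text \<open>Conjugation by \<open>v x\<close> carries \<open>x\<close> to
  \<open>z = v x v^-1\<close> and \<open>[v, x]\<close> to \<open>z x^-1\<close>. The factor
  \<open>z\<close> commutes with \<open>z\<close> and drops out of the next commutator, which
  accounts for the difference of one between the two lengths.\<close>

lemma engel_comm_swap: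
 assumes "v \<in> carrier G" "x \<in> carrier G"
 shows "engel_comm G v x (Suc (Suc n))
  = inv (v \<otimes> x) \<otimes> engel_comm G (inv x) (v \<otimes> x \<otimes> inv v) (Suc n) \<otimes> (v \<otimes> x)"
proof (induction n)
 case 0
 show ?case using assms by (simp add: word_simps)
next
 case (Suc n)
 define w where "w = engel_comm G (inv x) (v \<otimes> x \<otimes> inv v) (Suc n)"
 have w: "w \<in> carrier G" using assms by (simp add: w_def del: engel_comm.simps)
 have "engel_comm G v x (Suc (Suc (Suc n))) = comm G (inv (v \<otimes> x) \<otimes> w \<otimes> (v \<otimes> x)) x"
  using Suc by (simp only: engel_comm.simps(2)[of _ _ _ "Suc (Suc n)"] w_def)
 also have "\<dots> = inv (v \<otimes> x) \<otimes> comm G w (v \<otimes> x \<otimes> inv v) \<otimes> (v \<otimes> x)"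
  using assms w by (simp add: word_simps)
 finally show ?case by (simp only: w_def engel_comm.simps(2)[of _ _ _ "Suc n"])
qed

end


subsection \<open>Connected subgroups\<close>

text \<open>The sets satisfying \<open>closed\<close> play the role of Zariski closed sets; \<open>H\<close> is an irreducible
 subset with respect to them.\<close>
locale connected_subgroup = group G for G (structure) +
 fixes H :: "'a set" and closed :: "'a set \<Rightarrow> bool"
 assumes H_normal: "H \<lhd> G"
  and finite_index: "finite (rcosets H)"
  and almost_engel: "g \<in> carrier G \<Longrightarrow> almost_right_engel G g"
  and irreducible: "\<lbrakk>finite \<A>; \<And>Y. Y \<in> \<A> \<Longrightarrow> closed Y; H \<subseteq> \<Union>\<A>\<rbrakk> \<Longrightarrow> \<exists>Y\<in>\<A>. H \<subseteq> Y"
  and closed_translate: "\<lbrakk>closed Y; g \<in> carrier G\<rbrakk> \<Longrightarrow> closed {v \<in> carrier G. g \<otimes> v \<in> Y}"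
  and closed_comm: "\<lbrakk>x \<in> carrier G; Y \<subseteq> carrier G; s ` Y \<subseteq> carrier G\<rbrakk>
   \<Longrightarrow> closed {v \<in> carrier G. \<forall>h\<in>Y. comm G h (v \<otimes> x \<otimes> inv v) = s h}"
  and closed_conj: "\<lbrakk>h \<in> carrier G; k \<in> carrier G\<rbrakk> \<Longrightarrow> closed {v \<in> carrier G. h \<otimes> v = v \<otimes> k}"
begin

sublocale H: normal H G by (rule H_normal)

lemma H_carrier [simp, intro]: "h \<in> H \<Longrightarrow> h \<in> carrier G"
 by (rule H.mem_carrier)

text \<open>The exceptional set is given as a finite family because sets defined by linear
  conditions are not stable under finite unions.\<close>

definition generic :: "('a \<Rightarrow> bool) \<Rightarrow> bool" where
 "generic P \<longleftrightarrow> (\<exists>\<A>. finite \<A> \<and> (\<forall>Y\<in>\<A>. closed Y \<and> \<not> H \<subseteq> Y) \<and> (\<forall>v\<in>H. v \<notin> \<Union>\<A> \<longrightarrow> P v))"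

text \<open>Members of the family that contain \<open>H\<close> impose no restriction and are
  discarded. What remains for a generic \<open>v\<close> is this: a condition from the family that
  holds at \<open>v\<close> holds on all of \<open>H\<close>.\<close>

lemma genericI:
 assumes "finite \<A>" "\<And>Y. Y \<in> \<A> \<Longrightarrow> closed Y" "\<And>v. \<lbrakk>v \<in> H; \<And>Y. \<lbrakk>Y \<in> \<A>; v \<in> Y\<rbrakk> \<Longrightarrow> H \<subseteq> Y\<rbrakk> \<Longrightarrow> P v"
 shows "generic P"
 unfolding generic_def
 by (rule exI[of _ "{Y \<in> \<A>. \<not> H \<subseteq> Y}"]) (use assms in auto)

lemma generic_mono:
 assumes "generic P" "\<And>v. v \<in> H \<Longrightarrow> P v \<Longrightarrow> Q v"
 shows "generic Q"
proof -
 obtain \<A> where "finite \<A>" "\<forall>Y\<in>\<A>. closed Y \<and> \<not> H \<subseteq> Y" "\<forall>v\<in>H. v \<notin> \<Union>\<A> \<longrightarrow> P v"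
  using assms(1) unfolding generic_def by (elim exE conjE)
 then show ?thesis unfolding generic_def using assms(2) by (intro exI[of _ \<A>]) simp
qed

lemma generic_conj:
 assumes "generic P" "generic Q"
 shows "generic (\<lambda>v. P v \<and> Q v)"
proof -
 obtain \<A> where Y: "finite \<A>" "\<forall>Y\<in>\<A>. closed Y \<and> \<not> H \<subseteq> Y" "\<forall>v\<in>H. v \<notin> \<Union>\<A> \<longrightarrow> P v"
  using assms(1) unfolding generic_def by (elim exE conjE)
 obtain \<B> where Z: "finite \<B>" "\<forall>Y\<in>\<B>. closed Y \<and> \<not> H \<subseteq> Y" "\<forall>v\<in>H. v \<notin> \<Union>\<B> \<longrightarrow> Q v"
  using assms(2) unfolding generic_def by (elim exE conjE)
 show ?thesis unfolding generic_def
  by (rule exI[of _ "\<A> \<union> \<B>"]) (use Y Z in auto)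
qed

lemma generic_cover:
 assumes "generic (\<lambda>v. v \<in> \<Union>\<A>)" "finite \<A>" "\<And>Y. Y \<in> \<A> \<Longrightarrow> closed Y"
 obtains Y where "Y \<in> \<A>" "H \<subseteq> Y"
proof -
 obtain \<B> where Z: "finite \<B>" "\<forall>Y\<in>\<B>. closed Y \<and> \<not> H \<subseteq> Y" "\<forall>v\<in>H. v \<notin> \<Union>\<B> \<longrightarrow> v \<in> \<Union>\<A>"
  using assms(1) unfolding generic_def by (elim exE conjE)
 have "\<exists>Y\<in>\<A> \<union> \<B>. H \<subseteq> Y"
  by (rule irreducible) (use Z assms in auto)
 then show ?thesis using Z that by blast
qed

lemma generic_ex:
 assumes "generic P"
 obtains v where "v \<in> H" "P v"
proof (rule ccontr)
 assume "\<not> thesis"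
 then have "generic (\<lambda>v. v \<in> \<Union>{})" using generic_mono[OF assms] that by blast
 then show False using generic_cover[of "{}"] by auto
qed

text \<open>For \<open>h\<close> in \<open>H\<close>, a generic \<open>v\<close> has both
  \<open>v\<close> and \<open>h v\<close> in \<open>D\<close>, because translates of exceptional
  sets are exceptional; then \<open>h = (h v) v^-1\<close> lies in \<open>D\<close>.\<close>

lemma generic_subgroup:
 assumes D: "subgroup D G" and gen: "generic (\<lambda>v. v \<in> D)"
 shows "H \<subseteq> D"
proof
 fix h assume h: "h \<in> H"
 obtain \<A> where Y: "finite \<A>" "\<forall>Y\<in>\<A>. closed Y \<and> \<not> H \<subseteq> Y" "\<forall>v\<in>H. v \<notin> \<Union>\<A> \<longrightarrow> v \<in> D"
  using gen unfolding generic_def by (elim exE conjE)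
 have "generic (\<lambda>v. h \<otimes> v \<in> D)"
 proof (rule genericI[of "(\<lambda>Y. {v \<in> carrier G. h \<otimes> v \<in> Y}) ` \<A>"])
  show "finite ((\<lambda>Y. {v \<in> carrier G. h \<otimes> v \<in> Y}) ` \<A>)" using Y(1) by simp
  show "closed Z" if "Z \<in> (\<lambda>Y. {v \<in> carrier G. h \<otimes> v \<in> Y}) ` \<A>" for Z
   using that Y(2) h closed_translate by auto
 next
  fix v assume v: "v \<in> H"
   and gv: "\<And>Z. \<lbrakk>Z \<in> (\<lambda>Y. {v \<in> carrier G. h \<otimes> v \<in> Y}) ` \<A>; v \<in> Z\<rbrakk> \<Longrightarrow> H \<subseteq> Z"
  have "h \<otimes> v \<notin> Y" if YY: "Y \<in> \<A>" for Y
  proof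
   assume "h \<otimes> v \<in> Y"
   then have sub: "H \<subseteq> {v \<in> carrier G. h \<otimes> v \<in> Y}" using gv YY v by auto
   have "w \<in> Y" if w: "w \<in> H" for w
   proof -
    have "inv h \<otimes> w \<in> H" using h w by simp
    then have "h \<otimes> (inv h \<otimes> w) \<in> Y" using sub by blast
    then show ?thesis using h w by simp
   qed
   then show False using Y(2) YY by blast
  qed
  moreover have "h \<otimes> v \<in> H" using h v by simp
  ultimately show "h \<otimes> v \<in> D" using Y(3) by blast
 qed
 from generic_conj[OF gen this] obtain v where v: "v \<in> D" "h \<otimes> v \<in> D" "v \<in> H"
  by (rule generic_ex) blast
 have "(h \<otimes> v) \<otimes> inv v \<in> D" using v D by (simp add: subgroup.m_closed subgroup.m_inv_closed)
 then show "h \<in> D" using h v by (simp add: m_assoc)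
qed

text \<open>For each conjugate \<open>k\<close>, the \<open>v\<close> with \<open>h v = v k\<close>
  form a closed set, and finitely many of these cover \<open>H\<close>. One of them contains
  \<open>H\<close>, in particular 1, which forces \<open>k = h\<close>.\<close>

lemma finite_class_central:
 assumes h: "h \<in> carrier G" and fin: "finite {inv v \<otimes> h \<otimes> v |v. v \<in> H}" and w: "w \<in> H"
 shows "h \<otimes> w = w \<otimes> h"
proof -
 let ?C = "{inv v \<otimes> h \<otimes> v |v. v \<in> H}"
 have CG: "k \<in> carrier G" if "k \<in> ?C" for k using that h by auto
 have "\<exists>Y\<in>(\<lambda>k. {v \<in> carrier G. h \<otimes> v = v \<otimes> k}) ` ?C. H \<subseteq> Y"
 proof (rule irreducible)
  show "finite ((\<lambda>k. {v \<in> carrier G. h \<otimes> v = v \<otimes> k}) ` ?C)" using fin by simp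
  show "closed Y" if "Y \<in> (\<lambda>k. {v \<in> carrier G. h \<otimes> v = v \<otimes> k}) ` ?C" for Y
   using that closed_conj[OF h CG] by blast
  show "H \<subseteq> \<Union>((\<lambda>k. {v \<in> carrier G. h \<otimes> v = v \<otimes> k}) ` ?C)"
  proof
   fix v assume v: "v \<in> H"
   then have "h \<otimes> v = v \<otimes> (inv v \<otimes> h \<otimes> v)" using h by (simp add: m_assoc)
   then show "v \<in> \<Union>((\<lambda>k. {v \<in> carrier G. h \<otimes> v = v \<otimes> k}) ` ?C)" using v by blast
  qed
 qed
 then obtain k where k: "k \<in> ?C" "H \<subseteq> {v \<in> carrier G. h \<otimes> v = v \<otimes> k}" by blast
 have "h \<otimes> \<one> = \<one> \<otimes> k" using k(2) H.one_closed by blast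
 then have "h = k" using h CG[OF k(1)] by simp
 then show ?thesis using k w by blast
qed

definition centre :: "'a set" where
 "centre = {z \<in> H. \<forall>h\<in>H. z \<otimes> h = h \<otimes> z}"

lemma centre_carrier: "z \<in> centre \<Longrightarrow> z \<in> carrier G"
 by (simp add: centre_def)

lemma centre_commute: "z \<in> centre \<Longrightarrow> h \<in> H \<Longrightarrow> z \<otimes> h = h \<otimes> z"
 by (simp add: centre_def)

lemma conj_H: "h \<in> H \<Longrightarrow> g \<in> carrier G \<Longrightarrow> inv g \<otimes> h \<otimes> g \<in> H"
 by (rule H.inv_op_closed1)

lemma centre_conj:
 assumes "z \<in> centre" "g \<in> carrier G"
 shows "inv g \<otimes> z \<otimes> g \<in> centre"
proof -
 have z: "z \<in> H" "z \<in> carrier G" using assms by (auto simp: centre_def)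
 have "inv g \<otimes> z \<otimes> g \<otimes> h = h \<otimes> (inv g \<otimes> z \<otimes> g)" if h: "h \<in> H" for h
 proof -
  have gh: "g \<otimes> h \<otimes> inv g \<in> H" using h assms(2) by (rule H.inv_op_closed2[rotated])
  have "inv g \<otimes> z \<otimes> g \<otimes> h = inv g \<otimes> (z \<otimes> (g \<otimes> h \<otimes> inv g)) \<otimes> g"
   using z(2) h assms(2) by (simp add: m_assoc)
  also have "z \<otimes> (g \<otimes> h \<otimes> inv g) = (g \<otimes> h \<otimes> inv g) \<otimes> z"
   by (rule centre_commute[OF assms(1) gh])
  finally show ?thesis using z(2) h assms(2) by (simp add: m_assoc)
 qed
 then show ?thesis using z assms(2) by (auto simp: centre_def intro: conj_H)
qed

lemma commutes_mult:
 assumes "a \<in> carrier G" "b \<in> carrier G" "c \<in> carrier G" "c \<otimes> a = a \<otimes> c" "c \<otimes> b = b \<otimes> c"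
 shows "c \<otimes> (a \<otimes> b) = (a \<otimes> b) \<otimes> c"
 by (metis assms m_assoc)

lemma commutes_inv:
 assumes "a \<in> carrier G" "c \<in> carrier G" "c \<otimes> a = a \<otimes> c"
 shows "c \<otimes> inv a = inv a \<otimes> c"
 using assms by (metis inv_closed inv_solve_left inv_solve_right m_assoc m_closed)

lemma commutes_conj_iff:
 assumes "a \<in> carrier G" "c \<in> carrier G" "g \<in> carrier G"
 shows "(inv g \<otimes> c \<otimes> g) \<otimes> a = a \<otimes> (inv g \<otimes> c \<otimes> g)
   \<longleftrightarrow> c \<otimes> (g \<otimes> a \<otimes> inv g) = (g \<otimes> a \<otimes> inv g) \<otimes> c"
proof -
 have "c \<otimes> (g \<otimes> a \<otimes> inv g) = g \<otimes> ((inv g \<otimes> c \<otimes> g) \<otimes> a) \<otimes> inv g"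
  "(g \<otimes> a \<otimes> inv g) \<otimes> c = g \<otimes> (a \<otimes> (inv g \<otimes> c \<otimes> g)) \<otimes> inv g"
  using assms by (simp_all add: m_assoc)
 moreover have "g \<otimes> p \<otimes> inv g = g \<otimes> q \<otimes> inv g \<longleftrightarrow> p = q" if "p \<in> carrier G" "q \<in> carrier G" for p q
  using that assms(3) by simp
 ultimately show ?thesis using assms by (metis inv_closed m_closed)
qed

text \<open>The elements \<open>s v = x\<^sup>-\<^sup>1 v x v\<^sup>-\<^sup>1\<close> generate the group \<open>K\<close>; \<open>C\<close> is its centraliser, \<open>D\<close> the
 double centraliser, and the periodic elements of the abelian group \<open>C \<inter> D \<inter> H\<close> form a finite
 \<open>H\<close>-invariant set. Generic \<open>v\<close> drive the Engel sequence into that set.\<close>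
lemma generic_engel_centre:
 assumes x: "x \<in> carrier G"
 shows "generic (\<lambda>v. \<exists>n. engel_comm G v x n \<in> centre)"
proof -
 define s where "s v = inv x \<otimes> v \<otimes> x \<otimes> inv v" for v
 define C where "C = {c \<in> carrier G. \<forall>v\<in>H. c \<otimes> s v = s v \<otimes> c}"
 define D where "D = {d \<in> carrier G. \<forall>c\<in>C. c \<otimes> d = d \<otimes> c}"
 define B where "B = C \<inter> D \<inter> H"
 have sH: "s v \<in> H" if "v \<in> H" for v
  using that x conj_H[OF that x] by (simp add: s_def)
 have sG: "s v \<in> carrier G" if "v \<in> H" for v using sH that by blast
 have CG: "c \<in> carrier G" if "c \<in> C" for c using that by (simp add: C_def)
 have DG: "d \<in> carrier G" if "d \<in> D" for d using that by (simp add: D_def)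
 have BG: "b \<in> carrier G" if "b \<in> B" for b using that by (simp add: B_def D_def)
 have Cs: "c \<otimes> s v = s v \<otimes> c" if "c \<in> C" "v \<in> H" for c v using that by (simp add: C_def)
 have CD: "c \<otimes> d = d \<otimes> c" if "c \<in> C" "d \<in> D" for c d using that by (simp add: D_def)
 have sD: "s v \<in> D" if "v \<in> H" for v using that sG Cs by (simp add: D_def)
 have sx: "x \<otimes> s v \<otimes> inv x = s (x \<otimes> v \<otimes> inv x)" "inv x \<otimes> s v \<otimes> x = s (inv x \<otimes> v \<otimes> x)"
  if "v \<in> H" for v
  using that x by (simp_all add: s_def m_assoc inv_mult_group)
 \<comment> \<open>Together with \<open>sx\<close> this shows that \<open>x\<close> and
   \<open>H\<close> normalise the group generated by the \<open>s v\<close>, hence also its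
   centraliser \<open>C\<close> and double centraliser \<open>D\<close>.\<close>
 have sw: "w \<otimes> s v \<otimes> inv w = inv (s w) \<otimes> s (w \<otimes> v)" if "v \<in> H" "w \<in> H" for v w
  using that x by (simp add: s_def m_assoc inv_mult_group)
 have vH: "x \<otimes> v \<otimes> inv x \<in> H" "inv x \<otimes> v \<otimes> x \<in> H" if "v \<in> H" for v
  using that x by (auto intro: H.inv_op_closed1 H.inv_op_closed2)
 have Cx: "inv x \<otimes> c \<otimes> x \<in> C" if "c \<in> C" for c
  using that CG[OF that] x sG Cs[OF that] vH
  by (auto simp: C_def commutes_conj_iff sx)
 have Cxi: "x \<otimes> c \<otimes> inv x \<in> C" if "c \<in> C" for c
 proof -
  have "(inv (inv x) \<otimes> c \<otimes> inv x) \<otimes> s v = s v \<otimes> (inv (inv x) \<otimes> c \<otimes> inv x)" if v: "v \<in> H" for v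
   by (subst commutes_conj_iff) (use v CG[OF \<open>c \<in> C\<close>] x sG Cs[OF \<open>c \<in> C\<close>] vH sx in auto)
  then show ?thesis using CG[OF that] x by (simp add: C_def)
 qed
 have Cw: "inv w \<otimes> c \<otimes> w \<in> C" if c: "c \<in> C" and w: "w \<in> H" for c w
 proof -
  have "c \<otimes> (inv (s w) \<otimes> s (w \<otimes> v)) = (inv (s w) \<otimes> s (w \<otimes> v)) \<otimes> c" if v: "v \<in> H" for v
   by (rule commutes_mult) (use sG w v CG[OF c] Cs[OF c] in \<open>auto intro: commutes_inv\<close>)
  then show ?thesis
   using CG[OF c] w sG by (auto simp: C_def commutes_conj_iff sw)
 qed
 have Dconj: "inv g \<otimes> d \<otimes> g \<in> D" if d: "d \<in> D" and g: "g \<in> carrier G"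
  and Cg: "\<And>c. c \<in> C \<Longrightarrow> g \<otimes> c \<otimes> inv g \<in> C" for d g
 proof -
  have "c \<otimes> (inv g \<otimes> d \<otimes> g) = (inv g \<otimes> d \<otimes> g) \<otimes> c" if c: "c \<in> C" for c
   using commutes_conj_iff[OF CG[OF c] DG[OF d] g] CD[OF Cg[OF c] d] by simp
  then show ?thesis using DG[OF d] g by (simp add: D_def)
 qed
 have Dx: "inv x \<otimes> d \<otimes> x \<in> D" if "d \<in> D" for d using Dconj[OF that x Cxi] by simp
 have Dxi: "x \<otimes> d \<otimes> inv x \<in> D" if "d \<in> D" for d
  using Dconj[OF that, of "inv x"] x Cx by simp
 have Dw: "inv w \<otimes> d \<otimes> w \<in> D" if "d \<in> D" "w \<in> H" for d w
  using Dconj[OF that(1), of w] Cw[of _ "inv w"] that(2) by simp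
 have Dsub: "subgroup D G"
 proof (rule subgroupI)
  show "D \<subseteq> carrier G" using DG by blast
  have "\<one> \<in> D" by (simp add: D_def C_def)
  then show "D \<noteq> {}" by blast
  show "inv d \<in> D" if "d \<in> D" for d
   using that commutes_inv[OF DG[OF that] CG CD[OF _ that]] by (simp add: D_def)
  show "a \<otimes> b \<in> D" if "a \<in> D" "b \<in> D" for a b
   using that commutes_mult[OF DG[OF that(1)] DG[OF that(2)] CG CD[OF _ that(1)] CD[OF _ that(2)]]
   by (simp add: D_def)
 qed
 have Csub: "subgroup C G"
 proof (rule subgroupI)
  show "C \<subseteq> carrier G" using CG by blast
  have "\<one> \<in> C" using sG by (simp add: C_def)
  then show "C \<noteq> {}" by blast
  show "inv c \<in> C" if "c \<in> C" for c
   using CG[OF that] commutes_inv[OF CG[OF that] sG Cs[OF that, symmetric]] by (simp add: C_def)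
  show "a \<otimes> b \<in> C" if "a \<in> C" "b \<in> C" for a b
   using CG[OF that(1)] CG[OF that(2)]
    commutes_mult[OF CG[OF that(1)] CG[OF that(2)] sG Cs[OF that(1), symmetric] Cs[OF that(2), symmetric]]
   by (simp add: C_def)
 qed
 have Bsub: "subgroup B G"
  unfolding B_def using Csub Dsub H.subgroup_axioms by (intro subgroups_Inter_pair) auto
 have Bcomm: "a \<otimes> b = b \<otimes> a" if "a \<in> B" "b \<in> B" for a b
  by (rule CD) (use that in \<open>auto simp: B_def\<close>)
 have Bx: "inv x \<otimes> b \<otimes> x \<in> B" if "b \<in> B" for b
  using that Cx Dx vH by (simp add: B_def)
 have Bw: "inv w \<otimes> b \<otimes> w \<in> B" if "b \<in> B" "w \<in> H" for b w
  using that Cw Dw by (simp add: B_def)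
 define P where "P = {b \<in> B. engel_periodic G x b}"
 obtain R0 where R0: "finite R0" "right_engel_sink G x R0"
  using almost_engel[OF x] by (auto simp: almost_right_engel_def)
 have "P \<subseteq> R0"
  using engel_periodic_in_sink[OF Bsub Bcomm x Bx R0(2)] by (auto simp: P_def)
 then have finP: "finite P" using R0(1) finite_subset by blast
 \<comment> \<open>A conjugate of \<open>x\<close> under \<open>H\<close> differs from
   \<open>x\<close> by some \<open>s u\<close>, which centralises \<open>B\<close>. So all these
   conjugates act alike on \<open>B\<close>, and periodicity there does not depend on which one is
   used.\<close>
 have commB: "comm G b (inv w \<otimes> x \<otimes> w) = comm G b x" if b: "b \<in> B" and w: "w \<in> H" for b w
 proof -
  have iw: "inv w \<in> H" using w by simp
  have "inv w \<otimes> x \<otimes> w = x \<otimes> s (inv w)" using w x by (simp add: s_def m_assoc)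
  moreover have "comm G b (x \<otimes> s (inv w)) = inv b \<otimes> (inv (s (inv w)) \<otimes> ((inv x \<otimes> b \<otimes> x) \<otimes> s (inv w)))"
   using BG[OF b] x sG[OF iw] by (simp add: word_simps)
  moreover have "(inv x \<otimes> b \<otimes> x) \<otimes> s (inv w) = s (inv w) \<otimes> (inv x \<otimes> b \<otimes> x)"
   by (rule Cs) (use Bx[OF b] iw in \<open>auto simp: B_def\<close>)
  ultimately show ?thesis using BG[OF b] x sG[OF iw] by (simp add: word_simps)
 qed
 have Pw: "inv w \<otimes> b \<otimes> w \<in> P" if b: "b \<in> P" and w: "w \<in> H" for b w
 proof -
  have bB: "b \<in> B" using b by (simp add: P_def)
  let ?b = "inv w \<otimes> b \<otimes> w"
  have bw: "?b \<in> B" by (rule Bw[OF bB w])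
  have eB: "engel_comm G ?b x n \<in> B" for n
  proof (induction n)
   case (Suc n)
   have "comm G c x = inv c \<otimes> (inv x \<otimes> c \<otimes> x)" if "c \<in> B" for c
    using BG[OF that] x by (simp add: word_simps)
   then show ?case using Suc Bx Bsub by (simp add: subgroup.m_closed subgroup.m_inv_closed)
  qed (use bw in simp)
  have "engel_comm G ?b (inv w \<otimes> x \<otimes> w) n = engel_comm G ?b x n" for n
   by (induction n) (use commB[OF eB w] in simp_all)
  moreover have "engel_periodic G (inv w \<otimes> x \<otimes> w) ?b"
   by (rule engel_periodic_conj) (use b BG[OF bB] x w in \<open>auto simp: P_def\<close>)
  ultimately have "engel_periodic G x ?b" by (simp add: engel_periodic_def)
  then show ?thesis using bw by (simp add: P_def)
 qed
 have Pcentre: "b \<in> centre" if b: "b \<in> P" for b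
 proof -
  have "b \<in> H" using b by (simp add: P_def B_def)
  moreover have "{inv v \<otimes> b \<otimes> v |v. v \<in> H} \<subseteq> P" using Pw[OF b] by blast
  then have "finite {inv v \<otimes> b \<otimes> v |v. v \<in> H}" using finP finite_subset by blast
  ultimately show ?thesis using finite_class_central[of b] by (simp add: centre_def)
 qed
 obtain R where R: "finite R" "right_engel_sink G (inv x) R"
  using almost_engel[of "inv x"] x by (auto simp: almost_right_engel_def)
 have RG: "R \<subseteq> carrier G" using R(2) by (simp add: right_engel_sink_def)
 define Cl where "Cl Y t = {v \<in> carrier G. \<forall>h\<in>Y. comm G h (v \<otimes> x \<otimes> inv v) = t h}" for Y t
 let ?I = "SIGMA Y:Pow R. Y \<rightarrow>\<^sub>E R"
 show ?thesis
 proof (rule genericI[of "(\<lambda>(Y, t). Cl Y t) ` ?I"])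
  show "finite ((\<lambda>(Y, t). Cl Y t) ` ?I)"
   using R(1) finite_subset by (intro finite_imageI finite_SigmaI finite_PiE) auto
  show "closed Z" if "Z \<in> (\<lambda>(Y, t). Cl Y t) ` ?I" for Z
  proof -
   obtain Y t where "Y \<subseteq> R" "t \<in> Y \<rightarrow>\<^sub>E R" "Z = Cl Y t" using \<open>Z \<in> _\<close> by auto
   then show ?thesis using closed_comm[OF x, of Y t] RG unfolding Cl_def by (auto simp: PiE_iff)
  qed
  fix v assume v: "v \<in> H"
   and gv: "\<And>Z. \<lbrakk>Z \<in> (\<lambda>(Y, t). Cl Y t) ` ?I; v \<in> Z\<rbrakk> \<Longrightarrow> H \<subseteq> Z"
  define z where "z = v \<otimes> x \<otimes> inv v"
  have z: "z \<in> carrier G" using v x by (simp add: z_def)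
  define h where "h = engel_comm G (inv x) z"
  have hSuc: "h (Suc n) = comm G (h n) z" for n by (simp add: h_def)
  have hG: "h n \<in> carrier G" for n using x z by (simp add: h_def)
  obtain n1 where n1: "\<And>i. i \<ge> n1 \<Longrightarrow> h i \<in> R"
   using R(2) z unfolding right_engel_sink_def h_def by metis
  obtain n2 where n2: "\<And>i. i \<ge> n2 \<Longrightarrow> engel_periodic G z (h i)"
   using almost_right_engel_eventually_periodic[OF almost_engel[of "inv x"] _ z] x
   unfolding h_def by (metis inv_closed)
  define n where "n = max n1 n2"
  \<comment> \<open>The recurrent part of the sequence, all of it inside \<open>R\<close>;
    \<open>t\<close> records how \<open>z\<close> moves it. Only finitely many pairs
    \<open>(Y, t)\<close> can occur, however \<open>v\<close> is chosen.\<close>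
  define Y where "Y = h ` {n..}"
  define t where "t = restrict (\<lambda>a. comm G a z) Y"
  have YR: "Y \<subseteq> R" using n1 by (auto simp: Y_def n_def)
  have YY: "comm G a z \<in> Y" if aY: "a \<in> Y" for a
  proof -
   obtain i where "i \<ge> n" "a = h i" using aY by (auto simp: Y_def)
   then have "comm G a z = h (Suc i)" "Suc i \<in> {n..}" using hSuc by auto
   then show ?thesis unfolding Y_def by blast
  qed
  have "t \<in> Y \<rightarrow>\<^sub>E R" using YY YR by (auto simp: t_def)
  then have "Cl Y t \<in> (\<lambda>(Y, t). Cl Y t) ` ?I" using YR by force
  moreover have "v \<in> Cl Y t" using v by (simp add: Cl_def t_def z_def)
  \<comment> \<open>For generic \<open>v\<close> the transition map \<open>t\<close> observed at
    \<open>v\<close> is therefore the same for every conjugate \<open>w x w^-1\<close> with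
    \<open>w\<close> in \<open>H\<close>, including \<open>x\<close> itself.\<close>
  ultimately have HCl: "H \<subseteq> Cl Y t" using gv by blast
  have tw: "comm G a (w \<otimes> x \<otimes> inv w) = t a" if "a \<in> Y" "w \<in> H" for a w
   using HCl that by (auto simp: Cl_def)
  have tx: "comm G a x = t a" if "a \<in> Y" for a using tw[OF that H.one_closed] x by simp
  have sD1: "s v \<in> D" "inv (s v) \<in> D" using sD v Dsub by (auto intro: subgroup.m_inv_closed)
  have sH1: "s v \<in> H" "inv (s v) \<in> H" using sH v by auto
  have zs: "z = x \<otimes> s v" using v x by (simp add: z_def s_def m_assoc)
  have hD: "h (Suc i) \<in> D \<inter> H" for i
  proof (induction i)
   case 0
   have "h (Suc 0) = (x \<otimes> inv (s v) \<otimes> inv x) \<otimes> s v"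
    using x sG[OF v] by (simp add: h_def zs word_simps)
   then show ?case
    using Dxi[OF sD1(2)] sD1 sH1 H.inv_op_closed2[OF x sH1(2)] Dsub
    by (simp add: subgroup.m_closed)
  next
   case (Suc i)
   let ?d = "h (Suc i)"
   have "h (Suc (Suc i)) = inv ?d \<otimes> (inv (s v) \<otimes> (inv x \<otimes> ?d \<otimes> x) \<otimes> s v)"
    using x sG[OF v] hG[of "Suc i"] unfolding hSuc[of "Suc i"] by (simp add: zs word_simps)
   then show ?case
    using Suc Dx[of ?d] sD1 sH1 vH(2)[of ?d] Dsub
    by (simp add: subgroup.m_closed subgroup.m_inv_closed)
  qed
  \<comment> \<open>Since \<open>x\<close> and \<open>w x w^-1\<close> have the same commutator with
    \<open>a\<close>, they conjugate \<open>a\<close> to the same element. Hence \<open>a\<close>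
    commutes with \<open>w x w^-1 x^-1\<close>, which is \<open>s u\<close> for
    \<open>w = x^-1 u x\<close>.\<close>
  have aC: "a \<in> C" if a: "a \<in> Y" for a
  proof -
   have aG: "a \<in> carrier G" using a YR RG by blast
   have "a \<otimes> s u = s u \<otimes> a" if u: "u \<in> H" for u
   proof -
    define w where "w = inv x \<otimes> u \<otimes> x"
    have w: "w \<in> H" using vH(2)[OF u] by (simp add: w_def)
    define y where "y = w \<otimes> x \<otimes> inv w"
    have yG: "y \<in> carrier G" using w x by (simp add: y_def)
    have su: "s u = y \<otimes> inv x"
     using u x by (simp add: y_def w_def s_def m_assoc inv_mult_group)
    have "comm G a y = comm G a x" using tw[OF a w] tx[OF a] by (simp add: y_def)
    then have "a \<otimes> comm G a y = a \<otimes> comm G a x" by simp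
    then have "inv y \<otimes> a \<otimes> y = inv x \<otimes> a \<otimes> x"
     using aG yG x by (simp add: conj_eq_mult_comm)
    then have "y \<otimes> (inv y \<otimes> a \<otimes> y) \<otimes> inv x = y \<otimes> (inv x \<otimes> a \<otimes> x) \<otimes> inv x" by simp
    then show ?thesis using aG yG x by (simp add: su m_assoc)
   qed
   then show ?thesis using aG by (simp add: C_def)
  qed
  have eY: "engel_comm G a x i \<in> Y \<and> engel_comm G a z i = engel_comm G a x i" if "a \<in> Y" for a i
  proof (induction i)
   case (Suc i)
   have "comm G b z = comm G b x" if "b \<in> Y" for b using tw[OF that v] tx[OF that] by (simp add: z_def)
   then show ?case using Suc YY by (metis engel_comm.simps(2))
  qed (use that in simp)
  let ?a = "h (Suc n)"
  have aY: "?a \<in> Y" by (auto simp: Y_def)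
  have "engel_periodic G z ?a" using n2 by (simp add: n_def)
  then have "engel_periodic G x ?a" using eY[OF aY] by (simp add: engel_periodic_def)
  then have "?a \<in> P" using aC[OF aY] hD by (simp add: P_def B_def)
  then have "inv (v \<otimes> x) \<otimes> ?a \<otimes> (v \<otimes> x) \<in> centre"
   using Pcentre centre_conj v x by simp
  then have "engel_comm G v x (Suc (Suc n)) \<in> centre"
   using engel_comm_swap[of v x n] v x unfolding h_def z_def by (simp only: H_carrier)
  then show "\<exists>n. engel_comm G v x n \<in> centre" by blast
 qed
qed

end


subsection \<open>The hypercentre\<close>

context group
begin

lemma hypercenter_carrier: "x \<in> hypercenter G \<Longrightarrow> x \<in> carrier G"
 by (induction rule: hypercenter.induct) auto

lemma hypercenter_comm:
 "x \<in> hypercenter G \<Longrightarrow> g \<in> carrier G \<Longrightarrow> comm G x g \<in> hypercenter G"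
 by (erule hypercenter.cases) (auto intro: hypercenter.one)

text \<open>Conjugates and products have to be treated together: the commutator of
  \<open>x^a y\<close> with \<open>g\<close> is a conjugate of some \<open>[x, g']\<close>
  multiplied by \<open>[y, g]\<close>, again of the form covered by the induction hypothesis for
  \<open>[x, g']\<close>.\<close>

lemma hypercenter_conj_mult:
 assumes "x \<in> hypercenter G"
 shows "\<forall>a\<in>carrier G. \<forall>y\<in>hypercenter G. inv a \<otimes> x \<otimes> a \<otimes> y \<in> hypercenter G"
 using assms
proof (induction rule: hypercenter.induct)
 case one
 then show ?case using hypercenter_carrier by auto
next
 case (step x)
 show ?case
 proof (intro ballI)
  fix a y assume a: "a \<in> carrier G" and y: "y \<in> hypercenter G"
  have yG: "y \<in> carrier G" by (rule hypercenter_carrier[OF y])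
  show "inv a \<otimes> x \<otimes> a \<otimes> y \<in> hypercenter G"
  proof (rule hypercenter.step)
   show "inv a \<otimes> x \<otimes> a \<otimes> y \<in> carrier G" using step a yG by simp
   show "\<forall>g\<in>carrier G. comm G (inv a \<otimes> x \<otimes> a \<otimes> y) g \<in> hypercenter G"
   proof
    fix g assume g: "g \<in> carrier G"
    have "comm G (inv a \<otimes> x \<otimes> a \<otimes> y) g
     = inv (a \<otimes> y) \<otimes> comm G x (a \<otimes> g \<otimes> inv a) \<otimes> (a \<otimes> y) \<otimes> comm G y g"
     using step(1) a yG g by (simp add: word_simps)
    then show "comm G (inv a \<otimes> x \<otimes> a \<otimes> y) g \<in> hypercenter G"
     using step(2) a yG g hypercenter_comm[OF y g] by simp
   qed
  qed
 qed
qed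

lemma hypercenter_conj_inv:
 assumes "x \<in> hypercenter G"
 shows "\<forall>a\<in>carrier G. inv a \<otimes> inv x \<otimes> a \<in> hypercenter G"
 using assms
proof (induction rule: hypercenter.induct)
 case one
 then show ?case by (auto intro: hypercenter.one)
next
 case (step x)
 show ?case
 proof
  fix a assume a: "a \<in> carrier G"
  show "inv a \<otimes> inv x \<otimes> a \<in> hypercenter G"
  proof (rule hypercenter.step)
   show "inv a \<otimes> inv x \<otimes> a \<in> carrier G" using step a by simp
   show "\<forall>g\<in>carrier G. comm G (inv a \<otimes> inv x \<otimes> a) g \<in> hypercenter G"
   proof
    fix g assume g: "g \<in> carrier G"
    have "comm G (inv a \<otimes> inv x \<otimes> a) g
     = inv (inv x \<otimes> a) \<otimes> inv (comm G x (a \<otimes> g \<otimes> inv a)) \<otimes> (inv x \<otimes> a)"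
     using step(1) a g by (simp add: word_simps)
    then show "comm G (inv a \<otimes> inv x \<otimes> a) g \<in> hypercenter G"
     using step a g by simp
   qed
  qed
 qed
qed

lemma hypercenter_normal: "hypercenter G \<lhd> G"
proof -
 have conj: "inv a \<otimes> x \<otimes> a \<in> hypercenter G" if "x \<in> hypercenter G" "a \<in> carrier G" for x a
  using bspec[OF bspec[OF hypercenter_conj_mult[OF that(1)] that(2)] hypercenter.one]
   that(2) hypercenter_carrier[OF that(1)] by simp
 have "subgroup (hypercenter G) G"
 proof (rule subgroupI)
  show "hypercenter G \<subseteq> carrier G" using hypercenter_carrier by blast
  show "hypercenter G \<noteq> {}" using hypercenter.one by blast
  show "inv x \<in> hypercenter G" if "x \<in> hypercenter G" for x
   using bspec[OF hypercenter_conj_inv[OF that] one_closed] hypercenter_carrier[OF that] by simp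
  show "x \<otimes> y \<in> hypercenter G" if "x \<in> hypercenter G" "y \<in> hypercenter G" for x y
   using bspec[OF bspec[OF hypercenter_conj_mult[OF that(1)] one_closed] that(2)]
    hypercenter_carrier[OF that(1)] by simp
 qed
 then show ?thesis
  unfolding normal_inv_iff using conj by (metis inv_closed inv_inv)
qed

lemma hypercenter_hom:
 assumes K: "group K" and f: "f \<in> hom G K" and surj: "f ` carrier G = carrier K"
  and x: "x \<in> hypercenter G"
 shows "f x \<in> hypercenter K"
 using x
proof (induction rule: hypercenter.induct)
 case one
 then show ?case using hom_one[OF f is_group K] by (simp add: hypercenter.one)
next
 case (step x)
 have "comm K (f x) k \<in> hypercenter K" if k: "k \<in> carrier K" for k
 proof -
  obtain g where g: "g \<in> carrier G" "k = f g" using k surj by blast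
  then show ?thesis using step hom_comm[OF K f] by metis
 qed
 moreover have "f x \<in> carrier K" using step(1) surj by blast
 ultimately show ?case by (intro hypercenter.step) auto
qed

lemma hypercentral_epi:
 assumes "group K" "f \<in> hom G K" "f ` carrier G = carrier K" "hypercentral G"
 shows "hypercentral K"
proof -
 have "k \<in> hypercenter K" if "k \<in> carrier K" for k
 proof -
  obtain g where "g \<in> carrier G" "k = f g" using \<open>k \<in> carrier K\<close> unfolding assms(3)[symmetric] by (rule imageE)
  then show ?thesis using hypercenter_hom[OF assms(1-3), of g] assms(4) by (simp add: hypercentral_def)
 qed
 then show ?thesis
  using group.hypercenter_carrier[OF assms(1)] unfolding hypercentral_def by (intro equalityI subsetI) auto
qed

lemma Mod_carrier_iff: "c \<in> carrier (G Mod N) \<longleftrightarrow> (\<exists>g\<in>carrier G. c = N #> g)"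
 by (auto simp: FactGroup_def RCOSETS_def)

lemma Mod_eq_one_iff:
 assumes "N \<lhd> G" "g \<in> carrier G"
 shows "N #> g = \<one>\<^bsub>G Mod N\<^esub> \<longleftrightarrow> g \<in> N"
proof -
 have "subgroup N G" using assms normal_imp_subgroup by blast
 then show ?thesis
  using assms by (metis coset_join1 coset_join2 one_FactGroup subgroup.subset)
qed

lemma comm_Mod:
 assumes "N \<lhd> G" "a \<in> carrier G" "b \<in> carrier G"
 shows "comm (G Mod N) (N #> a) (N #> b) = N #> comm G a b"
 using hom_comm[OF normal.factorgroup_is_group normal.r_coset_hom_Mod] assms by metis

lemma engel_comm_Mod:
 assumes "N \<lhd> G" "a \<in> carrier G" "b \<in> carrier G"
 shows "engel_comm (G Mod N) (N #> a) (N #> b) n = N #> engel_comm G a b n"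
 using hom_engel_comm[OF normal.factorgroup_is_group normal.r_coset_hom_Mod] assms by metis

lemma hypercentral_of_Mod:
 assumes N: "N \<lhd> G" "N \<subseteq> hypercenter G" and hc: "hypercentral (G Mod N)"
 shows "hypercentral G"
proof -
 have "\<forall>x\<in>carrier G. c = N #> x \<longrightarrow> x \<in> hypercenter G" if "c \<in> hypercenter (G Mod N)" for c
  using that
 proof (induction rule: hypercenter.induct)
  case one
  then show ?case using Mod_eq_one_iff[OF N(1)] N(2) by (metis subsetD)
 next
  case (step c)
  show ?case
  proof (intro ballI impI)
   fix x assume x: "x \<in> carrier G" "c = N #> x"
   have "comm G x g \<in> hypercenter G" if g: "g \<in> carrier G" for g
   proof -
    have "N #> g \<in> carrier (G Mod N)" using g Mod_carrier_iff by blast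
    then show ?thesis using step(2) comm_Mod[OF N(1) x(1) g] x g by (metis comm_closed)
   qed
   then show "x \<in> hypercenter G" using x by (intro hypercenter.step) auto
  qed
 qed
 moreover have "N #> x \<in> hypercenter (G Mod N)" if "x \<in> carrier G" for x
  using hc that Mod_carrier_iff unfolding hypercentral_def by blast
 ultimately show ?thesis
  unfolding hypercentral_def using hypercenter_carrier by blast
qed

text \<open>If \<open>s\<close> is periodic then so is \<open>[s, x]\<close>, which is trivial by
  induction; the cycle returning to \<open>s\<close> then passes through 1 and consists of 1
  alone.\<close>

lemma hypercenter_engel_periodic:
 assumes "s \<in> hypercenter G"
 shows "\<forall>x\<in>carrier G. engel_periodic G x s \<longrightarrow> s = \<one>"
 using assms
proof (induction rule: hypercenter.induct)
 case (step s)
 show ?case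
 proof (intro ballI impI)
  fix x assume x: "x \<in> carrier G" and per: "engel_periodic G x s"
  have c: "comm G s x = \<one>" using step(2) x engel_periodic_comm[OF per] by blast
  obtain k where k: "k > 0" "engel_comm G s x k = s" using per by (auto simp: engel_periodic_def)
  then have "s = engel_comm G (comm G s x) x (k - 1)"
   by (metis Suc_diff_1 engel_comm_Suc_left)
  then show "s = \<one>" using c x by simp
 qed
qed simp

text \<open>Were there no such \<open>z\<close>, induction along the upper central series would put
  all of \<open>M\<close> into \<open>I\<close>. The set \<open>I\<close> is arbitrary apart from
  containing 1, so the lemma serves both for an intersection of subgroups (the normaliser condition)
  and for the hypercentre of the whole group.\<close>

lemma hypercentral_normaliser:
 assumes M: "subgroup M G" "hypercentral (G\<lparr>carrier := M\<rparr>)" and I: "\<one> \<in> I" "\<not> M \<subseteq> I"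
 shows "\<exists>z\<in>M. z \<notin> I \<and> (\<forall>m\<in>M. comm G z m \<in> I)"
proof (rule ccontr)
 assume "\<not> ?thesis"
 then have no: "z \<in> I" if "z \<in> M" "\<forall>m\<in>M. comm G z m \<in> I" for z using that by auto
 have "x \<in> I" if "x \<in> hypercenter (G\<lparr>carrier := M\<rparr>)" for x
  using that
 proof (induction rule: hypercenter.induct)
  case one
  then show ?case using I by simp
 next
  case (step x)
  then show ?case using no[of x] comm_subgroup[OF M(1), of x] by simp
 qed
 moreover have "hypercenter (G\<lparr>carrier := M\<rparr>) = M" using M(2) by (simp add: hypercentral_def)
 ultimately show False using I by auto
qed

subsection \<open>Finite Engel groups\<close>

text \<open>Both directions of conjugation are demanded so that inverses stay inside without any
  finiteness of \<open>I\<close>.\<close>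

definition normaliser :: "'a set \<Rightarrow> 'a set" where
 "normaliser I = {g \<in> carrier G. \<forall>i\<in>I. inv g \<otimes> i \<otimes> g \<in> I \<and> g \<otimes> i \<otimes> inv g \<in> I}"

lemma normaliser_subgroup:
 assumes I: "I \<subseteq> carrier G"
 shows "subgroup (normaliser I) G"
proof (rule subgroupI)
 show "normaliser I \<subseteq> carrier G" by (auto simp: normaliser_def)
 show "normaliser I \<noteq> {}" using I by (auto simp: normaliser_def intro!: exI[of _ \<one>])
 show "inv a \<in> normaliser I" if "a \<in> normaliser I" for a
  using that by (auto simp: normaliser_def)
 show "a \<otimes> b \<in> normaliser I" if "a \<in> normaliser I" "b \<in> normaliser I" for a b
 proof -
  have c: "a \<in> carrier G" "b \<in> carrier G" using that by (auto simp: normaliser_def)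
  have "inv (a \<otimes> b) \<otimes> i \<otimes> (a \<otimes> b) = inv b \<otimes> (inv a \<otimes> i \<otimes> a) \<otimes> b"
   "(a \<otimes> b) \<otimes> i \<otimes> inv (a \<otimes> b) = a \<otimes> (b \<otimes> i \<otimes> inv b) \<otimes> inv a" if "i \<in> I" for i
   using c that I by (auto simp: m_assoc inv_mult_group)
  then show ?thesis using that c by (simp add: normaliser_def)
 qed
qed

lemma normaliser_normal:
 assumes "subgroup I G" "normaliser I = carrier G"
 shows "I \<lhd> G"
 using assms unfolding normal_inv_iff normaliser_def by auto

lemma comm_imp_normaliser:
 assumes I: "subgroup I G" and M: "subgroup M G" "I \<subseteq> M"
  and z: "z \<in> M" "\<And>m. m \<in> M \<Longrightarrow> comm G z m \<in> I"
 shows "z \<in> normaliser I"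
proof -
 have iG: "i \<in> carrier G" if "i \<in> I" for i using I that by (rule subgroup.mem_carrier)
 have zG: "z \<in> carrier G" using M z by (simp add: subgroup.mem_carrier)
 have "inv z \<otimes> i \<otimes> z \<in> I" if i: "i \<in> I" for i
 proof -
  have "inv z \<otimes> i \<otimes> z = i \<otimes> inv (comm G z i)"
   using zG iG[OF i] by (simp add: word_simps)
  then show ?thesis using z(2)[of i] i I M(2) by (auto simp: subgroup.m_closed subgroup.m_inv_closed)
 qed
 moreover have "z \<otimes> i \<otimes> inv z \<in> I" if i: "i \<in> I" for i
 proof -
  have "z \<otimes> i \<otimes> inv z \<in> M" using i z M by (auto simp: subgroup.m_closed subgroup.m_inv_closed)
  then have "comm G z (z \<otimes> i \<otimes> inv z) \<in> I" by (rule z(2))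
  moreover have "z \<otimes> i \<otimes> inv z = i \<otimes> comm G z (z \<otimes> i \<otimes> inv z)"
   using zG iG[OF i] by (simp add: word_simps)
  ultimately show ?thesis using i I subgroup.m_closed by metis
 qed
 ultimately show ?thesis using zG by (simp add: normaliser_def)
qed

lemma finite_subgroups: "finite (carrier G) \<Longrightarrow> finite {M. subgroup M G}"
 by (rule finite_subset[of _ "Pow (carrier G)"]) (auto dest: subgroup.subset)

lemma conj_subgroup:
 assumes "subgroup M G" "y \<in> carrier G"
 shows "subgroup {g \<in> carrier G. inv y \<otimes> g \<otimes> y \<in> M} G"
proof (rule subgroupI)
 show "{g \<in> carrier G. inv y \<otimes> g \<otimes> y \<in> M} \<noteq> {}"
  using assms by (auto intro!: exI[of _ \<one>] simp: subgroup.one_closed)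
next
 fix a assume "a \<in> {g \<in> carrier G. inv y \<otimes> g \<otimes> y \<in> M}"
 then have a: "a \<in> carrier G" "inv (inv y \<otimes> a \<otimes> y) \<in> M"
  using subgroup.m_inv_closed[OF assms(1)] by auto
 then show "inv a \<in> {g \<in> carrier G. inv y \<otimes> g \<otimes> y \<in> M}"
  using assms(2) by (simp add: inv_mult_group m_assoc)
next
 fix a b assume "a \<in> {g \<in> carrier G. inv y \<otimes> g \<otimes> y \<in> M}" "b \<in> {g \<in> carrier G. inv y \<otimes> g \<otimes> y \<in> M}"
 then have a: "a \<in> carrier G" "b \<in> carrier G" "(inv y \<otimes> a \<otimes> y) \<otimes> (inv y \<otimes> b \<otimes> y) \<in> M"
  using subgroup.m_closed[OF assms(1)] by auto
 then show "a \<otimes> b \<in> {g \<in> carrier G. inv y \<otimes> g \<otimes> y \<in> M}"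
  using assms(2) by (simp add: m_assoc)
qed auto

definition maximal_subgroup :: "'a set \<Rightarrow> bool" where
 "maximal_subgroup M \<longleftrightarrow> subgroup M G \<and> M \<noteq> carrier G \<and>
   (\<forall>L. subgroup L G \<and> M \<subseteq> L \<longrightarrow> L = M \<or> L = carrier G)"

lemma maximal_subgroup_above:
 assumes fin: "finite (carrier G)" and L: "subgroup L G" "L \<noteq> carrier G"
 obtains M where "maximal_subgroup M" "L \<subseteq> M"
proof -
 let ?S = "{M. subgroup M G \<and> M \<noteq> carrier G \<and> L \<subseteq> M}"
 have fS: "finite ?S" by (rule finite_subset[OF _ finite_subgroups[OF fin]]) auto
 have nS: "?S \<noteq> {}" using L by blast
 obtain M where M: "M \<in> ?S" "\<forall>N\<in>?S. M \<subseteq> N \<longrightarrow> M = N"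
  using finite_has_maximal[OF fS nS] by (elim bexE)
 have "L' = M \<or> L' = carrier G" if "subgroup L' G" "M \<subseteq> L'" for L'
  using bspec[OF M(2), of L'] M(1) that by auto
 then have "maximal_subgroup M"
  unfolding maximal_subgroup_def using M(1) by auto
 then show ?thesis using that M by blast
qed

lemma maximal_subgroup_conj:
 assumes M: "maximal_subgroup M" and y: "y \<in> carrier G"
 shows "maximal_subgroup {g \<in> carrier G. inv y \<otimes> g \<otimes> y \<in> M}"
 unfolding maximal_subgroup_def
proof (intro conjI allI impI)
 let ?L = "{g \<in> carrier G. inv y \<otimes> g \<otimes> y \<in> M}"
 have Ms: "subgroup M G" "M \<subseteq> carrier G" using M subgroup.subset by (auto simp: maximal_subgroup_def)
 show "subgroup ?L G" using conj_subgroup Ms y by blast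
 obtain g where g: "g \<in> carrier G" "g \<notin> M" using M Ms by (auto simp: maximal_subgroup_def)
 have "y \<otimes> g \<otimes> inv y \<notin> ?L" using g y by (simp add: m_assoc)
 then show "?L \<noteq> carrier G" using g y by (metis inv_closed m_closed)
 fix L assume L: "subgroup L G \<and> ?L \<subseteq> L"
 let ?K = "{g \<in> carrier G. inv (inv y) \<otimes> g \<otimes> inv y \<in> L}"
 have "subgroup ?K G" using conj_subgroup[of L "inv y"] L y by blast
 moreover have "M \<subseteq> ?K"
 proof
  fix m assume m: "m \<in> M"
  then have "m \<in> carrier G" using Ms by blast
  moreover then have "y \<otimes> m \<otimes> inv y \<in> ?L" using m y by (simp add: m_assoc)
  ultimately show "m \<in> ?K" using L y by auto
 qed
 ultimately have K: "?K = M \<or> ?K = carrier G" using M unfolding maximal_subgroup_def by blast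
 have LK: "l \<in> L \<longleftrightarrow> inv y \<otimes> l \<otimes> y \<in> ?K" if "l \<in> carrier G" for l
  using that y by (simp add: m_assoc)
 have Lc: "L \<subseteq> carrier G" using L subgroup.subset by blast
 from K show "L = ?L \<or> L = carrier G"
 proof
  assume "?K = M"
  then have "L = ?L" using LK Lc by blast
  then show ?thesis ..
 next
  assume "?K = carrier G"
  then have "L = carrier G" using LK Lc y by blast
  then show ?thesis ..
 qed
qed

text \<open>This is the preimage of the centraliser of the image of \<open>z\<close> in
  \<open>G Mod S\<close>.\<close>

lemma comm_kernel_subgroup:
 assumes S: "S \<lhd> G" and z: "z \<in> carrier G"
 shows "subgroup {g \<in> carrier G. comm G z g \<in> S} G"
proof -
 interpret S: normal S G by fact
 show ?thesis
 proof (rule subgroupI)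
  show "{g \<in> carrier G. comm G z g \<in> S} \<noteq> {}" using z by (auto intro!: exI[of _ \<one>])
 next
  fix a assume a: "a \<in> {g \<in> carrier G. comm G z g \<in> S}"
  then have "a \<otimes> inv (comm G z a) \<otimes> inv a \<in> S" by (auto intro: S.inv_op_closed2)
  moreover have "comm G z (inv a) = a \<otimes> inv (comm G z a) \<otimes> inv a"
   using a z by (simp add: word_simps)
  ultimately show "inv a \<in> {g \<in> carrier G. comm G z g \<in> S}" using a by simp
 next
  fix a b assume a: "a \<in> {g \<in> carrier G. comm G z g \<in> S}" "b \<in> {g \<in> carrier G. comm G z g \<in> S}"
  then show "a \<otimes> b \<in> {g \<in> carrier G. comm G z g \<in> S}"
   using z by (auto simp: comm_mult_right intro!: S.m_closed S.inv_op_closed1)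
 qed auto
qed

text \<open>Two maximal subgroups with the largest possible intersection are normal: this replaces the
 Sylow-theoretic part of the usual proof that finite Engel groups are nilpotent.\<close>
lemma finite_engel_hypercentral_step:
 assumes fin: "finite (carrier G)"
  and engel: "\<And>g x. \<lbrakk>g \<in> carrier G; x \<in> carrier G\<rbrakk> \<Longrightarrow> \<exists>n. engel_comm G g x n = \<one>"
  and IH: "\<And>M. \<lbrakk>subgroup M G; M \<noteq> carrier G\<rbrakk> \<Longrightarrow> hypercentral (G\<lparr>carrier := M\<rparr>)"
 shows "hypercentral G"
proof -
 define S where "S = hypercenter G"
 have S: "S \<lhd> G" unfolding S_def by (rule hypercenter_normal)
 interpret S: normal S G by fact
 have Sstep: "x \<in> S" if "x \<in> carrier G" "\<And>g. g \<in> carrier G \<Longrightarrow> comm G x g \<in> S" for x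
  using that unfolding S_def by (intro hypercenter.step) auto
 have "S = carrier G"
 proof (rule ccontr)
  assume SG: "S \<noteq> carrier G"
  show False
  proof (cases "\<exists>M1 M2. maximal_subgroup M1 \<and> maximal_subgroup M2 \<and> M1 \<noteq> M2")
   case True
   let ?P = "{(M1, M2). maximal_subgroup M1 \<and> maximal_subgroup M2 \<and> M1 \<noteq> M2}"
   have "?P \<subseteq> {M. subgroup M G} \<times> {M. subgroup M G}" by (auto simp: maximal_subgroup_def)
   then have finP: "finite ?P" using finite_subgroups[OF fin] by (meson finite_SigmaI finite_subset)
   have neP: "?P \<noteq> {}" using True by blast
   define c where "c = Max ((\<lambda>(M1, M2). card (M1 \<inter> M2)) ` ?P)"
   have "c \<in> (\<lambda>(M1, M2). card (M1 \<inter> M2)) ` ?P" unfolding c_def using finP neP by (intro Max_in) auto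
   then obtain M1 M2 where M12: "maximal_subgroup M1" "maximal_subgroup M2" "M1 \<noteq> M2"
    "card (M1 \<inter> M2) = c" by auto
   have cmax: "card (L1 \<inter> L2) \<le> c" if "maximal_subgroup L1" "maximal_subgroup L2" "L1 \<noteq> L2" for L1 L2
   proof -
    have "card (L1 \<inter> L2) \<in> (\<lambda>(M1, M2). card (M1 \<inter> M2)) ` ?P" using that by force
    then show ?thesis unfolding c_def using finP by (intro Max_ge) auto
   qed
   define I where "I = M1 \<inter> M2"
   have sub: "subgroup M1 G" "subgroup M2 G" "M1 \<noteq> carrier G" "M2 \<noteq> carrier G"
    using M12 by (auto simp: maximal_subgroup_def)
   have I: "subgroup I G" unfolding I_def using sub by (intro subgroups_Inter_pair)
   have finI: "finite L" if "subgroup L G" for L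
    using that fin subgroup.subset finite_subset by blast
   have notsub: "\<not> M1 \<subseteq> I" "\<not> M2 \<subseteq> I"
    using M12 sub unfolding maximal_subgroup_def I_def by blast+
   \<comment> \<open>By the choice of \<open>c\<close>, two maximal subgroups whose intersection
     properly contains \<open>I\<close> coincide.\<close>
   have big: "L1 = L2" if L: "maximal_subgroup L1" "maximal_subgroup L2" "I \<subseteq> L1 \<inter> L2" "z \<in> L1 \<inter> L2" "z \<notin> I"
    for L1 L2 z
   proof (rule ccontr)
    assume "L1 \<noteq> L2"
    then have "card (L1 \<inter> L2) \<le> c" using L cmax by blast
    moreover have "I \<subset> L1 \<inter> L2" using L by blast
    then have "c < card (L1 \<inter> L2)"
     using M12(4) finI[of L1] L(1) unfolding I_def maximal_subgroup_def
     by (metis finite_Int psubset_card_mono)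
    ultimately show False by simp
   qed
   obtain z1 where z1: "z1 \<in> M1" "z1 \<notin> I" "\<And>m. m \<in> M1 \<Longrightarrow> comm G z1 m \<in> I"
    using hypercentral_normaliser[OF sub(1) IH[OF sub(1,3)] subgroup.one_closed[OF I] notsub(1)] by auto
   obtain z2 where z2: "z2 \<in> M2" "z2 \<notin> I" "\<And>m. m \<in> M2 \<Longrightarrow> comm G z2 m \<in> I"
    using hypercentral_normaliser[OF sub(2) IH[OF sub(2,4)] subgroup.one_closed[OF I] notsub(2)] by auto
   have I1: "I \<subseteq> M1" "I \<subseteq> M2" by (auto simp: I_def)
   have IG: "I \<subseteq> carrier G" using I subgroup.subset by blast
   have zN: "z1 \<in> normaliser I" "z2 \<in> normaliser I"
    using comm_imp_normaliser[OF I sub(1) I1(1) z1(1,3)] comm_imp_normaliser[OF I sub(2) I1(2) z2(1,3)]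
    by auto
   have IN: "I \<subseteq> normaliser I"
    using I IG by (auto simp: normaliser_def intro!: subgroup.m_closed subgroup.m_inv_closed)
   \<comment> \<open>A maximal subgroup above the normaliser would share \<open>z1\<close> with
     \<open>M1\<close> and \<open>z2\<close> with \<open>M2\<close> in addition to \<open>I\<close>,
     so it would equal both.\<close>
   have "normaliser I = carrier G"
   proof (rule ccontr)
    assume "normaliser I \<noteq> carrier G"
    then obtain M3 where M3: "maximal_subgroup M3" "normaliser I \<subseteq> M3"
     using maximal_subgroup_above[OF fin normaliser_subgroup[OF IG]] by blast
    have "M3 = M1" by (rule big[of _ _ z1]) (use M3 M12 zN z1 IN I1 in auto)
    moreover have "M3 = M2" by (rule big[of _ _ z2]) (use M3 M12 zN z2 IN I1 in auto)
    ultimately show False using M12 by blast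
   qed
   then have I_normal: "I \<lhd> G" by (rule normaliser_normal[OF I])
   obtain y where y: "y \<in> M2" "y \<notin> M1" using notsub by (auto simp: I_def)
   have yG: "y \<in> carrier G" and z1G: "z1 \<in> carrier G"
    using y z1 sub by (auto intro: subgroup.mem_carrier)
   obtain n where n: "engel_comm G y z1 n \<in> M1"
    using engel[OF yG z1G] subgroup.one_closed[OF sub(1)] by metis
   obtain j where j: "engel_comm G y z1 j \<notin> M1" "engel_comm G y z1 (Suc j) \<in> M1"
   proof -
    define k where "k = (LEAST n. engel_comm G y z1 n \<in> M1)"
    have k: "engel_comm G y z1 k \<in> M1" unfolding k_def using n by (rule LeastI)
    have "k \<noteq> 0" using k y by (metis engel_comm.simps(1))
    then obtain j where "k = Suc j" using not0_implies_Suc by blast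
    moreover have "engel_comm G y z1 j \<notin> M1"
     using not_less_Least[of j "\<lambda>n. engel_comm G y z1 n \<in> M1"] \<open>k = Suc j\<close> k_def by simp
    ultimately show thesis using that k by blast
   qed
   \<comment> \<open>The last term of the Engel sequence outside \<open>M1\<close>. As
     \<open>[u, z1]\<close> lies in \<open>M1\<close>, so does the conjugate of \<open>z1\<close> by
     \<open>u\<close>; hence \<open>M1\<close> and its conjugate share \<open>I\<close> and
     \<open>z1\<close>, and \<open>big\<close> identifies them.\<close>
   define u where "u = engel_comm G y z1 j"
   have uG: "u \<in> carrier G" using yG z1G by (simp add: u_def)
   have u: "u \<notin> M1" "comm G u z1 \<in> M1" using j by (auto simp: u_def)
   have "inv u \<otimes> z1 \<otimes> u = z1 \<otimes> inv (comm G u z1)" using uG z1G by (simp add: word_simps)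
   then have zu: "inv u \<otimes> z1 \<otimes> u \<in> M1"
    using z1 u sub by (simp add: subgroup.m_closed subgroup.m_inv_closed)
   let ?L = "{g \<in> carrier G. inv u \<otimes> g \<otimes> u \<in> M1}"
   have L: "?L = M1"
   proof (rule big[of _ _ z1])
    show "maximal_subgroup ?L" by (rule maximal_subgroup_conj[OF M12(1) uG])
    have "inv u \<otimes> i \<otimes> u \<in> I" if "i \<in> I" for i using that uG I_normal by (simp add: normal.inv_op_closed1)
    then show "I \<subseteq> ?L \<inter> M1" using I1 IG by blast
   qed (use M12 z1 zu z1G in auto)
   have uN: "u \<in> normaliser M1"
   proof -
    have "inv u \<otimes> m \<otimes> u \<in> M1" if "m \<in> M1" for m using that L by blast
    moreover have "u \<otimes> m \<otimes> inv u \<in> M1" if m: "m \<in> M1" for m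
    proof -
     have mG: "m \<in> carrier G" using m sub by (simp add: subgroup.mem_carrier)
     then have "u \<otimes> m \<otimes> inv u \<in> ?L" using uG m by (simp add: m_assoc)
     then show ?thesis using L by blast
    qed
    ultimately show ?thesis using uG by (simp add: normaliser_def)
   qed
   have M1G: "M1 \<subseteq> carrier G" using sub subgroup.subset by blast
   have MN: "M1 \<subseteq> normaliser M1"
    using sub(1) M1G by (auto simp: normaliser_def intro!: subgroup.m_closed subgroup.m_inv_closed)
   have gen: "K = carrier G" if "subgroup K G" "M1 \<subseteq> K" "v \<in> K" "v \<notin> M1" for K v
    using that M12(1) unfolding maximal_subgroup_def by blast
   have "normaliser M1 = carrier G"
    by (rule gen[OF normaliser_subgroup[OF M1G] MN uN u(1)])
   then have M1n: "M1 \<lhd> G" by (rule normaliser_normal[OF sub(1)])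
   interpret M1: normal M1 G by (rule M1n)
   show False
   proof (cases "M1 \<subseteq> S")
    case True
    then have SM: "S = M1"
     using M12(1) SG S.subgroup_axioms unfolding maximal_subgroup_def by blast
    have "{g \<in> carrier G. comm G u g \<in> S} = carrier G"
    proof (rule gen[OF comm_kernel_subgroup[OF S uG] _ _ u(1)])
     have "comm G u m \<in> M1" if "m \<in> M1" for m
      using that uG M1.inv_op_closed1[OF uG, of "inv m"] M1G by (auto simp: comm_def)
     then show "M1 \<subseteq> {g \<in> carrier G. comm G u g \<in> S}" using SM M1G by auto
     show "u \<in> {g \<in> carrier G. comm G u g \<in> S}" using uG by simp
    qed
    then have "u \<in> S" using Sstep[OF uG] by blast
    then show False using u SM by blast
   next
    case False
    obtain z where z: "z \<in> M1" "z \<notin> S" "\<And>m. m \<in> M1 \<Longrightarrow> comm G z m \<in> S"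
     using hypercentral_normaliser[OF sub(1) IH[OF sub(1,3)] S.one_closed False] by auto
    have zG: "z \<in> carrier G" using z M1G by blast
    \<comment> \<open>Being central in \<open>M1\<close> modulo \<open>S\<close> is preserved by
      commutation with \<open>u\<close>. The last term outside \<open>S\<close> then commutes modulo
      \<open>S\<close> with \<open>M1\<close> and with \<open>u\<close>, which generate the group,
      so it belongs to \<open>S\<close> after all.\<close>
    have zi: "engel_comm G z u i \<in> M1 \<and> (\<forall>m\<in>M1. comm G (engel_comm G z u i) m \<in> S)" for i
    proof (induction i)
     case (Suc i)
     define w where "w = engel_comm G z u i"
     have w: "w \<in> M1" "w \<in> carrier G" "\<And>m. m \<in> M1 \<Longrightarrow> comm G w m \<in> S"
      using Suc M1G by (auto simp: w_def)
     have e: "comm G w u = inv w \<otimes> (inv u \<otimes> w \<otimes> u)" using w uG by (simp add: word_simps)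
     have wu: "comm G w u \<in> M1" unfolding e using w uG M1.inv_op_closed1 by simp
     have "comm G (comm G w u) m \<in> S" if m: "m \<in> M1" for m
     proof -
      have mG: "m \<in> carrier G" using m M1G by blast
      define v where "v = inv u \<otimes> w \<otimes> u"
      have vG: "v \<in> carrier G" using w uG by (simp add: v_def)
      have "u \<otimes> m \<otimes> inv u \<in> M1" using m uG by (simp add: M1.inv_op_closed2)
      then have "inv u \<otimes> comm G w (u \<otimes> m \<otimes> inv u) \<otimes> u \<in> S" using w uG S.inv_op_closed1 by simp
      moreover have "inv u \<otimes> comm G w (u \<otimes> m \<otimes> inv u) \<otimes> u = comm G v m"
       using w uG mG by (simp add: v_def word_simps)
      ultimately have a: "comm G v m \<in> S" by simp
      have "comm G (inv w) m = w \<otimes> inv (comm G w m) \<otimes> inv w"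
       using w mG by (simp add: comm_inv_left)
      then have "comm G (inv w) m \<in> S" using w m S.inv_op_closed2 by simp
      then have "inv v \<otimes> comm G (inv w) m \<otimes> v \<in> S" using vG S.inv_op_closed1 by simp
      then show ?thesis
       using a w vG mG unfolding e v_def[symmetric] by (simp add: comm_mult_left)
     qed
     then show ?case using wu by (simp add: w_def)
    qed (use z in auto)
    obtain n where "engel_comm G z u n \<in> S"
     using engel[OF zG uG] S.one_closed by metis
    define k where "k = (LEAST n. engel_comm G z u n \<in> S)"
    have k: "engel_comm G z u k \<in> S" unfolding k_def using \<open>engel_comm G z u n \<in> S\<close> by (rule LeastI)
    have "k \<noteq> 0" using k z(2) by (metis engel_comm.simps(1))
    then obtain j where j: "k = Suc j" using not0_implies_Suc by blast
    define w where "w = engel_comm G z u j"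
    have w: "w \<in> carrier G" "w \<notin> S" "comm G w u \<in> S"
     using zG uG k j not_less_Least[of j "\<lambda>n. engel_comm G z u n \<in> S"] unfolding k_def w_def by auto
    have "{g \<in> carrier G. comm G w g \<in> S} = carrier G"
     by (rule gen[OF comm_kernel_subgroup[OF S w(1)] _ _ u(1)])
      (use zi[of j] M1G w uG in \<open>auto simp: w_def\<close>)
    then have "w \<in> S" using Sstep[OF w(1)] by blast
    then show False using w by blast
   qed
  next
   case False
   \<comment> \<open>When all maximal subgroups coincide, any element outside that subgroup
     generates the group, which is thus cyclic.\<close>
   obtain x where x: "x \<in> carrier G" "generate G {x} = carrier G"
   proof -
    have "\<exists>x\<in>carrier G. generate G {x} = carrier G"
    proof (rule ccontr)
     assume no: "\<not> (\<exists>x\<in>carrier G. generate G {x} = carrier G)"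
     obtain M where M: "maximal_subgroup M"
      using maximal_subgroup_above[OF fin S.subgroup_axioms SG] by blast
     have "x \<in> M" if x: "x \<in> carrier G" for x
     proof -
      have "subgroup (generate G {x}) G" using x by (intro generate_is_subgroup) auto
      then obtain M' where "maximal_subgroup M'" "generate G {x} \<subseteq> M'"
       using maximal_subgroup_above[OF fin] no x by blast
      moreover then have "M' = M" using False M by blast
      ultimately show ?thesis using generate.incl[of x "{x}" G] by blast
     qed
     then show False using M subgroup.subset unfolding maximal_subgroup_def by blast
    qed
    then show thesis using that by blast
   qed
   have "{g \<in> carrier G. comm G x g \<in> {\<one>}} = carrier G"
   proof -
    have "subgroup {g \<in> carrier G. comm G x g \<in> {\<one>}} G"
     by (rule comm_kernel_subgroup[OF one_is_normal x(1)])
    then have "generate G {x} \<subseteq> {g \<in> carrier G. comm G x g \<in> {\<one>}}"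
     using x by (intro generate_subgroup_incl) auto
    then show ?thesis using x by blast
   qed
   then have xS: "x \<in> S" using Sstep[OF x(1)] S.one_closed by force
   then have "generate G {x} \<subseteq> S" using S.subgroup_axioms by (intro generate_subgroup_incl) auto
   then show False using x SG S.subset by blast
  qed
 qed
 then show ?thesis by (simp add: hypercentral_def S_def)
qed

end

theorem finite_engel_hypercentral:
 assumes "group G" "finite (carrier G)"
  and "\<And>g x. \<lbrakk>g \<in> carrier G; x \<in> carrier G\<rbrakk> \<Longrightarrow> \<exists>n. engel_comm G g x n = \<one>\<^bsub>G\<^esub>"
 shows "hypercentral G"
 using assms
proof (induction "card (carrier G)" arbitrary: G rule: less_induct)
 case (less G)
 interpret group G by (rule less.prems)
 note fin = less.prems(2) and engel = less.prems(3)
 have IH: "hypercentral (G\<lparr>carrier := M\<rparr>)" if M: "subgroup M G" "M \<noteq> carrier G" for M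
 proof (rule less.hyps)
  have MG: "M \<subseteq> carrier G" using M(1) by (rule subgroup.subset)
  then show "card (carrier (G\<lparr>carrier := M\<rparr>)) < card (carrier G)"
   using fin M(2) psubset_card_mono[of "carrier G" M] by auto
  show "group (G\<lparr>carrier := M\<rparr>)" using M by (simp add: subgroup_imp_group)
  show "finite (carrier (G\<lparr>carrier := M\<rparr>))"
   using MG fin finite_subset by auto
  show "\<exists>n. engel_comm (G\<lparr>carrier := M\<rparr>) g x n = \<one>\<^bsub>G\<lparr>carrier := M\<rparr>\<^esub>"
   if "g \<in> carrier (G\<lparr>carrier := M\<rparr>)" "x \<in> carrier (G\<lparr>carrier := M\<rparr>)" for g x
   using that engel[of g x] M MG by (auto simp: engel_comm_subgroup)
 qed
 show ?case by (rule finite_engel_hypercentral_step[OF fin engel IH])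
qed


subsection \<open>Groups with hypercentre of finite index\<close>

context group
begin

lemma conj_pow:
 assumes "a \<in> carrier G" "g \<in> carrier G"
 shows "(inv g \<otimes> a \<otimes> g) [^] (k::nat) = inv g \<otimes> a [^] k \<otimes> g"
proof (induction k)
 case (Suc k)
 have "(inv g \<otimes> a \<otimes> g) [^] Suc k = (inv g \<otimes> a [^] k \<otimes> g) \<otimes> (inv g \<otimes> a \<otimes> g)"
  by (simp only: nat_pow_Suc Suc)
 also have "\<dots> = inv g \<otimes> a [^] Suc k \<otimes> g" using assms by (simp add: m_assoc)
 finally show ?case .
qed (use assms in simp)

section \<open>Finite conjugation-invariant sets of torsion elements\<close>

definition word :: "'a list \<Rightarrow> 'a" where
 "word xs = foldr (\<otimes>) xs \<one>"

lemma word_closed: "set xs \<subseteq> carrier G \<Longrightarrow> word xs \<in> carrier G"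
 by (induction xs) (auto simp: word_def)

lemma word_append:
 "set xs \<subseteq> carrier G \<Longrightarrow> set ys \<subseteq> carrier G \<Longrightarrow> word (xs @ ys) = word xs \<otimes> word ys"
proof (induction xs)
 case (Cons a xs)
 then show ?case using word_closed[of xs] word_closed[of ys] by (simp add: word_def m_assoc)
qed (use word_closed[of ys] in \<open>simp add: word_def\<close>)

lemma word_replicate: "p \<in> carrier G \<Longrightarrow> word (replicate k p) = p [^] k"
proof (induction k)
 case (Suc k)
 then have "word (replicate (Suc k) p) = p \<otimes> p [^] k" by (simp add: word_def)
 then show ?case using Suc.prems nat_pow_Suc2 by metis
qed (simp add: word_def)

text \<open>Each occurrence of \<open>p\<close> is moved to the front past the letters before it.
  These are replaced by conjugates under powers of \<open>p\<close>, which stay in \<open>P\<close>,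
  and the number of letters does not change.\<close>

lemma word_collect:
 assumes P: "P \<subseteq> carrier G" "\<And>a b. a \<in> P \<Longrightarrow> b \<in> P \<Longrightarrow> inv b \<otimes> a \<otimes> b \<in> P"
  and p: "p \<in> P" and xs: "set xs \<subseteq> P"
 shows "\<exists>ys. set ys \<subseteq> P \<and> length ys + count_list xs p = length xs
      \<and> word xs = p [^] count_list xs p \<otimes> word ys"
 using xs
proof (induction xs)
 case Nil
 show ?case by (rule exI[of _ "[]"]) (simp add: word_def)
next
 case (Cons a xs)
 define c where "c = count_list xs p"
 obtain ys where ys: "set ys \<subseteq> P" "length ys + c = length xs" "word xs = p [^] c \<otimes> word ys"
  using Cons unfolding c_def by auto
 have pG: "p \<in> carrier G" and aX: "a \<in> P" and aG: "a \<in> carrier G" using p P Cons.prems by auto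
 have yG: "word ys \<in> carrier G" using ys P by (intro word_closed) auto
 have wa: "word (a # xs) = a \<otimes> (p [^] c \<otimes> word ys)" using ys(3) by (simp add: word_def)
 show ?case
 proof (cases "a = p")
  case True
  have "word (a # xs) = p [^] Suc c \<otimes> word ys"
   using wa True pG yG nat_pow_Suc2[OF pG, of c] by (simp add: m_assoc[symmetric])
  then show ?thesis using ys True by (intro exI[of _ ys]) (auto simp: c_def)
 next
  case False
  have conj: "inv (p [^] j) \<otimes> a \<otimes> p [^] j \<in> P" for j :: nat
  proof (induction j)
   case (Suc j)
   have "inv (p [^] Suc j) \<otimes> a \<otimes> p [^] Suc j = inv p \<otimes> (inv (p [^] j) \<otimes> a \<otimes> p [^] j) \<otimes> p"
    using pG aG by (simp add: m_assoc inv_mult_group)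
   then show ?case using P(2)[OF Suc p] by simp
  qed (use aX aG in simp)
  define b where "b = inv (p [^] c) \<otimes> a \<otimes> p [^] c"
  have "word (a # xs) = p [^] c \<otimes> word (b # ys)"
   using wa pG aG yG by (simp add: b_def word_def m_assoc)
  then show ?thesis using ys conj[of c] False
   by (intro exI[of _ "b # ys"]) (auto simp: c_def b_def)
 qed
qed

text \<open>Dietzmann's lemma. In a word longer than \<open>card P * n\<close> some letter
  \<open>p\<close> occurs at least \<open>n\<close> times; collecting its occurrences in front and
  cancelling \<open>p^n\<close> shortens the word, so words of bounded length suffice.\<close>

lemma finite_generate_torsion:
 assumes P: "finite P" "P \<subseteq> carrier G" "\<And>a b. a \<in> P \<Longrightarrow> b \<in> P \<Longrightarrow> inv b \<otimes> a \<otimes> b \<in> P"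
  and n: "n > 0" "\<And>a. a \<in> P \<Longrightarrow> a [^] (n::nat) = \<one>"
 shows "finite (generate G P)"
proof -
 define B where "B = card P * n"
 have short: "\<exists>ys. set ys \<subseteq> P \<and> length ys \<le> B \<and> word ys = word xs" if "set xs \<subseteq> P" for xs
  using that
 proof (induction "length xs" arbitrary: xs rule: less_induct)
  case less
  show ?case
  proof (cases "length xs \<le> B")
   case False
   have "\<exists>p\<in>P. count_list xs p \<ge> n"
   proof (rule ccontr)
    assume "\<not> ?thesis"
    then have "sum (count_list xs) P \<le> sum (\<lambda>_. n) P" by (intro sum_mono) auto
    then show False using False sum_count_set[OF less.prems P(1)] by (simp add: B_def)
   qed
   then obtain p where p: "p \<in> P" "count_list xs p \<ge> n" by auto
   define c where "c = count_list xs p - n"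
   have c: "count_list xs p = c + n" using p by (simp add: c_def)
   obtain ys where ys: "set ys \<subseteq> P" "length ys + (c + n) = length xs" "word xs = p [^] (c + n) \<otimes> word ys"
    using word_collect[OF P(2,3) p(1) less.prems] c by auto
   have pG: "p \<in> carrier G" using p P by blast
   have "p [^] (c + n) = p [^] c \<otimes> p [^] n" using pG by (simp add: nat_pow_mult)
   then have pc: "p [^] (c + n) = p [^] c" using n(2)[OF p(1)] pG by simp
   let ?zs = "replicate c p @ ys"
   have zs: "set ?zs \<subseteq> P" using ys p by auto
   have "word ?zs = word xs"
    using ys pc pG P(2) by (subst word_append) (auto simp: word_replicate)
   moreover have "length ?zs < length xs" using ys n(1) by simp
   ultimately show ?thesis using less.hyps[OF _ zs] by auto
  qed (use less.prems in auto)
 qed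
 have "\<exists>xs. set xs \<subseteq> P \<and> g = word xs" if "g \<in> generate G P" for g
  using that
 proof (induction rule: generate.induct)
  case one
  show ?case by (rule exI[of _ "[]"]) (simp add: word_def)
 next
  case (incl h)
  then show ?case using P(2) by (intro exI[of _ "[h]"]) (auto simp: word_def)
 next
  case (inv h)
  have hG: "h \<in> carrier G" using inv P by blast
  have "h [^] (n - 1) \<otimes> h = \<one>"
   using n(2)[OF inv] n(1) nat_pow_Suc[of h "n - 1"] by simp
  then have "inv h = h [^] (n - 1)" using hG by (simp add: inv_equality)
  then show ?case using inv hG by (intro exI[of _ "replicate (n - 1) h"]) (auto simp: word_replicate)
 next
  case (eng h1 h2)
  then obtain xs ys where "set xs \<subseteq> P" "h1 = word xs" "set ys \<subseteq> P" "h2 = word ys" by auto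
  then show ?case using P(2) by (intro exI[of _ "xs @ ys"]) (auto simp: word_append)
 qed
 then have "generate G P \<subseteq> word ` {ys. set ys \<subseteq> P \<and> length ys \<le> B}"
  using short by (smt (verit) image_eqI mem_Collect_eq subsetI)
 then show ?thesis using finite_lists_length_le[OF P(1)] finite_subset by blast
qed

text \<open>The transfer \<open>\<tau>\<close> into \<open>Z\<close> is a homomorphism with \<open>\<tau>(a)\<^sup>n = \<tau>(a\<^sup>n) = a\<^bsup>n n\<^esup>\<close>.\<close>
lemma central_power_hom:
 assumes Z: "subgroup Z G" and central: "\<And>z g. z \<in> Z \<Longrightarrow> g \<in> carrier G \<Longrightarrow> z \<otimes> g = g \<otimes> z"
  and fin: "finite (rcosets Z)"
 obtains k :: nat where "k > 0" "\<And>a. a \<in> carrier G \<Longrightarrow> a [^] k \<in> Z"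
  "\<And>a b. a \<in> carrier G \<Longrightarrow> b \<in> carrier G \<Longrightarrow> (a \<otimes> b) [^] k = a [^] k \<otimes> b [^] k"
proof -
 have ZG: "z \<in> carrier G" if "z \<in> Z" for z using Z that by (rule subgroup.mem_carrier)
 have Zn: "Z \<lhd> G"
 proof (rule normal_invI[OF Z])
  fix g z assume g: "g \<in> carrier G" and z: "z \<in> Z"
  have "g \<otimes> z \<otimes> inv g = z" using central[OF z g] g ZG[OF z] by (metis inv_solve_right m_closed)
  then show "g \<otimes> z \<otimes> inv g \<in> Z" using z by simp
 qed
 define Z' where "Z' = G\<lparr>carrier := Z\<rparr>"
 have Z'simps: "carrier Z' = Z" "mult Z' = mult G" "one Z' = \<one>" by (simp_all add: Z'_def)
 have "group Z'" unfolding Z'_def using Z by (rule subgroup_imp_group)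
 then interpret Z': comm_group Z'
  by (rule group.group_comm_groupI) (use central ZG in \<open>auto simp: Z'simps\<close>)
 have powZ: "z [^]\<^bsub>Z'\<^esub> (i::nat) = z [^] i" for z i by (simp add: Z'_def flip: nat_pow_consistent)
 define n where "n = card (rcosets Z)"
 have ne: "Z \<in> rcosets Z" using subgroup.subgroup_in_rcosets[OF Z is_group] .
 have n0: "n > 0" unfolding n_def using fin ne by (auto simp: card_gt_0_iff)
 have an: "a [^] n \<in> Z" if a: "a \<in> carrier G" for a
 proof -
  interpret Q: group "G Mod Z" by (rule normal.factorgroup_is_group[OF Zn])
  interpret q: group_hom G "G Mod Z" "\<lambda>a. Z #> a"
   by unfold_locales (rule normal.r_coset_hom_Mod[OF Zn])
  have "Z #> a [^] n = (Z #> a) [^]\<^bsub>G Mod Z\<^esub> n" using a by (rule q.hom_nat_pow)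
  also have "\<dots> = \<one>\<^bsub>G Mod Z\<^esub>"
   using Q.pow_order_eq_1[of "Z #> a"] a q.hom_closed[OF a] by (simp add: Coset.order_def FactGroup_def n_def)
  finally show ?thesis using Mod_eq_one_iff[OF Zn] a by simp
 qed
 define rep where "rep c = (SOME g. g \<in> c)" for c :: "'a set"
 have rep: "rep c \<in> c" "rep c \<in> carrier G" "c = Z #> rep c" if c: "c \<in> rcosets Z" for c
 proof -
  obtain g where g: "g \<in> carrier G" "c = Z #> g" using c by (auto simp: RCOSETS_def)
  have "g \<in> c" using g Z rcos_self by metis
  then show 1: "rep c \<in> c" unfolding rep_def by (rule someI)
  show 2: "rep c \<in> carrier G" using 1 g r_coset_subset_G[OF subgroup.subset[OF Z]] by blast
  show "c = Z #> rep c" using g 1 repr_independence[OF _ _ Z] by metis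
 qed
 have mv: "c #> a \<in> rcosets Z" "c #> a = Z #> (rep c \<otimes> a)" if c: "c \<in> rcosets Z" and a: "a \<in> carrier G" for c a
 proof -
  have "c #> a = (Z #> rep c) #> a" using rep(3)[OF c] by simp
  also have "\<dots> = Z #> (rep c \<otimes> a)"
   using rep(2)[OF c] a subgroup.subset[OF Z] by (simp add: coset_mult_assoc)
  finally show 2: "c #> a = Z #> (rep c \<otimes> a)" .
  then show "c #> a \<in> rcosets Z" using rep(2)[OF c] a by (auto simp: RCOSETS_def)
 qed
 \<comment> \<open>The defining relation is
   \<open>rep c \<otimes> a = f a c \<otimes> rep (c #> a)\<close>; these factors in
   \<open>Z\<close>, multiplied over all cosets, give the transfer.\<close>
 define f where "f a c = rep c \<otimes> a \<otimes> inv (rep (c #> a))" for a c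
 have fZ: "f a c \<in> Z" if c: "c \<in> rcosets Z" and a: "a \<in> carrier G" for a c
 proof -
  have r: "rep (c #> a) \<in> Z #> (rep c \<otimes> a)" using rep(1)[OF mv(1)[OF c a]] mv(2)[OF c a] by simp
  obtain z where z: "z \<in> Z" "rep (c #> a) = z \<otimes> (rep c \<otimes> a)" using r by (auto simp: r_coset_def)
  have "f a c = inv z"
   using z ZG[OF z(1)] rep(2)[OF c] a by (simp add: f_def inv_mult_group m_assoc)
  then show ?thesis using z Z by (simp add: subgroup.m_inv_closed)
 qed
 define \<tau> where "\<tau> a = finprod Z' (f a) (rcosets Z)" for a
 have fPi: "f a \<in> rcosets Z \<rightarrow> carrier Z'" if "a \<in> carrier G" for a using fZ that by (auto simp: Z'simps)
 have \<tau>Z: "\<tau> a \<in> Z" if "a \<in> carrier G" for a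
  using Z'.finprod_closed[OF fPi[OF that]] by (simp add: \<tau>_def Z'simps)
 have \<tau>mult: "\<tau> (a \<otimes> b) = \<tau> a \<otimes> \<tau> b" if a: "a \<in> carrier G" and b: "b \<in> carrier G" for a b
 proof -
  have inj: "inj_on (\<lambda>c. c #> a) (rcosets Z)"
  proof (rule inj_onI)
   fix c d assume c: "c \<in> rcosets Z" and d: "d \<in> rcosets Z" and eq: "c #> a = d #> a"
   have sub: "c \<subseteq> carrier G" "d \<subseteq> carrier G"
    using subgroup.rcosets_carrier[OF Z is_group] c d by auto
   have "(c #> a) #> inv a = c" "(d #> a) #> inv a = d"
    using sub a by (simp_all add: coset_mult_assoc)
   then show "c = d" using eq by metis
  qed
  have im: "(\<lambda>c. c #> a) ` (rcosets Z) = rcosets Z"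
   by (rule endo_inj_surj[OF fin _ inj]) (use mv(1)[OF _ a] in auto)
  have "\<tau> (a \<otimes> b) = finprod Z' (\<lambda>c. f a c \<otimes>\<^bsub>Z'\<^esub> f b (c #> a)) (rcosets Z)"
   unfolding \<tau>_def
  proof (rule Z'.finprod_cong')
   show "(\<lambda>c. f a c \<otimes>\<^bsub>Z'\<^esub> f b (c #> a)) \<in> rcosets Z \<rightarrow> carrier Z'"
    using fZ a b mv(1) Z by (auto simp: Z'simps subgroup.m_closed)
   fix c assume c: "c \<in> rcosets Z"
   have "c #> (a \<otimes> b) = (c #> a) #> b"
    using subgroup.rcosets_carrier[OF Z is_group c] a b by (simp add: coset_mult_assoc)
   then show "f (a \<otimes> b) c = f a c \<otimes>\<^bsub>Z'\<^esub> f b (c #> a)"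
    using a b rep(2)[OF c] rep(2)[OF mv(1)[OF c a]] rep(2)[OF mv(1)[OF mv(1)[OF c a] b]]
    by (simp add: f_def Z'simps m_assoc)
  qed simp
  also have "\<dots> = finprod Z' (f a) (rcosets Z) \<otimes>\<^bsub>Z'\<^esub> finprod Z' (\<lambda>c. f b (c #> a)) (rcosets Z)"
   by (rule Z'.finprod_multf) (use fZ a b mv(1) in \<open>auto simp: Z'simps\<close>)
  also have "finprod Z' (\<lambda>c. f b (c #> a)) (rcosets Z) = finprod Z' (f b) ((\<lambda>c. c #> a) ` (rcosets Z))"
   by (rule Z'.finprod_reindex[symmetric]) (use fPi[OF b] im inj in auto)
  finally show ?thesis unfolding im \<tau>_def Z'simps .
 qed
 have \<tau>central: "\<tau> z = z [^] n" if z: "z \<in> Z" for z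
 proof -
  have "f z c = z" if c: "c \<in> rcosets Z" for c
  proof -
   have "Z #> (rep c \<otimes> z) = Z #> (z \<otimes> rep c)" using central[OF z rep(2)[OF c]] by simp
   also have "\<dots> = (Z #> z) #> rep c" using rep(2)[OF c] ZG[OF z] subgroup.subset[OF Z]
    by (simp add: coset_mult_assoc)
   also have "Z #> z = Z" using coset_join2[OF ZG[OF z] Z z] .
   finally have "c #> z = c" using mv(2)[OF c ZG[OF z]] rep(3)[OF c] by simp
   then have "f z c = rep c \<otimes> z \<otimes> inv (rep c)" by (simp add: f_def)
   also have "rep c \<otimes> z = z \<otimes> rep c" using central[OF z rep(2)[OF c]] by simp
   finally show ?thesis using rep(2)[OF c] ZG[OF z] by (simp add: m_assoc)
  qed
  then have "\<tau> z = finprod Z' (\<lambda>_. z) (rcosets Z)"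
   unfolding \<tau>_def by (intro Z'.finprod_cong') (use z in \<open>auto simp: Z'simps\<close>)
  then show ?thesis using Z'.finprod_const[of z "rcosets Z"] z by (simp add: Z'simps powZ n_def)
 qed
 have \<tau>pow: "\<tau> (a [^] i) = \<tau> a [^] i" if a: "a \<in> carrier G" for a and i :: nat
 proof (induction i)
  case 0
  show ?case using \<tau>central[OF subgroup.one_closed[OF Z]] by simp
 next
  case (Suc i)
  then show ?case using \<tau>mult[of "a [^] i" a] a by simp
 qed
 have key: "a [^] (n * n) = \<tau> a [^] n" if a: "a \<in> carrier G" for a
  using \<tau>pow[OF a, of n] \<tau>central[OF an[OF a]] a by (simp add: nat_pow_pow)
 show thesis
 proof (rule that[of "n * n"])
  show "n * n > 0" using n0 by simp
  show "a [^] (n * n) \<in> Z" if a: "a \<in> carrier G" for a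
   using Z'.nat_pow_closed[of "\<tau> a" n] \<tau>Z[OF a] unfolding key[OF a] powZ Z'simps .
  show "(a \<otimes> b) [^] (n * n) = a [^] (n * n) \<otimes> b [^] (n * n)"
   if a: "a \<in> carrier G" and b: "b \<in> carrier G" for a b
  proof -
   have "(\<tau> a \<otimes>\<^bsub>Z'\<^esub> \<tau> b) [^]\<^bsub>Z'\<^esub> n = \<tau> a [^]\<^bsub>Z'\<^esub> n \<otimes>\<^bsub>Z'\<^esub> \<tau> b [^]\<^bsub>Z'\<^esub> n"
    by (rule Z'.nat_pow_distrib) (use \<tau>Z a b in \<open>auto simp: Z'simps\<close>)
   then show ?thesis
    using a b by (simp add: key \<tau>mult powZ Z'simps)
  qed
 qed
qed

text \<open>Let \<open>q i\<close> run through the cycle of \<open>p\<close> and put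
  \<open>\<sigma> i = [q i, s]\<close>. By induction the commutators of \<open>s\<close> commute
  with every \<open>q j\<close>, and this turns conjugation by \<open>x\<close> into the recursion
  \<open>\<sigma> (i + 1) = [\<sigma> i, x z^-1]\<close> with \<open>z = [s, x]\<close>. So
  \<open>\<sigma> 0\<close> is a periodic element of the hypercentre and must be trivial.\<close>

lemma engel_periodic_commute_hypercenter:
 assumes "s \<in> hypercenter G"
 shows "\<forall>p\<in>carrier G. \<forall>x\<in>carrier G. engel_periodic G x p \<longrightarrow> p \<otimes> s = s \<otimes> p"
 using assms
proof (induction rule: hypercenter.induct)
 case one
 then show ?case by simp
next
 case (step s)
 have IH: "comm G s g \<in> hypercenter G"
  "\<And>p x. \<lbrakk>p \<in> carrier G; x \<in> carrier G; engel_periodic G x p\<rbrakk> \<Longrightarrow> p \<otimes> comm G s g = comm G s g \<otimes> p"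
  if "g \<in> carrier G" for g
  using step(2) that by auto
 interpret S: normal "hypercenter G" G by (rule hypercenter_normal)
 show ?case
 proof (intro ballI impI)
  fix p x assume p: "p \<in> carrier G" and x: "x \<in> carrier G" and per: "engel_periodic G x p"
  define q where "q i = engel_comm G p x i" for i
  have qG: "q i \<in> carrier G" for i using p x by (simp add: q_def)
  have qSuc: "q (Suc i) = comm G (q i) x" for i by (simp add: q_def)
  have qper: "engel_periodic G x (q i)" for i unfolding q_def by (rule engel_periodic_engel_comm[OF per])
  define \<sigma> where "\<sigma> i = comm G (q i) s" for i
  define z where "z = comm G s x"
  have zG: "z \<in> carrier G" using step(1) x by (simp add: z_def)
  have \<sigma>e: "\<sigma> i = inv (comm G s (q i))" for i using qG step(1) by (simp add: \<sigma>_def inv_comm)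
  have \<sigma>S: "\<sigma> i \<in> hypercenter G" for i using IH(1)[OF qG] by (simp add: \<sigma>e)
  have \<sigma>G: "\<sigma> i \<in> carrier G" for i using \<sigma>S hypercenter_carrier by simp
  have z_comm: "q i \<otimes> z = z \<otimes> q i" for i
   unfolding z_def by (rule IH(2)[OF x qG x qper])
  have \<sigma>_comm: "q j \<otimes> \<sigma> i = \<sigma> i \<otimes> q j" for i j
  proof -
   have "q j \<otimes> comm G s (q i) = comm G s (q i) \<otimes> q j" by (rule IH(2)[OF qG qG x qper])
   then show ?thesis unfolding \<sigma>e
    using qG[of i] qG[of j] step(1) comm_closed by (metis inv_closed inv_solve_left inv_solve_right m_assoc m_closed)
  qed
  have rec: "\<sigma> (Suc i) = comm G (\<sigma> i) (x \<otimes> inv z)" for i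
  proof -
   have "comm G (q i \<otimes> q (Suc i)) s = inv (q (Suc i)) \<otimes> \<sigma> i \<otimes> q (Suc i) \<otimes> \<sigma> (Suc i)"
    using qG step(1) by (simp add: comm_mult_left \<sigma>_def)
   also have "inv (q (Suc i)) \<otimes> \<sigma> i \<otimes> q (Suc i) = \<sigma> i"
    using \<sigma>_comm[of "Suc i" i, symmetric] qG \<sigma>G by (simp add: m_assoc)
   finally have c1: "comm G (q i \<otimes> q (Suc i)) s = \<sigma> i \<otimes> \<sigma> (Suc i)" .
   have c2: "comm G (q i \<otimes> q (Suc i)) z = \<one>"
   proof -
    have "(q i \<otimes> q (Suc i)) \<otimes> z = q i \<otimes> (z \<otimes> q (Suc i))"
     using qG zG z_comm[of "Suc i"] by (simp add: m_assoc)
    also have "\<dots> = (q i \<otimes> z) \<otimes> q (Suc i)" using qG zG by (simp add: m_assoc)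
    also have "\<dots> = z \<otimes> (q i \<otimes> q (Suc i))" using qG zG z_comm[of i] by (simp add: m_assoc)
    finally show ?thesis using qG zG by (simp add: comm_eq_one_iff)
   qed
   \<comment> \<open>Conjugation by \<open>x\<close> replaces \<open>q i\<close> by
     \<open>q i \<otimes> q (Suc i)\<close> and \<open>s\<close> by \<open>s \<otimes> z\<close>;
     expanding the resulting commutator with \<open>c1\<close> and \<open>c2\<close> yields the
     recursion.\<close>
   have "inv x \<otimes> \<sigma> i \<otimes> x = comm G (inv x \<otimes> q i \<otimes> x) (inv x \<otimes> s \<otimes> x)"
    using qG[of i] step(1) x by (simp add: comm_conj \<sigma>_def)
   also have "\<dots> = comm G (q i \<otimes> q (Suc i)) (s \<otimes> z)"
    using qG[of i] step(1) x by (simp add: conj_eq_mult_comm qSuc z_def)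
   also have "\<dots> = \<one> \<otimes> (inv z \<otimes> (\<sigma> i \<otimes> \<sigma> (Suc i)) \<otimes> z)"
    using qG zG step(1) c1 c2 by (simp add: comm_mult_right)
   finally have "inv x \<otimes> \<sigma> i \<otimes> x = inv z \<otimes> (\<sigma> i \<otimes> \<sigma> (Suc i)) \<otimes> z" using \<sigma>G zG by simp
   then have "inv (\<sigma> i) \<otimes> (z \<otimes> (inv x \<otimes> \<sigma> i \<otimes> x) \<otimes> inv z)
    = inv (\<sigma> i) \<otimes> (z \<otimes> (inv z \<otimes> (\<sigma> i \<otimes> \<sigma> (Suc i)) \<otimes> z) \<otimes> inv z)" by simp
   also have "\<dots> = \<sigma> (Suc i)" using \<sigma>G zG by (simp add: m_assoc)
   also have "inv (\<sigma> i) \<otimes> (z \<otimes> (inv x \<otimes> \<sigma> i \<otimes> x) \<otimes> inv z) = comm G (\<sigma> i) (x \<otimes> inv z)"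
    using \<sigma>G zG x by (simp add: word_simps)
   finally show ?thesis by simp
  qed
  have eng: "engel_comm G (\<sigma> 0) (x \<otimes> inv z) i = \<sigma> i" for i
   by (induction i) (simp_all add: rec)
  obtain k where k: "k > 0" "engel_comm G p x k = p" using per by (auto simp: engel_periodic_def)
  have "\<sigma> k = \<sigma> 0" using k by (simp add: \<sigma>_def q_def)
  then have "engel_periodic G (x \<otimes> inv z) (\<sigma> 0)"
   unfolding engel_periodic_def using k eng by (intro exI[of _ k]) simp
  then have "\<sigma> 0 = \<one>" using bspec[OF hypercenter_engel_periodic[OF \<sigma>S[of 0]], of "x \<otimes> inv z"] x zG by simp
  then show "p \<otimes> s = s \<otimes> p" using p step(1) by (simp add: \<sigma>_def q_def comm_eq_one_iff)
 qed
qed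

end


context group
begin

text \<open>Periodic elements commute with the hypercentre \<open>S\<close>, so a periodic
  \<open>p\<close> is determined by the cosets of \<open>p\<close> and of a witness
  \<open>x\<close>, and there are only finitely many. In the group \<open>N\<close> they generate,
  \<open>S \<inter> N\<close> is central of finite index, hence some power map is a homomorphism
  into \<open>S\<close>. It sends periodic elements to periodic elements of \<open>S\<close>, that
  is to 1, and Dietzmann's lemma makes \<open>N\<close> finite.\<close>

theorem finite_by_hypercentral_if_finite_index:
 assumes ae: "\<And>g. g \<in> carrier G \<Longrightarrow> almost_right_engel G g"
  and fin: "finite (rcosets (hypercenter G))"
 shows "\<exists>N. N \<lhd> G \<and> finite N \<and> hypercentral (G Mod N)"
proof -
 define S where "S = hypercenter G"
 have Sn: "S \<lhd> G" unfolding S_def by (rule hypercenter_normal)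
 interpret S: normal S G by (rule Sn)
 have SG: "s \<in> carrier G" if "s \<in> S" for s using that by (rule S.mem_carrier)
 have finS: "finite (rcosets S)" using fin by (simp add: S_def)
 define Per where "Per = {p \<in> carrier G. \<exists>x\<in>carrier G. engel_periodic G x p}"
 have PerG: "Per \<subseteq> carrier G" by (auto simp: Per_def)
 have PerI: "engel_comm G p x n \<in> Per" if "p \<in> carrier G" "x \<in> carrier G" "engel_periodic G x p" for p x n
  unfolding Per_def using that engel_periodic_engel_comm[OF that(3), of n] by auto
 have PS: "p \<otimes> s = s \<otimes> p" if "p \<in> Per" "s \<in> S" for p s
  using engel_periodic_commute_hypercenter[of s] that by (auto simp: Per_def S_def)
 have commS: "comm G s x \<in> S" if "s \<in> S" "x \<in> carrier G" for s x
  using that hypercenter_comm by (simp add: S_def)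
 have S_per: "s = \<one>" if "s \<in> S" "x \<in> carrier G" "engel_periodic G x s" for s x
  using bspec[OF hypercenter_engel_periodic, of s x] that by (simp add: S_def)
 have Per_conj: "inv g \<otimes> p \<otimes> g \<in> Per" if "p \<in> Per" "g \<in> carrier G" for p g
 proof -
  obtain x where x: "x \<in> carrier G" "engel_periodic G x p" "p \<in> carrier G"
   using \<open>p \<in> Per\<close> by (auto simp: Per_def)
  then have "engel_periodic G (inv g \<otimes> x \<otimes> g) (inv g \<otimes> p \<otimes> g)"
   using engel_periodic_conj that by simp
  moreover have "inv g \<otimes> x \<otimes> g \<in> carrier G" using x that by simp
  ultimately show ?thesis using x that unfolding Per_def by auto
 qed
 have finPer: "finite Per"
 proof -
  \<comment> \<open>One witness is fixed for each periodic element, so that the pair of cosets below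
    becomes a function of \<open>p\<close>.\<close>
  define xx where "xx p = (SOME x. x \<in> carrier G \<and> engel_periodic G x p)" for p
  have xx: "xx p \<in> carrier G" "engel_periodic G (xx p) p" if "p \<in> Per" for p
  proof -
   have "\<exists>x. x \<in> carrier G \<and> engel_periodic G x p" using that by (auto simp: Per_def)
   from someI_ex[OF this] show "xx p \<in> carrier G" "engel_periodic G (xx p) p" by (auto simp: xx_def)
  qed
  have "inj_on (\<lambda>p. (S #> p, S #> xx p)) Per"
  proof (rule inj_onI)
   fix p p' assume p: "p \<in> Per" and p': "p' \<in> Per" and "(S #> p, S #> xx p) = (S #> p', S #> xx p')"
   then have eq: "S #> p = S #> p'" "S #> xx p = S #> xx p'" by auto
   define x where "x = xx p"
   have x: "x \<in> carrier G" "engel_periodic G x p" using xx[OF p] by (auto simp: x_def)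
   have pG: "p \<in> carrier G" "p' \<in> carrier G" using p p' PerG by auto
   have "p' \<in> S #> p" using eq(1) rcos_self[OF pG(2) S.subgroup_axioms] by simp
   then obtain s where s: "s \<in> S" "p' = s \<otimes> p" by (auto simp: r_coset_def)
   have "xx p' \<in> S #> x" using eq(2) rcos_self[OF xx(1)[OF p'] S.subgroup_axioms] by (simp add: x_def)
   then obtain u where u: "u \<in> S" "xx p' = u \<otimes> x" by (auto simp: r_coset_def)
   have cu: "comm G q (u \<otimes> x) = comm G q x" if q: "q \<in> Per" for q
   proof -
    have qG: "q \<in> carrier G" using q PerG by auto
    have "comm G q u = \<one>" using PS[OF q u(1)] qG SG[OF u(1)] by (simp add: comm_eq_one_iff)
    then show ?thesis using qG x SG[OF u(1)] by (simp add: comm_mult_right)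
   qed
   have e1: "engel_comm G p' (u \<otimes> x) n = engel_comm G p' x n" for n
   proof (induction n)
    case (Suc n)
    have "engel_comm G p' (u \<otimes> x) n \<in> Per"
     using PerI[OF pG(2) xx(1)[OF p'] xx(2)[OF p']] u by simp
    then show ?case using Suc cu by simp
   qed simp
   then have per': "engel_periodic G x p'" using xx(2)[OF p'] u by (simp add: engel_periodic_def)
   have sS: "engel_comm G s x n \<in> S" for n
    by (induction n) (use s commS x in auto)
   \<comment> \<open>As \<open>S\<close> centralises the terms of the sequence of \<open>p\<close>,
     the sequence of \<open>s \<otimes> p\<close> is the termwise product. A common period of
     \<open>p\<close> and \<open>p'\<close> is then a period of \<open>s\<close>, which forces
     \<open>s = \<one>\<close>.\<close>
   have e2: "engel_comm G p' x n = engel_comm G s x n \<otimes> engel_comm G p x n" for n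
   proof (induction n)
    case (Suc n)
    define a where "a = engel_comm G s x n"
    define q where "q = engel_comm G p x n"
    have aG: "a \<in> carrier G" "comm G a x \<in> S" using sS commS x by (auto simp: a_def SG)
    have qP: "q \<in> Per" unfolding q_def by (rule PerI[OF pG(1) x])
    have qG: "q \<in> carrier G" using qP PerG by auto
    have "engel_comm G p' x (Suc n) = comm G (a \<otimes> q) x" using Suc by (simp add: a_def q_def)
    also have "\<dots> = inv q \<otimes> (comm G a x \<otimes> q) \<otimes> comm G q x"
     using aG qG x SG[OF aG(2)] by (simp add: comm_mult_left m_assoc)
    also have "comm G a x \<otimes> q = q \<otimes> comm G a x" using PS[OF qP aG(2)] by simp
    also have "inv q \<otimes> (q \<otimes> comm G a x) \<otimes> comm G q x = comm G a x \<otimes> comm G q x"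
     using aG qG x by simp
    finally show ?case by (simp add: a_def q_def)
   qed (use s in simp)
   obtain k where k: "k > 0" "engel_comm G p x k = p" "engel_comm G p' x k = p'"
    using engel_periodic_common_period[OF x(2) per'] by auto
   have "engel_comm G s x k \<otimes> p = s \<otimes> p" using e2[of k] k s by simp
   then have "engel_comm G s x k = s" using SG[OF sS] SG[OF s(1)] pG by simp
   then have "engel_periodic G x s" using k(1) by (auto simp: engel_periodic_def)
   then have "s = \<one>" using S_per s x by blast
   then show "p = p'" using s pG by simp
  qed
  moreover have "(\<lambda>p. (S #> p, S #> xx p)) ` Per \<subseteq> (rcosets S) \<times> (rcosets S)"
   using PerG xx(1) by (auto simp: RCOSETS_def)
  ultimately show ?thesis using finS by (meson finite_SigmaI finite_imageD finite_subset)
 qed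
 define N where "N = generate G Per"
 have Nn: "N \<lhd> G" unfolding N_def
 proof (rule normal_generateI[OF PerG])
  show "g \<otimes> h \<otimes> inv g \<in> Per" if "h \<in> Per" "g \<in> carrier G" for h g
   using Per_conj[OF that(1), of "inv g"] that by simp
 qed
 interpret N: normal N G by (rule Nn)
 have PN: "Per \<subseteq> N" unfolding N_def by (auto intro: generate.incl)
 have SN: "s \<otimes> a = a \<otimes> s" if s: "s \<in> S" and a: "a \<in> N" for s a
 proof -
  have "subgroup {g \<in> carrier G. comm G s g \<in> {\<one>}} G"
   by (rule comm_kernel_subgroup[OF one_is_normal SG[OF s]])
  moreover have "Per \<subseteq> {g \<in> carrier G. comm G s g \<in> {\<one>}}"
   using PS[OF _ s] PerG SG[OF s] by (auto simp: comm_eq_one_iff)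
  ultimately have "N \<subseteq> {g \<in> carrier G. comm G s g \<in> {\<one>}}"
   unfolding N_def by (intro generate_subgroup_incl)
  then show ?thesis using a SG[OF s] N.mem_carrier[OF a] by (auto simp: comm_eq_one_iff)
 qed
 define N' where "N' = G\<lparr>carrier := N\<rparr>"
 interpret N': group N' unfolding N'_def by (rule subgroup_imp_group[OF N.subgroup_axioms])
 have N's: "carrier N' = N" "mult N' = mult G" by (simp_all add: N'_def)
 have powN: "a [^]\<^bsub>N'\<^esub> (i::nat) = a [^] i" for a i by (simp add: N'_def flip: nat_pow_consistent)
 define Z where "Z = S \<inter> N"
 have Zsub: "subgroup Z N'"
  unfolding Z_def N'_def
  by (rule subgroup_incl[OF _ N.subgroup_axioms])
   (auto intro: subgroups_Inter_pair S.subgroup_axioms N.subgroup_axioms)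
 have Zfin: "finite (rcosets\<^bsub>N'\<^esub> Z)"
 proof -
  have "rcosets\<^bsub>N'\<^esub> Z \<subseteq> (\<lambda>c. c \<inter> N) ` (rcosets S)"
  proof
   fix c assume "c \<in> rcosets\<^bsub>N'\<^esub> Z"
   then obtain a where a: "a \<in> N" "c = Z #>\<^bsub>N'\<^esub> a" by (auto simp: RCOSETS_def N's)
   have aG: "a \<in> carrier G" using a by (simp add: N.mem_carrier)
   have "c = (S #> a) \<inter> N"
   proof (intro Set.set_eqI)
    fix y
    have "y \<in> N \<longleftrightarrow> s \<in> N" if "s \<in> S" "y = s \<otimes> a" for s
    proof
     assume "y \<in> N"
     then have "y \<otimes> inv a \<in> N" using a by simp
     then show "s \<in> N" using that SG aG by (simp add: m_assoc)
    qed (use that a in simp)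
    then show "y \<in> c \<longleftrightarrow> y \<in> (S #> a) \<inter> N"
     unfolding a(2) by (auto simp: r_coset_def Z_def N's)
   qed
   then show "c \<in> (\<lambda>c. c \<inter> N) ` (rcosets S)" using aG by (auto simp: RCOSETS_def)
  qed
  then show ?thesis using finS finite_surj by blast
 qed
 have Zcent: "z \<otimes>\<^bsub>N'\<^esub> g = g \<otimes>\<^bsub>N'\<^esub> z" if "z \<in> Z" "g \<in> carrier N'" for z g
  using that SN by (auto simp: Z_def N's)
 obtain k :: nat where k: "k > 0" "\<And>a. a \<in> N \<Longrightarrow> a [^] k \<in> Z"
  "\<And>a b. a \<in> N \<Longrightarrow> b \<in> N \<Longrightarrow> (a \<otimes> b) [^] k = a [^] k \<otimes> b [^] k"
  using N'.central_power_hom[OF Zsub Zcent Zfin] unfolding powN N's by auto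
 have tors: "p [^] k = \<one>" if p: "p \<in> Per" for p
 proof -
  obtain x where x: "x \<in> carrier G" "engel_periodic G x p" "p \<in> carrier G"
   using p by (auto simp: Per_def)
  \<comment> \<open>The \<open>k\<close>-th power map is a homomorphism on \<open>N\<close> that
    commutes with conjugation by \<open>x\<close>, so it carries the Engel sequence of
    \<open>p\<close> to that of \<open>p [^] k\<close>.\<close>
  have comm_pow: "comm G q x [^] k = comm G (q [^] k) x" if q: "q \<in> Per" for q
  proof -
   have qG: "q \<in> carrier G" "q \<in> N" using q PerG PN by auto
   have "comm G q x = inv q \<otimes> (inv x \<otimes> q \<otimes> x)" using qG x by (simp add: word_simps)
   then have "comm G q x [^] k = (inv q) [^] k \<otimes> (inv x \<otimes> q \<otimes> x) [^] k"
    using k(3)[of "inv q" "inv x \<otimes> q \<otimes> x"] qG x N.inv_op_closed1 by simp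
   also have "\<dots> = inv (q [^] k) \<otimes> (inv x \<otimes> q [^] k \<otimes> x)"
    using qG x by (simp only: nat_pow_inv conj_pow)
   also have "\<dots> = comm G (q [^] k) x" using qG x by (simp add: word_simps)
   finally show ?thesis .
  qed
  have "engel_comm G (p [^] k) x i = engel_comm G p x i [^] k" for i
   by (induction i) (use comm_pow PerI[OF x(3,1,2)] in auto)
  then have "engel_periodic G x (p [^] k)" using x(2) by (auto simp: engel_periodic_def)
  moreover have "p [^] k \<in> S" using k(2) p PN by (auto simp: Z_def)
  ultimately show ?thesis using S_per x by blast
 qed
 have finN: "finite N"
  unfolding N_def by (rule finite_generate_torsion[OF finPer PerG _ k(1) tors]) (use Per_conj PerG in auto)
 define Q where "Q = G Mod N"
 interpret Q: group Q unfolding Q_def by (rule N.factorgroup_is_group)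
 have \<pi>: "(\<lambda>a. N #> a) \<in> hom G Q" unfolding Q_def by (rule N.r_coset_hom_Mod)
 have Qc: "carrier Q = (\<lambda>a. N #> a) ` carrier G" by (auto simp: Q_def FactGroup_def RCOSETS_def)
 have Qengel: "\<exists>n. engel_comm Q a b n = \<one>\<^bsub>Q\<^esub>" if ab: "a \<in> carrier Q" "b \<in> carrier Q" for a b
 proof -
  obtain g x where g: "g \<in> carrier G" "a = N #> g" and x: "x \<in> carrier G" "b = N #> x"
   using ab unfolding Qc by auto
  obtain n where n: "\<And>i. i \<ge> n \<Longrightarrow> engel_periodic G x (engel_comm G g x i)"
   using almost_right_engel_eventually_periodic[OF ae[OF g(1)] g(1) x(1)] by auto
  have "engel_comm G g x n \<in> N"
   using PerI[OF _ x(1) n[of n], of 0] g x PN by auto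
  then have "engel_comm Q a b n = \<one>\<^bsub>Q\<^esub>"
   using engel_comm_Mod[OF Nn g(1) x(1)] Mod_eq_one_iff[OF Nn] g x by (simp add: Q_def)
  then show ?thesis by auto
 qed
 define S' where "S' = hypercenter Q"
 have S'n: "S' \<lhd> Q" unfolding S'_def by (rule Q.hypercenter_normal)
 interpret S': normal S' Q by (rule S'n)
 have SS': "N #> s \<in> S'" if "s \<in> S" for s
  unfolding S'_def by (rule hypercenter_hom[OF Q.is_group \<pi> Qc[symmetric]]) (use that in \<open>simp add: S_def\<close>)
 interpret QS: group "Q Mod S'" by (rule S'.factorgroup_is_group)
 have "carrier (Q Mod S') \<subseteq> (\<lambda>c. S' #>\<^bsub>Q\<^esub> (N #> (SOME g. g \<in> c))) ` (rcosets S)"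
 proof
  fix d assume "d \<in> carrier (Q Mod S')"
  then obtain g where g: "g \<in> carrier G" "d = S' #>\<^bsub>Q\<^esub> (N #> g)"
   using Q.Mod_carrier_iff unfolding Qc by auto
  define c where "c = S #> g"
  have "g \<in> c" unfolding c_def by (rule rcos_self[OF g(1) S.subgroup_axioms])
  then have "(SOME g. g \<in> c) \<in> c" by (rule someI)
  then obtain s where s: "s \<in> S" "(SOME g. g \<in> c) = s \<otimes> g" unfolding c_def by (auto simp: r_coset_def)
  have sQ: "N #> s \<in> carrier Q" "N #> g \<in> carrier Q" using SG[OF s(1)] g unfolding Qc by auto
  have "N #> (s \<otimes> g) = (N #> s) \<otimes>\<^bsub>Q\<^esub> (N #> g)"
   using hom_mult[OF \<pi> SG[OF s(1)] g(1)] .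
  then have "S' #>\<^bsub>Q\<^esub> (N #> (s \<otimes> g)) = S' #>\<^bsub>Q\<^esub> (N #> s) #>\<^bsub>Q\<^esub> (N #> g)"
   using Q.coset_mult_assoc[OF S'.subset sQ] by simp
  also have "S' #>\<^bsub>Q\<^esub> (N #> s) = S'"
   by (rule Q.coset_join2[OF sQ(1) S'.subgroup_axioms SS'[OF s(1)]])
  finally have "d = S' #>\<^bsub>Q\<^esub> (N #> (SOME g. g \<in> c))" using g s by simp
  moreover have "c \<in> rcosets S" using g by (auto simp: c_def RCOSETS_def)
  ultimately show "d \<in> (\<lambda>c. S' #>\<^bsub>Q\<^esub> (N #> (SOME g. g \<in> c))) ` (rcosets S)" by auto
 qed
 then have "finite (carrier (Q Mod S'))" using finS finite_surj by blast
 moreover have "\<exists>n. engel_comm (Q Mod S') a b n = \<one>\<^bsub>Q Mod S'\<^esub>"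
  if ab: "a \<in> carrier (Q Mod S')" "b \<in> carrier (Q Mod S')" for a b
 proof -
  obtain g x where g: "g \<in> carrier Q" "a = S' #>\<^bsub>Q\<^esub> g" and x: "x \<in> carrier Q" "b = S' #>\<^bsub>Q\<^esub> x"
   using ab Q.Mod_carrier_iff by auto
  obtain n where "engel_comm Q g x n = \<one>\<^bsub>Q\<^esub>" using Qengel[OF g(1) x(1)] by auto
  then have "engel_comm (Q Mod S') a b n = \<one>\<^bsub>Q Mod S'\<^esub>"
   using Q.engel_comm_Mod[OF S'n g(1) x(1), of n] Q.Mod_eq_one_iff[OF S'n Q.one_closed] g x by simp
  then show ?thesis by auto
 qed
 ultimately have "hypercentral (Q Mod S')"
  using finite_engel_hypercentral[OF QS.is_group] by auto
 then have "hypercentral Q"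
  using Q.hypercentral_of_Mod[OF S'n] by (simp add: S'_def)
 then show ?thesis using Nn finN unfolding Q_def by auto
qed

subsection \<open>Fixed points of unipotent actions\<close>

text \<open>If the sequence of \<open>a\<close> does not stop after one step, let \<open>b\<close>
  and \<open>c = [b, x]\<close> be its last two terms before 1. Then \<open>x\<close> fixes
  \<open>c\<close>, so \<open>x^j\<close> conjugates \<open>b\<close> to \<open>b c^j\<close>; since
  \<open>x^r\<close> centralises \<open>b\<close>, the element \<open>c\<close> is
  \<open>r\<close>-torsion and hence trivial.\<close>

lemma unipotent_finite_order_trivial:
 assumes A: "\<And>a. a \<in> A \<Longrightarrow> a \<in> carrier G" "\<And>a. a \<in> A \<Longrightarrow> comm G a x \<in> A"
  and x: "x \<in> carrier G" and engel: "\<And>a. a \<in> A \<Longrightarrow> \<exists>n. engel_comm G a x n = \<one>"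
  and r: "\<And>a. a \<in> A \<Longrightarrow> a \<otimes> x [^] (r::nat) = x [^] r \<otimes> a"
  and tors: "\<And>a. a \<in> A \<Longrightarrow> a [^] r = \<one> \<Longrightarrow> a = \<one>"
  and a: "a \<in> A"
 shows "a \<otimes> x = x \<otimes> a"
proof (rule ccontr)
 assume nc: "a \<otimes> x \<noteq> x \<otimes> a"
 have eA: "engel_comm G a x n \<in> A" for n by (induction n) (use a A in auto)
 define n where "n = (LEAST n. engel_comm G a x n = \<one>)"
 have n: "engel_comm G a x n = \<one>" unfolding n_def by (rule LeastI_ex[OF engel[OF a]])
 have min: "engel_comm G a x i \<noteq> \<one>" if "i < n" for i
  using not_less_Least that unfolding n_def by blast
 have "n \<noteq> 0" using n nc x by (metis engel_comm.simps(1) l_one r_one)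
 moreover have "n \<noteq> 1" using n nc x A(1)[OF a] by (auto simp: comm_eq_one_iff)
 ultimately obtain i where i: "n = Suc (Suc i)" by (metis One_nat_def not0_implies_Suc)
 define b where "b = engel_comm G a x i"
 define c where "c = comm G b x"
 have b: "b \<in> A" "b \<in> carrier G" using eA A by (auto simp: b_def)
 have c: "c \<in> A" "c \<in> carrier G" using A b by (auto simp: c_def)
 have c1: "c \<noteq> \<one>" using min[of "Suc i"] i by (simp add: c_def b_def)
 have "comm G c x = \<one>" using n i by (simp add: c_def b_def)
 then have cx: "inv x \<otimes> c \<otimes> x = c" using conj_eq_mult_comm[OF c(2) x] c by simp
 have bx: "inv x \<otimes> b \<otimes> x = b \<otimes> c" using conj_eq_mult_comm[OF b(2) x] by (simp add: c_def)
 have pow: "inv (x [^] j) \<otimes> b \<otimes> x [^] j = b \<otimes> c [^] j" for j :: nat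
 proof (induction j)
  case (Suc j)
  have "inv (x [^] Suc j) \<otimes> b \<otimes> x [^] Suc j = inv x \<otimes> (inv (x [^] j) \<otimes> b \<otimes> x [^] j) \<otimes> x"
   using x b by (simp add: inv_mult_group m_assoc)
  also have "\<dots> = (inv x \<otimes> b \<otimes> x) \<otimes> (inv x \<otimes> c [^] j \<otimes> x)"
   unfolding Suc using x b c by (simp add: m_assoc)
  also have "inv x \<otimes> c [^] j \<otimes> x = c [^] j" using conj_pow[OF c(2) x, of j] cx by simp
  also have "(inv x \<otimes> b \<otimes> x) \<otimes> c [^] j = b \<otimes> c [^] Suc j"
   unfolding bx using b c nat_pow_Suc2[OF c(2), of j] by (simp add: m_assoc)
  finally show ?case .
 qed (use b in simp)
 have "inv (x [^] r) \<otimes> b \<otimes> x [^] r = b"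
  using r[OF b(1)] b x by (simp add: m_assoc)
 then have "b \<otimes> c [^] r = b \<otimes> \<one>" using pow[of r] b by simp
 then have "c [^] r = \<one>" using b c by (meson l_cancel nat_pow_closed one_closed)
 then show False using tors[OF c(1)] c1 by simp
qed

lemma power_in_finite_index:
 assumes C: "subgroup C G" "finite (rcosets C)" and x: "x \<in> carrier G"
 obtains r :: nat where "r > 0" "x [^] r \<in> C"
proof -
 have "range (\<lambda>i::nat. C #> x [^] i) \<subseteq> rcosets C" using x by (auto simp: RCOSETS_def)
 then have "\<not> inj (\<lambda>i::nat. C #> x [^] i)"
  using C(2) finite_subset range_inj_infinite by blast
 then obtain a b :: nat where ab: "a \<noteq> b" "C #> x [^] a = C #> x [^] b" by (auto simp: inj_on_def)
 define i j where "i = min a b" and "j = max a b"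
 have ij: "i < j" "C #> x [^] i = C #> x [^] j"
  using ab by (auto simp: i_def j_def min_def max_def)
 have "x [^] j \<in> C #> x [^] i" using ij rcos_self[of "x [^] j" C] C x by simp
 then obtain c where c: "c \<in> C" "x [^] j = c \<otimes> x [^] i" by (auto simp: r_coset_def)
 have "x [^] j = x [^] (j - i) \<otimes> x [^] i" using ij x by (simp add: nat_pow_mult)
 then have "x [^] (j - i) = c" using c x subgroup.mem_carrier[OF C(1) c(1)] by simp
 then show ?thesis using that[of "j - i"] ij c by simp
qed

text \<open>A prime divisor \<open>q\<close> of the order yields an element of order
  \<open>q\<close> inside a Sylow-type subgroup, and its \<open>p\<close>-power torsion forces
  \<open>q = p\<close>.\<close>

lemma order_prime_power:
 assumes fin: "finite (carrier G)" and p: "Factorial_Ring.prime (p::nat)"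
  and pp: "\<And>x. x \<in> carrier G \<Longrightarrow> \<exists>k. x [^] (p ^ k) = \<one>"
 shows "\<exists>n. Coset.order G = p ^ n"
proof -
 have q: "q = p" if q: "Factorial_Ring.prime q" "q dvd Coset.order G" for q
 proof -
  obtain m where m: "Coset.order G = q ^ 1 * m" using q(2) by auto
  obtain L where L: "subgroup L G" "card L = q ^ 1"
   using sylow_thm[OF q(1) is_group m fin] by auto
  have "L \<noteq> {\<one>}" using L q(1) by (auto simp: prime_nat_iff)
  then obtain x where x: "x \<in> L" "x \<noteq> \<one>" using subgroup.one_closed[OF L(1)] by auto
  have xG: "x \<in> carrier G" using subgroup.mem_carrier[OF L(1) x(1)] .
  interpret L: group "G\<lparr>carrier := L\<rparr>" by (rule subgroup_imp_group[OF L(1)])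
  have "x [^]\<^bsub>G\<lparr>carrier := L\<rparr>\<^esub> Coset.order (G\<lparr>carrier := L\<rparr>) = \<one>"
   using L.pow_order_eq_1[of x] x by simp
  then have "x [^] q = \<one>" using L(2) by (simp add: Coset.order_def flip: nat_pow_consistent)
  then have "ord x dvd q" using pow_eq_id[OF xG] by simp
  moreover have "ord x \<noteq> 1" using x xG ord_eq_1 by blast
  ultimately have "ord x = q" using q(1) by (auto simp: prime_nat_iff)
  moreover obtain k where "x [^] (p ^ k) = \<one>" using pp[OF xG] by auto
  then have "ord x dvd p ^ k" using pow_eq_id[OF xG] by simp
  ultimately show ?thesis using q(1) p by (metis prime_dvd_power primes_dvd_imp_eq)
 qed
 have pos: "Coset.order G > 0" using fin by (simp add: order_gt_0_iff_finite)
 obtain n r where nr: "Coset.order G = p ^ n * r" "\<not> p dvd r"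
  using pos p multiplicity_decompose'[of "Coset.order G" p] by (metis not_prime_unit not_less_zero)
 have "r = 1"
 proof (rule ccontr)
  assume "r \<noteq> 1"
  then obtain q' where "Factorial_Ring.prime q'" "q' dvd r" using prime_factor_nat by blast
  then show False using q[of q'] nr by auto
 qed
 then show ?thesis using nr by auto
qed

end

text \<open>Every orbit outside the fixed points has \<open>p\<close>-power size greater than 1, so
  these orbits contribute a multiple of \<open>p\<close> to \<open>card E\<close>.\<close>

lemma p_group_fixed_points:
 assumes act: "group_action P E \<phi>" and p: "Factorial_Ring.prime p" "Coset.order P = p ^ n" and E: "finite E" "p dvd card E"
 shows "p dvd card {e \<in> E. \<forall>g\<in>carrier P. \<phi> g e = e}"
proof -
 interpret group_action P E \<phi> by (rule act)
 let ?F = "{e \<in> E. \<forall>g\<in>carrier P. \<phi> g e = e}"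
 let ?C = "(\<lambda>e. orbit P \<phi> e) ` (E - ?F)"
 have sub: "orbit P \<phi> e \<subseteq> E" if "e \<in> E" for e
  using that element_image by (auto simp: orbit_def)
 have same: "orbit P \<phi> e = orbit P \<phi> d" if e: "e \<in> E" and d: "d \<in> orbit P \<phi> e" for e d
 proof -
  have dE: "d \<in> E" using sub[OF e] d by auto
  have "y \<in> orbit P \<phi> e" if "y \<in> orbit P \<phi> d" for y
   using orbit_trans[OF e dE _ d that] sub[OF dE] that by auto
  moreover have "y \<in> orbit P \<phi> d" if "y \<in> orbit P \<phi> e" for y
   using orbit_trans[OF dE e _ orbit_sym[OF e dE d] that] sub[OF e] that by auto
  ultimately show ?thesis by auto
 qed
 have U: "\<Union>?C = E - ?F"
 proof
  show "E - ?F \<subseteq> \<Union>?C" using orbit_refl by fastforce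
  show "\<Union>?C \<subseteq> E - ?F"
  proof
   fix d assume "d \<in> \<Union>?C"
   then obtain e where e: "e \<in> E - ?F" "d \<in> orbit P \<phi> e" by auto
   have dE: "d \<in> E" using sub e by auto
   have "d \<notin> ?F"
   proof
    assume dF: "d \<in> ?F"
    then have "orbit P \<phi> d \<subseteq> {d}" by (auto simp: orbit_def)
    then have "e = d" using same[of e d] e orbit_refl[of e] by auto
    then show False using e dF by auto
   qed
   then show "d \<in> E - ?F" using dE by auto
  qed
 qed
 have "p dvd card (\<Union>?C)"
 proof (rule dvd_partition)
  show "finite (\<Union>?C)" unfolding U using E by simp
  show "\<forall>c\<in>?C. p dvd card c"
  proof
   fix c assume "c \<in> ?C"
   then obtain e where e: "e \<in> E" "e \<notin> ?F" "c = orbit P \<phi> e" by auto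
   have "card c dvd p ^ n" using orbit_stabilizer_theorem[OF e(1)] p(2) e(3) by (metis dvd_triv_left mult.commute)
   then obtain i where i: "card c = p ^ i" using p(1) divides_primepow_nat by auto
   have "i \<noteq> 0"
   proof
    assume "i = 0"
    then have "card c = 1" using i by simp
    then have "c = {e}" using orbit_refl[OF e(1)] e(3) by (metis card_1_singletonE singletonD)
    then have "\<phi> g e = e" if "g \<in> carrier P" for g
     using that e(3) by (auto simp: orbit_def)
    then show False using e by auto
   qed
   then show "p dvd card c" using i by (cases i) auto
  qed
  show "\<forall>c1\<in>?C. \<forall>c2\<in>?C. c1 \<noteq> c2 \<longrightarrow> c1 \<inter> c2 = {}"
  proof (intro ballI impI)
   fix c1 c2 assume c: "c1 \<in> ?C" "c2 \<in> ?C" "c1 \<noteq> c2"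
   then obtain e1 e2 where e: "e1 \<in> E" "c1 = orbit P \<phi> e1" "e2 \<in> E" "c2 = orbit P \<phi> e2" by auto
   show "c1 \<inter> c2 = {}"
   proof (rule ccontr)
    assume "c1 \<inter> c2 \<noteq> {}"
    then obtain d where "d \<in> c1" "d \<in> c2" by auto
    then show False using same[OF e(1), of d] same[OF e(3), of d] e c by auto
   qed
  qed
 qed
 moreover have "card E = card ?F + card (E - ?F)"
  using E card_Un_disjoint[of ?F "E - ?F"] by (simp add: Un_absorb1 Un_Diff_cancel)
 ultimately show ?thesis using E(2) U by (simp add: dvd_add_left_iff)
qed


context group
begin

text \<open>The least positive exponent annihilating some nontrivial element of \<open>A\<close> is
  prime: for a proper factorisation \<open>d * e\<close>, either \<open>b\<close> is already killed
  by \<open>d\<close>, or \<open>b [^] d\<close> is nontrivial and killed by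
  \<open>e\<close>.\<close>

lemma prime_torsion:
 assumes A: "subgroup A G" and a: "a \<in> A" "a \<noteq> \<one>" "a [^] (r::nat) = \<one>" "r > 0"
 obtains p b where "Factorial_Ring.prime (p::nat)" "b \<in> A" "b \<noteq> \<one>" "b [^] p = \<one>"
proof -
 define P where "P s \<longleftrightarrow> s > 0 \<and> (\<exists>b\<in>A. b \<noteq> \<one> \<and> b [^] s = \<one>)" for s :: nat
 have "P r" using a by (auto simp: P_def)
 define p where "p = (LEAST s. P s)"
 have p: "P p" unfolding p_def using \<open>P r\<close> by (rule LeastI)
 have min: "\<not> P s" if "s < p" for s using not_less_Least that unfolding p_def by blast
 obtain b where b: "b \<in> A" "b \<noteq> \<one>" "b [^] p = \<one>" "p > 0" using p by (auto simp: P_def)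
 have bG: "b \<in> carrier G" using subgroup.mem_carrier[OF A b(1)] .
 have "p \<noteq> 1" using b bG by auto
 have "Factorial_Ring.prime p"
 proof (rule prime_natI)
  show "2 \<le> p" using b(4) \<open>p \<noteq> 1\<close> by simp
  fix u v assume uv: "p dvd u * v"
  show "p dvd u \<or> p dvd v"
  proof (rule ccontr)
   assume "\<not> (p dvd u \<or> p dvd v)"
   define d where "d = gcd p u"
   have d: "d dvd p" "d < p" "d > 0"
   proof -
    show "d dvd p" by (simp add: d_def)
    have "d \<noteq> p" using \<open>\<not> (p dvd u \<or> p dvd v)\<close> by (metis d_def gcd_dvd2)
    then show "d < p" using b(4) \<open>d dvd p\<close> by (simp add: dvd_imp_le le_neq_implies_less)
    show "d > 0" using b(4) by (simp add: d_def)
   qed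
   obtain e where e: "p = d * e" using d(1) by blast
   have "d > 1"
   proof (rule ccontr)
    assume "\<not> d > 1"
    then have "d = 1" using d(3) by linarith
    then have "coprime p u" by (simp add: d_def coprime_iff_gcd_eq_1)
    then have "p dvd v" using uv by (simp add: coprime_dvd_mult_right_iff)
    then show False using \<open>\<not> (p dvd u \<or> p dvd v)\<close> by simp
   qed
   then have e': "e < p" "e > 0" using e b(4) by auto
   show False
   proof (cases "b [^] d = \<one>")
    case True
    then show False using min[OF d(2)] d(3) b by (auto simp: P_def)
   next
    case False
    have "(b [^] d) [^] e = \<one>" using b(3) e bG by (simp add: nat_pow_pow)
    moreover have "b [^] d \<in> A"
     by (induction d) (use A b(1) in \<open>auto simp: subgroup.one_closed subgroup.m_closed\<close>)
    ultimately show False using min[OF e'(1)] e'(2) False by (auto simp: P_def)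
   qed
  qed
 qed
 then show ?thesis using that b by blast
qed

text \<open>If \<open>A\<close> is torsion-free, each \<open>x\<close> acts on \<open>A\<close> as a
  unipotent automorphism of finite order, so trivially. Otherwise the conjugates of an element of
  prime order \<open>p\<close> are finite in number, because \<open>C\<close> centralises
  \<open>A\<close>, and generate a finite normal subgroup \<open>M\<close> of exponent
  \<open>p\<close>. On \<open>M\<close> the group acts as a \<open>p\<close>-group, so there is a
  nontrivial fixed point.\<close>

theorem right_engel_central_element:
 assumes A: "subgroup A G" "\<And>a b. a \<in> A \<Longrightarrow> b \<in> A \<Longrightarrow> a \<otimes> b = b \<otimes> a"
   "\<And>a g. a \<in> A \<Longrightarrow> g \<in> carrier G \<Longrightarrow> inv g \<otimes> a \<otimes> g \<in> A"
  and C: "subgroup C G" "finite (rcosets C)" "\<And>a c. a \<in> A \<Longrightarrow> c \<in> C \<Longrightarrow> a \<otimes> c = c \<otimes> a"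
  and engel: "\<And>a x. a \<in> A \<Longrightarrow> x \<in> carrier G \<Longrightarrow> \<exists>n. engel_comm G a x n = \<one>"
  and ne: "A \<noteq> {\<one>}"
 shows "\<exists>z\<in>A. z \<noteq> \<one> \<and> (\<forall>g\<in>carrier G. z \<otimes> g = g \<otimes> z)"
proof -
 have AG: "a \<in> carrier G" if "a \<in> A" for a using A(1) that by (rule subgroup.mem_carrier)
 have CG: "c \<in> carrier G" if "c \<in> C" for c using C(1) that by (rule subgroup.mem_carrier)
 have one: "\<one> \<in> A" using A(1) by (rule subgroup.one_closed)
 show ?thesis
 proof (cases "\<exists>a\<in>A. a \<noteq> \<one> \<and> (\<exists>r::nat>0. a [^] r = \<one>)")
  case False
  obtain a where a: "a \<in> A" "a \<noteq> \<one>" using ne one by auto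
  have "a \<otimes> x = x \<otimes> a" if x: "x \<in> carrier G" for x
  proof -
   obtain r :: nat where r: "r > 0" "x [^] r \<in> C" using power_in_finite_index[OF C(1,2) x] by auto
   show ?thesis
   proof (rule unipotent_finite_order_trivial[of A x r])
    show "comm G a x \<in> A" if "a \<in> A" for a
    proof -
     have "comm G a x = inv a \<otimes> (inv x \<otimes> a \<otimes> x)" using AG[OF that] x by (simp add: word_simps)
     then show ?thesis using A(3)[OF that x] that A(1) by (simp add: subgroup.m_closed subgroup.m_inv_closed)
    qed
    show "b = \<one>" if "b \<in> A" "b [^] r = \<one>" for b using False r that by blast
   qed (use AG x engel C(3) r a in auto)
  qed
  then show ?thesis using a by auto
 next
  case True
  then obtain a0 and r0 :: nat where "a0 \<in> A" "a0 \<noteq> \<one>" "a0 [^] r0 = \<one>" "r0 > 0" by auto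
  then obtain p a where p: "Factorial_Ring.prime (p::nat)" and a: "a \<in> A" "a \<noteq> \<one>" "a [^] p = \<one>"
   using prime_torsion[OF A(1)] by metis
  have aG: "a \<in> carrier G" by (rule AG[OF a(1)])
  define K where "K = {inv g \<otimes> a \<otimes> g |g. g \<in> carrier G}"
  have KA: "K \<subseteq> A" using A(3)[OF a(1)] by (auto simp: K_def)
  have aK: "a \<in> K" using aG by (auto simp: K_def intro!: exI[of _ \<one>])
  have Kconj: "inv h \<otimes> b \<otimes> h \<in> K" if b: "b \<in> K" and h: "h \<in> carrier G" for b h
  proof -
   obtain g where g: "g \<in> carrier G" "b = inv g \<otimes> a \<otimes> g" using b by (auto simp: K_def)
   then have "inv h \<otimes> b \<otimes> h = inv (g \<otimes> h) \<otimes> a \<otimes> (g \<otimes> h)" using h aG by (simp add: m_assoc inv_mult_group)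
   then show ?thesis using g h by (auto simp: K_def)
  qed
  have finK: "finite K"
  proof -
   have "K \<subseteq> (\<lambda>c. inv (SOME g. g \<in> c) \<otimes> a \<otimes> (SOME g. g \<in> c)) ` (rcosets C)"
   proof
    fix b assume "b \<in> K"
    then obtain g where g: "g \<in> carrier G" "b = inv g \<otimes> a \<otimes> g" by (auto simp: K_def)
    define h where "h = (SOME h. h \<in> C #> g)"
    have "h \<in> C #> g" unfolding h_def using rcos_self[OF g(1) C(1)] by (rule someI)
    then obtain c where c: "c \<in> C" "h = c \<otimes> g" by (auto simp: r_coset_def)
    have "inv h \<otimes> a \<otimes> h = inv g \<otimes> (inv c \<otimes> (a \<otimes> c)) \<otimes> g"
     using c CG[OF c(1)] g aG by (simp add: m_assoc inv_mult_group)
    also have "a \<otimes> c = c \<otimes> a" by (rule C(3)[OF a(1) c(1)])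
    finally have "b = inv h \<otimes> a \<otimes> h" using g CG[OF c(1)] aG by simp
    then show "b \<in> (\<lambda>c. inv (SOME g. g \<in> c) \<otimes> a \<otimes> (SOME g. g \<in> c)) ` (rcosets C)"
     using g(1) unfolding h_def by (intro image_eqI[of _ _ "C #> g"]) (auto simp: RCOSETS_def)
   qed
   then show ?thesis using C(2) finite_surj by blast
  qed
  have Kp: "b [^] p = \<one>" if "b \<in> K" for b
   using that conj_pow[OF aG] a(3) by (auto simp: K_def)
  have KG: "K \<subseteq> carrier G" using KA AG by auto
  define M where "M = generate G K"
  have finM: "finite M"
   unfolding M_def by (rule finite_generate_torsion[OF finK KG _ _ Kp]) (use Kconj KG p in \<open>auto simp: prime_gt_0_nat\<close>)
  have Mn: "M \<lhd> G" unfolding M_def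
  proof (rule normal_generateI[OF KG])
   show "g \<otimes> h \<otimes> inv g \<in> K" if "h \<in> K" "g \<in> carrier G" for h g
    using Kconj[OF that(1), of "inv g"] that by simp
  qed
  interpret M: normal M G by (rule Mn)
  have MA: "M \<subseteq> A" unfolding M_def by (rule generate_subgroup_incl[OF KA A(1)])
  have Mp: "b [^] p = \<one>" if "b \<in> M" for b
   using that unfolding M_def
  proof (induction rule: generate.induct)
   case (inv h)
   then show ?case using Kp[OF inv] KG nat_pow_inv by auto
  next
   case (eng h1 h2)
   have h: "h1 \<in> A" "h2 \<in> A" using eng(1,2) MA by (auto simp: M_def)
   show ?case using pow_mult_distrib[OF A(2)[OF h] AG[OF h(1)] AG[OF h(2)], of p] eng by simp
  qed (auto simp: Kp)
  have aM: "a \<in> M" unfolding M_def using aK by (rule generate.incl)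
  have pM: "p dvd card M"
  proof -
   interpret M': group "G\<lparr>carrier := M\<rparr>" by (rule subgroup_imp_group[OF M.subgroup_axioms])
   have "a [^]\<^bsub>G\<lparr>carrier := M\<rparr>\<^esub> Coset.order (G\<lparr>carrier := M\<rparr>) = \<one>"
    using M'.pow_order_eq_1[of a] aM by simp
   then have "a [^] card M = \<one>" by (simp add: Coset.order_def flip: nat_pow_consistent)
   then have "ord a dvd card M" using pow_eq_id[OF aG] by simp
   moreover have "ord a dvd p" using pow_eq_id[OF aG] a by simp
   then have "ord a = p" using p a aG ord_eq_1 by (metis prime_nat_iff)
   ultimately show ?thesis by simp
  qed
  \<comment> \<open>With \<open>r = p^k r'\<close> and \<open>p\<close> not dividing
    \<open>r'\<close>, the element \<open>y = x^(p^k)\<close> acts on \<open>M\<close> unipotently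
    with order dividing \<open>r'\<close>. There is no \<open>r'\<close>-torsion in
    \<open>M\<close>, so this action is trivial.\<close>
  have unip: "\<exists>k. \<forall>b\<in>M. b \<otimes> x [^] (p ^ k) = x [^] (p ^ k) \<otimes> b" if x: "x \<in> carrier G" for x
  proof -
   obtain r :: nat where r: "r > 0" "x [^] r \<in> C" using power_in_finite_index[OF C(1,2) x] by auto
   obtain k r' where kr: "r = p ^ k * r'" "\<not> p dvd r'"
    using r(1) p multiplicity_decompose'[of r p] by (metis not_prime_unit not_less_zero)
   define y where "y = x [^] (p ^ k)"
   have y: "y \<in> carrier G" "y [^] r' \<in> C" using x r kr by (auto simp: y_def nat_pow_pow)
   have "b \<otimes> y = y \<otimes> b" if b: "b \<in> M" for b
   proof (rule unipotent_finite_order_trivial[of M y r'])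
    show "comm G c y \<in> M" if "c \<in> M" for c
    proof -
     have "comm G c y = inv c \<otimes> (inv y \<otimes> c \<otimes> y)" using M.mem_carrier[OF that] y by (simp add: word_simps)
     then show ?thesis using M.inv_op_closed1[OF y(1) that] that by simp
    qed
    show "c = \<one>" if c: "c \<in> M" "c [^] r' = \<one>" for c
    proof -
     have cG: "c \<in> carrier G" using M.mem_carrier[OF c(1)] .
     have "ord c dvd r'" "ord c dvd p" using pow_eq_id[OF cG] c Mp by auto
     then have "ord c = 1" using p kr(2) by (metis prime_nat_iff)
     then show ?thesis using ord_eq_1[OF cG] by simp
    qed
    show "c \<otimes> y [^] r' = y [^] r' \<otimes> c" if "c \<in> M" for c using C(3) y(2) that MA by auto
    show "\<exists>n. engel_comm G c y n = \<one>" if "c \<in> M" for c using engel y(1) that MA by auto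
   qed (use y b M.mem_carrier in auto)
   then show ?thesis unfolding y_def by auto
  qed
  define f where "f g = (\<lambda>m\<in>M. g \<otimes> m \<otimes> inv g)" for g
  have fM: "g \<otimes> m \<otimes> inv g \<in> M" if "g \<in> carrier G" "m \<in> M" for g m
   using that by (rule M.inv_op_closed2)
  have fB: "f g \<in> carrier (BijGroup M)" if g: "g \<in> carrier G" for g
  proof -
   have "bij_betw (f g) M M"
   proof (rule bij_betw_byWitness[of _ "f (inv g)"])
    show "\<forall>m\<in>M. f (inv g) (f g m) = m" "\<forall>m\<in>M. f g (f (inv g) m) = m"
     using g fM[OF g] fM[of "inv g"] M.mem_carrier by (auto simp: f_def m_assoc)
    show "f g ` M \<subseteq> M" "f (inv g) ` M \<subseteq> M" using g fM[OF g] fM[of "inv g"] by (auto simp: f_def)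
   qed
   then show ?thesis by (auto simp: BijGroup_def Bij_def f_def)
  qed
  have fhom: "f \<in> hom G (BijGroup M)"
  proof (rule homI)
   fix x y assume xy: "x \<in> carrier G" "y \<in> carrier G"
   have "f (x \<otimes> y) = compose M (f x) (f y)"
    using xy fM[OF xy(2)] M.mem_carrier
    by (intro ext) (auto simp: f_def compose_def m_assoc inv_mult_group)
   then show "f (x \<otimes> y) = f x \<otimes>\<^bsub>BijGroup M\<^esub> f y"
    using fB[OF xy(1)] fB[OF xy(2)] by (simp add: BijGroup_def)
  qed (use fB in auto)
  have BG: "group (BijGroup M)" by (rule group_BijGroup)
  interpret B: group "BijGroup M" by (rule BG)
  interpret f: group_hom G "BijGroup M" f by unfold_locales (rule fhom)
  define P where "P = (BijGroup M)\<lparr>carrier := f ` carrier G\<rparr>"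
  have Psub: "subgroup (f ` carrier G) (BijGroup M)" by (rule f.img_is_subgroup)
  interpret P: group P unfolding P_def by (rule B.subgroup_imp_group[OF Psub])
  have Pact: "group_action P M id"
   unfolding group_action_def group_hom_def group_hom_axioms_def
   using P.is_group BG f.img_is_subgroup[THEN subgroup.subset] by (auto simp: P_def hom_def)
  have finP: "finite (carrier P)"
  proof -
   have "carrier P \<subseteq> M \<rightarrow>\<^sub>E M"
    using f.img_is_subgroup[THEN subgroup.subset]
    by (auto simp: P_def f_def intro: fM)
   then show ?thesis using finM finite_PiE[of M "\<lambda>_. M"] finite_subset by auto
  qed
  have "\<exists>n. Coset.order P = p ^ n"
  proof (rule P.order_prime_power[OF finP p])
   fix \<phi> assume "\<phi> \<in> carrier P"
   then obtain x where x: "x \<in> carrier G" "\<phi> = f x" by (auto simp: P_def)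
   obtain k where k: "\<forall>b\<in>M. b \<otimes> x [^] (p ^ k) = x [^] (p ^ k) \<otimes> b" using unip[OF x(1)] by auto
   have "f (x [^] (p ^ k)) = f \<one>"
   proof (rule ext)
    fix m
    have "x [^] (p ^ k) \<otimes> m \<otimes> inv (x [^] (p ^ k)) = m" if m: "m \<in> M"
    proof -
     have "x [^] (p ^ k) \<otimes> m = m \<otimes> x [^] (p ^ k)" using k m by simp
     then have "x [^] (p ^ k) \<otimes> m \<otimes> inv (x [^] (p ^ k)) = m \<otimes> x [^] (p ^ k) \<otimes> inv (x [^] (p ^ k))" by simp
     then show ?thesis using x M.mem_carrier[OF m] by (simp add: m_assoc)
    qed
    then show "f (x [^] (p ^ k)) m = f \<one> m" using M.mem_carrier by (auto simp: f_def)
   qed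
   then have "f x [^]\<^bsub>BijGroup M\<^esub> (p ^ k) = \<one>\<^bsub>BijGroup M\<^esub>"
    using f.hom_nat_pow[OF x(1), of "p ^ k"] f.hom_one by simp
   then have "\<phi> [^]\<^bsub>P\<^esub> (p ^ k) = \<one>\<^bsub>P\<^esub>"
    unfolding x(2) P_def by (simp flip: B.nat_pow_consistent)
   then show "\<exists>k. \<phi> [^]\<^bsub>P\<^esub> (p ^ k) = \<one>\<^bsub>P\<^esub>" by auto
  qed
  then obtain n where n: "Coset.order P = p ^ n" by auto
  let ?F = "{e \<in> M. \<forall>g\<in>carrier P. id g e = e}"
  have "p dvd card ?F" by (rule p_group_fixed_points[OF Pact p n finM pM])
  moreover have oneF: "\<one> \<in> ?F" by (auto simp: P_def f_def)
  have "finite ?F" using finM by simp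
  then have "card ?F > 0" using oneF card_gt_0_iff[of ?F] by blast
  ultimately have "card ?F \<ge> 2" using p prime_ge_2_nat dvd_imp_le by (meson le_trans)
  then have "?F \<noteq> {\<one>}" by auto
  then obtain z where z: "z \<in> ?F" "z \<noteq> \<one>" using oneF by blast
  have zM: "z \<in> M" "z \<in> carrier G" using z M.mem_carrier by auto
  have "z \<otimes> g = g \<otimes> z" if g: "g \<in> carrier G" for g
  proof -
   have "f g z = z" using z g by (auto simp: P_def)
   then have "g \<otimes> z \<otimes> inv g = z" using zM by (simp add: f_def)
   then have "g \<otimes> z \<otimes> inv g \<otimes> g = z \<otimes> g" by simp
   then show ?thesis using zM g by (simp add: m_assoc)
  qed
  then show ?thesis using z zM MA by auto
 qed
qed

lemma finite_rcosets_hom: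
 assumes H: "subgroup H G" "finite (rcosets H)" and K: "group K" "f \<in> hom G K" "f ` carrier G = carrier K"
  and T: "subgroup T K" "f ` H \<subseteq> T"
 shows "finite (rcosets\<^bsub>K\<^esub> T)"
proof -
 interpret K: group K by (rule K)
 have "rcosets\<^bsub>K\<^esub> T \<subseteq> (\<lambda>c. T #>\<^bsub>K\<^esub> f (SOME g. g \<in> c)) ` (rcosets H)"
 proof
  fix d assume "d \<in> rcosets\<^bsub>K\<^esub> T"
  then obtain g where g: "g \<in> carrier G" "d = T #>\<^bsub>K\<^esub> f g" by (auto simp: RCOSETS_def simp flip: K(3))
  have "(SOME x. x \<in> H #> g) \<in> H #> g" using rcos_self[OF g(1) H(1)] by (rule someI)
  then obtain h where h: "h \<in> H" "(SOME x. x \<in> H #> g) = h \<otimes> g" by (auto simp: r_coset_def)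
  have hG: "h \<in> carrier G" using H(1) h(1) by (rule subgroup.mem_carrier)
  have fc: "f h \<in> carrier K" "f g \<in> carrier K" using hG g K(3) by auto
  have "T #>\<^bsub>K\<^esub> f (h \<otimes> g) = T #>\<^bsub>K\<^esub> f h #>\<^bsub>K\<^esub> f g"
   using K.coset_mult_assoc[OF subgroup.subset[OF T(1)] fc] hom_mult[OF K(2) hG g(1)] by simp
  also have "T #>\<^bsub>K\<^esub> f h = T" using K.coset_join2[OF fc(1) T(1)] T(2) h(1) by auto
  finally have "d = T #>\<^bsub>K\<^esub> f (SOME x. x \<in> H #> g)" using g h by simp
  then show "d \<in> (\<lambda>c. T #>\<^bsub>K\<^esub> f (SOME g. g \<in> c)) ` (rcosets H)"
   using g(1) by (intro image_eqI[of _ _ "H #> g"]) (auto simp: RCOSETS_def)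
 qed
 then show ?thesis using H(2) finite_surj by blast
qed

lemma almost_right_engel_hom:
 assumes K: "group K" "f \<in> hom G K" "f ` carrier G = carrier K" and g: "g \<in> carrier G" "almost_right_engel G g"
 shows "almost_right_engel K (f g)"
proof -
 obtain R where R: "finite R" "R \<subseteq> carrier G" "\<forall>x\<in>carrier G. \<exists>n>0. \<forall>k\<ge>n. engel_comm G g x k \<in> R"
  using g(2) by (auto simp: almost_right_engel_def right_engel_sink_def)
 have "\<exists>n>0. \<forall>k\<ge>n. engel_comm K (f g) y k \<in> f ` R" if y: "y \<in> carrier K" for y
 proof -
  obtain x where x: "x \<in> carrier G" "y = f x" using y K(3) by auto
  obtain n where "n > 0" "\<forall>k\<ge>n. engel_comm G g x k \<in> R" using R(3) x by auto
  then show ?thesis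
   using hom_engel_comm[OF K(1,2) g(1) x(1), symmetric] x by (intro exI[of _ n]) auto
 qed
 moreover have "f ` R \<subseteq> carrier K" using R(2) K(3) by blast
 ultimately show ?thesis
  unfolding almost_right_engel_def right_engel_sink_def
  using R(1) by (intro exI[of _ "f ` R"]) simp
qed

lemma finite_by_hypercentral_of_Mod:
 assumes N0: "N0 \<lhd> G" "finite N0"
  and ex: "\<exists>N. N \<lhd> (G Mod N0) \<and> finite N \<and> hypercentral ((G Mod N0) Mod N)"
 shows "\<exists>N. N \<lhd> G \<and> finite N \<and> hypercentral (G Mod N)"
proof -
 obtain N1 where N1: "N1 \<lhd> (G Mod N0)" "finite N1" "hypercentral ((G Mod N0) Mod N1)" using ex by auto
 interpret N0: normal N0 G by (rule N0)
 interpret Q: group "G Mod N0" by (rule N0.factorgroup_is_group)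
 interpret N1: normal N1 "G Mod N0" by (rule N1)
 interpret Q1: group "(G Mod N0) Mod N1" by (rule N1.factorgroup_is_group)
 define f where "f g = N1 #>\<^bsub>G Mod N0\<^esub> (N0 #> g)" for g
 have "f = (\<lambda>c. N1 #>\<^bsub>G Mod N0\<^esub> c) \<circ> (\<lambda>g. N0 #> g)" by (auto simp: f_def)
 then have fhom: "f \<in> hom G ((G Mod N0) Mod N1)"
  using Group.hom_compose[OF N0.r_coset_hom_Mod N1.r_coset_hom_Mod] by simp
 interpret f: group_hom G "(G Mod N0) Mod N1" f by unfold_locales (rule fhom)
 have surj: "f ` carrier G = carrier ((G Mod N0) Mod N1)"
  by (auto simp: f_def FactGroup_def RCOSETS_def)
 define N where "N = kernel G ((G Mod N0) Mod N1) f"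
 have Nn: "N \<lhd> G" unfolding N_def by (rule f.normal_kernel)
 have "N \<subseteq> \<Union>N1"
 proof
  fix g assume "g \<in> N"
  then have g: "g \<in> carrier G" "f g = \<one>\<^bsub>(G Mod N0) Mod N1\<^esub>" by (auto simp: N_def kernel_def)
  have "N0 #> g \<in> carrier (G Mod N0)" using g by (auto simp: FactGroup_def RCOSETS_def)
  then have "N0 #> g \<in> N1" using Q.Mod_eq_one_iff[OF N1(1)] g(2) unfolding f_def by blast
  then show "g \<in> \<Union>N1" using rcos_self[OF g(1) N0.subgroup_axioms] by blast
 qed
 moreover have "finite c" if "c \<in> N1" for c
 proof -
  have "c \<in> carrier (G Mod N0)" using that by (rule N1.mem_carrier)
  then obtain g where "g \<in> carrier G" "c = N0 #> g" using Mod_carrier_iff by blast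
  then show ?thesis using N0(2) by (auto simp: r_coset_def)
 qed
 ultimately have finN: "finite N" using N1(2) by (meson finite_Union finite_subset)
 let ?h = "\<lambda>c. the_elem (f ` c)"
 have iso: "?h \<in> iso (G Mod N) ((G Mod N0) Mod N1)"
  unfolding N_def by (rule f.FactGroup_iso_set[OF surj])
 have GN: "group (G Mod N)" by (rule normal.factorgroup_is_group[OF Nn])
 have inv: "inv_into (carrier (G Mod N)) ?h \<in> iso ((G Mod N0) Mod N1) (G Mod N)"
  by (rule group.iso_set_sym[OF GN iso])
 have "hypercentral (G Mod N)"
  by (rule Q1.hypercentral_epi[OF GN _ _ N1(3)]) (use inv in \<open>auto simp: iso_def bij_betw_def\<close>)
 then show ?thesis using Nn finN by auto
qed

end


subsection \<open>Reduction to nilpotency of the connected subgroup\<close>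

text \<open>The upper central series of \<open>H\<close> modulo \<open>N\<close>. For
  \<open>N\<close> trivial, containment of \<open>H\<close> in some term expresses that
  \<open>H\<close> is nilpotent.\<close>

fun upper_series :: "('a, 'b) monoid_scheme \<Rightarrow> 'a set \<Rightarrow> 'a set \<Rightarrow> nat \<Rightarrow> 'a set" where
 "upper_series G H N 0 = N"
| "upper_series G H N (Suc j) = {b \<in> H. \<forall>h\<in>H. comm G b h \<in> upper_series G H N j}"

lemma upper_series_mono: "N \<subseteq> N' \<Longrightarrow> upper_series G H N j \<subseteq> upper_series G H N' j"
 by (induction j) auto

context group
begin

lemma upper_series_step_normal:
 assumes H: "H \<lhd> G" and Y: "Y \<lhd> G"
 shows "{b \<in> H. \<forall>h\<in>H. comm G b h \<in> Y} \<lhd> G"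
proof -
 interpret H: normal H G by (rule H)
 interpret Y: normal Y G by (rule Y)
 let ?T = "{b \<in> H. \<forall>h\<in>H. comm G b h \<in> Y}"
 have sub: "subgroup ?T G"
 proof (rule subgroupI)
  show "?T \<subseteq> carrier G" using H.mem_carrier by auto
  have "\<one> \<in> ?T" using H.mem_carrier by auto
  then show "?T \<noteq> {}" by blast
 next
  fix a assume a: "a \<in> ?T"
  then have aG: "a \<in> carrier G" "a \<in> H" using H.mem_carrier by auto
  have "comm G (inv a) h \<in> Y" if h: "h \<in> H" for h
   unfolding comm_inv_left[OF aG(1) H.mem_carrier[OF h]]
   using a h aG by (intro Y.inv_op_closed2) auto
  then show "inv a \<in> ?T" using aG by simp
 next
  fix a b assume a: "a \<in> ?T" and b: "b \<in> ?T"
  then have G: "a \<in> carrier G" "b \<in> carrier G" "a \<in> H" "b \<in> H" using H.mem_carrier by auto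
  have "comm G (a \<otimes> b) h \<in> Y" if h: "h \<in> H" for h
   unfolding comm_mult_left[OF G(1,2) H.mem_carrier[OF h]]
   using a b h G by (intro Y.m_closed Y.inv_op_closed1) auto
  then show "a \<otimes> b \<in> ?T" using G by simp
 qed
 show ?thesis
 proof (rule normal_invI[OF sub])
  fix g b assume g: "g \<in> carrier G" and b: "b \<in> ?T"
  have bG: "b \<in> carrier G" "b \<in> H" using b H.mem_carrier by auto
  have "comm G (g \<otimes> b \<otimes> inv g) h \<in> Y" if h: "h \<in> H" for h
  proof -
   have "inv g \<otimes> h \<otimes> g \<in> H" using h g by (simp add: H.inv_op_closed1)
   then have "g \<otimes> comm G b (inv g \<otimes> h \<otimes> g) \<otimes> inv g \<in> Y" using b g by (intro Y.inv_op_closed2) auto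
   moreover have "g \<otimes> comm G b (inv g \<otimes> h \<otimes> g) \<otimes> inv g = comm G (g \<otimes> b \<otimes> inv g) h"
    using bG g H.mem_carrier[OF h] by (simp add: word_simps)
   ultimately show ?thesis by simp
  qed
  moreover have "g \<otimes> b \<otimes> inv g \<in> H" using bG g by (intro H.inv_op_closed2)
  ultimately show "g \<otimes> b \<otimes> inv g \<in> ?T" by simp
 qed
qed

lemma upper_series_normal:
 assumes "H \<lhd> G" "N \<lhd> G"
 shows "upper_series G H N j \<lhd> G"
proof (induction j)
 case (Suc j)
 show ?case using upper_series_step_normal[OF assms(1) Suc] by simp
qed (use assms in simp)

lemma upper_series_subset_Suc:
 assumes "N \<lhd> G" "H \<lhd> G" "N \<subseteq> H"
 shows "upper_series G H N j \<subseteq> upper_series G H N (Suc j)"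
proof (induction j)
 case 0
 interpret N: normal N G by (rule assms)
 interpret H: normal H G by (rule assms)
 have "comm G b h \<in> N" if b: "b \<in> N" and h: "h \<in> H" for b h
 proof -
  have G: "b \<in> carrier G" "h \<in> carrier G" using b h N.mem_carrier H.mem_carrier by auto
  have "comm G b h = inv b \<otimes> (inv h \<otimes> b \<otimes> h)" using G by (simp add: word_simps)
  then show ?thesis using N.inv_op_closed1[OF G(2) b] b by simp
 qed
 then show ?case using assms(3) by auto
next
 case (Suc j)
 show ?case unfolding upper_series.simps(2) using Suc by auto
qed

lemma upper_series_contains:
 assumes "N \<lhd> G" "H \<lhd> G" "N \<subseteq> H"
 shows "N \<subseteq> upper_series G H N j"
proof (induction j)
 case (Suc j)
 then show ?case using upper_series_subset_Suc[OF assms, of j] by blast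
qed simp

text \<open>Conjugating \<open>u = [b, h]\<close> by \<open>x\<close> gives
  \<open>[b b1, h k]\<close>. Since \<open>k\<close> commutes with everything that occurs, this is
  \<open>u \<otimes> [b1, h]\<close>, whence the claim. The identity transports an Engel sequence of
  \<open>b\<close> to one of \<open>[b, h]\<close>, provided that \<open>[h, x]\<close> is already
  known to behave well.\<close>

lemma comm_pairing:
 assumes G: "b \<in> carrier G" "h \<in> carrier G" "x \<in> carrier G"
  and b1: "b1 = comm G b x" and k: "k = comm G h x"
  and bk: "b \<otimes> k = k \<otimes> b" "b1 \<otimes> k = k \<otimes> b1"
  and c: "comm G b h \<otimes> b1 = b1 \<otimes> comm G b h"
   "comm G b h \<otimes> k = k \<otimes> comm G b h" "comm G b1 h \<otimes> k = k \<otimes> comm G b1 h"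
 shows "comm G b1 h = comm G (comm G b h) x"
proof -
 define u where "u = comm G b h"
 define v where "v = comm G b1 h"
 have cl: "b1 \<in> carrier G" "k \<in> carrier G" "u \<in> carrier G" "v \<in> carrier G"
  using G by (auto simp: b1 k u_def v_def)
 have bb: "comm G (b \<otimes> b1) h = u \<otimes> v"
 proof -
  have "comm G (b \<otimes> b1) h = inv b1 \<otimes> (u \<otimes> b1) \<otimes> v"
   using G cl by (simp add: comm_mult_left u_def v_def m_assoc)
  also have "u \<otimes> b1 = b1 \<otimes> u" using c(1) by (simp add: u_def)
  finally show ?thesis using cl by simp
 qed
 have bbk: "comm G (b \<otimes> b1) k = \<one>"
 proof -
  have "(b \<otimes> b1) \<otimes> k = b \<otimes> (k \<otimes> b1)" using G cl bk(2) by (simp add: m_assoc)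
  also have "\<dots> = (b \<otimes> k) \<otimes> b1" using G cl by (simp add: m_assoc)
  also have "\<dots> = k \<otimes> (b \<otimes> b1)" unfolding bk(1) using G cl by (simp add: m_assoc)
  finally show ?thesis using G cl by (simp add: comm_eq_one_iff)
 qed
 have uvk: "(u \<otimes> v) \<otimes> k = k \<otimes> (u \<otimes> v)"
 proof -
  have "(u \<otimes> v) \<otimes> k = u \<otimes> (v \<otimes> k)" using cl by (simp add: m_assoc)
  also have "v \<otimes> k = k \<otimes> v" using c(3) by (simp add: v_def)
  also have "u \<otimes> (k \<otimes> v) = (u \<otimes> k) \<otimes> v" using cl by (simp add: m_assoc)
  also have "u \<otimes> k = k \<otimes> u" using c(2) by (simp add: u_def)
  finally show ?thesis using cl by (simp add: m_assoc)
 qed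
 have "inv x \<otimes> u \<otimes> x = comm G (inv x \<otimes> b \<otimes> x) (inv x \<otimes> h \<otimes> x)"
  using G by (simp add: u_def comm_conj)
 also have "\<dots> = comm G (b \<otimes> b1) (h \<otimes> k)" using G by (simp add: conj_eq_mult_comm b1 k)
 also have "\<dots> = comm G (b \<otimes> b1) k \<otimes> (inv k \<otimes> comm G (b \<otimes> b1) h \<otimes> k)"
  using G cl by (intro comm_mult_right) auto
 also have "\<dots> = inv k \<otimes> ((u \<otimes> v) \<otimes> k)" unfolding bb bbk using cl by (simp add: m_assoc)
 also have "\<dots> = u \<otimes> v" unfolding uvk using cl by simp
 finally have "inv x \<otimes> u \<otimes> x = u \<otimes> v" .
 then have "inv u \<otimes> (inv x \<otimes> u \<otimes> x) = v" using cl by simp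
 then show ?thesis using cl G unfolding u_def[symmetric] v_def[symmetric] by (simp add: word_simps)
qed

end

declare upper_series.simps(2) [simp del]

context connected_subgroup
begin

lemma centre_H: "a \<in> centre \<Longrightarrow> a \<in> H" by (simp add: centre_def)

lemma centre_subgroup: "subgroup centre G"
proof (rule subgroupI)
 show "centre \<subseteq> carrier G" using centre_carrier by blast
 have "\<one> \<in> centre" by (auto simp: centre_def)
 then show "centre \<noteq> {}" by blast
 show "inv a \<in> centre" if a: "a \<in> centre" for a
 proof -
  have "inv a \<otimes> h = h \<otimes> inv a" if h: "h \<in> H" for h
   using commutes_inv[OF centre_carrier[OF a] H_carrier[OF h] centre_commute[OF a h, symmetric]] by simp
  then show ?thesis using a by (auto simp: centre_def)
 qed
 show "a \<otimes> b \<in> centre" if a: "a \<in> centre" and b: "b \<in> centre" for a b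
 proof -
  have "(a \<otimes> b) \<otimes> h = h \<otimes> (a \<otimes> b)" if h: "h \<in> H" for h
   using commutes_mult[OF centre_carrier[OF a] centre_carrier[OF b] H_carrier[OF h]
     centre_commute[OF a h, symmetric] centre_commute[OF b h, symmetric]] by simp
  note com = this
  have "a \<otimes> b \<in> H" by (rule H.m_closed[OF centre_H[OF a] centre_H[OF b]])
  then show ?thesis unfolding centre_def by (intro CollectI conjI ballI com)
 qed
qed

lemma centre_comm:
 assumes "a \<in> centre" "x \<in> carrier G"
 shows "comm G a x \<in> centre"
proof -
 have "comm G a x = inv a \<otimes> (inv x \<otimes> a \<otimes> x)"
  using assms centre_carrier by (simp add: word_simps)
 then show ?thesis
  using centre_conj[OF assms] assms(1) centre_subgroup by (simp add: subgroup.m_closed subgroup.m_inv_closed)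
qed

lemma centre_engel_comm: "a \<in> centre \<Longrightarrow> x \<in> carrier G \<Longrightarrow> engel_comm G a x n \<in> centre"
 by (induction n) (auto intro: centre_comm)

lemma centre_engel_comm_mult:
 assumes a: "a \<in> centre" and b: "b \<in> centre" and x: "x \<in> carrier G"
 shows "engel_comm G (a \<otimes> b) x n = engel_comm G a x n \<otimes> engel_comm G b x n"
proof (induction n)
 case (Suc n)
 let ?a = "engel_comm G a x n" and ?b = "engel_comm G b x n"
 have ab: "?a \<in> centre" "?b \<in> centre" using centre_engel_comm a b x by auto
 have G: "?a \<in> carrier G" "?b \<in> carrier G" using ab centre_carrier by auto
 have "comm G (?a \<otimes> ?b) x = inv ?b \<otimes> (comm G ?a x \<otimes> ?b) \<otimes> comm G ?b x"
  using G x by (simp add: comm_mult_left m_assoc)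
 also have "comm G ?a x \<otimes> ?b = ?b \<otimes> comm G ?a x"
  by (rule centre_commute[OF centre_comm[OF ab(1) x] centre_H[OF ab(2)]])
 finally have "comm G (?a \<otimes> ?b) x = comm G ?a x \<otimes> comm G ?b x" using G x by simp
 then show ?case using Suc by simp
qed simp

section \<open>Periodic elements of the centre of the connected subgroup\<close>

definition periodic_centre :: "'a \<Rightarrow> 'a set" where
 "periodic_centre x = {b \<in> centre. engel_periodic G x b}"

lemma finite_periodic_centre: "x \<in> carrier G \<Longrightarrow> finite (periodic_centre x)"
proof -
 assume x: "x \<in> carrier G"
 obtain R where R: "finite R" "right_engel_sink G x R"
  using almost_engel[OF x] by (auto simp: almost_right_engel_def)
 have "a \<otimes> b = b \<otimes> a" if "a \<in> centre" "b \<in> centre" for a b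
  by (rule centre_commute[OF that(1) centre_H[OF that(2)]])
 then have "periodic_centre x \<subseteq> R"
  using engel_periodic_in_sink[OF centre_subgroup _ x centre_conj[OF _ x] R(2)]
  by (auto simp: periodic_centre_def)
 then show ?thesis using R(1) finite_subset by blast
qed

lemma periodic_centre_subgroup:
 assumes x: "x \<in> carrier G"
 shows "subgroup (periodic_centre x) G"
proof (rule subgroupI)
 show "periodic_centre x \<subseteq> carrier G" using centre_carrier by (auto simp: periodic_centre_def)
 have "\<one> \<in> periodic_centre x"
  using x subgroup.one_closed[OF centre_subgroup]
  by (auto simp: periodic_centre_def engel_periodic_def intro!: exI[of _ 1])
 then show "periodic_centre x \<noteq> {}" by blast
next
 fix a assume "a \<in> periodic_centre x"
 then have a: "a \<in> centre" "engel_periodic G x a" by (auto simp: periodic_centre_def)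
 have ia: "inv a \<in> centre" using a(1) centre_subgroup by (simp add: subgroup.m_inv_closed)
 have "engel_comm G a x n \<otimes> engel_comm G (inv a) x n = \<one>" for n
  using centre_engel_comm_mult[OF a(1) ia x, of n] centre_carrier[OF a(1)] x by simp
 then have e: "engel_comm G (inv a) x n = inv (engel_comm G a x n)" for n
  using centre_carrier[OF a(1)] centre_carrier[OF ia] x by (metis engel_comm_closed inv_equality inv_inv)
 then show "inv a \<in> periodic_centre x" using a ia by (auto simp: periodic_centre_def engel_periodic_def)
next
 fix a b assume "a \<in> periodic_centre x" "b \<in> periodic_centre x"
 then have ab: "a \<in> centre" "b \<in> centre" "engel_periodic G x a" "engel_periodic G x b"
  by (auto simp: periodic_centre_def)
 obtain k where "k > 0" "engel_comm G a x k = a" "engel_comm G b x k = b"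
  using engel_periodic_common_period[OF ab(3,4)] by auto
 then have "engel_periodic G x (a \<otimes> b)"
  unfolding engel_periodic_def using centre_engel_comm_mult[OF ab(1,2) x] by (intro exI[of _ k]) simp
 then show "a \<otimes> b \<in> periodic_centre x"
  using ab centre_subgroup by (simp add: periodic_centre_def subgroup.m_closed)
qed

lemma periodic_centre_coset:
 assumes x: "x \<in> carrier G" and h: "h \<in> H"
 shows "periodic_centre (h \<otimes> x) = periodic_centre x"
proof -
 have c: "comm G b (h \<otimes> x) = comm G b x" if b: "b \<in> centre" for b
 proof -
  have "comm G b h = \<one>"
   using centre_commute[OF b h] centre_carrier[OF b] h by (simp add: comm_eq_one_iff)
  then show ?thesis using x h centre_carrier[OF b] by (simp add: comm_mult_right)
 qed
 have "engel_comm G b (h \<otimes> x) n = engel_comm G b x n" if b: "b \<in> centre" for b n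
  by (induction n) (use c[OF centre_engel_comm[OF b x]] in simp_all)
 then show ?thesis by (auto simp: periodic_centre_def engel_periodic_def)
qed

definition N0 :: "'a set" where
 "N0 = generate G (\<Union>x\<in>carrier G. periodic_centre x)"

text \<open>\<open>H\<close> acts trivially on its centre, so \<open>periodic_centre x\<close>
  depends only on the coset of \<open>x\<close>: finitely many finite subgroups are involved. Their
  union is conjugation invariant and of bounded exponent, so Dietzmann's lemma applies.\<close>

lemma N0_facts: "N0 \<lhd> G" "finite N0" "N0 \<subseteq> centre" "\<And>x. x \<in> carrier G \<Longrightarrow> periodic_centre x \<subseteq> N0"
proof -
 let ?U = "\<Union>x\<in>carrier G. periodic_centre x"
 have UG: "?U \<subseteq> carrier G" using centre_carrier by (auto simp: periodic_centre_def)
 have Uc: "?U \<subseteq> centre" by (auto simp: periodic_centre_def)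
 have "periodic_centre ` carrier G \<subseteq> (\<lambda>c. periodic_centre (SOME g. g \<in> c)) ` (rcosets H)"
 proof
  fix F assume "F \<in> periodic_centre ` carrier G"
  then obtain x where x: "x \<in> carrier G" "F = periodic_centre x" by auto
  have "(SOME g. g \<in> H #> x) \<in> H #> x" using rcos_self[OF x(1) H.subgroup_axioms] by (rule someI)
  then obtain h where "h \<in> H" "(SOME g. g \<in> H #> x) = h \<otimes> x" by (auto simp: r_coset_def)
  then have "F = periodic_centre (SOME g. g \<in> H #> x)" using periodic_centre_coset x by simp
  then show "F \<in> (\<lambda>c. periodic_centre (SOME g. g \<in> c)) ` (rcosets H)"
   using x(1) by (intro image_eqI[of _ _ "H #> x"]) (auto simp: RCOSETS_def)
 qed
 then have "finite (periodic_centre ` carrier G)" using finite_index finite_surj by blast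
 then have finU: "finite ?U" using finite_periodic_centre by (intro finite_Union) auto
 have Uconj: "inv g \<otimes> b \<otimes> g \<in> ?U" if b: "b \<in> ?U" and g: "g \<in> carrier G" for b g
 proof -
  obtain x where x: "x \<in> carrier G" "b \<in> centre" "engel_periodic G x b"
   using b by (auto simp: periodic_centre_def)
  have "inv g \<otimes> b \<otimes> g \<in> periodic_centre (inv g \<otimes> x \<otimes> g)"
   using engel_periodic_conj[OF centre_carrier[OF x(2)] x(1) g x(3)] centre_conj[OF x(2) g]
   by (simp add: periodic_centre_def)
  moreover have "inv g \<otimes> x \<otimes> g \<in> carrier G" using x g by simp
  ultimately show ?thesis by blast
 qed
 \<comment> \<open>Each subgroup involved has order at most \<open>card\<close> of the union, so the
   factorial is a common multiple of all these orders.\<close>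
 have tors: "b [^] (fact (card ?U) :: nat) = \<one>" if b: "b \<in> ?U" for b
 proof -
  obtain x where x: "x \<in> carrier G" "b \<in> periodic_centre x" using b by auto
  let ?F = "periodic_centre x"
  have F: "subgroup ?F G" by (rule periodic_centre_subgroup[OF x(1)])
  interpret F: group "G\<lparr>carrier := ?F\<rparr>" by (rule subgroup_imp_group[OF F])
  have "b [^]\<^bsub>G\<lparr>carrier := ?F\<rparr>\<^esub> Coset.order (G\<lparr>carrier := ?F\<rparr>) = \<one>"
   using F.pow_order_eq_1[of b] x by simp
  then have bF: "b [^] card ?F = \<one>" by (simp add: Coset.order_def flip: nat_pow_consistent)
  have "card ?F \<le> card ?U" using finU x(1) by (intro card_mono) auto
  moreover have "card ?F > 0" using finite_periodic_centre[OF x(1)] x(2) by (auto simp: card_gt_0_iff)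
  ultimately have "card ?F dvd (fact (card ?U) :: nat)" by (intro dvd_fact) auto
  then obtain m where m: "(fact (card ?U) :: nat) = card ?F * m" by blast
  have bG: "b \<in> carrier G" using x(2) centre_carrier by (simp add: periodic_centre_def)
  then show ?thesis unfolding m using bF nat_pow_pow[OF bG, of "card ?F" m] by simp
 qed
 show "finite N0"
  unfolding N0_def
 proof (rule finite_generate_torsion[OF finU UG _ _ tors])
  show "inv b \<otimes> a \<otimes> b \<in> ?U" if "a \<in> ?U" "b \<in> ?U" for a b
   by (rule Uconj[OF that(1) subsetD[OF UG that(2)]])
 qed simp
 show "N0 \<lhd> G" unfolding N0_def
 proof (rule normal_generateI[OF UG])
  show "g \<otimes> h \<otimes> inv g \<in> ?U" if "h \<in> ?U" "g \<in> carrier G" for h g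
   using Uconj[OF that(1), of "inv g"] that by simp
 qed
 show "N0 \<subseteq> centre" unfolding N0_def by (rule generate_subgroup_incl[OF Uc centre_subgroup])
 show "periodic_centre x \<subseteq> N0" if "x \<in> carrier G" for x
  unfolding N0_def using that by (auto intro: generate.incl)
qed

section \<open>The upper central series modulo the periodic central elements\<close>

abbreviation Y :: "nat \<Rightarrow> 'a set" where "Y j \<equiv> upper_series G H N0 j"

lemma N0_H: "N0 \<subseteq> H" using N0_facts(3) centre_H by blast

lemma Y_normal: "Y j \<lhd> G" by (rule upper_series_normal[OF H_normal N0_facts(1)])

lemma N0_Y: "N0 \<subseteq> Y j" by (rule upper_series_contains[OF N0_facts(1) H_normal N0_H])

text \<open>An element of \<open>H\<close> that is central modulo the finite group \<open>N0\<close>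
  has only finitely many \<open>H\<close>-conjugates, and connectedness then makes it central:
  passing to the quotient creates no new central elements.\<close>

lemma Y_1: "Y (Suc 0) \<subseteq> centre"
proof
 fix b assume "b \<in> Y (Suc 0)"
 then have b: "b \<in> H" "\<And>h. h \<in> H \<Longrightarrow> comm G b h \<in> N0" by (auto simp: upper_series.simps)
 have "{inv v \<otimes> b \<otimes> v |v. v \<in> H} \<subseteq> (\<lambda>n. b \<otimes> n) ` N0"
  using b conj_eq_mult_comm[of b] by auto
 then have "finite {inv v \<otimes> b \<otimes> v |v. v \<in> H}" using N0_facts(2) finite_surj by blast
 then have "b \<otimes> w = w \<otimes> b" if "w \<in> H" for w using finite_class_central[of b w] b that by auto
 then show "b \<in> centre" using b by (simp add: centre_def)
qed

text \<open>For a periodic \<open>b\<close> in \<open>Y (i + 2)\<close>, let \<open>D\<close>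
  consist of the \<open>h\<close> in \<open>H\<close> commuting modulo \<open>Y i\<close> with the
  whole cycle of \<open>b\<close>. If \<open>[h, x]\<close> is in \<open>D\<close>, the elements
  \<open>[b_n, h]\<close> form an Engel sequence that is periodic modulo \<open>Y i\<close>, and the
  induction hypothesis for \<open>Y (i + 1)\<close> makes it trivial there; so \<open>h\<close> is
  in \<open>D\<close>. Going backwards along \<open>[v, x, ..., x]\<close> from the centre puts
  generic \<open>v\<close> into \<open>D\<close>, hence all of \<open>H\<close>, and
  \<open>b\<close> drops to \<open>Y (i + 1)\<close>.\<close>

lemma engel_periodic_in_N0:
 "\<lbrakk>b \<in> Y j; x \<in> carrier G; engel_periodic G x b\<rbrakk> \<Longrightarrow> b \<in> N0"
proof (induction j arbitrary: b x)
 case (Suc j)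
 show ?case
 proof (cases j)
  case 0
  then have "b \<in> periodic_centre x" using Suc.prems Y_1 by (auto simp: periodic_centre_def)
  then show ?thesis using N0_facts(4) Suc.prems by blast
 next
  case (Suc i)
  note x = \<open>x \<in> carrier G\<close> and per = \<open>engel_periodic G x b\<close>
  define M where "M = Y i"
  have Mn: "M \<lhd> G" unfolding M_def by (rule Y_normal)
  interpret M: normal M G by (rule Mn)
  have bY: "b \<in> Y (Suc (Suc i))" using Suc.prems Suc by simp
  interpret Y2: normal "Y (Suc (Suc i))" G by (rule Y_normal)
  interpret Y1: normal "Y (Suc i)" G by (rule Y_normal)
  have Y1D: "comm G a h \<in> M" if "a \<in> Y (Suc i)" "h \<in> H" for a h
   using that by (simp add: M_def upper_series.simps(2))
  have Y2D: "comm G a h \<in> Y (Suc i)" if "a \<in> Y (Suc (Suc i))" "h \<in> H" for a h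
   using that unfolding upper_series.simps(2)[of _ _ _ "Suc i"] by simp
  have Y2H: "a \<in> H" if "a \<in> Y (Suc (Suc i))" for a using that by (simp add: upper_series.simps(2))
  define bb where "bb n = engel_comm G b x n" for n
  have bbSuc: "bb (Suc n) = comm G (bb n) x" for n by (simp add: bb_def)
  have bbY: "bb n \<in> Y (Suc (Suc i))" for n
  proof (induction n)
   case (Suc n)
   have "bb (Suc n) = inv (bb n) \<otimes> (inv x \<otimes> bb n \<otimes> x)"
    using Y2.mem_carrier[OF Suc] x by (simp add: bbSuc word_simps)
   then show ?case using Suc Y2.inv_op_closed1[OF x Suc] by simp
  qed (use bY in \<open>simp add: bb_def\<close>)
  have bbH: "bb n \<in> H" for n using Y2H bbY by blast
  have bbG: "bb n \<in> carrier G" for n using bbH by blast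
  define D where "D = \<Inter>(insert H (range (\<lambda>n. {g \<in> carrier G. comm G (bb n) g \<in> M})))"
  have D: "subgroup D G" unfolding D_def
   by (rule subgroups_Inter) (use comm_kernel_subgroup[OF Mn bbG] H.subgroup_axioms in auto)
  have Diff: "h \<in> D \<longleftrightarrow> h \<in> H \<and> (\<forall>n. comm G (bb n) h \<in> M)" for h
   by (auto simp: D_def)
  obtain k where k: "k > 0" "bb k = bb 0" using per by (auto simp: engel_periodic_def bb_def)
  have back_step: "h \<in> D" if h: "h \<in> H" and hx: "comm G h x \<in> D" for h
  proof -
   define a where "a n = comm G (bb n) h" for n
   have hG: "h \<in> carrier G" using h by blast
   have aY: "a n \<in> Y (Suc i)" for n unfolding a_def by (rule Y2D[OF bbY h])
   have aG: "a n \<in> carrier G" for n using Y1.mem_carrier[OF aY] .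
   have hxH: "comm G h x \<in> H" using hx Diff by blast
   interpret Q: group "G Mod M" by (rule M.factorgroup_is_group)
   let ?q = "\<lambda>g. M #> g"
   have qc: "?q g \<in> carrier (G Mod M)" if "g \<in> carrier G" for g
    using that by (auto simp: FactGroup_def RCOSETS_def)
   have q_comm: "?q u \<otimes>\<^bsub>G Mod M\<^esub> ?q v = ?q v \<otimes>\<^bsub>G Mod M\<^esub> ?q u"
    if "u \<in> carrier G" "v \<in> carrier G" "comm G u v \<in> M" for u v
   proof -
    have "comm (G Mod M) (?q u) (?q v) = \<one>\<^bsub>G Mod M\<^esub>"
     using comm_Mod[OF Mn that(1,2)] Mod_eq_one_iff[OF Mn, of "comm G u v"] that by simp
    then show ?thesis using Q.comm_eq_one_iff qc that by blast
   qed
   have rec: "?q (a (Suc n)) = comm (G Mod M) (?q (a n)) (?q x)" for n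
   proof -
    have "comm (G Mod M) (?q (bb (Suc n))) (?q h)
     = comm (G Mod M) (comm (G Mod M) (?q (bb n)) (?q h)) (?q x)"
    proof (rule Q.comm_pairing[where k = "?q (comm G h x)"])
     show "?q (bb (Suc n)) = comm (G Mod M) (?q (bb n)) (?q x)"
      using comm_Mod[OF Mn bbG x] by (simp add: bbSuc)
     show "?q (comm G h x) = comm (G Mod M) (?q h) (?q x)"
      using comm_Mod[OF Mn hG x] by simp
     show "?q (bb n) \<otimes>\<^bsub>G Mod M\<^esub> ?q (comm G h x) = ?q (comm G h x) \<otimes>\<^bsub>G Mod M\<^esub> ?q (bb n)"
      using bbG hG x hx Diff by (intro q_comm) auto
     show "?q (bb (Suc n)) \<otimes>\<^bsub>G Mod M\<^esub> ?q (comm G h x) = ?q (comm G h x) \<otimes>\<^bsub>G Mod M\<^esub> ?q (bb (Suc n))"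
      using bbG hG x hx Diff by (intro q_comm) auto
     have e: "comm (G Mod M) (?q (bb n)) (?q h) = ?q (a n)" for n
      using comm_Mod[OF Mn bbG hG] by (simp add: a_def)
     show "comm (G Mod M) (?q (bb n)) (?q h) \<otimes>\<^bsub>G Mod M\<^esub> ?q (bb (Suc n))
      = ?q (bb (Suc n)) \<otimes>\<^bsub>G Mod M\<^esub> comm (G Mod M) (?q (bb n)) (?q h)"
      unfolding e by (rule q_comm[OF aG bbG Y1D[OF aY bbH]])
     show "comm (G Mod M) (?q (bb n)) (?q h) \<otimes>\<^bsub>G Mod M\<^esub> ?q (comm G h x)
      = ?q (comm G h x) \<otimes>\<^bsub>G Mod M\<^esub> comm (G Mod M) (?q (bb n)) (?q h)"
      unfolding e by (rule q_comm[OF aG _ Y1D[OF aY hxH]]) (use hG x in simp)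
     show "comm (G Mod M) (?q (bb (Suc n))) (?q h) \<otimes>\<^bsub>G Mod M\<^esub> ?q (comm G h x)
      = ?q (comm G h x) \<otimes>\<^bsub>G Mod M\<^esub> comm (G Mod M) (?q (bb (Suc n))) (?q h)"
      unfolding e by (rule q_comm[OF aG _ Y1D[OF aY hxH]]) (use hG x in simp)
    qed (use qc bbG hG x in auto)
    then show ?thesis using comm_Mod[OF Mn bbG hG] by (simp add: a_def)
   qed
   have eq: "engel_comm (G Mod M) (?q (a 0)) (?q x) n = ?q (a n)" for n
    by (induction n) (simp_all add: rec)
   have "a k = a 0" using k by (simp add: a_def)
   then have "engel_comm (G Mod M) (?q (a 0)) (?q x) k = ?q (a 0)" using eq[of k] by simp
   then have e2: "?q (engel_comm G (a 0) x (k * j)) = ?q (a 0)" for j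
    using engel_comm_mult_period engel_comm_Mod[OF Mn aG x] by metis
   obtain n1 where n1: "\<And>i. i \<ge> n1 \<Longrightarrow> engel_periodic G x (engel_comm G (a 0) x i)"
    using almost_right_engel_eventually_periodic[OF almost_engel[OF aG] aG x] by blast
   have eY: "engel_comm G (a 0) x n \<in> Y (Suc i)" for n
   proof (induction n)
    case (Suc n)
    have "engel_comm G (a 0) x (Suc n)
     = inv (engel_comm G (a 0) x n) \<otimes> (inv x \<otimes> engel_comm G (a 0) x n \<otimes> x)"
     using Y1.mem_carrier[OF Suc] x by (simp add: word_simps)
    then show ?case using Suc Y1.inv_op_closed1[OF x Suc] by (simp del: engel_comm.simps)
   qed (use aY in simp)
   \<comment> \<open>The sequence of \<open>a 0\<close> is so far periodic only modulo
     \<open>M\<close>. At a multiple of \<open>k\<close> beyond \<open>n1\<close> the term is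
     genuinely periodic, so the induction hypothesis puts it into \<open>N0\<close>, while modulo
     \<open>M\<close> it still equals \<open>a 0\<close>.\<close>
   have "k * n1 \<ge> n1" using k(1) by simp
   then have "engel_comm G (a 0) x (k * n1) \<in> N0"
    using Suc.IH[unfolded \<open>j = Suc i\<close>, OF eY x n1] by blast
   then have "engel_comm G (a 0) x (k * n1) \<in> M" using N0_Y[of i] by (auto simp: M_def)
   then have q1: "?q (a 0) = \<one>\<^bsub>G Mod M\<^esub>"
    using e2[of n1] Mod_eq_one_iff[OF Mn] aG x by (metis engel_comm_closed)
   have "a n \<in> M" for n
   proof -
    have "?q (a n) = engel_comm (G Mod M) \<one>\<^bsub>G Mod M\<^esub> (?q x) n" using eq[of n] q1 by simp
    also have "\<dots> = \<one>\<^bsub>G Mod M\<^esub>" using Q.engel_comm_one qc[OF x] by blast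
    finally show ?thesis using Mod_eq_one_iff[OF Mn aG] by simp
   qed
   then show ?thesis using Diff h by (simp add: a_def)
  qed
  have genD: "v \<in> D" if v: "v \<in> H" and e: "engel_comm G v x n \<in> centre" for v n
  proof -
   have vH: "engel_comm G v x m \<in> H" for m
   proof (induction m)
    case (Suc m)
    have "engel_comm G v x (Suc m)
     = inv (engel_comm G v x m) \<otimes> (inv x \<otimes> engel_comm G v x m \<otimes> x)"
     using H.mem_carrier[OF Suc] x by (simp add: word_simps)
    then show ?case using Suc conj_H[OF Suc x] by (simp del: engel_comm.simps)
   qed (use v in simp)
   have "engel_comm G v x n \<in> D"
   proof -
    have "comm G (bb m) (engel_comm G v x n) = \<one>" for m
     using centre_commute[OF e bbH[of m]] bbG vH by (simp add: comm_eq_one_iff)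
    then show ?thesis using Diff vH by simp
   qed
   then have "engel_comm G v x (n - m) \<in> D" for m
   proof (induction m)
    case (Suc m)
    show ?case
    proof (cases "m < n")
     case True
     then have "n - m = Suc (n - Suc m)" by simp
     then have "comm G (engel_comm G v x (n - Suc m)) x \<in> D" using Suc by simp
     then show ?thesis using back_step vH by blast
    next
     case False
     then show ?thesis using Suc by simp
    qed
   qed simp
   from this[of n] show ?thesis by simp
  qed
  have "generic (\<lambda>v. v \<in> D)"
   by (rule generic_mono[OF generic_engel_centre[OF x]]) (elim exE, rule genD)
  then have "H \<subseteq> D" by (rule generic_subgroup[OF D])
  then have "comm G (bb 0) h \<in> M" if "h \<in> H" for h using that Diff by blast
  then have "b \<in> Y (Suc i)" using bbH[of 0] by (simp add: bb_def M_def upper_series.simps(2))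
  then show ?thesis using Suc.IH[of b x] x per Suc by simp
 qed
qed simp

text \<open>Modulo \<open>N0\<close>, elements of \<open>H\<close> are right Engel. Dividing further
  by the hypercentre leaves a group \<open>Q\<close> with trivial centre; a nontrivial image of the
  nilpotent group \<open>H\<close> in it would have a nontrivial centre, and
  \<open>right_engel_central_element\<close> would produce a central element of \<open>Q\<close>. So
  \<open>H\<close> lands in a hypercentre of finite index.\<close>

theorem nilpotent_imp_finite_by_hypercentral:
 assumes nilp: "H \<subseteq> upper_series G H {\<one>} c"
 shows "\<exists>N. N \<lhd> G \<and> finite N \<and> hypercentral (G Mod N)"
proof -
 have HY: "H \<subseteq> Y c"
  using nilp upper_series_mono[of "{\<one>}" N0 G H c] subgroup.one_closed[OF normal_imp_subgroup[OF N0_facts(1)]]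
  by auto
 have engelN0: "\<exists>n. engel_comm G b x n \<in> N0" if b: "b \<in> H" and x: "x \<in> carrier G" for b x
 proof -
  obtain n where n: "\<And>i. i \<ge> n \<Longrightarrow> engel_periodic G x (engel_comm G b x i)"
   using almost_right_engel_eventually_periodic[OF almost_engel _ x] b by blast
  have "engel_comm G b x m \<in> H" for m
  proof (induction m)
   case (Suc m)
   have "engel_comm G b x (Suc m)
    = inv (engel_comm G b x m) \<otimes> (inv x \<otimes> engel_comm G b x m \<otimes> x)"
    using H.mem_carrier[OF Suc] x by (simp add: word_simps)
   then show ?case using Suc conj_H[OF Suc x] by (simp del: engel_comm.simps)
  qed (use b in simp)
  then have "engel_comm G b x n \<in> Y c" using HY by blast
  then show ?thesis using engel_periodic_in_N0[OF _ x n] by blast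
 qed
 note N0n = N0_facts(1)
 define \<Gamma> where "\<Gamma> = G Mod N0"
 interpret \<Gamma>: group \<Gamma> unfolding \<Gamma>_def by (rule normal.factorgroup_is_group[OF N0n])
 define \<pi> where "\<pi> g = N0 #> g" for g
 have \<pi>: "\<pi> \<in> hom G \<Gamma>" unfolding \<pi>_def \<Gamma>_def by (rule normal.r_coset_hom_Mod[OF N0n])
 have \<pi>s: "\<pi> ` carrier G = carrier \<Gamma>" by (auto simp: \<pi>_def \<Gamma>_def FactGroup_def RCOSETS_def)
 define S where "S = hypercenter \<Gamma>"
 have Sn: "S \<lhd> \<Gamma>" unfolding S_def by (rule \<Gamma>.hypercenter_normal)
 interpret S: normal S \<Gamma> by (rule Sn)
 define Q where "Q = \<Gamma> Mod S"
 interpret Q: group Q unfolding Q_def by (rule S.factorgroup_is_group)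
 define \<rho> where "\<rho> g = S #>\<^bsub>\<Gamma>\<^esub> \<pi> g" for g
 have "\<rho> = (\<lambda>c. S #>\<^bsub>\<Gamma>\<^esub> c) \<circ> \<pi>" by (auto simp: \<rho>_def)
 then have \<rho>: "\<rho> \<in> hom G Q" unfolding Q_def using Group.hom_compose[OF \<pi> S.r_coset_hom_Mod] by simp
 have \<rho>s: "\<rho> ` carrier G = carrier Q"
 proof -
  have "\<rho> ` carrier G = (\<lambda>c. S #>\<^bsub>\<Gamma>\<^esub> c) ` carrier \<Gamma>" unfolding \<pi>s[symmetric] by (auto simp: \<rho>_def)
  then show ?thesis by (auto simp: Q_def FactGroup_def RCOSETS_def)
 qed
 interpret r: group_hom G Q \<rho> by unfold_locales (rule \<rho>)
 have \<pi>c: "\<pi> g \<in> carrier \<Gamma>" if "g \<in> carrier G" for g using that \<pi>s by blast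
 have \<rho>1: "\<rho> g = \<one>\<^bsub>Q\<^esub> \<longleftrightarrow> \<pi> g \<in> S" if "g \<in> carrier G" for g
  unfolding \<rho>_def Q_def by (rule \<Gamma>.Mod_eq_one_iff[OF Sn \<pi>c[OF that]])
 have \<rho>_comm: "\<rho> (comm G a b) = comm Q (\<rho> a) (\<rho> b)" if "a \<in> carrier G" "b \<in> carrier G" for a b
  using hom_comm[OF Q.is_group \<rho> that] .
 have trivial_centre: "\<rho> z = \<one>\<^bsub>Q\<^esub>" if z: "z \<in> carrier G" "\<And>g. g \<in> carrier G \<Longrightarrow> \<rho> (comm G z g) = \<one>\<^bsub>Q\<^esub>" for z
 proof -
  have "comm \<Gamma> (\<pi> z) d \<in> S" if d: "d \<in> carrier \<Gamma>" for d
  proof -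
   obtain g where g: "g \<in> carrier G" "d = \<pi> g" using d \<pi>s by blast
   have "\<pi> (comm G z g) \<in> S" using \<rho>1[of "comm G z g"] z(2)[OF g(1)] z(1) g(1) by simp
   then show ?thesis using hom_comm[OF \<Gamma>.is_group \<pi> z(1) g(1)] g(2) by simp
  qed
  then have "\<pi> z \<in> S" unfolding S_def using \<pi>c[OF z(1)] by (intro hypercenter.step) auto
  then show ?thesis using \<rho>1[OF z(1)] by simp
 qed
 have HS: "\<rho> b = \<one>\<^bsub>Q\<^esub>" if "b \<in> H" for b
 proof (rule ccontr)
  assume "\<rho> b \<noteq> \<one>\<^bsub>Q\<^esub>"
  \<comment> \<open>The elements of \<open>H\<close> whose image is central in the image of
    \<open>H\<close>. If all of them mapped to 1, induction along the upper central series would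
    make the whole image trivial.\<close>
  define A0 where "A0 = {b \<in> H. \<forall>h\<in>H. \<rho> (comm G b h) = \<one>\<^bsub>Q\<^esub>}"
  have ker: "kernel G Q \<rho> \<lhd> G" by (rule r.normal_kernel)
  have "A0 = {b \<in> H. \<forall>h\<in>H. comm G b h \<in> kernel G Q \<rho>}" by (auto simp: A0_def kernel_def)
  then have A0n: "A0 \<lhd> G" using upper_series_step_normal[OF H_normal ker] by simp
  interpret A0: normal A0 G by (rule A0n)
  have A0H: "A0 \<subseteq> H" by (auto simp: A0_def)
  have "\<exists>a\<in>A0. \<rho> a \<noteq> \<one>\<^bsub>Q\<^esub>"
  proof (rule ccontr)
   assume no: "\<not> ?thesis"
   have "\<forall>a\<in>upper_series G H {\<one>} j. \<rho> a = \<one>\<^bsub>Q\<^esub>" for j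
   proof (induction j)
    case (Suc j)
    then have "upper_series G H {\<one>} (Suc j) \<subseteq> A0" by (auto simp: A0_def upper_series.simps(2))
    then show ?case using no by blast
   qed (simp add: r.hom_one)
   then show False using nilp \<open>b \<in> H\<close> \<open>\<rho> b \<noteq> \<one>\<^bsub>Q\<^esub>\<close> by blast
  qed
  then obtain a0 where a0: "a0 \<in> A0" "\<rho> a0 \<noteq> \<one>\<^bsub>Q\<^esub>" by blast
  have "\<exists>z\<in>\<rho> ` A0. z \<noteq> \<one>\<^bsub>Q\<^esub> \<and> (\<forall>g\<in>carrier Q. z \<otimes>\<^bsub>Q\<^esub> g = g \<otimes>\<^bsub>Q\<^esub> z)"
  proof (rule Q.right_engel_central_element[of _ "\<rho> ` H"])
   show "subgroup (\<rho> ` A0) Q" by (rule r.subgroup_img_is_subgroup[OF A0.subgroup_axioms])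
   show Hs: "subgroup (\<rho> ` H) Q" by (rule r.subgroup_img_is_subgroup[OF H.subgroup_axioms])
   show "finite (rcosets\<^bsub>Q\<^esub> (\<rho> ` H))"
    by (rule finite_rcosets_hom[OF H.subgroup_axioms finite_index Q.is_group \<rho> \<rho>s Hs]) simp
   have AH: "\<rho> a \<otimes>\<^bsub>Q\<^esub> \<rho> h = \<rho> h \<otimes>\<^bsub>Q\<^esub> \<rho> a" if a: "a \<in> A0" and h: "h \<in> H" for a h
   proof -
    have G: "a \<in> carrier G" "h \<in> carrier G" using A0.mem_carrier[OF a] h by auto
    have "comm Q (\<rho> a) (\<rho> h) = \<one>\<^bsub>Q\<^esub>" using a h \<rho>_comm[OF G] by (simp add: A0_def)
    then show ?thesis using Q.comm_eq_one_iff[OF r.hom_closed[OF G(1)] r.hom_closed[OF G(2)]] by simp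
   qed
   show "a \<otimes>\<^bsub>Q\<^esub> b = b \<otimes>\<^bsub>Q\<^esub> a" if ab: "a \<in> \<rho> ` A0" "b \<in> \<rho> ` A0" for a b
   proof -
    obtain a' b' where "a = \<rho> a'" "b = \<rho> b'" "a' \<in> A0" "b' \<in> H" using ab A0H by auto
    then show ?thesis using AH by simp
   qed
   show "a \<otimes>\<^bsub>Q\<^esub> b = b \<otimes>\<^bsub>Q\<^esub> a" if ab: "a \<in> \<rho> ` A0" "b \<in> \<rho> ` H" for a b
   proof -
    obtain a' b' where "a = \<rho> a'" "b = \<rho> b'" "a' \<in> A0" "b' \<in> H" using ab by auto
    then show ?thesis using AH by simp
   qed
   show "inv\<^bsub>Q\<^esub> g \<otimes>\<^bsub>Q\<^esub> a \<otimes>\<^bsub>Q\<^esub> g \<in> \<rho> ` A0" if ab: "a \<in> \<rho> ` A0" "g \<in> carrier Q" for a g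
   proof -
    obtain a' g' where ag: "a = \<rho> a'" "g = \<rho> g'" "a' \<in> A0" "g' \<in> carrier G"
     using ab unfolding \<rho>s[symmetric] by auto
    have "inv\<^bsub>Q\<^esub> g \<otimes>\<^bsub>Q\<^esub> a \<otimes>\<^bsub>Q\<^esub> g = \<rho> (inv g' \<otimes> a' \<otimes> g')"
     using ag A0.mem_carrier[OF ag(3)] by simp
    then show ?thesis using A0.inv_op_closed1[OF ag(4,3)] by blast
   qed
   show "\<exists>n. engel_comm Q a x n = \<one>\<^bsub>Q\<^esub>" if ab: "a \<in> \<rho> ` A0" "x \<in> carrier Q" for a x
   proof -
    obtain a' x' where ag: "a = \<rho> a'" "x = \<rho> x'" "a' \<in> A0" "x' \<in> carrier G"
     using ab unfolding \<rho>s[symmetric] by auto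
    obtain n where n: "engel_comm G a' x' n \<in> N0" using engelN0[of a' x'] ag A0H by blast
    have a'G: "a' \<in> carrier G" using A0.mem_carrier[OF ag(3)] .
    have "\<pi> (engel_comm G a' x' n) = \<one>\<^bsub>\<Gamma>\<^esub>"
     using Mod_eq_one_iff[OF N0n, of "engel_comm G a' x' n"] n a'G ag(4) by (simp add: \<pi>_def \<Gamma>_def)
    then have "\<rho> (engel_comm G a' x' n) = \<one>\<^bsub>Q\<^esub>"
     using \<rho>1[of "engel_comm G a' x' n"] a'G ag(4) by simp
    then show ?thesis using hom_engel_comm[OF Q.is_group \<rho> a'G ag(4), of n] ag by auto
   qed
   show "\<rho> ` A0 \<noteq> {\<one>\<^bsub>Q\<^esub>}" using a0 by blast
  qed
  then obtain z where z: "z \<in> A0" "\<rho> z \<noteq> \<one>\<^bsub>Q\<^esub>" "\<forall>g\<in>carrier Q. \<rho> z \<otimes>\<^bsub>Q\<^esub> g = g \<otimes>\<^bsub>Q\<^esub> \<rho> z" by blast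
  have zG: "z \<in> carrier G" using A0.mem_carrier[OF z(1)] .
  have "\<rho> (comm G z g) = \<one>\<^bsub>Q\<^esub>" if g: "g \<in> carrier G" for g
   using z(3) g \<rho>_comm[OF zG g] Q.comm_eq_one_iff[OF r.hom_closed[OF zG] r.hom_closed[OF g]] by simp
  then show False using trivial_centre[OF zG] z(2) by blast
 qed
 have "\<pi> ` H \<subseteq> S" using HS \<rho>1 by blast
 then have "finite (rcosets\<^bsub>\<Gamma>\<^esub> (hypercenter \<Gamma>))"
  using finite_rcosets_hom[OF H.subgroup_axioms finite_index \<Gamma>.is_group \<pi> \<pi>s S.subgroup_axioms]
  by (simp add: S_def)
 moreover have "almost_right_engel \<Gamma> d" if d: "d \<in> carrier \<Gamma>" for d
 proof -
  obtain g where "g \<in> carrier G" "d = \<pi> g" using d unfolding \<pi>s[symmetric] by auto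
  then show ?thesis using almost_right_engel_hom[OF \<Gamma>.is_group \<pi> \<pi>s] almost_engel by blast
 qed
 ultimately have "\<exists>N. N \<lhd> \<Gamma> \<and> finite N \<and> hypercentral (\<Gamma> Mod N)"
  using \<Gamma>.finite_by_hypercentral_if_finite_index by blast
 then show ?thesis
  unfolding \<Gamma>_def by (rule finite_by_hypercentral_of_Mod[OF N0n N0_facts(2)])
qed

end


subsection \<open>Existence of a connected normal subgroup of finite index\<close>

text \<open>Closed sets are the preimages under \<open>F\<close> of linear subspaces of a finite-dimensional space, so
 descending chains of closed sets are bounded by the dimension.\<close>
locale translation_space = group G + vector_space scale
 for G :: "('a, 'c) monoid_scheme" (structure) and scale :: "'k::field \<Rightarrow> 'v::ab_group_add \<Rightarrow> 'v" +
 fixes F :: "'a \<Rightarrow> 'v" and L R :: "'a \<Rightarrow> 'v \<Rightarrow> 'v" and B0 :: "'v set"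
 assumes finB0: "finite B0" and F_span: "F ` carrier G \<subseteq> span B0"
  and lin_L: "g \<in> carrier G \<Longrightarrow> Vector_Spaces.linear scale scale (L g)"
  and lin_R: "g \<in> carrier G \<Longrightarrow> Vector_Spaces.linear scale scale (R g)"
  and F_L: "g \<in> carrier G \<Longrightarrow> v \<in> carrier G \<Longrightarrow> F (g \<otimes> v) = L g (F v)"
  and F_R: "g \<in> carrier G \<Longrightarrow> v \<in> carrier G \<Longrightarrow> F (v \<otimes> g) = R g (F v)"
begin

text \<open>The span of the image of \<open>C\<close> is the smallest subspace whose preimage
  contains \<open>C\<close>; the condition says that this preimage is \<open>C\<close>
  itself.\<close>

definition closed :: "'a set \<Rightarrow> bool" where
 "closed C \<longleftrightarrow> C \<subseteq> carrier G \<and> (\<forall>v\<in>carrier G. F v \<in> span (F ` C) \<longrightarrow> v \<in> C)"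

lemma closed_subset: "closed C \<Longrightarrow> C \<subseteq> carrier G"
 by (simp add: closed_def)

lemma closedD: "closed C \<Longrightarrow> v \<in> carrier G \<Longrightarrow> F v \<in> span (F ` C) \<Longrightarrow> v \<in> C"
 by (simp add: closed_def)

lemma closed_carrier: "closed (carrier G)"
 by (simp add: closed_def)

lemma closed_Int:
 assumes "closed C" "closed D"
 shows "closed (C \<inter> D)"
proof -
 have "v \<in> C \<inter> D" if "v \<in> carrier G" "F v \<in> span (F ` (C \<inter> D))" for v
  using that closedD[OF assms(1), of v] closedD[OF assms(2), of v]
   span_mono[of "F ` (C \<inter> D)" "F ` C"] span_mono[of "F ` (C \<inter> D)" "F ` D"] by blast
 then show ?thesis using closed_subset[OF assms(1)] by (auto simp: closed_def)
qed

text \<open>Homogeneity is asked only in the form that scaling preserves zeros, so the conditions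
  may take values in any abelian group without a scalar multiplication being fixed there.\<close>

lemma closedI_functionals:
 assumes "\<And>l. l \<in> \<Lambda> \<Longrightarrow> (\<forall>x y. l (x + y) = l x + (l y :: 'w::ab_group_add)) \<and> (\<forall>c x. l x = 0 \<longrightarrow> l (scale c x) = 0)"
 shows "closed {v \<in> carrier G. \<forall>l\<in>\<Lambda>. l (F v) = 0}"
proof -
 let ?C = "{v \<in> carrier G. \<forall>l\<in>\<Lambda>. l (F v) = 0}"
 have "l u = 0" if l: "l \<in> \<Lambda>" and u: "u \<in> span (F ` ?C)" for l u
  using u
 proof (induction rule: span_induct_alt)
  case base
  have "l 0 + l 0 = l 0" using assms[OF l] by (metis add_0)
  then show ?case by simp
 next
  case (step c x y)
  have "l x = 0" using step(1) l by blast
  then show ?case using assms[OF l] step(2) by simp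
 qed
 then show ?thesis unfolding closed_def by (intro conjI ballI impI CollectI subsetI) blast+
qed

lemma linear_span_image:
 assumes "Vector_Spaces.linear scale scale T" "x \<in> span S" "T ` S \<subseteq> span S'"
 shows "T x \<in> span S'"
proof -
 interpret T: Vector_Spaces.linear scale scale T by (rule assms(1))
 show ?thesis using assms(2)
 proof (induction rule: span_induct_alt)
  case base
  show ?case by (simp add: T.zero span_zero)
 next
  case (step c x y)
  then show ?case using assms(3)
   by (auto simp: T.add T.scale intro!: span_add span_scale)
 qed
qed

lemma closed_left:
 assumes C: "closed C" and g: "g \<in> carrier G"
 shows "closed {v \<in> carrier G. g \<otimes> v \<in> C}"
proof -
 let ?D = "{v \<in> carrier G. g \<otimes> v \<in> C}"
 have "g \<otimes> v \<in> C" if v: "v \<in> carrier G" and Fv: "F v \<in> span (F ` ?D)" for v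
 proof -
  have "L g (F v) \<in> span (F ` C)"
   by (rule linear_span_image[OF lin_L[OF g] Fv]) (use g in \<open>auto simp: F_L[symmetric] intro!: span_base\<close>)
  then show ?thesis using closedD[OF C] g v F_L[OF g v] by simp
 qed
 then show ?thesis by (auto simp: closed_def)
qed

lemma closed_right:
 assumes C: "closed C" and g: "g \<in> carrier G"
 shows "closed {v \<in> carrier G. v \<otimes> g \<in> C}"
proof -
 let ?D = "{v \<in> carrier G. v \<otimes> g \<in> C}"
 have "v \<otimes> g \<in> C" if v: "v \<in> carrier G" and Fv: "F v \<in> span (F ` ?D)" for v
 proof -
  have "R g (F v) \<in> span (F ` C)"
   by (rule linear_span_image[OF lin_R[OF g] Fv]) (use g in \<open>auto simp: F_R[symmetric] intro!: span_base\<close>)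
  then show ?thesis using closedD[OF C] g v F_R[OF g v] by simp
 qed
 then show ?thesis by (auto simp: closed_def)
qed

section \<open>Dimension of closed sets and decomposition into irreducible ones\<close>

definition rk :: "'a set \<Rightarrow> nat" where
 "rk C = Max (card ` {B. B \<subseteq> F ` C \<and> independent B})"

lemma indep_bound:
 assumes "C \<subseteq> carrier G" "B \<subseteq> F ` C" "independent B"
 shows "finite B \<and> card B \<le> card B0"
 by (rule independent_span_bound[OF finB0 assms(3)]) (use assms F_span in blast)

lemma rk_set_finite:
 assumes "C \<subseteq> carrier G"
 shows "finite (card ` {B. B \<subseteq> F ` C \<and> independent B})"
 by (rule finite_subset[of _ "{..card B0}"]) (use indep_bound[OF assms] in auto)

lemma rk_ge:
 assumes "C \<subseteq> carrier G" "B \<subseteq> F ` C" "independent B"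
 shows "card B \<le> rk C"
 unfolding rk_def using rk_set_finite[OF assms(1)] assms by (intro Max_ge) auto

lemma rk_attained:
 assumes "C \<subseteq> carrier G"
 obtains B where "B \<subseteq> F ` C" "independent B" "card B = rk C"
proof -
 have "rk C \<in> card ` {B. B \<subseteq> F ` C \<and> independent B}"
  unfolding rk_def by (rule Max_in[OF rk_set_finite[OF assms]]) (use independent_empty in auto)
 then show ?thesis using that by auto
qed

lemma rk_less:
 assumes C: "closed C" and D: "D \<subseteq> carrier G" and CD: "C \<subset> D"
 shows "rk C < rk D"
proof -
 obtain B where B: "B \<subseteq> F ` C" "independent B" "card B = rk C"
  using rk_attained[OF closed_subset[OF C]] by blast
 obtain v where v: "v \<in> D" "v \<notin> C" using CD by blast
 have "F v \<notin> span B"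
 proof
  assume "F v \<in> span B"
  then have "F v \<in> span (F ` C)" using span_mono[OF B(1)] by blast
  then show False using closedD[OF C] v D by blast
 qed
 then have ind: "independent (insert (F v) B)" and nB: "F v \<notin> B"
  using B(2) by (auto simp: independent_insert intro: span_base)
 have "card (insert (F v) B) \<le> rk D"
  by (rule rk_ge[OF D _ ind]) (use B v CD in blast)
 moreover have "finite B" using indep_bound[OF closed_subset[OF C] B(1,2)] by simp
 ultimately show ?thesis using B(3) nB by simp
qed

definition irr :: "'a set \<Rightarrow> bool" where
 "irr C \<longleftrightarrow> C \<noteq> {} \<and> closed C \<and>
   (\<forall>\<A>. finite \<A> \<longrightarrow> (\<forall>Y\<in>\<A>. closed Y) \<longrightarrow> C \<subseteq> \<Union>\<A> \<longrightarrow> (\<exists>Y\<in>\<A>. C \<subseteq> Y))"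

lemma irrD: "irr C \<Longrightarrow> finite \<A> \<Longrightarrow> (\<And>Y. Y \<in> \<A> \<Longrightarrow> closed Y) \<Longrightarrow> C \<subseteq> \<Union>\<A> \<Longrightarrow> \<exists>Y\<in>\<A>. C \<subseteq> Y"
 by (simp add: irr_def)

lemma irr_closed: "irr C \<Longrightarrow> closed C"
 by (simp add: irr_def)

text \<open>If finitely many closed \<open>Y\<close> cover a nonempty \<open>C\<close> and none
  contains it, then \<open>C\<close> is the union of the closed sets \<open>C \<inter> Y\<close>,
  each of strictly smaller \<open>rk\<close>, and the induction on \<open>rk\<close> decomposes
  these.\<close>

lemma irr_decomposition:
 "closed C \<Longrightarrow> \<exists>\<A>. finite \<A> \<and> (\<forall>Y\<in>\<A>. irr Y) \<and> C = \<Union>\<A>"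
proof (induction "rk C" arbitrary: C rule: less_induct)
 case less
 show ?case
 proof (cases "C = {} \<or> irr C")
  case True
  then show ?thesis
  proof
   assume "C = {}"
   then show ?thesis by (intro exI[of _ "{}"]) auto
  next
   assume "irr C"
   then show ?thesis by (intro exI[of _ "{C}"]) auto
  qed
 next
  case False
  then obtain \<A> where A: "finite \<A>" "\<forall>Y\<in>\<A>. closed Y" "C \<subseteq> \<Union>\<A>" "\<forall>Y\<in>\<A>. \<not> C \<subseteq> Y"
   using less.prems by (auto simp: irr_def)
  have "\<exists>\<B>. finite \<B> \<and> (\<forall>Z\<in>\<B>. irr Z) \<and> C \<inter> Y = \<Union>\<B>" if Y: "Y \<in> \<A>" for Y
  proof (rule less.hyps)
   show cl: "closed (C \<inter> Y)" using closed_Int less.prems A(2) Y by blast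
   show "rk (C \<inter> Y) < rk C"
    by (rule rk_less[OF cl closed_subset[OF less.prems]]) (use A(4) Y in blast)
  qed
  then obtain f where f: "\<And>Y. Y \<in> \<A> \<Longrightarrow> finite (f Y) \<and> (\<forall>Z\<in>f Y. irr Z) \<and> C \<inter> Y = \<Union>(f Y)"
   by metis
  have "C = \<Union>(\<Union>(f ` \<A>))"
  proof -
   have "C = (\<Union>Y\<in>\<A>. C \<inter> Y)" using A(3) by blast
   also have "\<dots> = (\<Union>Y\<in>\<A>. \<Union>(f Y))" using f by simp
   finally show ?thesis by blast
  qed
  then show ?thesis using f A(1) by (intro exI[of _ "\<Union>(f ` \<A>)"]) auto
 qed
qed

text \<open>The translate of \<open>C\<close> by \<open>g\<close>, written as a preimage so that
  \<open>closed_left\<close> applies to it directly.\<close>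

definition tr :: "'a \<Rightarrow> 'a set \<Rightarrow> 'a set" where
 "tr g C = {v \<in> carrier G. inv g \<otimes> v \<in> C}"

lemma tr_tr: "g \<in> carrier G \<Longrightarrow> h \<in> carrier G \<Longrightarrow> tr g (tr h C) = tr (g \<otimes> h) C"
 by (auto simp: tr_def inv_mult_group m_assoc)

lemma tr_one: "C \<subseteq> carrier G \<Longrightarrow> tr \<one> C = C"
 by (auto simp: tr_def)

lemma tr_mono: "C \<subseteq> D \<Longrightarrow> tr g C \<subseteq> tr g D"
 by (auto simp: tr_def)

lemma tr_inv: "g \<in> carrier G \<Longrightarrow> C \<subseteq> carrier G \<Longrightarrow> tr (inv g) (tr g C) = C" "g \<in> carrier G \<Longrightarrow> C \<subseteq> carrier G \<Longrightarrow> tr g (tr (inv g) C) = C"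
 by (auto simp: tr_tr tr_one)

lemma closed_tr: "closed C \<Longrightarrow> g \<in> carrier G \<Longrightarrow> closed (tr g C)"
 unfolding tr_def by (rule closed_left) auto

lemma tr_subset_iff:
 assumes "g \<in> carrier G" "C \<subseteq> carrier G" "D \<subseteq> carrier G"
 shows "tr g C \<subseteq> D \<longleftrightarrow> C \<subseteq> tr (inv g) D"
 using tr_mono[of "tr g C" D "inv g"] tr_mono[of C "tr (inv g) D" g] tr_inv assms by metis

lemma irr_tr:
 assumes C: "irr C" and g: "g \<in> carrier G"
 shows "irr (tr g C)"
 unfolding irr_def
proof (intro conjI allI impI)
 have CG: "C \<subseteq> carrier G" using closed_subset[OF irr_closed[OF C]] .
 show "closed (tr g C)" using closed_tr irr_closed C g by blast
 obtain c where "c \<in> C" using C by (auto simp: irr_def)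
 then have "g \<otimes> c \<in> tr g C" using CG g by (auto simp: tr_def)
 then show "tr g C \<noteq> {}" by blast
 fix \<A> assume A: "finite \<A>" "\<forall>Y\<in>\<A>. closed Y" "tr g C \<subseteq> \<Union>\<A>"
 have "C \<subseteq> \<Union>(tr (inv g) ` \<A>)"
 proof
  fix c assume c: "c \<in> C"
  then have "g \<otimes> c \<in> tr g C" using CG g by (auto simp: tr_def)
  then have "g \<otimes> c \<in> \<Union>\<A>" using A(3) by blast
  then show "c \<in> \<Union>(tr (inv g) ` \<A>)" using c CG g by (auto simp: tr_def)
 qed
 then have "\<exists>Y\<in>tr (inv g) ` \<A>. C \<subseteq> Y"
  by (intro irrD[OF C]) (use A closed_tr g in auto)
 then obtain Y where Y: "Y \<in> \<A>" "C \<subseteq> tr (inv g) Y" by blast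
 then have "tr g C \<subseteq> Y" using tr_subset_iff[OF g CG closed_subset] A(2) by blast
 then show "\<exists>Y\<in>\<A>. tr g C \<subseteq> Y" using Y by blast
qed

section \<open>Irreducible components and their common stabiliser\<close>

definition comps :: "'a set set" where
 "comps = {C. irr C \<and> (\<forall>D. irr D \<longrightarrow> C \<subseteq> D \<longrightarrow> D = C)}"

lemma comps_carrier: "C \<in> comps \<Longrightarrow> C \<subseteq> carrier G"
 using closed_subset irr_closed by (auto simp: comps_def)

lemma tr_comps:
 assumes C: "C \<in> comps" and g: "g \<in> carrier G"
 shows "tr g C \<in> comps"
proof -
 have CG: "C \<subseteq> carrier G" by (rule comps_carrier[OF C])
 have "D = tr g C" if D: "irr D" "tr g C \<subseteq> D" for D
 proof -
  have DG: "D \<subseteq> carrier G" using closed_subset irr_closed D by blast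
  have "C \<subseteq> tr (inv g) D" using tr_subset_iff[OF g CG DG] D by simp
  moreover have "irr (tr (inv g) D)" using irr_tr D g by simp
  ultimately have "tr (inv g) D = C" using C by (simp add: comps_def)
  then show ?thesis using tr_inv(2)[OF g DG] by simp
 qed
 then show ?thesis using irr_tr[OF _ g] C by (simp add: comps_def)
qed

lemma comps_finite_nonempty: "finite comps" "comps \<noteq> {}"
proof -
 obtain \<A> where A: "finite \<A>" "\<forall>Y\<in>\<A>. irr Y" "carrier G = \<Union>\<A>"
  using irr_decomposition[OF closed_carrier] by blast
 have sub: "\<exists>Y\<in>\<A>. C \<subseteq> Y" if "irr C" for C
  by (rule irrD[OF that A(1)]) (use A irr_closed closed_subset that in auto)
 have "comps \<subseteq> \<A>"
 proof
  fix C assume C: "C \<in> comps"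
  then have "irr C" by (simp add: comps_def)
  then obtain Y where Y: "Y \<in> \<A>" "C \<subseteq> Y" using sub by blast
  then have "Y = C" using C A(2) by (auto simp: comps_def)
  then show "C \<in> \<A>" using Y by simp
 qed
 then show "finite comps" using A(1) finite_subset by blast
 have "\<A> \<noteq> {}" using A(3) one_closed by blast
 then obtain M where M: "M \<in> \<A>" "\<forall>N\<in>\<A>. M \<subseteq> N \<longrightarrow> M = N"
  using finite_has_maximal[OF A(1)] by auto
 have "D = M" if D: "irr D" "M \<subseteq> D" for D
 proof -
  obtain Y where Y: "Y \<in> \<A>" "D \<subseteq> Y" using sub D by blast
  then have "M = Y" using M(2) D by blast
  then show ?thesis using Y D by blast
 qed
 then have "M \<in> comps" using M A(2) by (simp add: comps_def)
 then show "comps \<noteq> {}" by blast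
qed

text \<open>The kernel of the permutation action of \<open>G\<close> on its finitely many
  components, which makes normality and finite index immediate; it takes the place of the identity
  component of an algebraic group.\<close>

definition H0 :: "'a set" where
 "H0 = {g \<in> carrier G. \<forall>C\<in>comps. tr g C = C}"

lemma H0_carrier: "h \<in> H0 \<Longrightarrow> h \<in> carrier G"
 unfolding H0_def by (erule CollectE, erule conjunct1)

lemma H0_fix: "h \<in> H0 \<Longrightarrow> C \<in> comps \<Longrightarrow> tr h C = C"
 unfolding H0_def by (erule CollectE, erule conjE, erule bspec)

lemma H0_I: "h \<in> carrier G \<Longrightarrow> (\<And>C. C \<in> comps \<Longrightarrow> tr h C = C) \<Longrightarrow> h \<in> H0"
 unfolding H0_def by (intro CollectI conjI ballI)

lemma H0_normal: "H0 \<lhd> G"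
proof -
 have sub: "subgroup H0 G"
 proof (rule subgroupI)
  show "H0 \<subseteq> carrier G" by (auto simp: H0_def)
  have "\<one> \<in> H0" using comps_carrier tr_one by (auto simp: H0_def)
  then show "H0 \<noteq> {}" by blast
  show "inv a \<in> H0" if a: "a \<in> H0" for a
  proof -
   have "tr (inv a) C = C" if C: "C \<in> comps" for C
    using tr_inv(1)[of a C] a C comps_carrier[OF C] by (simp add: H0_def)
   then show ?thesis using a by (simp add: H0_def)
  qed
  show "a \<otimes> b \<in> H0" if "a \<in> H0" "b \<in> H0" for a b
   using that by (auto simp: H0_def tr_tr[symmetric])
 qed
 show ?thesis
 proof (rule normal_invI[OF sub])
  fix g h assume g: "g \<in> carrier G" and h: "h \<in> H0"
  have hG: "h \<in> carrier G" using h by (simp add: H0_def)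
  have "tr (g \<otimes> h \<otimes> inv g) C = C" if C: "C \<in> comps" for C
  proof -
   have "tr (g \<otimes> h \<otimes> inv g) C = tr g (tr h (tr (inv g) C))" using g hG by (simp add: tr_tr m_assoc)
   also have "tr h (tr (inv g) C) = tr (inv g) C" using h tr_comps[OF C, of "inv g"] g by (simp add: H0_def)
   finally show ?thesis using tr_inv(2)[OF g comps_carrier[OF C]] by simp
  qed
  then show "g \<otimes> h \<otimes> inv g \<in> H0" using g hG by (simp add: H0_def)
 qed
qed

lemma H0_finite_index: "finite (rcosets H0)"
proof -
 interpret H0: normal H0 G by (rule H0_normal)
 define f where "f g = (\<lambda>C\<in>comps. tr (inv g) C)" for g
 have "f ` carrier G \<subseteq> comps \<rightarrow>\<^sub>E comps" using tr_comps by (auto simp: f_def)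
 then have fin: "finite (f ` carrier G)"
  using comps_finite_nonempty(1) finite_PiE[of comps "\<lambda>_. comps"] finite_subset by blast
 have eq: "H0 #> g = H0 #> g'" if g: "g \<in> carrier G" and g': "g' \<in> carrier G" and f: "f g = f g'" for g g'
 proof -
  have "tr (g' \<otimes> inv g) C = C" if C: "C \<in> comps" for C
  proof -
   have "tr (inv g) C = tr (inv g') C" using f C by (metis f_def restrict_apply')
   then have "tr g' (tr (inv g) C) = C" using tr_inv(2)[OF g' comps_carrier[OF C]] by simp
   then show ?thesis using g g' by (simp add: tr_tr)
  qed
  then have "g' \<otimes> inv g \<in> H0" using g g' by (intro H0_I) auto
  then have "(g' \<otimes> inv g) \<otimes> g \<in> H0 #> g" unfolding r_coset_def by blast
  then have "g' \<in> H0 #> g" using g g' by (simp add: m_assoc)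
  then show ?thesis using repr_independence[OF _ g H0.subgroup_axioms] by blast
 qed
 have "rcosets H0 \<subseteq> (\<lambda>y. H0 #> (SOME g. g \<in> carrier G \<and> f g = y)) ` (f ` carrier G)"
 proof
  fix c assume "c \<in> rcosets H0"
  then obtain g where g: "g \<in> carrier G" "c = H0 #> g" by (auto simp: RCOSETS_def)
  define g' where "g' = (SOME g'. g' \<in> carrier G \<and> f g' = f g)"
  have "g' \<in> carrier G \<and> f g' = f g" unfolding g'_def by (rule someI[of _ g]) (use g in simp)
  then have "c = H0 #> g'" using eq[OF g(1)] g(2) by simp
  then show "c \<in> (\<lambda>y. H0 #> (SOME g. g \<in> carrier G \<and> f g = y)) ` (f ` carrier G)"
   unfolding g'_def using g(1) by blast
 qed
 then show ?thesis using fin finite_surj by blast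
qed

text \<open>A component \<open>C\<close> is a union of right cosets of \<open>H0\<close>, so a
  finite cover of \<open>H0\<close> by closed sets yields, by right translation, a finite cover of
  \<open>C\<close>. Irreducibility gives one translate containing \<open>C\<close>, hence containing
  the coset it was built for, and translating back gives a member containing
  \<open>H0\<close>.\<close>

lemma H0_irreducible:
 assumes A: "finite \<A>" "\<And>Y. Y \<in> \<A> \<Longrightarrow> closed Y" "H0 \<subseteq> \<Union>\<A>"
 shows "\<exists>Y\<in>\<A>. H0 \<subseteq> Y"
proof (rule ccontr)
 assume no: "\<not> (\<exists>Y\<in>\<A>. H0 \<subseteq> Y)"
 interpret H0: normal H0 G by (rule H0_normal)
 obtain C where C: "C \<in> comps" using comps_finite_nonempty by blast
 have CG: "C \<subseteq> carrier G" by (rule comps_carrier[OF C])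
 have irrC: "irr C" using C by (simp add: comps_def)
 define T where "T Y g = {v \<in> carrier G. v \<otimes> inv g \<in> Y}" for Y g
 define rep where "rep c = (SOME g. g \<in> c)" for c :: "'a set"
 define \<B> where "\<B> = (\<lambda>(c, Y). T Y (rep c)) ` ({c \<in> rcosets H0. c \<subseteq> C} \<times> \<A>)"
 have rep: "rep c \<in> c" "c = H0 #> rep c" "rep c \<in> carrier G" if c: "c \<in> rcosets H0" for c
 proof -
  obtain g where g: "g \<in> carrier G" "c = H0 #> g" using c by (auto simp: RCOSETS_def)
  have "g \<in> c" using g rcos_self[OF g(1) H0.subgroup_axioms] by simp
  then show 1: "rep c \<in> c" unfolding rep_def by (rule someI)
  then show 2: "rep c \<in> carrier G" using H0.rcosets_carrier[OF is_group c] by blast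
  show "c = H0 #> rep c" using g 1 repr_independence[OF _ g(1) H0.subgroup_axioms] by blast
 qed
 have "\<exists>Y\<in>\<B>. C \<subseteq> Y"
 proof (rule irrD[OF irrC])
  show "finite \<B>" unfolding \<B>_def using H0_finite_index A(1) by auto
  show "closed Y" if "Y \<in> \<B>" for Y
   using that closed_right[OF A(2), of _ "inv (rep _)"] rep(3) unfolding \<B>_def T_def by auto
  show "C \<subseteq> \<Union>\<B>"
  proof
   fix x assume x: "x \<in> C"
   have xG: "x \<in> carrier G" using x CG by blast
   define c where "c = H0 #> x"
   have c: "c \<in> rcosets H0" using xG by (auto simp: c_def RCOSETS_def)
   have "h \<otimes> x \<in> C" if h: "h \<in> H0" for h
   proof -
    have hG: "h \<in> carrier G" by (rule H0_carrier[OF h])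
    have "h \<otimes> x \<in> tr h C" unfolding tr_def using x xG hG by simp
    then show ?thesis unfolding H0_fix[OF h C] .
   qed
   then have cC: "c \<subseteq> C" by (auto simp: c_def r_coset_def)
   have "x \<in> c" unfolding c_def by (rule rcos_self[OF xG H0.subgroup_axioms])
   then have "x \<in> H0 #> rep c" using rep(2)[OF c] by simp
   then obtain h where h: "h \<in> H0" "x = h \<otimes> rep c" by (auto simp: r_coset_def)
   then have "x \<otimes> inv (rep c) = h" using rep(3)[OF c] by (simp add: m_assoc)
   then obtain Y where "Y \<in> \<A>" "x \<in> T Y (rep c)" using A(3) h xG by (auto simp: T_def)
   then show "x \<in> \<Union>\<B>" using c cC unfolding \<B>_def by auto
  qed
 qed
 then obtain c Y where cY: "c \<in> rcosets H0" "c \<subseteq> C" "Y \<in> \<A>" "C \<subseteq> T Y (rep c)" unfolding \<B>_def by auto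
 have "h \<in> Y" if h: "h \<in> H0" for h
 proof -
  have "h \<otimes> rep c \<in> H0 #> rep c" using h unfolding r_coset_def by blast
  then have "h \<otimes> rep c \<in> T Y (rep c)" using rep(2)[OF cY(1)] cY(2,4) by blast
  then show ?thesis using rep(3)[OF cY(1)] H0.mem_carrier[OF h] by (simp add: T_def m_assoc)
 qed
 then show False using no cY(3) by blast
qed

end


subsection \<open>Spectral idempotents in algebras\<close>

locale K_algebra =
 fixes sc :: "'k::field \<Rightarrow> 'r::ring_1 \<Rightarrow> 'r"
 assumes sc_add_right: "sc c (x + y) = sc c x + sc c y"
  and sc_add_left: "sc (c + d) x = sc c x + sc d x"
  and sc_sc [simp]: "sc c (sc d x) = sc (c * d) x"
  and sc_one [simp]: "sc 1 x = x"
  and sc_mult_left [simp]: "sc c x * y = sc c (x * y)"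
  and sc_mult_right [simp]: "x * sc c y = sc c (x * y)"
begin

lemma sc_zero_left [simp]: "sc 0 x = 0"
 using sc_add_left[of 0 0 x] by simp

lemma sc_zero_right [simp]: "sc c 0 = 0"
 using sc_add_right[of c 0 0] by simp

lemma sc_minus_left [simp]: "sc (- c) x = - sc c x"
 using sc_add_left[of "- c" c x] by (simp add: add_eq_0_iff)

lemma sc_minus_right [simp]: "sc c (- x) = - sc c x"
 using sc_add_right[of c "- x" x] by (simp add: add_eq_0_iff)

lemma sc_diff_right: "sc c (x - y) = sc c x - sc c y"
 using sc_add_right[of c x "- y"] by simp

lemma sc_diff_left: "sc (c - d) x = sc c x - sc d x"
 using sc_add_left[of c "- d" x] by simp

lemma sc_eq_0_iff [simp]: "sc c x = 0 \<longleftrightarrow> c = 0 \<or> x = 0"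
proof
 assume s: "sc c x = 0"
 show "c = 0 \<or> x = 0"
 proof (rule disjCI)
  assume "x \<noteq> 0"
  show "c = 0"
  proof (rule ccontr)
   assume "c \<noteq> 0"
   then have "x = sc (inverse c) (sc c x)" by simp
   then show False using s \<open>x \<noteq> 0\<close> by simp
  qed
 qed
qed auto

definition aev :: "'k poly \<Rightarrow> 'r \<Rightarrow> 'r" where
 "aev p x = fold_coeffs (\<lambda>a b. sc a 1 + x * b) p 0"

lemma aev_0 [simp]: "aev 0 x = 0"
 by (simp add: aev_def)

lemma aev_pCons [simp]: "aev (pCons a p) x = sc a 1 + x * aev p x"
 by (cases "p = 0 \<and> a = 0") (auto simp: aev_def)

lemma aev_add [simp]: "aev (p + q) x = aev p x + aev q x"
 by (induction p q rule: poly_induct2) (simp_all add: algebra_simps sc_add_left)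

lemma aev_smult [simp]: "aev (smult c p) x = sc c (aev p x)"
 by (induction p) (simp_all add: sc_add_right)

lemma aev_mult [simp]: "aev (p * q) x = aev p x * aev q x"
 by (induction p) (simp_all add: algebra_simps)

lemma aev_1 [simp]: "aev 1 x = 1"
 by (simp add: one_pCons)

lemma aev_minus [simp]: "aev (- p) x = - aev p x"
 using aev_smult[of "- 1" p x] by simp

lemma aev_diff [simp]: "aev (p - q) x = aev p x - aev q x"
 using aev_add[of p "- q" x] by simp

lemma aev_power [simp]: "aev (p ^ n) x = aev p x ^ n"
 by (induction n) auto

lemma aev_sum [simp]: "aev (\<Sum>i\<in>I. f i) x = (\<Sum>i\<in>I. aev (f i) x)"
 by (induction I rule: infinite_finite_induct) auto

lemma aev_commute: "A * x = x * A \<Longrightarrow> A * aev p x = aev p x * A"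
proof (induction p)
 case (pCons a p)
 have "A * (x * aev p x) = x * (A * aev p x)" using pCons.prems by (metis mult.assoc)
 also have "\<dots> = x * aev p x * A" using pCons by (simp add: mult.assoc)
 finally show ?case by (simp add: algebra_simps)
qed simp

lemma aev_commute_aev: "aev p x * aev q x = aev q x * aev p x"
 by (metis aev_mult mult.commute)

lemma aev_eigen: "x * A = sc \<mu> A \<Longrightarrow> aev p x * A = sc (poly p \<mu>) A"
proof (induction p)
 case (pCons a p)
 have "x * aev p x * A = sc (\<mu> * poly p \<mu>) A"
  using pCons by (simp add: mult.assoc mult.commute[of \<mu>])
 then show ?case by (simp add: algebra_simps sc_add_left)
qed simp

lemma aev_dvd: "p dvd q \<Longrightarrow> aev p x = 0 \<Longrightarrow> aev q x = 0"
 by auto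

lemma eigen_power: "T * B = sc a B \<Longrightarrow> T ^ n * B = sc (a ^ n) B"
 by (induction n) (auto simp: mult.assoc mult.commute)

lemma shift_eigen: "x * B = sc \<mu> B \<Longrightarrow> (x - sc \<nu> 1) ^ n * B = sc ((\<mu> - \<nu>) ^ n) B"
 by (rule eigen_power) (simp add: algebra_simps sc_diff_left)

text \<open>The last nonzero element of the sequence \<open>(x - \<kappa>)\<^sup>i A\<close> is an eigenvector.\<close>
lemma generalised_eigenvector:
 assumes "(x - sc \<kappa> 1) ^ n * A = 0" "A \<noteq> 0"
 obtains i where "(x - sc \<kappa> 1) ^ i * A \<noteq> 0" "x * ((x - sc \<kappa> 1) ^ i * A) = sc \<kappa> ((x - sc \<kappa> 1) ^ i * A)"
proof -
 define m where "m = (LEAST n. (x - sc \<kappa> 1) ^ n * A = 0)"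
 have m: "(x - sc \<kappa> 1) ^ m * A = 0" unfolding m_def using assms(1) by (rule LeastI)
 then have "m \<noteq> 0" using assms(2) by (metis mult_1 power_0)
 then obtain i where i: "m = Suc i" using not0_implies_Suc by blast
 have "(x - sc \<kappa> 1) * ((x - sc \<kappa> 1) ^ i * A) = 0" using m i by (simp add: mult.assoc)
 then have "x * ((x - sc \<kappa> 1) ^ i * A) = sc \<kappa> ((x - sc \<kappa> 1) ^ i * A)" by (simp add: algebra_simps)
 moreover have "(x - sc \<kappa> 1) ^ i * A \<noteq> 0"
  using not_less_Least[of i "\<lambda>n. (x - sc \<kappa> 1) ^ n * A = 0"] i m_def by simp
 ultimately show ?thesis using that by blast
qed

lemma shift_commute: "(x - sc a 1) ^ m * (x - sc b 1) ^ n = (x - sc b 1) ^ n * (x - sc a 1) ^ m"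
proof -
 have "aev ([:- a, 1:] ^ m) x * aev ([:- b, 1:] ^ n) x = aev ([:- b, 1:] ^ n) x * aev ([:- a, 1:] ^ m) x"
  by (rule aev_commute_aev)
 then show ?thesis by simp
qed

lemma coprime_shifts:
 assumes "(x - sc a 1) ^ m * B = 0" "(x - sc b 1) ^ n * B = 0" "a \<noteq> b"
 shows "B = 0"
proof (rule ccontr)
 assume "B \<noteq> 0"
 then obtain i where i: "(x - sc a 1) ^ i * B \<noteq> 0" "x * ((x - sc a 1) ^ i * B) = sc a ((x - sc a 1) ^ i * B)"
  using generalised_eigenvector[OF assms(1)] by blast
 have "(x - sc b 1) ^ n * ((x - sc a 1) ^ i * B) = (x - sc a 1) ^ i * ((x - sc b 1) ^ n * B)"
  using shift_commute[of x b n a i] by (metis mult.assoc)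
 then have "sc ((a - b) ^ n) ((x - sc a 1) ^ i * B) = 0"
  using shift_eigen[OF i(2), of b n] assms(2) by simp
 then show False using i(1) assms(3) by simp
qed

text \<open>The polynomial \<open>X - \<mu>\<close> divides \<open>X^j - \<mu>^j\<close>, and so do
  their \<open>n\<close>-th powers.\<close>

lemma power_shift_kills:
 assumes "(x - sc \<mu> 1) ^ n * A = 0"
 shows "(x ^ j - sc (\<mu> ^ j) 1) ^ n * A = 0"
proof -
 have "[:- \<mu>, 1:] dvd [:0, 1:] ^ j - [:\<mu> ^ j:]" by (simp add: poly_eq_0_iff_dvd[symmetric])
 then have "[:- \<mu>, 1:] ^ n dvd ([:0, 1:] ^ j - [:\<mu> ^ j:]) ^ n" by (rule dvd_power_same)
 then obtain q where "([:0, 1:] ^ j - [:\<mu> ^ j:]) ^ n = q * [:- \<mu>, 1:] ^ n"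
  by (metis dvd_def mult.commute)
 then have "aev (([:0, 1:] ^ j - [:\<mu> ^ j:]) ^ n) x = aev q x * aev ([:- \<mu>, 1:] ^ n) x" by (metis aev_mult)
 then have "(x ^ j - sc (\<mu> ^ j) 1) ^ n = aev q x * (x - sc \<mu> 1) ^ n" by simp
 then show ?thesis using assms by (simp add: mult.assoc)
qed

text \<open>Eigenvectors are taken in the ring itself, under left multiplication. For matrices this
  gives the usual eigenvalues, since the columns of \<open>A\<close> are then eigenvectors.\<close>

definition spec :: "'r \<Rightarrow> 'k set" where
 "spec x = {\<mu>. \<exists>A. A \<noteq> 0 \<and> x * A = sc \<mu> A}"

definition gpoly :: "'k set \<Rightarrow> 'k poly" where
 "gpoly L = (\<Prod>\<mu>\<in>L. [:- \<mu>, 1:])"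

lemma spec_subset:
 assumes "finite L" "aev (gpoly L ^ n) x = 0"
 shows "spec x \<subseteq> L"
proof
 fix \<mu> assume "\<mu> \<in> spec x"
 then obtain A where A: "A \<noteq> 0" "x * A = sc \<mu> A" by (auto simp: spec_def)
 have "sc (poly (gpoly L ^ n) \<mu>) A = 0" using aev_eigen[OF A(2), of "gpoly L ^ n"] assms(2) by simp
 then have "poly (gpoly L) \<mu> = 0" using A by auto
 then have "\<exists>\<nu>\<in>L. poly [:- \<nu>, 1:] \<mu> = 0"
  unfolding gpoly_def poly_prod using assms(1) by (simp add: prod_zero_iff)
 then show "\<mu> \<in> L" by auto
qed

lemma gpoly_remove: "finite L \<Longrightarrow> \<mu> \<in> L \<Longrightarrow> gpoly L = [:- \<mu>, 1:] * gpoly (L - {\<mu>})"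
 unfolding gpoly_def by (rule prod.remove)

definition lag :: "'k set \<Rightarrow> 'k \<Rightarrow> 'k poly" where
 "lag L \<mu> = smult (\<Prod>\<nu>\<in>L - {\<mu>}. inverse (\<mu> - \<nu>)) (gpoly (L - {\<mu>}))"

lemma poly_lag:
 assumes "finite L" "\<mu> \<in> L"
 shows "poly (lag L \<mu>) \<mu> = 1"
proof -
 have "poly (lag L \<mu>) \<mu> = (\<Prod>\<nu>\<in>L - {\<mu>}. inverse (\<mu> - \<nu>) * (\<mu> - \<nu>))"
  unfolding lag_def gpoly_def by (simp add: poly_prod prod.distrib)
 also have "\<dots> = 1" by (rule prod.neutral) (auto intro!: left_inverse)
 finally show ?thesis .
qed

lemma poly_lag_other:
 assumes "finite L" "\<nu> \<in> L" "\<nu> \<noteq> \<mu>"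
 shows "poly (lag L \<mu>) \<nu> = 0"
proof -
 have "poly (gpoly (L - {\<mu>})) \<nu> = 0"
  unfolding gpoly_def poly_prod using assms by (intro prod_zero) (auto intro!: bexI[of _ \<nu>])
 then show ?thesis by (simp add: lag_def)
qed

definition idp :: "'k set \<Rightarrow> nat \<Rightarrow> 'k \<Rightarrow> 'k poly" where
 "idp L n \<mu> = 1 - (1 - lag L \<mu> ^ n) ^ n"

lemma dvd_one_minus_power: "u dvd 1 - (1 - u) ^ (n::nat)" for u :: "'k poly"
proof (induction n)
 case (Suc n)
 have "1 - (1 - u) ^ Suc n = (1 - (1 - u) ^ n) + u * (1 - u) ^ n" by (simp add: algebra_simps)
 then show ?case using Suc.IH by (metis dvd_add dvd_triv_left)
qed simp

text \<open>Since \<open>lag\<close> is 1 at \<open>\<mu>\<close> and 0 at the other roots, \<open>idp\<close> is idempotent modulo \<open>gpoly L ^ n\<close>.\<close>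
lemma idempotents:
 assumes fin: "finite L" and ann: "aev (gpoly L ^ n) y = 0"
 defines "P \<equiv> \<lambda>\<mu>. aev (idp L n \<mu>) y"
 shows "\<And>\<mu> \<nu>. \<mu> \<in> L \<Longrightarrow> \<nu> \<in> L \<Longrightarrow> \<mu> \<noteq> \<nu> \<Longrightarrow> P \<mu> * P \<nu> = 0"
  and "(\<Sum>\<mu>\<in>L. P \<mu>) = 1"
  and "\<And>\<mu>. \<mu> \<in> L \<Longrightarrow> P \<mu> * P \<mu> = P \<mu>"
  and "\<And>\<mu>. \<mu> \<in> L \<Longrightarrow> (y - sc \<mu> 1) ^ n * P \<mu> = 0"
  and "\<And>\<mu> A. A * y = y * A \<Longrightarrow> A * P \<mu> = P \<mu> * A"
proof -
 have dvdP: "lag L \<mu> ^ n dvd idp L n \<mu>" for \<mu>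
  unfolding idp_def by (rule dvd_one_minus_power)
 have gdvd: "gpoly (L - {\<mu>}) dvd lag L \<mu>" for \<mu> unfolding lag_def by (simp add: dvd_smult)
 have xdvd: "[:- \<nu>, 1:] dvd lag L \<mu>" if "\<nu> \<in> L" "\<nu> \<noteq> \<mu>" for \<mu> \<nu>
  using poly_lag_other[OF fin that] by (simp add: poly_eq_0_iff_dvd)
 show orth: "P \<mu> * P \<nu> = 0" if "\<mu> \<in> L" "\<nu> \<in> L" "\<mu> \<noteq> \<nu>" for \<mu> \<nu>
 proof -
  have "gpoly L dvd lag L \<nu> * lag L \<mu>"
   unfolding gpoly_remove[OF fin that(1)] by (rule mult_dvd_mono[OF xdvd gdvd]) (use that in auto)
  then have "gpoly L ^ n dvd idp L n \<mu> * idp L n \<nu>"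
   using mult_dvd_mono[OF dvdP[of \<mu>] dvdP[of \<nu>]]
   by (metis dvd_power_same dvd_trans mult.commute power_mult_distrib)
  from aev_dvd[OF this ann] show ?thesis by (simp add: P_def)
 qed
 have one_minus: "[:- \<mu>, 1:] ^ n dvd 1 - idp L n \<mu>" if "\<mu> \<in> L" for \<mu>
 proof -
  have "poly (1 - lag L \<mu> ^ n) \<mu> = 0" using poly_lag[OF fin that] by simp
  then have "[:- \<mu>, 1:] dvd 1 - lag L \<mu> ^ n" using poly_eq_0_iff_dvd by blast
  then show ?thesis unfolding idp_def by (simp add: dvd_power_same)
 qed
 have "aev (\<Prod>\<mu>\<in>S. 1 - idp L n \<mu>) y = 1 - (\<Sum>\<mu>\<in>S. P \<mu>)" if "S \<subseteq> L" for S
  using finite_subset[OF that fin] that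
 proof (induction S rule: finite_induct)
  case (insert \<nu> S)
  have "P \<nu> * (\<Sum>\<mu>\<in>S. P \<mu>) = 0"
   unfolding sum_distrib_left by (rule sum.neutral) (use insert orth in auto)
  moreover have "aev (\<Prod>\<mu>\<in>insert \<nu> S. 1 - idp L n \<mu>) y = (1 - P \<nu>) * (1 - (\<Sum>\<mu>\<in>S. P \<mu>))"
   using insert by (simp add: P_def)
  moreover have "(1 - P \<nu>) * (1 - u) = 1 - (P \<nu> + u) + P \<nu> * u" for u by (simp add: algebra_simps)
  ultimately show ?case using insert by simp
 qed simp
 moreover have "gpoly L ^ n dvd (\<Prod>\<mu>\<in>L. 1 - idp L n \<mu>)"
 proof -
  have "gpoly L ^ n = (\<Prod>\<mu>\<in>L. [:- \<mu>, 1:] ^ n)" unfolding gpoly_def by (rule prod_power_distrib)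
  then show ?thesis using one_minus by (simp add: prod_dvd_prod)
 qed
 ultimately show sum: "(\<Sum>\<mu>\<in>L. P \<mu>) = 1" using aev_dvd[OF _ ann] by force
 show "P \<mu> * P \<mu> = P \<mu>" if "\<mu> \<in> L" for \<mu>
 proof -
  have "P \<mu> = P \<mu> * (\<Sum>\<nu>\<in>L. P \<nu>)" by (simp add: sum)
  also have "\<dots> = (\<Sum>\<nu>\<in>L. if \<nu> = \<mu> then P \<mu> * P \<mu> else 0)"
   unfolding sum_distrib_left by (rule sum.cong) (use orth that in auto)
  also have "\<dots> = P \<mu> * P \<mu>" using fin that by simp
  finally show ?thesis by simp
 qed
 show "(y - sc \<mu> 1) ^ n * P \<mu> = 0" if "\<mu> \<in> L" for \<mu>
 proof -
  have "gpoly L dvd [:- \<mu>, 1:] * lag L \<mu>"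
   unfolding gpoly_remove[OF fin that] by (rule mult_dvd_mono[OF dvd_refl gdvd])
  then have "gpoly L ^ n dvd ([:- \<mu>, 1:] * lag L \<mu>) ^ n" by (rule dvd_power_same)
  also have "([:- \<mu>, 1:] * lag L \<mu>) ^ n = [:- \<mu>, 1:] ^ n * lag L \<mu> ^ n" by (rule power_mult_distrib)
  also have "\<dots> dvd [:- \<mu>, 1:] ^ n * idp L n \<mu>" by (rule mult_dvd_mono[OF dvd_refl dvdP])
  finally have "gpoly L ^ n dvd [:- \<mu>, 1:] ^ n * idp L n \<mu>" .
  from aev_dvd[OF this ann] show ?thesis by (simp add: P_def)
 qed
 show "A * P \<mu> = P \<mu> * A" if "A * y = y * A" for \<mu> A
  unfolding P_def by (rule aev_commute[OF that])
qed

end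

text \<open>\<open>R\<close> is a subalgebra of a possibly much larger ring. Finite dimension over
  an algebraically closed field enters through \<open>annihilator\<close>, where one number
  \<open>d\<close> bounds both the number of eigenvalues and the nilpotency exponent.\<close>

locale fd_algebra = K_algebra sc for sc :: "'k::field \<Rightarrow> 'r::ring_1 \<Rightarrow> 'r" +
 fixes R :: "'r set" and d :: nat
 assumes R_one: "1 \<in> R" and R_add: "x \<in> R \<Longrightarrow> y \<in> R \<Longrightarrow> x + y \<in> R"
  and R_mult: "x \<in> R \<Longrightarrow> y \<in> R \<Longrightarrow> x * y \<in> R" and R_sc: "x \<in> R \<Longrightarrow> sc c x \<in> R"
  and d_pos: "d > 0"
  and annihilator: "x \<in> R \<Longrightarrow> \<exists>L. finite L \<and> card L \<le> d \<and> aev (gpoly L ^ d) x = 0"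
begin

lemma R_zero: "0 \<in> R" using R_sc[OF R_one, of 0] by simp

lemma R_aev: "x \<in> R \<Longrightarrow> aev p x \<in> R"
 by (induction p) (auto intro: R_zero R_add R_mult R_sc R_one)

lemma R_power: "x \<in> R \<Longrightarrow> x ^ n \<in> R"
 by (induction n) (auto intro: R_one R_mult)

lemma R_sum: "(\<And>i. i \<in> I \<Longrightarrow> f i \<in> R) \<Longrightarrow> (\<Sum>i\<in>I. f i) \<in> R"
 by (induction I rule: infinite_finite_induct) (auto intro: R_zero R_add)

text \<open>A root in \<open>L\<close> that is not an eigenvalue can be removed: if the product of
  the remaining factors were nonzero, a power of \<open>x - \<mu>\<close> would kill it, and
  \<open>generalised_eigenvector\<close> would exhibit an eigenvector for
  \<open>\<mu>\<close>.\<close>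

lemma spec_annihilates:
 assumes x: "x \<in> R"
 shows "finite (spec x)" "card (spec x) \<le> d" "aev (gpoly (spec x) ^ d) x = 0"
proof -
 obtain L where L: "finite L" "card L \<le> d" "aev (gpoly L ^ d) x = 0" using annihilator[OF x] by blast
 have sL: "spec x \<subseteq> L" by (rule spec_subset[OF L(1,3)])
 then show "finite (spec x)" "card (spec x) \<le> d"
  using L finite_subset card_mono[OF L(1) sL] by auto
 have "aev (gpoly (L - S) ^ d) x = 0" if "S \<subseteq> L" "S \<inter> spec x = {}" for S
  using finite_subset[OF that(1) L(1)] that
 proof (induction S rule: finite_induct)
  case (insert \<mu> S)
  have \<mu>: "\<mu> \<in> L - S" "\<mu> \<notin> spec x" using insert by auto
  define B where "B = aev (gpoly (L - S - {\<mu>}) ^ d) x"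
  have "gpoly (L - S) ^ d = [:- \<mu>, 1:] ^ d * gpoly (L - S - {\<mu>}) ^ d"
   using gpoly_remove[of "L - S" \<mu>] L(1) \<mu>(1) by (simp only: finite_Diff power_mult_distrib)
  moreover have "aev (gpoly (L - S) ^ d) x = 0" using insert by blast
  ultimately have "aev ([:- \<mu>, 1:] ^ d) x * B = 0" unfolding B_def by (simp only: aev_mult)
  then have "(x - sc \<mu> 1) ^ d * B = 0" by simp
  then have "B = 0"
   using generalised_eigenvector[of x \<mu> d B] \<mu>(2) unfolding spec_def by blast
  then have "aev (gpoly (L - S - {\<mu>}) ^ d) x = 0" unfolding B_def .
  moreover have "L - insert \<mu> S = L - S - {\<mu>}" by (rule Diff_insert)
  ultimately show ?case by (simp only:)
 next
  case empty
  show ?case using L(3) by (simp only: Diff_empty)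
 qed
 from this[of "L - spec x"] show "aev (gpoly (spec x) ^ d) x = 0"
  using sL by (simp add: double_diff Diff_disjoint Int_commute)
qed

definition proj :: "'r \<Rightarrow> 'k \<Rightarrow> 'r" where
 "proj y \<mu> = aev (idp (spec y) d \<mu>) y"

lemma proj_facts:
 assumes y: "y \<in> R"
 shows "\<And>\<mu> \<nu>. \<mu> \<in> spec y \<Longrightarrow> \<nu> \<in> spec y \<Longrightarrow> \<mu> \<noteq> \<nu> \<Longrightarrow> proj y \<mu> * proj y \<nu> = 0"
  and "(\<Sum>\<mu>\<in>spec y. proj y \<mu>) = 1"
  and "\<And>\<mu>. \<mu> \<in> spec y \<Longrightarrow> proj y \<mu> * proj y \<mu> = proj y \<mu>"
  and "\<And>\<mu>. \<mu> \<in> spec y \<Longrightarrow> (y - sc \<mu> 1) ^ d * proj y \<mu> = 0"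
  and "\<And>\<mu> A. A * y = y * A \<Longrightarrow> A * proj y \<mu> = proj y \<mu> * A"
  and "\<And>\<mu>. proj y \<mu> \<in> R"
 unfolding proj_def
 by (fact idempotents[OF spec_annihilates(1,3)[OF y]] R_aev[OF y])+

lemma proj_eigen:
 assumes y: "y \<in> R" and A: "y * A = sc \<mu> A" and \<mu>: "\<mu> \<in> spec y"
 shows "proj y \<mu> * A = A"
proof -
 have "proj y \<nu> * A = 0" if \<nu>: "\<nu> \<in> spec y" "\<nu> \<noteq> \<mu>" for \<nu>
 proof -
  have "poly (idp (spec y) d \<nu>) \<mu> = 0"
   using poly_lag_other[OF spec_annihilates(1)[OF y] \<mu>, of \<nu>] \<nu>(2) \<mu>
   by (simp add: idp_def zero_power[OF d_pos])
  then show ?thesis unfolding proj_def using aev_eigen[OF A] by simp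
 qed
 then have "(\<Sum>\<nu>\<in>spec y. proj y \<nu> * A) = proj y \<mu> * A"
  using spec_annihilates(1)[OF y] \<mu> by (subst sum.remove[of _ \<mu>]) (auto intro!: sum.neutral)
 then show ?thesis using proj_facts(2)[OF y] by (simp add: sum_distrib_right[symmetric])
qed

lemma proj_nonzero:
 assumes y: "y \<in> R" and \<mu>: "\<mu> \<in> spec y"
 shows "proj y \<mu> \<noteq> 0"
proof -
 obtain A where A: "A \<noteq> 0" "y * A = sc \<mu> A" using \<mu> by (auto simp: spec_def)
 then show ?thesis using proj_eigen[OF y A(2) \<mu>] by auto
qed

lemma proj_decomp: "y \<in> R \<Longrightarrow> A = (\<Sum>\<mu>\<in>spec y. proj y \<mu> * A)"
 using proj_facts(2)[of y] by (simp add: sum_distrib_right[symmetric])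

lemma proj_decomp_ex:
 assumes "y \<in> R" "A \<noteq> 0"
 obtains \<mu> where "\<mu> \<in> spec y" "proj y \<mu> * A \<noteq> 0"
 using proj_decomp[OF assms(1), of A] assms(2) by (metis (no_types, lifting) sum.neutral)

text \<open>For another eigenvalue \<open>\<mu>\<close>, the component
  \<open>proj y \<mu> * A\<close> is killed by powers of both \<open>y^j - c^j\<close> and
  \<open>y^j - \<mu>^j\<close>, which are coprime because \<open>j\<close>-th powers separate the
  spectrum. So a block of \<open>y\<close> can be recognised from \<open>y^j\<close> alone.\<close>

lemma proj_generalised:
 assumes y: "y \<in> R" and A: "(y ^ j - sc (c ^ j) 1) ^ n * A = 0" and c: "c \<in> spec y"
  and inj: "inj_on (\<lambda>\<mu>. \<mu> ^ j) (spec y)"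
 shows "proj y c * A = A"
proof -
 have "proj y \<mu> * A = 0" if \<mu>: "\<mu> \<in> spec y" "\<mu> \<noteq> c" for \<mu>
 proof (rule coprime_shifts)
  show "c ^ j \<noteq> \<mu> ^ j" using inj c \<mu> by (auto dest: inj_onD)
  have "proj y \<mu> * (y ^ j - sc (c ^ j) 1) ^ n = (y ^ j - sc (c ^ j) 1) ^ n * proj y \<mu>"
  proof -
   have "proj y \<mu> * aev (([:0, 1:] ^ j - [:c ^ j:]) ^ n) y = aev (([:0, 1:] ^ j - [:c ^ j:]) ^ n) y * proj y \<mu>"
    unfolding proj_def by (rule aev_commute_aev)
   then show ?thesis by simp
  qed
  then have "(y ^ j - sc (c ^ j) 1) ^ n * (proj y \<mu> * A) = proj y \<mu> * ((y ^ j - sc (c ^ j) 1) ^ n * A)"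
   by (simp add: mult.assoc[symmetric])
  then show "(y ^ j - sc (c ^ j) 1) ^ n * (proj y \<mu> * A) = 0" using A by simp
  show "(y ^ j - sc (\<mu> ^ j) 1) ^ d * (proj y \<mu> * A) = 0"
   by (rule power_shift_kills) (use proj_facts(4)[OF y \<mu>(1)] in \<open>simp add: mult.assoc[symmetric]\<close>)
 qed
 then have "(\<Sum>\<nu>\<in>spec y. proj y \<nu> * A) = proj y c * A"
  using spec_annihilates(1)[OF y] c by (subst sum.remove[of _ c]) (auto intro!: sum.neutral)
 then show ?thesis using proj_facts(2)[OF y] by (simp add: sum_distrib_right[symmetric])
qed

lemma spec_power:
 assumes x: "x \<in> R"
 shows "spec (x ^ j) = (\<lambda>\<mu>. \<mu> ^ j) ` spec x"
proof
 show "(\<lambda>\<mu>. \<mu> ^ j) ` spec x \<subseteq> spec (x ^ j)"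
  using eigen_power by (auto simp: spec_def)
 show "spec (x ^ j) \<subseteq> (\<lambda>\<mu>. \<mu> ^ j) ` spec x"
 proof
  fix \<kappa> assume "\<kappa> \<in> spec (x ^ j)"
  then obtain A where A: "A \<noteq> 0" "x ^ j * A = sc \<kappa> A" by (auto simp: spec_def)
  obtain \<mu> where \<mu>: "\<mu> \<in> spec x" "proj x \<mu> * A \<noteq> 0" using proj_decomp_ex[OF x A(1)] by blast
  let ?B = "proj x \<mu> * A"
  have "x ^ j * ?B = proj x \<mu> * (x ^ j * A)"
   using proj_facts(5)[OF x power_commutes, of j \<mu>] by (metis mult.assoc)
  then have B: "x ^ j * ?B = sc \<kappa> ?B" using A by simp
  have "(x ^ j - sc (\<mu> ^ j) 1) ^ d * ?B = 0"
   by (rule power_shift_kills) (use proj_facts(4)[OF x \<mu>(1)] in \<open>simp add: mult.assoc[symmetric]\<close>)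
  then have "(\<kappa> - \<mu> ^ j) ^ d = 0" using shift_eigen[OF B, of "\<mu> ^ j" d] \<mu>(2) by simp
  then show "\<kappa> \<in> (\<lambda>\<mu>. \<mu> ^ j) ` spec x" using \<mu>(1) by auto
 qed
qed

end


subsection \<open>Exponential polynomials\<close>

text \<open>The exponential variable \<open>n\<close> and the polynomial variable
  \<open>\<tau>\<close> are decoupled. In characteristic 0 vanishing on the diagonal
  \<open>n = \<tau>\<close> determines the coefficients, so it implies vanishing at
  \<open>\<tau> = 0\<close>, where only the semisimple part is left.\<close>

definition EP :: "(nat \<Rightarrow> nat \<Rightarrow> 'k::field) \<Rightarrow> bool" where
 "EP f \<longleftrightarrow> (\<exists>C P. finite C \<and> 0 \<notin> C \<and> (\<forall>n \<tau>. f n \<tau> = (\<Sum>c\<in>C. c ^ n * poly (P c) (of_nat \<tau>))))"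

lemma EP_const: "EP (\<lambda>n \<tau>. a)"
 unfolding EP_def by (rule exI[of _ "{1}"], rule exI[of _ "\<lambda>_. [:a:]"]) auto

lemma EP_exp: "c \<noteq> 0 \<Longrightarrow> EP (\<lambda>n \<tau>. c ^ n)"
 unfolding EP_def by (rule exI[of _ "{c}"], rule exI[of _ "\<lambda>_. 1"]) auto

lemma EP_var: "EP (\<lambda>n \<tau>. of_nat \<tau>)"
 unfolding EP_def by (rule exI[of _ "{1}"], rule exI[of _ "\<lambda>_. [:0, 1:]"]) auto

lemma EP_add:
 assumes "EP f" "EP g"
 shows "EP (\<lambda>n \<tau>. f n \<tau> + g n \<tau>)"
proof -
 obtain C P where f: "finite C" "0 \<notin> C" "\<And>n \<tau>. f n \<tau> = (\<Sum>c\<in>C. c ^ n * poly (P c) (of_nat \<tau>))"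
  using assms(1) by (auto simp: EP_def)
 obtain D Q where g: "finite D" "0 \<notin> D" "\<And>n \<tau>. g n \<tau> = (\<Sum>c\<in>D. c ^ n * poly (Q c) (of_nat \<tau>))"
  using assms(2) by (auto simp: EP_def)
 define S where "S c = (if c \<in> C then P c else 0) + (if c \<in> D then Q c else 0)" for c
 have "f n \<tau> + g n \<tau> = (\<Sum>c\<in>C \<union> D. c ^ n * poly (S c) (of_nat \<tau>))" for n \<tau>
 proof -
  have "f n \<tau> = (\<Sum>c\<in>C \<union> D. c ^ n * poly (if c \<in> C then P c else 0) (of_nat \<tau>))"
   unfolding f(3) by (rule sum.mono_neutral_cong_left) (use f g in auto)
  moreover have "g n \<tau> = (\<Sum>c\<in>C \<union> D. c ^ n * poly (if c \<in> D then Q c else 0) (of_nat \<tau>))"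
   unfolding g(3) by (rule sum.mono_neutral_cong_left) (use f g in auto)
  ultimately show ?thesis by (simp add: S_def sum.distrib[symmetric] distrib_left)
 qed
 then show ?thesis unfolding EP_def using f g by (intro exI[of _ "C \<union> D"] exI[of _ S]) auto
qed

lemma EP_sum: "finite I \<Longrightarrow> (\<And>i. i \<in> I \<Longrightarrow> EP (f i)) \<Longrightarrow> EP (\<lambda>n \<tau>. \<Sum>i\<in>I. f i n \<tau>)"
proof (induction I rule: finite_induct)
 case empty
 show ?case using EP_const[of 0] by simp
next
 case (insert i I)
 then show ?case using EP_add[of "f i" "\<lambda>n \<tau>. \<Sum>i\<in>I. f i n \<tau>"] by simp
qed

lemma EP_monomial_mult:
 assumes "EP f" "c0 \<noteq> 0"
 shows "EP (\<lambda>n \<tau>. c0 ^ n * poly p (of_nat \<tau>) * f n \<tau>)"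
proof -
 obtain C P where f: "finite C" "0 \<notin> C" "\<And>n \<tau>. f n \<tau> = (\<Sum>c\<in>C. c ^ n * poly (P c) (of_nat \<tau>))"
  using assms(1) by (auto simp: EP_def)
 have inj: "inj_on (\<lambda>c. c0 * c) C" using assms(2) by (auto simp: inj_on_def)
 have "c0 ^ n * poly p (of_nat \<tau>) * f n \<tau>
  = (\<Sum>c\<in>(\<lambda>c. c0 * c) ` C. c ^ n * poly (p * P (c / c0)) (of_nat \<tau>))" for n \<tau>
  unfolding f(3) sum.reindex[OF inj] sum_distrib_left
  by (rule sum.cong) (use assms(2) in \<open>auto simp: power_mult_distrib field_simps\<close>)
 then show ?thesis unfolding EP_def using f assms(2)
  by (intro exI[of _ "(\<lambda>c. c0 * c) ` C"] exI[of _ "\<lambda>c. p * P (c / c0)"]) auto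
qed

lemma EP_mult:
 assumes "EP f" "EP g"
 shows "EP (\<lambda>n \<tau>. f n \<tau> * g n \<tau>)"
proof -
 obtain C P where f: "finite C" "0 \<notin> C" "\<And>n \<tau>. f n \<tau> = (\<Sum>c\<in>C. c ^ n * poly (P c) (of_nat \<tau>))"
  using assms(1) by (auto simp: EP_def)
 have "EP (\<lambda>n \<tau>. \<Sum>c\<in>C. c ^ n * poly (P c) (of_nat \<tau>) * g n \<tau>)"
  by (rule EP_sum[OF f(1)], rule EP_monomial_mult[OF assms(2)]) (use f(2) in auto)
 then show ?thesis by (simp add: f(3) sum_distrib_right)
qed

lemma EP_prod: "finite I \<Longrightarrow> (\<And>i. i \<in> I \<Longrightarrow> EP (f i)) \<Longrightarrow> EP (\<lambda>n \<tau>. \<Prod>i\<in>I. f i n \<tau>)"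
proof (induction I rule: finite_induct)
 case empty
 show ?case using EP_const[of 1] by simp
next
 case (insert i I)
 then show ?case using EP_mult[of "f i" "\<lambda>n \<tau>. \<Prod>i\<in>I. f i n \<tau>"] by simp
qed

lemma of_nat_inj_char_0:
 assumes "CHAR('k::field) = 0" "of_nat a = (of_nat b :: 'k)"
 shows "a = b"
proof -
 have *: "a = b" if "a \<le> b" "of_nat a = (of_nat b :: 'k)" for a b
 proof -
  have "of_nat (b - a) = (0::'k)" using that by (simp add: of_nat_diff)
  then have "CHAR('k) dvd b - a" using of_nat_eq_0_iff_char_dvd[where ?'a = 'k] by blast
  then show ?thesis using assms(1) that(1) by simp
 qed
 show ?thesis using *[of a b] *[of b a] assms(2) by (metis le_cases)
qed

text \<open>Passing from \<open>f n\<close> to \<open>f (n + 1) - c0 * f n\<close> lowers the degree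
  of the coefficient at \<open>c0\<close>, or kills it, and raises no other degree, so all the new
  coefficients vanish by induction. Then every \<open>P c\<close> with \<open>c \<noteq> c0\<close>
  is 0, and \<open>P c0\<close> is invariant under the shift by 1, hence constant in characteristic
  0; the value at \<open>n = 0\<close> shows that the constant is 0.\<close>

lemma exp_poly_independent:
 fixes C :: "'k::field set" and P :: "'k \<Rightarrow> 'k poly"
 assumes char: "CHAR('k) = 0" and C: "finite C" "0 \<notin> C"
  and zero: "\<And>n. (\<Sum>c\<in>C. c ^ n * poly (P c) (of_nat n)) = 0"
 shows "\<forall>c\<in>C. P c = 0"
 using zero
proof (induction "\<Sum>c\<in>C. if P c = 0 then 0 else Suc (degree (P c))" arbitrary: P rule: less_induct)
 case less
 show ?case
 proof (rule ccontr)
  assume "\<not> (\<forall>c\<in>C. P c = 0)"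
  then obtain c0 where c0: "c0 \<in> C" "P c0 \<noteq> 0" by auto
  have c00: "c0 \<noteq> 0" using c0 C by auto
  define Q where "Q c = smult c (pcompose (P c) [:1, 1:]) - smult c0 (P c)" for c
  let ?s = "\<lambda>p :: 'k poly. if p = 0 then 0 else Suc (degree p)"
  have zeroQ: "(\<Sum>c\<in>C. c ^ n * poly (Q c) (of_nat n)) = 0" for n
  proof -
   have "(\<Sum>c\<in>C. c ^ n * poly (Q c) (of_nat n))
    = (\<Sum>c\<in>C. c ^ Suc n * poly (P c) (of_nat (Suc n))) - c0 * (\<Sum>c\<in>C. c ^ n * poly (P c) (of_nat n))"
    unfolding sum_distrib_left sum_subtractf[symmetric]
    by (rule sum.cong) (auto simp: Q_def poly_pcompose algebra_simps)
   then show ?thesis using less.prems[of n] less.prems[of "Suc n"] by simp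
  qed
  have le: "?s (Q c) \<le> ?s (P c)" for c
  proof (cases "P c = 0")
   case False
   have "degree (Q c) \<le> degree (P c)" unfolding Q_def
    by (rule degree_diff_le) (auto intro: order.trans[OF degree_smult_le] simp: degree_pcompose)
   then show ?thesis using False by simp
  qed (simp add: Q_def)
  have coeffQ: "coeff (Q c) (degree (P c)) = (c - c0) * lead_coeff (P c)" for c
  proof -
   have "coeff (pcompose (P c) [:1, 1:]) (degree (P c)) = lead_coeff (P c)"
    using lead_coeff_comp[of "[:1, 1:]" "P c"] by (simp add: degree_pcompose)
   then show ?thesis by (simp add: Q_def algebra_simps)
  qed
  have "?s (Q c0) < ?s (P c0)"
  proof (cases "Q c0 = 0")
   case False
   have "coeff (Q c0) (degree (P c0)) = 0" using coeffQ[of c0] by simp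
   then have "degree (Q c0) \<noteq> degree (P c0)" using False by (metis leading_coeff_0_iff)
   then show ?thesis using le[of c0] False c0 by simp
  qed (use c0 in simp)
  then have strict: "(\<Sum>c\<in>C. ?s (Q c)) < (\<Sum>c\<in>C. ?s (P c))"
   by (intro sum_strict_mono_ex1[OF C(1)]) (use le c0 in auto)
  have Q0: "\<forall>c\<in>C. Q c = 0" by (rule less.hyps[OF strict zeroQ])
  have others: "P c = 0" if "c \<in> C" "c \<noteq> c0" for c
  proof -
   have "(c - c0) * lead_coeff (P c) = 0" using Q0 that coeffQ[of c] by simp
   then show ?thesis using that by simp
  qed
  define p where "p = P c0"
  have shift: "poly p (x + 1) = poly p x" for x
  proof -
   have "smult c0 (pcompose p [:1, 1:]) = smult c0 p" using Q0 c0 by (simp add: Q_def p_def)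
   then have "smult (inverse c0) (smult c0 (pcompose p [:1, 1:])) = smult (inverse c0) (smult c0 p)" by simp
   then have "pcompose p [:1, 1:] = p" using c00 by simp
   then have "poly (pcompose p [:1, 1:]) x = poly p x" by simp
   then show ?thesis by (simp add: poly_pcompose add.commute)
  qed
  have pn: "poly p (of_nat n) = poly p 0" for n
  proof (induction n)
   case (Suc n)
   then show ?case using shift[of "of_nat n"] by (simp add: add.commute)
  qed simp
  have "range (of_nat :: nat \<Rightarrow> 'k) \<subseteq> {x. poly (p - [:poly p 0:]) x = 0}" using pn by auto
  moreover have "infinite (range (of_nat :: nat \<Rightarrow> 'k))"
   using of_nat_inj_char_0[OF char] by (intro range_inj_infinite injI)
  ultimately have "p - [:poly p 0:] = 0" using poly_roots_finite finite_subset by blast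
  then have pc: "p = [:poly p 0:]" by simp
  have "(\<Sum>c\<in>C. c ^ 0 * poly (P c) (of_nat 0)) = poly p 0"
   using c0 C(1) others by (subst sum.remove[of _ c0]) (auto simp: p_def intro!: sum.neutral)
  then have "poly p 0 = 0" using less.prems[of 0] by simp
  then show False using pc c0 by (simp add: p_def)
 qed
qed

lemma EP_diagonal_zero:
 assumes "CHAR('k::field) = 0" "EP f" "\<And>n. f n n = (0::'k)"
 shows "f n \<tau> = 0"
proof -
 obtain C P where f: "finite C" "0 \<notin> C" "\<And>n \<tau>. f n \<tau> = (\<Sum>c\<in>C. c ^ n * poly (P c) (of_nat \<tau>))"
  using assms(2) by (auto simp: EP_def)
 have "\<forall>c\<in>C. P c = 0"
  by (rule exp_poly_independent[OF assms(1) f(1,2)]) (use assms(3) f(3) in metis)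
 then show ?thesis unfolding f(3) by (simp add: sum.neutral)
qed

lemma EP_choose:
 assumes char: "CHAR('k::field) = 0"
 shows "EP (\<lambda>n \<tau>. of_nat (\<tau> choose k) :: 'k)"
proof (induction k)
 case 0
 show ?case using EP_const[of 1] by simp
next
 case (Suc k)
 have nz: "(of_nat (Suc k) :: 'k) \<noteq> 0" using of_nat_inj_char_0[OF char, of "Suc k" 0] by auto
 have "(of_nat (\<tau> choose Suc k) :: 'k) = inverse (of_nat (Suc k)) * ((of_nat \<tau> + - of_nat k) * of_nat (\<tau> choose k))" for \<tau>
 proof -
  have "(of_nat (Suc k) :: 'k) * of_nat (\<tau> choose Suc k) = (of_nat \<tau> - of_nat k) * of_nat (\<tau> choose k)"
  proof (cases "k \<le> \<tau>")
   case True
   have "Suc k * (\<tau> choose Suc k) = (\<tau> - k) * (\<tau> choose k)" using True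
    by (metis binomial_absorb_comp binomial_absorption mult.commute)
   then have "(of_nat (Suc k * (\<tau> choose Suc k)) :: 'k) = of_nat ((\<tau> - k) * (\<tau> choose k))" by simp
   then show ?thesis using True by (simp only: of_nat_mult of_nat_diff)
  qed (simp add: binomial_eq_0)
  then show ?thesis using nz by (simp add: field_simps)
 qed
 moreover have "EP (\<lambda>n \<tau>. inverse (of_nat (Suc k)) * ((of_nat \<tau> + - of_nat k) * of_nat (\<tau> choose k)) :: 'k)"
  by (intro EP_mult EP_add EP_const EP_var Suc)
 ultimately show ?case by simp
qed

lemma EP_det:
 assumes "\<And>i j. i < m \<Longrightarrow> j < m \<Longrightarrow> EP (\<lambda>n \<tau>. a n \<tau> i j)"
 shows "EP (\<lambda>n \<tau>. det (mat m m (\<lambda>(i, j). a n \<tau> i j)))"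
proof -
 have "EP (\<lambda>n \<tau>. \<Sum>p | p permutes {0..<m}. signof p * (\<Prod>i = 0..<m. a n \<tau> i (p i)))"
 proof (rule EP_sum)
  fix p assume "p \<in> {p. p permutes {0..<m}}"
  then have "p i < m" if "i < m" for i using that permutes_in_image by fastforce
  then show "EP (\<lambda>n \<tau>. signof p * (\<Prod>i = 0..<m. a n \<tau> i (p i)))"
   using assms by (intro EP_mult EP_const EP_prod) auto
 qed (simp add: finite_permutations)
 moreover have "det (mat m m (\<lambda>(i, j). a n \<tau> i j)) = (\<Sum>p | p permutes {0..<m}. signof p * (\<Prod>i = 0..<m. a n \<tau> i (p i)))" for n \<tau>
  unfolding det_def
  by (auto intro!: sum.cong prod.cong simp: permutes_in_image)
 ultimately show ?thesis by simp
qed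

section \<open>Exponential polynomials with values in an algebra\<close>

context K_algebra
begin

inductive EPR :: "(nat \<Rightarrow> nat \<Rightarrow> 'r) \<Rightarrow> bool" where
 const: "EPR (\<lambda>n \<tau>. A)"
| scale: "EP f \<Longrightarrow> EPR Z \<Longrightarrow> EPR (\<lambda>n \<tau>. sc (f n \<tau>) (Z n \<tau>))"
| add: "EPR Z \<Longrightarrow> EPR Z' \<Longrightarrow> EPR (\<lambda>n \<tau>. Z n \<tau> + Z' n \<tau>)"

lemma EPR_mult:
 assumes "EPR Z" "EPR Z'"
 shows "EPR (\<lambda>n \<tau>. Z n \<tau> * Z' n \<tau>)"
 using assms(1)
proof (induction rule: EPR.induct)
 case (const A)
 show ?case using assms(2)
 proof (induction rule: EPR.induct)
  case (const B)
  show ?case by (rule EPR.const)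
 next
  case (scale f Z)
  then show ?case using EPR.scale[of f "\<lambda>n \<tau>. A * Z n \<tau>"] by simp
 next
  case (add Z Z')
  then show ?case using EPR.add[of "\<lambda>n \<tau>. A * Z n \<tau>" "\<lambda>n \<tau>. A * Z' n \<tau>"] by (simp add: distrib_left)
 qed
next
 case (scale f Z)
 then show ?case using EPR.scale[of f "\<lambda>n \<tau>. Z n \<tau> * Z' n \<tau>"] by simp
next
 case (add Z W)
 then show ?case using EPR.add[of "\<lambda>n \<tau>. Z n \<tau> * Z' n \<tau>" "\<lambda>n \<tau>. W n \<tau> * Z' n \<tau>"] by (simp add: distrib_right)
qed

lemma EPR_sum: "finite I \<Longrightarrow> (\<And>i. i \<in> I \<Longrightarrow> EPR (f i)) \<Longrightarrow> EPR (\<lambda>n \<tau>. \<Sum>i\<in>I. f i n \<tau>)"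
proof (induction I rule: finite_induct)
 case empty
 show ?case using EPR.const[of 0] by simp
next
 case (insert i I)
 then show ?case using EPR.add[of "f i" "\<lambda>n \<tau>. \<Sum>i\<in>I. f i n \<tau>"] by simp
qed

lemma EPR_power: "EPR Z \<Longrightarrow> EPR (\<lambda>n \<tau>. Z n \<tau> ^ e)"
 by (induction e) (auto intro: EPR.const EPR_mult)

lemma EPR_aev: "EPR Z \<Longrightarrow> EPR (\<lambda>n \<tau>. aev p (Z n \<tau>))"
 by (induction p) (auto intro: EPR.const EPR_mult EPR.add)

lemma EPR_functional:
 assumes "EPR Z" "\<And>x y. l (x + y) = l x + l y" "\<And>c x. l (sc c x) = c * l x"
 shows "EP (\<lambda>n \<tau>. l (Z n \<tau>))"
 using assms(1) by (induction rule: EPR.induct) (auto simp: assms(2,3) intro: EP_const EP_mult EP_add)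

end

subsection \<open>The number of eigenvalues is lower semicontinuous\<close>

text \<open>The two properties of the trace on nilpotents and idempotents are what makes a Gram
  determinant detect the number of distinct eigenvalues.\<close>

locale traced_algebra = fd_algebra sc R d
 for sc :: "'k::field \<Rightarrow> 'r::ring_1 \<Rightarrow> 'r" and R d +
 fixes tr :: "'r \<Rightarrow> 'k"
 assumes tr_add: "tr (x + y) = tr x + tr y" and tr_sc: "tr (sc c x) = c * tr x"
  and tr_nilpotent: "x \<in> R \<Longrightarrow> x ^ n = 0 \<Longrightarrow> tr x = 0"
  and tr_idempotent: "\<lbrakk>CHAR('k) = 0; x \<in> R; x * x = x; x \<noteq> 0\<rbrakk> \<Longrightarrow> tr x \<noteq> 0"
begin

lemma tr_0: "tr 0 = 0"
 using tr_sc[of 0 0] by simp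

lemma tr_sum: "tr (\<Sum>i\<in>I. f i) = (\<Sum>i\<in>I. tr (f i))"
 by (induction I rule: infinite_finite_induct) (auto simp: tr_0 tr_add)

text \<open>On the block of \<open>\<mu>\<close> the element \<open>f(z) - f(\<mu>)\<close> is
  nilpotent, so it contributes nothing to the trace.\<close>

lemma tr_aev:
 assumes z: "z \<in> R"
 shows "tr (aev f z) = (\<Sum>\<mu>\<in>spec z. poly f \<mu> * tr (proj z \<mu>))"
proof -
 have "tr (aev f z * proj z \<mu>) = poly f \<mu> * tr (proj z \<mu>)" if \<mu>: "\<mu> \<in> spec z" for \<mu>
 proof -
  have "[:- \<mu>, 1:] dvd f - [:poly f \<mu>:]" by (simp add: poly_eq_0_iff_dvd[symmetric])
  then obtain q where q: "f - [:poly f \<mu>:] = [:- \<mu>, 1:] * q" by (rule dvdE)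
  define n where "n = [:- \<mu>, 1:] * q * idp (spec z) d \<mu>"
  have "aev (n ^ d) z = aev (q ^ d) z * (aev ([:- \<mu>, 1:] ^ d) z * aev (idp (spec z) d \<mu> ^ d) z)"
   unfolding aev_mult[symmetric] n_def by (simp only: power_mult_distrib mult_ac)
  also have "aev (idp (spec z) d \<mu> ^ d) z = proj z \<mu> * proj z \<mu> ^ (d - 1)"
   unfolding aev_power proj_def[symmetric] using d_pos by (simp add: power_eq_if)
  also have "aev ([:- \<mu>, 1:] ^ d) z * (proj z \<mu> * proj z \<mu> ^ (d - 1)) = 0"
   using proj_facts(4)[OF z \<mu>] by (simp add: mult.assoc[symmetric])
  finally have "tr (aev n z) = 0"
   using tr_nilpotent[OF R_aev[OF z], of n d] by simp
  moreover have "aev n z = aev f z * proj z \<mu> + sc (- poly f \<mu>) (proj z \<mu>)"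
   unfolding n_def q[symmetric] by (simp add: proj_def algebra_simps)
  ultimately show ?thesis by (simp add: tr_add tr_sc del: sc_minus_left)
 qed
 moreover have "aev f z = (\<Sum>\<mu>\<in>spec z. aev f z * proj z \<mu>)"
  using proj_facts(2)[OF z] by (simp add: sum_distrib_left[symmetric])
 ultimately show ?thesis by (metis (no_types, lifting) sum.cong tr_sum)
qed

text \<open>By \<open>tr_aev\<close> the matrix factors through the spectrum, which has fewer than
  \<open>s + 1\<close> points. Both factors are padded by zeros to square size, and the last row of
  \<open>B\<close> is zero.\<close>

lemma gram_det_zero:
 assumes z: "z \<in> R" and s: "card (spec z) \<le> s"
 shows "det (mat (Suc s) (Suc s) (\<lambda>(i, j). tr (aev (f i * f j) z))) = 0"
proof -
 obtain g where g: "bij_betw g {..<card (spec z)} (spec z)"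
  using ex_bij_betw_nat_finite[OF spec_annihilates(1)[OF z]] by (auto simp: atLeast0LessThan)
 let ?r = "card (spec z)"
 let ?n = "Suc s"
 define A where "A = mat ?n ?n (\<lambda>(i, k). if k < ?r then poly (f i) (g k) * tr (proj z (g k)) else 0)"
 define B where "B = mat ?n ?n (\<lambda>(k, j). if k < ?r then poly (f j) (g k) else 0)"
 have M: "mat ?n ?n (\<lambda>(i, j). tr (aev (f i * f j) z)) = A * B"
 proof (rule eq_matI)
  fix i j assume "i < dim_row (A * B)" "j < dim_col (A * B)"
  then have ij: "i < ?n" "j < ?n" by (auto simp: A_def B_def)
  have "(A * B) $$ (i, j) = (\<Sum>k\<in>{0..<?n}. if k < ?r then poly (f i) (g k) * tr (proj z (g k)) * poly (f j) (g k) else 0)"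
   using ij by (simp add: A_def B_def scalar_prod_def if_distrib cong: if_cong)
  also have "\<dots> = (\<Sum>k\<in>{..<?r}. poly (f i) (g k) * tr (proj z (g k)) * poly (f j) (g k))"
   by (rule sum.mono_neutral_cong_right) (use s in auto)
  also have "\<dots> = (\<Sum>\<mu>\<in>spec z. poly (f i) \<mu> * tr (proj z \<mu>) * poly (f j) \<mu>)"
   by (rule sum.reindex_bij_betw[OF g])
  also have "\<dots> = tr (aev (f i * f j) z)" unfolding tr_aev[OF z] by (simp add: mult_ac)
  finally show "mat ?n ?n (\<lambda>(i, j). tr (aev (f i * f j) z)) $$ (i, j) = (A * B) $$ (i, j)" using ij by simp
 qed (auto simp: A_def B_def)
 have "det B = 0"
 proof -
  have "B $$ (s, j) = 0" if "j < ?n" for j using that s by (simp add: B_def)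
  then have "(\<Prod>i = 0..<?n. B $$ (i, p i)) = 0" if "p permutes {0..<?n}" for p
   using that by (intro prod_zero) (auto intro!: bexI[of _ s] simp: permutes_in_image)
  then show ?thesis unfolding det_def by (auto simp: B_def intro!: sum.neutral)
 qed
 then show ?thesis unfolding M by (subst det_mult[of _ ?n]) (auto simp: A_def B_def)
qed

text \<open>For the test polynomials that evaluate to the spectral idempotents at the chosen
  eigenvalues, the Gram matrix is diagonal, with traces of nonzero idempotents on the
  diagonal.\<close>

lemma gram_det_nonzero:
 assumes char: "CHAR('k) = 0" and z: "z \<in> R" and g: "inj_on g {..s}" "g ` {..s} \<subseteq> spec z"
 shows "det (mat (Suc s) (Suc s) (\<lambda>(i, j). tr (aev (idp (spec z) d (g i) * idp (spec z) d (g j)) z))) \<noteq> 0"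
proof -
 let ?M = "mat (Suc s) (Suc s) (\<lambda>(i, j). tr (aev (idp (spec z) d (g i) * idp (spec z) d (g j)) z))"
 have gs: "g i \<in> spec z" if "i < Suc s" for i using g(2) that by auto
 have entry: "?M $$ (i, j) = (if i = j then tr (proj z (g i)) else 0)" if "i < Suc s" "j < Suc s" for i j
 proof -
  have "?M $$ (i, j) = tr (proj z (g i) * proj z (g j))" using that by (simp add: proj_def)
  moreover have "g i \<noteq> g j" if "i \<noteq> j" using inj_onD[OF g(1), of i j] that \<open>i < Suc s\<close> \<open>j < Suc s\<close> by auto
  ultimately show ?thesis
   using proj_facts(1)[OF z gs[OF that(1)] gs[OF that(2)]] proj_facts(3)[OF z gs[OF that(1)]] tr_0
   by (cases "i = j") (simp_all only: simp_thms if_True if_False)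
 qed
 have "det ?M = prod_list (diag_mat ?M)"
 proof (rule det_upper_triangular)
  show "upper_triangular ?M" unfolding upper_triangular_def
  proof (intro allI impI)
   fix i j assume "i < dim_row ?M" "j < i"
   then have "i < Suc s" "j < Suc s" "i \<noteq> j" by auto
   then show "?M $$ (i, j) = 0" using entry[of i j] by (simp only: if_False)
  qed
 qed auto
 also have "\<dots> = (\<Prod>i = 0..<Suc s. tr (proj z (g i)))"
 proof -
  have "prod_list (diag_mat ?M) = (\<Prod>i\<in>set [0..<Suc s]. ?M $$ (i, i))"
   unfolding diag_mat_def by (subst prod.distinct_set_conv_list) (simp_all del: upt_Suc)
  also have "\<dots> = (\<Prod>i = 0..<Suc s. tr (proj z (g i)))"
   by (rule prod.cong) (auto simp only: entry set_upt atLeastLessThan_iff simp_thms if_True)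
  finally show ?thesis .
 qed
 also have "\<dots> \<noteq> 0"
  using tr_idempotent[OF char proj_facts(6)[OF z] proj_facts(3)[OF z gs] proj_nonzero[OF z gs]] by simp
 finally show ?thesis .
qed

text \<open>The semisimple part of \<open>y\<close>, to the power \<open>a\<close>.\<close>
definition ss_pow :: "'r \<Rightarrow> nat \<Rightarrow> 'r" where
 "ss_pow y a = (\<Sum>c\<in>spec y. sc (c ^ a) (proj y c))"

lemma ss_pow_R: "y \<in> R \<Longrightarrow> ss_pow y a \<in> R"
 unfolding ss_pow_def by (intro R_sum R_sc proj_facts)

text \<open>In characteristic 0 the powers of \<open>y\<close> are the diagonal of a two-variable exponential
 polynomial whose values at \<open>(a, 0)\<close> are the powers of the semisimple part.\<close>
lemma card_spec_semisimple_part_char_0: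
 assumes char: "CHAR('k) = 0" and y: "y \<in> R" "0 \<notin> spec y" and w: "w \<in> R"
  and bound: "\<And>n. card (spec ((w * y ^ n) ^ e)) \<le> s"
 shows "card (spec ((w * ss_pow y a) ^ e)) \<le> s"
proof (rule ccontr)
 assume big: "\<not> ?thesis"
 \<comment> \<open>On the block of \<open>c\<close> the binomial theorem gives \<open>y^n\<close> as
   the sum over \<open>k\<close> of \<open>c^(n-k) (n choose k) (y - c)^k\<close>, cut off at
   \<open>d\<close> by nilpotency. Replacing the \<open>n\<close> in the binomial coefficient by
   \<open>\<tau>\<close> separates the two kinds of dependence.\<close>
 define Z where "Z n \<tau> = (\<Sum>c\<in>spec y. \<Sum>k<d. sc (c ^ n * inverse c ^ k * of_nat (\<tau> choose k)) ((y - sc c 1) ^ k * proj y c))" for n \<tau>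
 have finy: "finite (spec y)" by (rule spec_annihilates[OF y(1)])
 have c0: "c \<noteq> 0" if "c \<in> spec y" for c using y(2) that by auto
 have Z0: "Z a 0 = ss_pow y a" for a
 proof -
  have "(\<Sum>k<d. sc (c ^ a * inverse c ^ k * of_nat (0 choose k)) ((y - sc c 1) ^ k * proj y c)) = sc (c ^ a) (proj y c)" for c
  proof -
   have "(\<Sum>k<d. sc (c ^ a * inverse c ^ k * of_nat (0 choose k)) ((y - sc c 1) ^ k * proj y c))
    = (\<Sum>k\<in>{0}. sc (c ^ a * inverse c ^ k * of_nat (0 choose k)) ((y - sc c 1) ^ k * proj y c))"
    by (rule sum.mono_neutral_right) (use d_pos in \<open>auto simp: binomial_eq_0\<close>)
   then show ?thesis by simp
  qed
  then show ?thesis unfolding Z_def ss_pow_def by simp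
 qed
 have Zn: "Z n n = y ^ n" for n
 proof -
  have "(\<Sum>k<d. sc (c ^ n * inverse c ^ k * of_nat (n choose k)) ((y - sc c 1) ^ k * proj y c)) = y ^ n * proj y c"
   if c: "c \<in> spec y" for c
  proof -
   let ?t = "\<lambda>k. sc (c ^ n * inverse c ^ k * of_nat (n choose k)) ((y - sc c 1) ^ k * proj y c)"
   have "[:0, 1:] ^ n = ([:- c, 1:] + [:c:]) ^ n" by simp
   also have "\<dots> = (\<Sum>k\<le>n. of_nat (n choose k) * [:- c, 1:] ^ k * [:c:] ^ (n - k))" by (rule binomial_ring)
   finally have "aev ([:0, 1:] ^ n) y = aev (\<Sum>k\<le>n. of_nat (n choose k) * [:- c, 1:] ^ k * [:c:] ^ (n - k)) y"
    by simp
   then have "y ^ n = (\<Sum>k\<le>n. sc (of_nat (n choose k) * c ^ (n - k)) ((y - sc c 1) ^ k))"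
    by (simp add: of_nat_poly poly_const_pow mult_ac)
   then have "y ^ n * proj y c = (\<Sum>k\<le>n. sc (of_nat (n choose k) * c ^ (n - k)) ((y - sc c 1) ^ k * proj y c))"
    by (simp add: sum_distrib_right)
   also have "\<dots> = (\<Sum>k\<le>n. ?t k)"
    by (rule sum.cong) (use c0[OF c] in \<open>auto simp: power_diff field_simps\<close>)
   also have "\<dots> = (\<Sum>k\<in>{..n} \<union> {..<d}. ?t k)"
    by (rule sum.mono_neutral_left) (auto simp: binomial_eq_0)
   also have "\<dots> = (\<Sum>k<d. ?t k)"
   proof (rule sum.mono_neutral_right)
    show "\<forall>k\<in>{..n} \<union> {..<d} - {..<d}. ?t k = 0"
    proof
     fix k assume "k \<in> {..n} \<union> {..<d} - {..<d}"
     then obtain j where "k = j + d" by (metis DiffD2 add.commute le_Suc_ex lessThan_iff not_less)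
     then have "(y - sc c 1) ^ k * proj y c = (y - sc c 1) ^ j * ((y - sc c 1) ^ d * proj y c)"
      by (simp add: power_add mult.assoc)
     then show "?t k = 0" using proj_facts(4)[OF y(1) c] by simp
    qed
   qed auto
   finally show ?thesis by simp
  qed
  then have "Z n n = (\<Sum>c\<in>spec y. y ^ n * proj y c)" unfolding Z_def by simp
  then show ?thesis using proj_facts(2)[OF y(1)] by (simp add: sum_distrib_left[symmetric])
 qed
 have ZE: "EPR Z" unfolding Z_def
  by (intro EPR_sum EPR.scale EPR.const EP_mult EP_exp EP_const EP_choose[OF char] finy) (use c0 in auto)
 define z where "z n \<tau> = (w * Z n \<tau>) ^ e" for n \<tau>
 have zE: "EPR z" unfolding z_def by (intro EPR_power EPR_mult EPR.const ZE)
 have z0R: "z a 0 \<in> R" unfolding z_def Z0 by (intro R_power R_mult w ss_pow_R y)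
 have zdR: "z n n \<in> R" for n unfolding z_def Zn by (intro R_power R_mult w y)
 have "Suc s \<le> card (spec (z a 0))" using big by (simp add: z_def Z0)
 then obtain T where T: "T \<subseteq> spec (z a 0)" "card T = Suc s" "finite T"
  by (meson obtain_subset_with_card_n)
 obtain g where "bij_betw g {..<Suc s} T"
  using ex_bij_betw_nat_finite[OF T(3)] T(2) by (auto simp: atLeast0LessThan)
 then have g: "inj_on g {..s}" "g ` {..s} \<subseteq> spec (z a 0)"
  using T(1) by (auto simp: bij_betw_def lessThan_Suc_atMost)
 \<comment> \<open>The test polynomials are chosen once, at the point \<open>(a, 0)\<close>.
   Therefore \<open>D\<close> is an exponential polynomial, zero on the diagonal by the bound on the
   eigenvalues of \<open>(w y^n)^e\<close>, yet nonzero at \<open>(a, 0)\<close>.\<close>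
 define f where "f i = idp (spec (z a 0)) d (g i)" for i
 define D where "D n \<tau> = det (mat (Suc s) (Suc s) (\<lambda>(i, j). tr (aev (f i * f j) (z n \<tau>))))" for n \<tau>
 have "EP D" unfolding D_def
  by (intro EP_det EPR_functional EPR_aev zE tr_add tr_sc)
 moreover have "D n n = 0" for n
  unfolding D_def by (rule gram_det_zero[OF zdR]) (use bound in \<open>simp add: z_def Zn\<close>)
 ultimately have "D a 0 = 0" using EP_diagonal_zero[OF char] by blast
 moreover have "D a 0 \<noteq> 0"
  unfolding D_def f_def by (rule gram_det_nonzero[OF char z0R g])
 ultimately show False by simp
qed

text \<open>For \<open>q = p^d\<close>, which is at least \<open>d\<close>, Frobenius gives
  \<open>(y - c)^q = y^q - c^q\<close>. This annihilates the block of \<open>c\<close>, so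
  \<open>y^q\<close> acts there as a scalar and is its own semisimple part.\<close>

lemma ss_pow_char_p:
 assumes p: "CHAR('k) \<noteq> 0"
 obtains q where "q > 0" "\<And>y b. y \<in> R \<Longrightarrow> ss_pow y (q * b) = y ^ (q * b)"
proof -
 let ?p = "CHAR('k)"
 have pp: "Factorial_Ring.prime ?p" using p by (simp add: prime_CHAR_semidom)
 define q where "q = ?p ^ d"
 have qd: "d \<le> q" unfolding q_def using prime_gt_1_nat[OF pp] by (simp add: less_imp_le power_gt_expt)
 have q0: "q > 0" using qd d_pos by simp
 have main: "ss_pow y (q * b) = y ^ (q * b)" if y: "y \<in> R" for y b
 proof -
  have "y ^ (q * b) * proj y c = sc (c ^ (q * b)) (proj y c)" if c: "c \<in> spec y" for c
  proof -
   have "([:- c, 1:] + [:c:]) ^ q = [:- c, 1:] ^ q + [:c:] ^ q"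
    by (rule freshmans_dream') (use pp in \<open>simp_all add: q_def\<close>)
   then have "aev (([:- c, 1:] + [:c:]) ^ q) y = aev ([:- c, 1:] ^ q + [:c:] ^ q) y" by simp
   then have e: "(y - sc c 1) ^ q = y ^ q - sc (c ^ q) 1" by (simp add: poly_const_pow)
   obtain j where j: "q = j + d" using qd by (metis add.commute le_Suc_ex)
   have "(y - sc c 1) ^ q * proj y c = (y - sc c 1) ^ j * ((y - sc c 1) ^ d * proj y c)"
    unfolding j by (simp add: power_add mult.assoc)
   then have "y ^ q * proj y c = sc (c ^ q) (proj y c)"
    using proj_facts(4)[OF y c] e by (simp add: left_diff_distrib)
   then have "(y ^ q) ^ b * proj y c = sc ((c ^ q) ^ b) (proj y c)" by (rule eigen_power)
   then show ?thesis by (simp add: power_mult)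
  qed
  then have "ss_pow y (q * b) = (\<Sum>c\<in>spec y. y ^ (q * b) * proj y c)" unfolding ss_pow_def by simp
  then show ?thesis using proj_facts(2)[OF y] by (simp add: sum_distrib_left[symmetric])
 qed
 show thesis by (rule that[OF q0 main])
qed

text \<open>The factor \<open>q\<close> gives both characteristics a common statement: it is 1 in
  characteristic 0; in positive characteristic the semisimple powers in question are actual powers
  of \<open>y\<close>, for which the bound is an instance of the hypothesis.\<close>

lemma card_spec_semisimple_part:
 obtains q where "q > 0"
  "\<And>y w e s b. \<lbrakk>y \<in> R; 0 \<notin> spec y; w \<in> R; \<And>n. card (spec ((w * y ^ n) ^ e)) \<le> s\<rbrakk>
   \<Longrightarrow> card (spec ((w * ss_pow y (q * b)) ^ e)) \<le> s"
proof (cases "CHAR('k) = 0")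
 case True
 show ?thesis
  by (rule that[of 1]) (use card_spec_semisimple_part_char_0[OF True] in auto)
next
 case False
 obtain q where q: "q > 0" "\<And>y b. y \<in> R \<Longrightarrow> ss_pow y (q * b) = y ^ (q * b)"
  using ss_pow_char_p[OF False] by blast
 show ?thesis by (rule that[OF q(1)]) (simp add: q(2))
qed

end


subsection \<open>Central idempotents for a connected linear group\<close>

text \<open>A bounded number of exponents is bad for each of the finitely many pairs.\<close>
lemma separating_exponent:
 fixes T :: "('k::field \<times> 'k) set"
 assumes T: "finite T" "card T * card T < N"
  and nz: "\<And>c \<nu>. (c, \<nu>) \<in> T \<Longrightarrow> c \<noteq> 0 \<and> \<nu> \<noteq> 0"
  and sep: "\<And>c \<nu> c' \<nu>' j. \<lbrakk>(c, \<nu>) \<in> T; (c', \<nu>') \<in> T; c \<noteq> c'; 0 < j; j \<le> N\<rbrakk> \<Longrightarrow> c ^ (Q * j) \<noteq> c' ^ (Q * j)"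
 obtains b where "inj_on (\<lambda>(c, \<nu>). c ^ (Q * b) * \<nu>) T"
proof -
 define f where "f b = (\<lambda>(c::'k, \<nu>). c ^ (Q * b) * \<nu>)" for b
 define bad where "bad u v = {b \<in> {1..N}. f b u = f b v}" for u v
 have le1: "card (bad u v) \<le> 1" if u: "u \<in> T" and v: "v \<in> T" and ne: "u \<noteq> v" for u v
 proof -
  obtain c \<nu> c' \<nu>' where uv: "u = (c, \<nu>)" "v = (c', \<nu>')" by (metis surj_pair)
  have n: "c \<noteq> 0" "\<nu> \<noteq> 0" "c' \<noteq> 0" "\<nu>' \<noteq> 0" using nz u v uv by auto
  \<comment> \<open>From two bad exponents \<open>b < b'\<close>, division leaves
    \<open>c^(Q j) = c'^(Q j)\<close> with \<open>j = b' - b\<close>, contrary to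
    \<open>sep\<close>; for \<open>c = c'\<close> even one bad exponent would give equal
    pairs.\<close>
  have no: False if b: "b \<in> bad u v" "b' \<in> bad u v" "b < b'" for b b'
  proof (cases "c = c'")
   case True
   then show False using b(1) ne n uv by (auto simp: bad_def f_def)
  next
   case False
   define j where "j = b' - b"
   have b': "b' = b + j" "0 < j" "j \<le> N" using b by (auto simp: j_def bad_def)
   have e1: "c ^ (Q * b) * \<nu> = c' ^ (Q * b) * \<nu>'" using b(1) uv by (simp add: bad_def f_def)
   have e2: "c ^ (Q * b) * c ^ (Q * j) * \<nu> = c' ^ (Q * b) * c' ^ (Q * j) * \<nu>'"
    using b(2) uv b'(1) by (simp add: bad_def f_def power_add distrib_left)
   have "c ^ (Q * j) * (c' ^ (Q * b) * \<nu>') = c ^ (Q * j) * (c ^ (Q * b) * \<nu>)" using e1 by simp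
   also have "\<dots> = c' ^ (Q * j) * (c' ^ (Q * b) * \<nu>')" using e2 by (simp add: mult_ac)
   finally have "c ^ (Q * j) = c' ^ (Q * j)" using n by simp
   then show False using sep[of c \<nu> c' \<nu>' j] u v uv False b' by simp
  qed
  have "finite (bad u v)" by (simp add: bad_def)
  show ?thesis
  proof (rule ccontr)
   assume "\<not> ?thesis"
   then obtain b b' where "b \<in> bad u v" "b' \<in> bad u v" "b \<noteq> b'"
    by (metis \<open>finite (bad u v)\<close> card_le_Suc0_iff_eq One_nat_def)
   then show False using no[of b b'] no[of b' b] by (metis linorder_neqE_nat)
  qed
 qed
 let ?D = "{(u, v) \<in> T \<times> T. u \<noteq> v}"
 let ?B = "\<Union>(u, v)\<in>?D. bad u v"
 have finD: "finite ?D" by (rule finite_subset[of _ "T \<times> T"]) (use T(1) in auto)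
 have "card ?B \<le> (\<Sum>(u, v)\<in>?D. card (bad u v))"
  using card_UN_le[OF finD, of "\<lambda>(u, v). bad u v"] by (simp add: case_prod_unfold)
 also have "\<dots> \<le> (\<Sum>(u, v)\<in>?D. 1)" by (rule sum_mono) (use le1 in auto)
 also have "\<dots> = card ?D" by (simp add: case_prod_unfold)
 also have "\<dots> \<le> card (T \<times> T)" by (rule card_mono) (use T in auto)
 also have "\<dots> < N" using T(2) by (simp add: card_cartesian_product)
 finally have less: "card ?B < card {1..N}" by simp
 have BN: "?B \<subseteq> {1..N}" by (auto simp: bad_def)
 have "\<not> {1..N} \<subseteq> ?B"
 proof
  assume "{1..N} \<subseteq> ?B"
  then have "card ?B = card {1..N}" by (intro arg_cong[where f = card] equalityI BN)
  then show False using less by (simp only: less_irrefl)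
 qed
 then obtain b where b: "b \<in> {1..N}" "b \<notin> ?B" unfolding subset_iff by blast
 have "inj_on (f b) T"
 proof (rule inj_onI, rule ccontr)
  fix u v assume uv: "u \<in> T" "v \<in> T" "f b u = f b v" "u \<noteq> v"
  then have "b \<in> bad u v" using b(1) by (simp add: bad_def)
  then show False using b(2) uv by blast
 qed
 then show thesis using that[of b] by (simp add: f_def)
qed

text \<open>An orbit of the permutation has length at most \<open>s\<close>, and every such length
  divides \<open>fact s\<close>.\<close>

lemma injective_iterate_fixes:
 assumes "finite L" "\<sigma> ` L \<subseteq> L" "inj_on \<sigma> L" "c \<in> L" "card L \<le> s"
 shows "(\<sigma> ^^ fact s) c = c"
proof -
 have inL: "(\<sigma> ^^ n) c \<in> L" for n by (induction n) (use assms in auto)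
 have "\<not> inj_on (\<lambda>n. (\<sigma> ^^ n) c) {0..s}"
 proof
  assume "inj_on (\<lambda>n. (\<sigma> ^^ n) c) {0..s}"
  then have "card {0..s} \<le> card L" using inL assms(1) by (intro card_inj_on_le[of "\<lambda>n. (\<sigma> ^^ n) c"]) auto
  then show False using assms(5) by simp
 qed
 then obtain a b where ab: "a \<le> s" "b \<le> s" "a \<noteq> b" "(\<sigma> ^^ a) c = (\<sigma> ^^ b) c"
  by (auto simp: inj_on_def)
 define i l where "i = min a b" and "l = max a b - min a b"
 have l: "0 < l" "l \<le> s" "(\<sigma> ^^ i) c = (\<sigma> ^^ (i + l)) c"
  using ab by (auto simp: i_def l_def min_def max_def)
 have cancel: "(\<sigma> ^^ i) u = (\<sigma> ^^ i) v \<Longrightarrow> u = v" if "u \<in> L" "v \<in> L" for u v i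
  using that
 proof (induction i arbitrary: u v)
  case (Suc i)
  have "(\<sigma> ^^ i) (\<sigma> u) = (\<sigma> ^^ i) (\<sigma> v)" using Suc.prems by (simp add: funpow_swap1)
  then have "\<sigma> u = \<sigma> v" using Suc.IH assms(2) Suc.prems by blast
  then show ?case using assms(3) Suc.prems by (auto dest: inj_onD)
 qed simp
 have fix1: "(\<sigma> ^^ l) c = c"
  using cancel[of "(\<sigma> ^^ l) c" c i] inL[of l] assms(4) l(3) by (simp add: funpow_add)
 have "(\<sigma> ^^ (l * n)) c = c" for n by (induction n) (simp_all add: funpow_add fix1)
 moreover have "l dvd fact s" using l by (simp add: dvd_fact)
 ultimately show ?thesis by (metis dvd_def)
qed

locale linear_connected = connected_subgroup G H closed + traced_algebra sc R d tr
 for G :: "('a, 'b) monoid_scheme" (structure) and H closed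
  and sc :: "'k::field \<Rightarrow> 'r::ring_1 \<Rightarrow> 'r" and R d tr +
 fixes \<phi> :: "'a \<Rightarrow> 'r"
 assumes \<phi>_mult: "\<lbrakk>a \<in> carrier G; b \<in> carrier G\<rbrakk> \<Longrightarrow> \<phi> (a \<otimes> b) = \<phi> a * \<phi> b"
  and \<phi>_one: "\<phi> \<one> = 1"
  and \<phi>_R: "g \<in> carrier G \<Longrightarrow> \<phi> g \<in> R"
  and closed_linear: "(\<And>l. l \<in> \<Lambda> \<Longrightarrow> (\<forall>x y. l (x + y) = l x + l y) \<and> (\<forall>c x. l (sc c x) = sc c (l x)))
   \<Longrightarrow> closed {v \<in> carrier G. \<forall>l\<in>\<Lambda>. l (\<phi> v) = (0::'r)}"
begin

lemma \<phi>_inv: "g \<in> carrier G \<Longrightarrow> \<phi> (inv g) * \<phi> g = 1" "g \<in> carrier G \<Longrightarrow> \<phi> g * \<phi> (inv g) = 1"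
 by (simp_all add: \<phi>_mult[symmetric] \<phi>_one)

lemma \<phi>_pow: "g \<in> carrier G \<Longrightarrow> \<phi> (g [^] (n::nat)) = \<phi> g ^ n"
 by (induction n) (simp_all add: \<phi>_one \<phi>_mult power_commutes)

lemma \<phi>_inv_commute:
 assumes "g \<in> carrier G" "\<phi> g * A = A * \<phi> g"
 shows "\<phi> (inv g) * A = A * \<phi> (inv g)"
proof -
 have "\<phi> (inv g) * A = \<phi> (inv g) * (A * \<phi> g) * \<phi> (inv g)"
  using \<phi>_inv(2)[OF assms(1)] by (simp add: mult.assoc)
 also have "\<dots> = (\<phi> (inv g) * \<phi> g) * A * \<phi> (inv g)" by (simp add: assms(2)[symmetric] mult.assoc)
 finally show ?thesis using \<phi>_inv(1)[OF assms(1)] by simp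
qed

lemma \<phi>_unit_nonzero:
 assumes "g \<in> carrier G" "A \<noteq> 0"
 shows "\<phi> g * A \<noteq> 0"
proof
 assume "\<phi> g * A = 0"
 then have "\<phi> (inv g) * (\<phi> g * A) = 0" by simp
 then show False using \<phi>_inv(1)[OF assms(1)] assms(2) by (simp add: mult.assoc[symmetric])
qed

lemma zero_notin_spec: "g \<in> carrier G \<Longrightarrow> 0 \<notin> spec (\<phi> g)"
 using \<phi>_unit_nonzero by (auto simp: spec_def)

lemma pow_H: "h \<in> H \<Longrightarrow> h [^] (n::nat) \<in> H"
 by (induction n) auto

lemma generic_engel_one:
 assumes y: "y \<in> H"
 shows "generic (\<lambda>v. \<exists>n. engel_comm G v y n = \<one>)"
proof (rule generic_mono[OF generic_engel_centre[OF H_carrier[OF y]]])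
 fix v assume v: "v \<in> H" and "\<exists>n. engel_comm G v y n \<in> centre"
 then obtain n where n: "engel_comm G v y n \<in> centre" by blast
 then have "engel_comm G v y (Suc n) = \<one>"
  using centre_commute[OF n y] v y by (simp add: comm_eq_one_iff)
 then show "\<exists>n. engel_comm G v y n = \<one>" by blast
qed

lemma eigenvector_in:
 assumes x: "x \<in> R" and P: "P * x = x * P" and A: "A \<noteq> 0" "P * A = A" "proj x \<nu> * A = A" "\<nu> \<in> spec x"
 shows "\<exists>B. B \<noteq> 0 \<and> P * B = B \<and> x * B = sc \<nu> B"
proof -
 have "(x - sc \<nu> 1) ^ d * A = 0"
  using proj_facts(4)[OF x A(4)] A(3) by (metis mult.assoc mult_zero_left)
 then obtain i where i: "(x - sc \<nu> 1) ^ i * A \<noteq> 0"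
  "x * ((x - sc \<nu> 1) ^ i * A) = sc \<nu> ((x - sc \<nu> 1) ^ i * A)"
  using generalised_eigenvector[OF _ A(1)] by blast
 have "P * (x - sc \<nu> 1) ^ i = (x - sc \<nu> 1) ^ i * P"
  using aev_commute[OF P, of "[:- \<nu>, 1:] ^ i"] by simp
 then have "P * ((x - sc \<nu> 1) ^ i * A) = (x - sc \<nu> 1) ^ i * A" using A(2) by (metis mult.assoc)
 then show ?thesis using i by blast
qed

lemma eigenvector_in_ex:
 assumes x: "x \<in> R" and P: "P * x = x * P" and A: "A \<noteq> 0" "P * A = A"
 obtains \<nu> B where "B \<noteq> 0" "P * B = B" "x * B = sc \<nu> B"
proof -
 obtain \<nu> where \<nu>: "\<nu> \<in> spec x" "proj x \<nu> * A \<noteq> 0" using proj_decomp_ex[OF x A(1)] by blast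
 have "P * (proj x \<nu> * A) = proj x \<nu> * A"
  using proj_facts(5)[OF x P, of \<nu>] A(2) by (metis mult.assoc)
 moreover have "proj x \<nu> * (proj x \<nu> * A) = proj x \<nu> * A"
  using proj_facts(3)[OF x \<nu>(1)] by (simp add: mult.assoc[symmetric])
 ultimately show ?thesis using eigenvector_in[OF x P \<nu>(2) _ _ \<nu>(1)] that by blast
qed

text \<open>Let \<open>M j\<close> be the largest number of eigenvalues of \<open>j\<close>-th
  powers of elements of \<open>H\<close>, and \<open>s = M e\<close> its minimum over
  \<open>j > 0\<close>. If \<open>x\<close> attains \<open>M (e * E)\<close> and
  \<open>y = x^e\<close>, then \<open>s \<le> M (e * E)\<close>, which counts the
  \<open>E\<close>-th powers of the eigenvalues of \<open>y\<close>, while \<open>y\<close> has at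
  most \<open>M e = s\<close> eigenvalues. So all these counts agree and no two eigenvalues of
  \<open>y\<close> have the same \<open>E\<close>-th power.\<close>

lemma exists_regular:
 obtains e s where "e > 0" "\<And>x. x \<in> H \<Longrightarrow> card (spec (\<phi> x ^ e)) \<le> s"
  "\<And>E. E > 0 \<Longrightarrow> \<exists>y\<in>H. card (spec (\<phi> y)) = s \<and> inj_on (\<lambda>c. c ^ E) (spec (\<phi> y))"
proof -
 define M where "M j = Max ((\<lambda>x. card (spec (\<phi> x ^ j))) ` H)" for j
 have fin: "finite ((\<lambda>x. card (spec (\<phi> x ^ j))) ` H)" for j
  by (rule finite_subset[of _ "{..d}"]) (use spec_annihilates(2) R_power \<phi>_R in auto)
 have ne: "(\<lambda>x. card (spec (\<phi> x ^ j))) ` H \<noteq> {}" for j using H.one_closed by blast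
 have M_ge: "card (spec (\<phi> x ^ j)) \<le> M j" if "x \<in> H" for x j
  unfolding M_def using fin that by (intro Max_ge) auto
 have M_at: "\<exists>x\<in>H. card (spec (\<phi> x ^ j)) = M j" for j
  using Max_in[OF fin ne, of j] unfolding M_def by auto
 define P where "P m \<longleftrightarrow> (\<exists>j>0. M j = m)" for m
 define s where "s = (LEAST m. P m)"
 have "P (M 1)" by (auto simp: P_def intro: exI[of _ 1])
 then have "P s" unfolding s_def by (rule LeastI)
 then obtain e where e: "e > 0" "M e = s" by (auto simp: P_def)
 have min: "s \<le> M j" if "j > 0" for j
  unfolding s_def by (rule Least_le) (use that in \<open>auto simp: P_def\<close>)
 have "\<exists>y\<in>H. card (spec (\<phi> y)) = s \<and> inj_on (\<lambda>c. c ^ E) (spec (\<phi> y))" if E: "E > 0" for E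
 proof -
  obtain x where x: "x \<in> H" "card (spec (\<phi> x ^ (e * E))) = M (e * E)" using M_at by blast
  define y where "y = x [^] e"
  have y: "y \<in> H" "\<phi> y = \<phi> x ^ e" using x pow_H \<phi>_pow by (auto simp: y_def)
  have yR: "\<phi> y \<in> R" using \<phi>_R y by blast
  have "spec (\<phi> x ^ (e * E)) = (\<lambda>c. c ^ E) ` spec (\<phi> y)"
   using spec_power[OF yR, of E] y(2) by (simp add: power_mult)
  then have 1: "s \<le> card ((\<lambda>c. c ^ E) ` spec (\<phi> y))" using x(2) min[of "e * E"] e E by simp
  have fy: "finite (spec (\<phi> y))" by (rule spec_annihilates(1)[OF yR])
  have 2: "card (spec (\<phi> y)) \<le> s" using M_ge[OF x(1), of e] y(2) e(2) by simp
  have 3: "card ((\<lambda>c. c ^ E) ` spec (\<phi> y)) \<le> card (spec (\<phi> y))" by (rule card_image_le[OF fy])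
  have "inj_on (\<lambda>c. c ^ E) (spec (\<phi> y))" by (rule eq_card_imp_inj_on[OF fy]) (use 1 2 3 in simp)
  moreover have "card (spec (\<phi> y)) = s" using 1 2 3 by simp
  ultimately show ?thesis using y(1) by blast
 qed
 then show thesis using that[OF e(1), of s] M_ge e(2) by blast
qed

text \<open>The idempotents are the spectral projections of a regular \<open>y\<close>. The crucial
  implication is that \<open>k\<close> maps blocks of \<open>y\<close> into blocks as soon as
  \<open>[k, y]\<close> does; it is propagated backwards along Engel sequences that end in
  1.\<close>

theorem central_idempotents:
 obtains L :: "'k set" and e :: nat and p where "finite L" "e > (0::nat)" "(\<Sum>c\<in>L. p c) = 1"
  "\<And>c. c \<in> L \<Longrightarrow> p c \<in> R" "\<And>c. c \<in> L \<Longrightarrow> p c * p c = p c"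
  "\<And>c c'. \<lbrakk>c \<in> L; c' \<in> L; c \<noteq> c'\<rbrakk> \<Longrightarrow> p c * p c' = 0"
  "\<And>w c. \<lbrakk>w \<in> H; c \<in> L\<rbrakk> \<Longrightarrow> \<phi> w * p c = p c * \<phi> w"
  "\<And>w c. \<lbrakk>w \<in> H; c \<in> L\<rbrakk> \<Longrightarrow> \<exists>\<nu>. (\<phi> w ^ e - sc \<nu> 1) ^ d * p c = 0"
proof -
 obtain e s where e: "e > 0" and es: "\<And>x. x \<in> H \<Longrightarrow> card (spec (\<phi> x ^ e)) \<le> s"
  and reg: "\<And>E. E > 0 \<Longrightarrow> \<exists>y\<in>H. card (spec (\<phi> y)) = s \<and> inj_on (\<lambda>c. c ^ E) (spec (\<phi> y))"
  using exists_regular by blast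
 obtain q where q: "q > 0" and qss:
  "\<And>y w e s b. \<lbrakk>y \<in> R; 0 \<notin> spec y; w \<in> R; \<And>n. card (spec ((w * y ^ n) ^ e)) \<le> s\<rbrakk>
   \<Longrightarrow> card (spec ((w * ss_pow y (q * b)) ^ e)) \<le> s"
  using card_spec_semisimple_part by blast
 \<comment> \<open>\<open>N\<close> exceeds the square of \<open>s + 1\<close>, the number of points
   handed to \<open>separating_exponent\<close>, and the summand \<open>fact s\<close> gives
   \<open>s \<le> N\<close>. Consequently the exponents \<open>q * e * j\<close> with
   \<open>0 < j \<le> N\<close>, as well as \<open>fact s * e\<close>, divide \<open>E\<close> and
   are injective on the spectrum of \<open>y\<close>.\<close>
 define N where "N = Suc (Suc s * Suc s) + fact s"
 define E where "E = q * e * fact N"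
 have "E > 0" using q e by (simp add: E_def)
 then obtain y where y: "y \<in> H" and cs: "card (spec (\<phi> y)) = s" and injE: "inj_on (\<lambda>c. c ^ E) (spec (\<phi> y))"
  using reg by blast
 define L where "L = spec (\<phi> y)"
 define p where "p = proj (\<phi> y)"
 have yG: "y \<in> carrier G" using y by blast
 have yR: "\<phi> y \<in> R" using \<phi>_R yG .
 have finL: "finite L" unfolding L_def by (rule spec_annihilates(1)[OF yR])
 have p_orth: "p c * p c' = 0" if "c \<in> L" "c' \<in> L" "c \<noteq> c'" for c c'
  using proj_facts(1)[OF yR] that by (simp add: p_def L_def)
 have p_sum: "(\<Sum>c\<in>L. p c) = 1" using proj_facts(2)[OF yR] by (simp add: p_def L_def)
 have p_idem: "p c * p c = p c" if "c \<in> L" for c using proj_facts(3)[OF yR] that by (simp add: p_def L_def)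
 have p_comm: "A * p c = p c * A" if "A * \<phi> y = \<phi> y * A" for A c using proj_facts(5)[OF yR that] by (simp add: p_def)
 have p_R: "p c \<in> R" for c using proj_facts(6)[OF yR] by (simp add: p_def)
 have p_nz: "p c \<noteq> 0" if "c \<in> L" for c using proj_nonzero[OF yR] that by (simp add: p_def L_def)
 have L0: "c \<noteq> 0" if "c \<in> L" for c using zero_notin_spec[OF yG] that by (auto simp: L_def)
 have inj_dvd: "inj_on (\<lambda>c. c ^ j) L" if jE: "j dvd E" for j
 proof (rule inj_onI)
  fix c c' assume c: "c \<in> L" "c' \<in> L" "c ^ j = c' ^ j"
  obtain m where "E = j * m" using jE by (rule dvdE)
  then have "c ^ E = c' ^ E" using c(3) by (simp add: power_mult)
  then show "c = c'" using injE c by (auto simp: L_def dest: inj_onD)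
 qed
 have p_ss: "ss_pow (\<phi> y) a * B = sc (c ^ a) B" if c: "c \<in> L" and B: "p c * B = B" for a c B
 proof -
  have "p c' * B = 0" if "c' \<in> L" "c' \<noteq> c" for c'
   using p_orth[OF that(1) c that(2)] B by (metis mult.assoc mult_zero_left)
  then have "(\<Sum>c'\<in>L. sc (c' ^ a) (p c' * B)) = sc (c ^ a) (p c * B)"
   using finL c by (subst sum.remove[of _ c]) (auto intro!: sum.neutral)
  then show ?thesis using B by (simp add: ss_pow_def L_def p_def sum_distrib_right)
 qed
 have p_ss_comm: "ss_pow (\<phi> y) a * W = W * ss_pow (\<phi> y) a" if "\<And>c. c \<in> L \<Longrightarrow> W * p c = p c * W" for a W
  using that unfolding ss_pow_def p_def L_def by (simp add: sum_distrib_left sum_distrib_right)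
 text \<open>An element commuting with all \<open>p c\<close> cannot have two \<open>e\<close>-inequivalent eigenvalues on one
  block: otherwise some \<open>w y\<^sup>n\<close> would have more than \<open>s\<close> eigenvalues.\<close>
 have unique: "\<mu> ^ e = \<mu>' ^ e"
  if w: "w \<in> H" and comm: "\<And>c. c \<in> L \<Longrightarrow> \<phi> w * p c = p c * \<phi> w" and c: "c \<in> L"
   and A: "A \<noteq> 0" "p c * A = A" "\<phi> w * A = sc \<mu> A" and A': "A' \<noteq> 0" "p c * A' = A'" "\<phi> w * A' = sc \<mu>' A'"
  for w c A \<mu> A' \<mu>'
 proof (rule ccontr)
  assume ne: "\<mu> ^ e \<noteq> \<mu>' ^ e"
  have wG: "w \<in> carrier G" using w by blast
  have wR: "\<phi> w \<in> R" by (rule \<phi>_R[OF wG])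
  define good where "good c \<mu> \<longleftrightarrow> (\<exists>B. B \<noteq> 0 \<and> p c * B = B \<and> \<phi> w * B = sc \<mu> B)" for c \<mu>
  have "\<exists>\<mu>. good c' \<mu>" if c': "c' \<in> L" for c'
   using eigenvector_in_ex[OF wR comm[OF c', symmetric] p_nz[OF c'] p_idem[OF c']] unfolding good_def by metis
  then obtain m where m: "\<And>c'. c' \<in> L \<Longrightarrow> good c' (m c')" by metis
  \<comment> \<open>One eigenvalue of \<open>w\<close> for each block other than \<open>c\<close>
    and two for \<open>c\<close>, raised to the power \<open>e\<close>: in total
    \<open>s + 1\<close> pairs, one more than the number of eigenvalues that can be
    tolerated.\<close>
  define T where "T = (\<lambda>c'. (c', m c' ^ e)) ` (L - {c}) \<union> {(c, \<mu> ^ e), (c, \<mu>' ^ e)}"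
  have Tgood: "fst u \<in> L \<and> (\<exists>\<mu>. good (fst u) \<mu> \<and> snd u = \<mu> ^ e)" if "u \<in> T" for u
   using that m c A A' unfolding T_def good_def by fastforce
  have finT: "finite T" using finL by (simp add: T_def)
  have "card T = card ((\<lambda>c'. (c', m c' ^ e)) ` (L - {c})) + card {(c, \<mu> ^ e), (c, \<mu>' ^ e)}"
   unfolding T_def by (rule card_Un_disjoint) (use finL in auto)
  also have "card ((\<lambda>c'. (c', m c' ^ e)) ` (L - {c})) = card (L - {c})"
   by (rule card_image) (auto simp: inj_on_def)
  also have "card (L - {c}) = s - 1" using c finL cs by (simp add: L_def)
  also have "card {(c, \<mu> ^ e), (c, \<mu>' ^ e)} = 2" using ne by simp
  finally have "card T = s - 1 + 2" .
  moreover have "0 < s" using c finL card_gt_0_iff[of L] cs unfolding L_def by blast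
  ultimately have cT: "card T = Suc s" by simp
  have T0: "c \<noteq> 0 \<and> \<nu> \<noteq> 0" if cT: "(c, \<nu>) \<in> T" for c \<nu>
  proof -
   obtain \<mu> B where "c \<in> L" "\<nu> = \<mu> ^ e" "B \<noteq> 0" "\<phi> w * B = sc \<mu> B"
    using Tgood[OF cT] by (auto simp: good_def)
   moreover then have "\<mu> \<noteq> 0" using \<phi>_unit_nonzero[OF wG] by fastforce
   ultimately show ?thesis using L0 by simp
  qed
  obtain b where b: "inj_on (\<lambda>(c, \<nu>). c ^ (q * e * b) * \<nu>) T"
  proof (rule separating_exponent[of T N "q * e"])
   show "card T * card T < N" by (simp add: cT N_def)
   show "c1 ^ (q * e * j) \<noteq> c2 ^ (q * e * j)"
    if "(c1, n1) \<in> T" "(c2, n2) \<in> T" "c1 \<noteq> c2" "0 < j" "j \<le> N" for c1 n1 c2 n2 j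
   proof -
    have "q * e * j dvd E" unfolding E_def using that by (simp add: dvd_fact)
    then show ?thesis using inj_dvd Tgood[OF that(1)] Tgood[OF that(2)] that(3) by (auto dest: inj_onD)
   qed
  qed (use finT T0 in blast)+
  let ?z = "(\<phi> w * ss_pow (\<phi> y) (q * b)) ^ e"
  have "card (spec ?z) \<le> s"
  proof (rule qss[OF yR zero_notin_spec[OF yG] wR])
   fix n
   have "\<phi> w * \<phi> y ^ n = \<phi> (w \<otimes> y [^] n)" using wG yG by (simp add: \<phi>_mult \<phi>_pow)
   moreover have "w \<otimes> y [^] n \<in> H" using w pow_H[OF y] by simp
   ultimately show "card (spec ((\<phi> w * \<phi> y ^ n) ^ e)) \<le> s" using es by simp
  qed
  moreover have "(\<lambda>(c, \<nu>). c ^ (q * e * b) * \<nu>) ` T \<subseteq> spec ?z"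
  proof
   fix \<kappa> assume "\<kappa> \<in> (\<lambda>(c, \<nu>). c ^ (q * e * b) * \<nu>) ` T"
   then obtain c1 \<nu>1 where T1: "(c1, \<nu>1) \<in> T" "\<kappa> = c1 ^ (q * e * b) * \<nu>1" by auto
   obtain \<mu>1 B where B: "c1 \<in> L" "\<nu>1 = \<mu>1 ^ e" "B \<noteq> 0" "p c1 * B = B" "\<phi> w * B = sc \<mu>1 B"
    using Tgood[OF T1(1)] by (auto simp: good_def)
   have "\<phi> w * ss_pow (\<phi> y) (q * b) * B = sc (c1 ^ (q * b) * \<mu>1) B"
    using p_ss[OF B(1,4)] B(5) by (simp add: mult.assoc)
   then have "?z * B = sc ((c1 ^ (q * b) * \<mu>1) ^ e) B" by (rule eigen_power)
   moreover have "(c1 ^ (q * b) * \<mu>1) ^ e = \<kappa>"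
    unfolding T1(2) B(2) by (simp add: power_mult_distrib power_mult[symmetric] mult_ac)
   ultimately show "\<kappa> \<in> spec ?z" using B(3) by (auto simp: spec_def)
  qed
  moreover have "?z \<in> R" by (intro R_power R_mult wR ss_pow_R yR)
  ultimately have "card ((\<lambda>(c, \<nu>). c ^ (q * e * b) * \<nu>) ` T) \<le> s"
   by (meson card_mono le_trans spec_annihilates(1))
  then show False using card_image[OF b] cT by simp
 qed
 \<comment> \<open>Each block is carried into a single block. This is the property propagated along
   the Engel sequence; it is weaker than commuting with all \<open>p c\<close>.\<close>
 define perm where "perm a \<longleftrightarrow> (\<forall>c\<in>L. \<exists>c'\<in>L. p c' * a * p c = a * p c)" for a
 have fixes_commutes: "A * p c = p c * A" if "\<And>c. c \<in> L \<Longrightarrow> p c * A * p c = A * p c" "c \<in> L" for A c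
 proof -
  have "p c * A = (\<Sum>c'\<in>L. p c * A * p c')" using p_sum by (simp add: sum_distrib_left[symmetric])
  also have "\<dots> = (\<Sum>c'\<in>L. p c * p c' * A * p c')"
   by (rule sum.cong) (use that(1) in \<open>auto simp: mult.assoc\<close>)
  also have "\<dots> = p c * p c * A * p c"
  proof -
   have "p c * p c' * A * p c' = 0" if "c' \<in> L - {c}" for c'
    using p_orth[of c c'] \<open>c \<in> L\<close> that by auto
   then show ?thesis using finL that(2) by (subst sum.remove[of _ c]) (auto intro!: sum.neutral)
  qed
  finally show ?thesis using p_idem that by (simp add: mult.assoc)
 qed
 have step: "perm (\<phi> k)" if k: "k \<in> H" and z: "perm (\<phi> (comm G k y))" for k
 proof -
  have kG: "k \<in> carrier G" using k by blast
  \<comment> \<open>A conjugate of the inverse of \<open>y\<close>, equal to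
    \<open>[k, y] y^-1\<close>. Since \<open>y\<close> preserves all blocks, \<open>g\<close> maps
    blocks into blocks just as \<open>[k, y]\<close> does; being invertible, it permutes
    them.\<close>
  define g where "g = inv k \<otimes> inv y \<otimes> k"
  have gH: "g \<in> H" using k y by (simp add: g_def)
  have gG: "g \<in> carrier G" using gH by blast
  define b where "b = \<phi> g"
  have "comm G k y \<otimes> inv y = g" using kG yG by (simp add: g_def word_simps)
  then have bz: "b = \<phi> (comm G k y) * \<phi> (inv y)" using kG yG by (simp add: b_def \<phi>_mult[symmetric])
  have yp: "\<phi> (inv y) * p c = p c * \<phi> (inv y)" for c by (rule \<phi>_inv_commute[OF yG]) (rule p_comm, simp)
  have "\<exists>c'\<in>L. p c' * b * p c = b * p c" if cL: "c \<in> L" for c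
  proof -
   obtain c' where c': "c' \<in> L" "p c' * \<phi> (comm G k y) * p c = \<phi> (comm G k y) * p c"
    using z cL unfolding perm_def by blast
   have "p c' * b * p c = p c' * \<phi> (comm G k y) * p c * \<phi> (inv y)"
    unfolding bz using yp[of c] by (simp add: mult.assoc)
   also have "\<dots> = b * p c" unfolding c'(2) bz using yp[of c] by (simp add: mult.assoc)
   finally show ?thesis using c' by blast
  qed
  then obtain \<sigma> where \<sigma>: "\<And>c. c \<in> L \<Longrightarrow> \<sigma> c \<in> L \<and> p (\<sigma> c) * b * p c = b * p c" by metis
  have "L \<subseteq> \<sigma> ` L"
  proof
   fix c' assume c': "c' \<in> L"
   show "c' \<in> \<sigma> ` L"
   proof (rule ccontr)
    assume no: "c' \<notin> \<sigma> ` L"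
    have "p c' * b * p c = 0" if c: "c \<in> L" for c
    proof -
     have "c' \<noteq> \<sigma> c" using no c by blast
     then have "p c' * p (\<sigma> c) = 0" using p_orth[OF c', of "\<sigma> c"] \<sigma>[OF c] by blast
     then have "p c' * (p (\<sigma> c) * b * p c) = 0" by (simp add: mult.assoc[symmetric])
     then show ?thesis using \<sigma>[OF c] by (simp add: mult.assoc)
    qed
    then have "(\<Sum>c\<in>L. p c' * b * p c) = 0" by simp
    then have "p c' * b = 0" using p_sum by (simp add: sum_distrib_left[symmetric])
    then have "p c' * (b * \<phi> (inv g)) = 0" by (simp add: mult.assoc[symmetric])
    then show False using \<phi>_inv(2)[OF gG] p_nz[OF c'] by (simp add: b_def)
   qed
  qed
  moreover have sub: "\<sigma> ` L \<subseteq> L" using \<sigma> by blast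
  ultimately have inj: "inj_on \<sigma> L" using finL by (metis endo_inj_surj eq_card_imp_inj_on subset_antisym)
  have bpow: "p ((\<sigma> ^^ n) c) * b ^ n * p c = b ^ n * p c \<and> (\<sigma> ^^ n) c \<in> L" if c: "c \<in> L" for c n
  proof (induction n)
   case (Suc n)
   let ?c = "(\<sigma> ^^ n) c"
   have "b ^ Suc n * p c = b * (p ?c * b ^ n * p c)" using Suc by (simp add: mult.assoc)
   also have "\<dots> = (b * p ?c) * b ^ n * p c" by (simp add: mult.assoc)
   also have "b * p ?c = p (\<sigma> ?c) * b * p ?c" using \<sigma> Suc by simp
   also have "p (\<sigma> ?c) * b * p ?c * b ^ n * p c = p (\<sigma> ?c) * b * (p ?c * b ^ n * p c)" by (simp add: mult.assoc)
   also have "\<dots> = p (\<sigma> ?c) * b ^ Suc n * p c" using Suc by (simp add: mult.assoc)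
   finally show ?case using \<sigma> Suc by simp
  qed (use that p_idem in simp)
  define j where "j = (fact s :: nat)"
  have fixb: "p c * b ^ j * p c = b ^ j * p c" if "c \<in> L" for c
   using bpow[OF that, of j] injective_iterate_fixes[OF finL sub inj that, of s] cs by (simp add: j_def L_def)
  \<comment> \<open>This is \<open>k^-1 y^j k\<close> with \<open>j = fact s\<close>. The
    permutation induced by \<open>g\<close> has trivial \<open>j\<close>-th power, so
    \<open>w\<close> commutes with all \<open>p c\<close> and \<open>unique\<close> applies to
    it.\<close>
  define w where "w = inv (g [^] j)"
  have wH: "w \<in> H" using pow_H[OF gH] by (simp add: w_def)
  have wG: "w \<in> carrier G" using wH by blast
  have wR: "\<phi> w \<in> R" by (rule \<phi>_R[OF wG])
  have wp: "\<phi> w * p c = p c * \<phi> w" if "c \<in> L" for c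
   unfolding w_def by (rule \<phi>_inv_commute) (use gG fixes_commutes[OF fixb that] in \<open>auto simp: \<phi>_pow b_def\<close>)
  have "g [^] i = inv k \<otimes> inv (y [^] i) \<otimes> k" for i :: nat
   unfolding g_def using conj_pow[of "inv y" k i] kG yG by (simp add: nat_pow_inv)
  then have "w = inv k \<otimes> y [^] j \<otimes> k" using kG yG by (simp add: w_def inv_mult_group m_assoc)
  then have "k \<otimes> w = y [^] j \<otimes> k" using kG yG by (simp add: m_assoc)
  then have kw: "\<phi> k * \<phi> w = \<phi> y ^ j * \<phi> k" using kG wG yG by (metis \<phi>_mult \<phi>_pow nat_pow_closed)
  have jE: "j * e dvd E"
  proof -
   have "j dvd fact N" unfolding j_def by (rule fact_dvd) (simp add: N_def trans_le_add2 fact_ge_self)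
   then show ?thesis unfolding E_def by (simp add: mult.assoc mult_dvd_mono mult.commute dvd_mult)
  qed
  have spec_w: "\<exists>c\<in>L. \<nu> = c ^ j" if \<nu>: "\<nu> \<in> spec (\<phi> w)" for \<nu>
  proof -
   obtain A where A: "A \<noteq> 0" "\<phi> w * A = sc \<nu> A" using \<nu> by (auto simp: spec_def)
   have "\<phi> y ^ j * (\<phi> k * A) = \<phi> k * (\<phi> w * A)" using kw by (simp add: mult.assoc[symmetric])
   then have "\<phi> y ^ j * (\<phi> k * A) = sc \<nu> (\<phi> k * A)" using A by simp
   then have "\<nu> \<in> spec (\<phi> y ^ j)" using \<phi>_unit_nonzero[OF kG A(1)] by (auto simp: spec_def)
   then show ?thesis using spec_power[OF yR, of j] by (auto simp: L_def)
  qed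
  have "\<exists>c'\<in>L. p c' * \<phi> k * p c = \<phi> k * p c" if c: "c \<in> L" for c
  proof -
   obtain \<nu> where \<nu>: "\<nu> \<in> spec (\<phi> w)" "proj (\<phi> w) \<nu> * p c \<noteq> 0" using proj_decomp_ex[OF wR p_nz[OF c]] by blast
   obtain c' where c': "c' \<in> L" "\<nu> = c' ^ j" using spec_w[OF \<nu>(1)] by blast
   have pp: "p c * proj (\<phi> w) \<kappa> = proj (\<phi> w) \<kappa> * p c" for \<kappa>
    by (rule proj_facts(5)[OF wR]) (use wp[OF c] in simp)
   have eig: "\<exists>B. B \<noteq> 0 \<and> p c * B = B \<and> \<phi> w * B = sc \<kappa> B"
    if \<kappa>: "\<kappa> \<in> spec (\<phi> w)" "proj (\<phi> w) \<kappa> * p c \<noteq> 0" for \<kappa>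
   proof (rule eigenvector_in[OF wR wp[OF c, symmetric] \<kappa>(2) _ _ \<kappa>(1)])
    have "p c * (proj (\<phi> w) \<kappa> * p c) = proj (\<phi> w) \<kappa> * (p c * p c)" using pp[of \<kappa>] by (simp add: mult.assoc[symmetric])
    then show "p c * (proj (\<phi> w) \<kappa> * p c) = proj (\<phi> w) \<kappa> * p c" using p_idem[OF c] by simp
    show "proj (\<phi> w) \<kappa> * (proj (\<phi> w) \<kappa> * p c) = proj (\<phi> w) \<kappa> * p c"
     using proj_facts(3)[OF wR \<kappa>(1)] by (simp add: mult.assoc[symmetric])
   qed
   \<comment> \<open>The eigenvalues of \<open>w\<close> are \<open>j\<close>-th powers of elements
     of \<open>L\<close>, and on one block their \<open>e\<close>-th powers agree. As
     \<open>j * e\<close> separates \<open>L\<close>, only one eigenvalue is left on the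
     block.\<close>
   have "proj (\<phi> w) \<kappa> * p c = 0" if \<kappa>: "\<kappa> \<in> spec (\<phi> w)" "\<kappa> \<noteq> \<nu>" for \<kappa>
   proof (rule ccontr)
    assume "proj (\<phi> w) \<kappa> * p c \<noteq> 0"
    then obtain B where B: "B \<noteq> 0" "p c * B = B" "\<phi> w * B = sc \<kappa> B" using eig[OF \<kappa>(1)] by blast
    obtain B' where B': "B' \<noteq> 0" "p c * B' = B'" "\<phi> w * B' = sc \<nu> B'" using eig[OF \<nu>] by blast
    have "\<kappa> ^ e = \<nu> ^ e" by (rule unique[OF wH wp c B B'])
    moreover obtain c1 where c1: "c1 \<in> L" "\<kappa> = c1 ^ j" using spec_w[OF \<kappa>(1)] by blast
    ultimately have "c1 ^ (j * e) = c' ^ (j * e)" using c' by (simp add: power_mult)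
    then have "c1 = c'" using inj_dvd[OF jE] c1 c' by (auto dest: inj_onD)
    then show False using c1 c' \<kappa> by simp
   qed
   then have "(\<Sum>\<kappa>\<in>spec (\<phi> w). proj (\<phi> w) \<kappa> * p c) = proj (\<phi> w) \<nu> * p c"
    using spec_annihilates(1)[OF wR] \<nu>(1) by (subst sum.remove[of _ \<nu>]) (auto intro!: sum.neutral)
   then have pc: "proj (\<phi> w) \<nu> * p c = p c" using proj_decomp[OF wR, of "p c"] by simp
   then have w0: "(\<phi> w - sc \<nu> 1) ^ d * p c = 0"
    using proj_facts(4)[OF wR \<nu>(1)] by (metis mult.assoc mult_zero_left)
   \<comment> \<open>Through \<open>k w = y^j k\<close>, the generalised eigenspace of
     \<open>w\<close> is carried by \<open>k\<close> into one of \<open>y^j\<close>, which by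
     \<open>proj_generalised\<close> is a block of \<open>y\<close>.\<close>
   have "(\<phi> y ^ j - sc \<nu> 1) ^ n * \<phi> k = \<phi> k * (\<phi> w - sc \<nu> 1) ^ n" for n
   proof (induction n)
    case (Suc n)
    have 1: "(\<phi> y ^ j - sc \<nu> 1) * \<phi> k = \<phi> k * (\<phi> w - sc \<nu> 1)" using kw by (simp add: algebra_simps)
    have "(\<phi> y ^ j - sc \<nu> 1) ^ Suc n * \<phi> k = (\<phi> y ^ j - sc \<nu> 1) * ((\<phi> y ^ j - sc \<nu> 1) ^ n * \<phi> k)"
     by (simp only: power_Suc mult.assoc)
    also have "\<dots> = ((\<phi> y ^ j - sc \<nu> 1) * \<phi> k) * (\<phi> w - sc \<nu> 1) ^ n" unfolding Suc by (simp only: mult.assoc)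
    also have "\<dots> = \<phi> k * (\<phi> w - sc \<nu> 1) ^ Suc n" unfolding 1 by (simp only: power_Suc mult.assoc)
    finally show ?case .
   qed simp
   then have "(\<phi> y ^ j - sc (c' ^ j) 1) ^ d * (\<phi> k * p c) = 0"
    using w0 unfolding c'(2) by (metis mult.assoc mult_zero_right)
   moreover have "inj_on (\<lambda>\<mu>. \<mu> ^ j) (spec (\<phi> y))"
    using inj_dvd[of j] jE by (metis L_def dvd_mult_left)
   ultimately have "p c' * (\<phi> k * p c) = \<phi> k * p c"
    using proj_generalised[OF yR] c'(1) unfolding p_def L_def by blast
   then show ?thesis using c'(1) by (auto simp: mult.assoc)
  qed
  then show ?thesis by (simp add: perm_def)
 qed
 have perm_one: "perm 1" unfolding perm_def using p_idem by auto
 have back_to: "perm (\<phi> v)" if v: "v \<in> H" and n: "engel_comm G v y n = \<one>" for v n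
 proof -
  have vH: "engel_comm G v y m \<in> H" for m by (rule engel_comm_in_subgroup[OF H.subgroup_axioms v y])
  have "perm (\<phi> (engel_comm G v y (n - m)))" for m
  proof (induction m)
   case 0
   show ?case using n perm_one \<phi>_one by simp
  next
   case (Suc m)
   show ?case
   proof (cases "m < n")
    case True
    then have "n - m = Suc (n - Suc m)" by simp
    then have "perm (\<phi> (comm G (engel_comm G v y (n - Suc m)) y))" using Suc by simp
    then show ?thesis by (rule step[OF vH])
   next
    case False
    then show ?thesis using Suc by simp
   qed
  qed
  from this[of n] show ?thesis by simp
 qed
 \<comment> \<open>For a prescribed map \<open>f\<close> of blocks the condition is linear in
   \<open>\<phi> v\<close>, and there are only finitely many \<open>f\<close>; hence one
   \<open>f\<close> serves all of \<open>H\<close>.\<close>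
 define Cl where "Cl f = {v \<in> carrier G. \<forall>l\<in>(\<lambda>c x. p (f c) * x * p c - x * p c) ` L. l (\<phi> v) = 0}" for f
 have Cl_iff: "v \<in> Cl f \<longleftrightarrow> v \<in> carrier G \<and> (\<forall>c\<in>L. p (f c) * \<phi> v * p c = \<phi> v * p c)" for v f
  by (auto simp: Cl_def)
 have "generic (\<lambda>v. v \<in> \<Union>(Cl ` (L \<rightarrow>\<^sub>E L)))"
 proof (rule generic_mono[OF generic_engel_one[OF y]])
  fix v assume v: "v \<in> H" and "\<exists>n. engel_comm G v y n = \<one>"
  then have "perm (\<phi> v)" using back_to by blast
  then obtain f where f: "\<And>c. c \<in> L \<Longrightarrow> f c \<in> L \<and> p (f c) * \<phi> v * p c = \<phi> v * p c"
   unfolding perm_def by metis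
  have "v \<in> Cl (restrict f L)" using v f by (auto simp: Cl_iff)
  moreover have "restrict f L \<in> L \<rightarrow>\<^sub>E L" using f by auto
  ultimately show "v \<in> \<Union>(Cl ` (L \<rightarrow>\<^sub>E L))" by blast
 qed
 moreover have "finite (Cl ` (L \<rightarrow>\<^sub>E L))" using finL by (intro finite_imageI finite_PiE) auto
 moreover have "closed Y" if YC: "Y \<in> Cl ` (L \<rightarrow>\<^sub>E L)" for Y
 proof -
  obtain f where "Y = Cl f" using YC by blast
  then show ?thesis unfolding Cl_def
   by (simp only:) (rule closed_linear, auto simp: algebra_simps sc_diff_right)
 qed
 ultimately obtain Y where Y: "Y \<in> Cl ` (L \<rightarrow>\<^sub>E L)" "H \<subseteq> Y" using generic_cover by metis
 then obtain f where f: "f \<in> L \<rightarrow>\<^sub>E L" "H \<subseteq> Cl f" by blast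
 \<comment> \<open>The same \<open>f\<close> describes the action of the identity element, which
   fixes every block.\<close>
 have fc: "f c = c" if c: "c \<in> L" for c
 proof (rule ccontr)
  assume "f c \<noteq> c"
  then have "p (f c) * p c = 0" using p_orth f(1) c by (auto simp: PiE_iff)
  moreover have "\<one> \<in> Cl f" using f(2) H.one_closed by blast
  then have "p (f c) * p c = p c" using c \<phi>_one by (simp add: Cl_iff)
  ultimately show False using p_nz[OF c] by simp
 qed
 have Hp: "\<phi> w * p c = p c * \<phi> w" if w: "w \<in> H" and c: "c \<in> L" for w c
 proof (rule fixes_commutes[OF _ c])
  fix c assume "c \<in> L"
  then show "p c * \<phi> w * p c = \<phi> w * p c" using f(2) w fc Cl_iff by fastforce
 qed
 have nil: "\<exists>\<nu>. (\<phi> w ^ e - sc \<nu> 1) ^ d * p c = 0" if w: "w \<in> H" and c: "c \<in> L" for w c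
 proof -
  have wR: "\<phi> w \<in> R" using \<phi>_R w by blast
  have eig: "\<exists>B. B \<noteq> 0 \<and> p c * B = B \<and> \<phi> w * B = sc \<kappa> B"
   if \<kappa>: "\<kappa> \<in> spec (\<phi> w)" "proj (\<phi> w) \<kappa> * p c \<noteq> 0" for \<kappa>
  proof (rule eigenvector_in[OF wR Hp[OF w c, symmetric] \<kappa>(2) _ _ \<kappa>(1)])
   have "p c * (proj (\<phi> w) \<kappa> * p c) = proj (\<phi> w) \<kappa> * (p c * p c)"
    using proj_facts(5)[OF wR Hp[OF w c, symmetric], of \<kappa>] by (simp add: mult.assoc[symmetric])
   then show "p c * (proj (\<phi> w) \<kappa> * p c) = proj (\<phi> w) \<kappa> * p c" using p_idem[OF c] by simp
   show "proj (\<phi> w) \<kappa> * (proj (\<phi> w) \<kappa> * p c) = proj (\<phi> w) \<kappa> * p c"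
    using proj_facts(3)[OF wR \<kappa>(1)] by (simp add: mult.assoc[symmetric])
  qed
  obtain \<nu> where \<nu>: "\<nu> \<in> spec (\<phi> w)" "proj (\<phi> w) \<nu> * p c \<noteq> 0" using proj_decomp_ex[OF wR p_nz[OF c]] by blast
  have "(\<phi> w ^ e - sc (\<nu> ^ e) 1) ^ d * (proj (\<phi> w) \<kappa> * p c) = 0" if \<kappa>: "\<kappa> \<in> spec (\<phi> w)" for \<kappa>
  proof (cases "proj (\<phi> w) \<kappa> * p c = 0")
   case False
   obtain B where B: "B \<noteq> 0" "p c * B = B" "\<phi> w * B = sc \<kappa> B" using eig[OF \<kappa> False] by blast
   obtain B' where B': "B' \<noteq> 0" "p c * B' = B'" "\<phi> w * B' = sc \<nu> B'" using eig[OF \<nu>] by blast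
   have ee: "\<kappa> ^ e = \<nu> ^ e" by (rule unique[OF w Hp[OF w] c B B'])
   have "(\<phi> w ^ e - sc (\<kappa> ^ e) 1) ^ d * (proj (\<phi> w) \<kappa> * p c) = 0"
    by (rule power_shift_kills) (use proj_facts(4)[OF wR \<kappa>] in \<open>simp add: mult.assoc[symmetric]\<close>)
   then show ?thesis unfolding ee .
  qed simp
  then have "(\<Sum>\<kappa>\<in>spec (\<phi> w). (\<phi> w ^ e - sc (\<nu> ^ e) 1) ^ d * (proj (\<phi> w) \<kappa> * p c)) = 0" by (intro sum.neutral) blast
  then have "(\<phi> w ^ e - sc (\<nu> ^ e) 1) ^ d * p c = 0"
   using proj_decomp[OF wR, of "p c"] by (simp add: sum_distrib_left[symmetric])
  then show ?thesis by blast
 qed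
 show thesis by (rule that[OF finL e p_sum p_R p_idem p_orth Hp nil])
qed

end


subsection \<open>Traces on quotients of invariant subspaces\<close>

locale trace_space = vector_space scale for scale :: "'a::field \<Rightarrow> 'b::ab_group_add \<Rightarrow> 'b"
begin

definition srank :: "'b set \<Rightarrow> nat" where
 "srank S = Max (card ` {B. B \<subseteq> S \<and> independent B})"

lemma srank_less:
 assumes fin: "finite B0" and S': "S' \<subseteq> span B0" and S: "subspace S" "S \<subset> S'"
 shows "srank S < srank S'"
proof -
 have bound: "finite B \<and> card B \<le> card B0" if "B \<subseteq> S'" "independent B" for B
  by (rule independent_span_bound[OF fin that(2)]) (use that S' in blast)
 have finS: "finite (card ` {B. B \<subseteq> T \<and> independent B})" if "T \<subseteq> S'" for T
  by (rule finite_subset[of _ "{..card B0}"]) (use bound that in auto)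
 have "srank S \<in> card ` {B. B \<subseteq> S \<and> independent B}"
  unfolding srank_def by (rule Max_in[OF finS]) (use S independent_empty in auto)
 then obtain B where B: "B \<subseteq> S" "independent B" "card B = srank S" by auto
 obtain v where v: "v \<in> S'" "v \<notin> S" using S by blast
 have "v \<notin> span B" using span_minimal[OF B(1) S(1)] v by blast
 then have ind: "independent (insert v B)" and nB: "v \<notin> B"
  using B(2) by (auto simp: independent_insert intro: span_base)
 have "card (insert v B) \<le> srank S'"
  unfolding srank_def by (rule Max_ge[OF finS]) (use ind B v S in auto)
 moreover have "finite B" using bound B S by blast
 ultimately show ?thesis using B(3) nB by simp
qed

lemma srank_le:
 assumes fin: "finite B0" and S': "S' \<subseteq> span B0"
 shows "srank S' \<le> card B0"
proof -
 have bound: "finite B \<and> card B \<le> card B0" if "B \<subseteq> S'" "independent B" for B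
  by (rule independent_span_bound[OF fin that(2)]) (use that S' in blast)
 have finS: "finite (card ` {B. B \<subseteq> S' \<and> independent B})"
  by (rule finite_subset[of _ "{..card B0}"]) (use bound in auto)
 have "srank S' \<in> card ` {B. B \<subseteq> S' \<and> independent B}"
  unfolding srank_def by (rule Max_in[OF finS]) (use independent_empty in auto)
 then show ?thesis using bound by auto
qed

definition linop :: "('b \<Rightarrow> 'b) \<Rightarrow> bool" where
 "linop T \<longleftrightarrow> (\<forall>x y. T (x + y) = T x + T y) \<and> (\<forall>c x. T (scale c x) = scale c (T x))"

lemma linop_simps:
 assumes "linop T"
 shows "T (x + y) = T x + T y" "T (scale c x) = scale c (T x)" "T 0 = 0" "T (x - y) = T x - T y"
  "T (\<Sum>i\<in>I. f i) = (\<Sum>i\<in>I. T (f i))"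
proof -
 show a: "T (x + y) = T x + T y" for x y using assms by (simp add: linop_def)
 show s: "T (scale c x) = scale c (T x)" for c x using assms by (simp add: linop_def)
 show z: "T 0 = 0" using s[of 0 0] by simp
 show "T (x - y) = T x - T y" using a[of "x - y" y] by simp
 show "T (\<Sum>i\<in>I. f i) = (\<Sum>i\<in>I. T (f i))"
  by (induction I rule: infinite_finite_induct) (auto simp: a z)
qed

lemma linop_id: "linop (\<lambda>x. x)" by (simp add: linop_def)

lemma linop_add: "linop S \<Longrightarrow> linop T \<Longrightarrow> linop (\<lambda>x. S x + T x)"
 by (simp add: linop_def scale_right_distrib algebra_simps)

lemma linop_scale: "linop T \<Longrightarrow> linop (\<lambda>x. scale c (T x))"
 by (simp add: linop_def scale_right_distrib scale_left_commute)

definition pev :: "'a poly \<Rightarrow> ('b \<Rightarrow> 'b) \<Rightarrow> 'b \<Rightarrow> 'b" where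
 "pev p T v = fold_coeffs (\<lambda>a b. scale a v + T b) p 0"

lemma pev_0 [simp]: "pev 0 T v = 0"
 by (simp add: pev_def)

lemma pev_pCons: "linop T \<Longrightarrow> pev (pCons a p) T v = scale a v + T (pev p T v)"
 by (cases "p = 0 \<and> a = 0") (auto simp: pev_def linop_simps)

lemma pev_add: "linop T \<Longrightarrow> pev (p + q) T v = pev p T v + pev q T v"
 by (induction p q rule: poly_induct2) (auto simp: pev_pCons linop_simps scale_left_distrib)

lemma pev_smult: "linop T \<Longrightarrow> pev (smult c p) T v = scale c (pev p T v)"
 by (induction p) (auto simp: pev_pCons linop_simps scale_right_distrib)

lemma pev_sum: "linop T \<Longrightarrow> pev (\<Sum>i\<in>I. f i) T v = (\<Sum>i\<in>I. pev (f i) T v)"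
 by (induction I rule: infinite_finite_induct) (auto simp: pev_add)

lemma pev_monom: "linop T \<Longrightarrow> pev (monom c n) T v = scale c ((T ^^ n) v)"
 by (induction n) (auto simp: monom_0 monom_Suc pev_pCons linop_simps)

lemma pev_root:
 assumes "linop T"
 shows "pev ([:- \<mu>, 1:] * g) T v = T (pev g T v) - scale \<mu> (pev g T v)"
proof -
 have "[:- \<mu>, 1:] * g = smult (- \<mu>) g + pCons 0 g" by simp
 then show ?thesis using assms by (simp only: pev_add pev_smult pev_pCons) simp
qed

lemma pev_in:
 assumes "linop T" "subspace S" "\<And>x. x \<in> S \<Longrightarrow> T x \<in> S" "v \<in> S"
 shows "pev p T v \<in> S"
 by (induction p) (use assms in \<open>auto simp: pev_pCons intro: subspace_0 subspace_add subspace_scale\<close>)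

text \<open>Among the iterates of \<open>v\<close> up to \<open>card B0\<close>, either two coincide
  or the set of them is linearly dependent. The first case is separate because a repetition
  disappears in the set.\<close>

lemma pev_annihilator:
 assumes T: "linop T" and fin: "finite B0" and v: "\<And>n. (T ^^ n) v \<in> span B0"
 obtains p where "p \<noteq> 0" "degree p \<le> card B0" "pev p T v = 0"
proof (cases "inj_on (\<lambda>n. (T ^^ n) v) {..card B0}")
 case False
 then obtain i j where ij: "i \<le> card B0" "j \<le> card B0" "i \<noteq> j" "(T ^^ i) v = (T ^^ j) v"
  by (auto simp: inj_on_def)
 define p where "p = monom (1::'a) i + monom (- 1) j"
 have "coeff p i = 1" using ij by (simp add: p_def)
 then have "p \<noteq> 0" by auto
 moreover have "degree p \<le> card B0" unfolding p_def
  by (rule degree_add_le) (use ij in \<open>auto intro: order.trans[OF degree_monom_le]\<close>)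
 moreover have "pev p T v = 0" using ij(4) T by (simp add: p_def pev_add pev_monom)
 ultimately show ?thesis using that by blast
next
 case True
 let ?S = "(\<lambda>n. (T ^^ n) v) ` {..card B0}"
 have cS: "card ?S = Suc (card B0)" using card_image[OF True] by simp
 have "\<not> independent ?S"
 proof
  assume "independent ?S"
  then have "card ?S \<le> card B0" using independent_span_bound[OF fin, of ?S] v by auto
  then show False using cS by simp
 qed
 then obtain u where u: "\<exists>w\<in>?S. u w \<noteq> 0" "(\<Sum>w\<in>?S. scale (u w) w) = 0"
  by (subst (asm) dependent_finite) auto
 define p where "p = (\<Sum>n\<le>card B0. monom (u ((T ^^ n) v)) n)"
 have cf: "coeff p n = u ((T ^^ n) v)" if "n \<le> card B0" for n
  using that by (simp add: p_def coeff_sum)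
 obtain n where "n \<le> card B0" "u ((T ^^ n) v) \<noteq> 0" using u(1) by auto
 then have "p \<noteq> 0" using cf by force
 moreover have "degree p \<le> card B0" unfolding p_def
  by (rule degree_sum_le) (auto intro: order.trans[OF degree_monom_le])
 moreover have "pev p T v = (\<Sum>w\<in>?S. scale (u w) w)"
  unfolding sum.reindex[OF True] by (simp add: p_def pev_sum[OF T] pev_monom[OF T])
 ultimately show ?thesis using that u(2) by simp
qed

section \<open>Bases, coordinates and traces of sections\<close>

definition invariant :: "('b \<Rightarrow> 'b) \<Rightarrow> 'b set \<Rightarrow> bool" where
 "invariant T S \<longleftrightarrow> (\<forall>x\<in>S. T x \<in> S)"

text \<open>Representatives in \<open>W\<close> of a basis of the section \<open>W / U\<close>,
  stated without forming the quotient space. Correspondingly \<open>qco\<close> gives coordinates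
  and \<open>qtr\<close> the trace of the operator induced on the section.\<close>

definition qbasis :: "'b set \<Rightarrow> 'b set \<Rightarrow> nat \<Rightarrow> (nat \<Rightarrow> 'b) \<Rightarrow> bool" where
 "qbasis U W k b \<longleftrightarrow> (\<forall>i<k. b i \<in> W) \<and> (\<forall>x\<in>W. \<exists>c. x - (\<Sum>i<k. scale (c i) (b i)) \<in> U)
   \<and> (\<forall>c. (\<Sum>i<k. scale (c i) (b i)) \<in> U \<longrightarrow> (\<forall>i<k. c i = 0))"

definition qco :: "'b set \<Rightarrow> nat \<Rightarrow> (nat \<Rightarrow> 'b) \<Rightarrow> 'b \<Rightarrow> nat \<Rightarrow> 'a" where
 "qco U k b x = (SOME c. x - (\<Sum>i<k. scale (c i) (b i)) \<in> U)"

definition qtr :: "'b set \<Rightarrow> nat \<Rightarrow> (nat \<Rightarrow> 'b) \<Rightarrow> ('b \<Rightarrow> 'b) \<Rightarrow> 'a" where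
 "qtr U k b T = (\<Sum>i<k. qco U k b (T (b i)) i)"

lemma qbasis_unique: "\<lbrakk>qbasis U W k b; (\<Sum>i<k. scale (c i) (b i)) \<in> U; i < k\<rbrakk> \<Longrightarrow> c i = 0"
 unfolding qbasis_def by blast

lemma qco_in:
 assumes "qbasis U W k b" "x \<in> W"
 shows "x - (\<Sum>i<k. scale (qco U k b x i) (b i)) \<in> U"
proof -
 have "\<exists>c. x - (\<Sum>i<k. scale (c i) (b i)) \<in> U" using assms by (simp add: qbasis_def)
 then show ?thesis unfolding qco_def by (rule someI_ex)
qed

lemma qco_eq:
 assumes U: "subspace U" and b: "qbasis U W k b" and x: "x \<in> W" "x - (\<Sum>i<k. scale (c i) (b i)) \<in> U" and i: "i < k"
 shows "qco U k b x i = c i"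
proof -
 have "(x - (\<Sum>i<k. scale (c i) (b i))) - (x - (\<Sum>i<k. scale (qco U k b x i) (b i))) \<in> U"
  using subspace_diff[OF U x(2) qco_in[OF b x(1)]] .
 then have "(\<Sum>i<k. scale (qco U k b x i - c i) (b i)) \<in> U"
  by (simp add: sum_subtractf scale_left_diff_distrib)
 from qbasis_unique[OF b this i] show ?thesis by simp
qed

lemma qco_add:
 assumes U: "subspace U" and W: "subspace W" and b: "qbasis U W k b" and xy: "x \<in> W" "y \<in> W" and i: "i < k"
 shows "qco U k b (x + y) i = qco U k b x i + qco U k b y i"
proof (rule qco_eq[OF U b _ _ i])
 show "x + y \<in> W" by (rule subspace_add[OF W xy])
 have "(x - (\<Sum>i<k. scale (qco U k b x i) (b i))) + (y - (\<Sum>i<k. scale (qco U k b y i) (b i))) \<in> U"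
  by (rule subspace_add[OF U qco_in[OF b xy(1)] qco_in[OF b xy(2)]])
 then show "x + y - (\<Sum>i<k. scale (qco U k b x i + qco U k b y i) (b i)) \<in> U"
  by (simp add: scale_left_distrib sum.distrib algebra_simps)
qed

lemma qco_scale:
 assumes U: "subspace U" and W: "subspace W" and b: "qbasis U W k b" and x: "x \<in> W" and i: "i < k"
 shows "qco U k b (scale c x) i = c * qco U k b x i"
proof (rule qco_eq[OF U b _ _ i])
 show "scale c x \<in> W" by (rule subspace_scale[OF W x])
 have "scale c (x - (\<Sum>i<k. scale (qco U k b x i) (b i))) \<in> U" by (rule subspace_scale[OF U qco_in[OF b x]])
 then show "scale c x - (\<Sum>i<k. scale (c * qco U k b x i) (b i)) \<in> U"
  by (simp add: scale_right_diff_distrib scale_sum_right)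
qed

lemma qco_sum:
 assumes U: "subspace U" and W: "subspace W" and b: "qbasis U W k b" and i: "i < k"
  and x: "\<And>j. j \<in> J \<Longrightarrow> x j \<in> W" and J: "finite J"
 shows "qco U k b (\<Sum>j\<in>J. scale (c j) (x j)) i = (\<Sum>j\<in>J. c j * qco U k b (x j) i)"
 using J x
proof (induction J rule: finite_induct)
 case empty
 have "qco U k b 0 i = 0" by (rule qco_eq[OF U b subspace_0[OF W] _ i]) (simp add: subspace_0[OF U])
 then show ?case by simp
next
 case (insert j J)
 then show ?case
  by (simp add: qco_add[OF U W b] qco_scale[OF U W b] i subspace_scale[OF W] subspace_sum[OF W])
qed

lemma qco_cong:
 assumes U: "subspace U" and b: "qbasis U W k b" and x: "x \<in> W" "y \<in> W" "x - y \<in> U" and i: "i < k"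
 shows "qco U k b x i = qco U k b y i"
proof (rule qco_eq[OF U b x(1) _ i])
 have "(x - y) + (y - (\<Sum>i<k. scale (qco U k b y i) (b i))) \<in> U"
  by (rule subspace_add[OF U x(3) qco_in[OF b x(2)]])
 then show "x - (\<Sum>i<k. scale (qco U k b y i) (b i)) \<in> U" by simp
qed

text \<open>With \<open>M\<close> expressing \<open>b\<close> through \<open>b'\<close> modulo
  \<open>U\<close>, both traces are evaluations of one double sum in the two possible
  orders.\<close>

lemma qtr_basis_independent:
 assumes U: "subspace U" "U \<subseteq> W" and W: "subspace W" and b: "qbasis U W k b" and b': "qbasis U W k' b'"
  and T: "linop T" "invariant T U" "invariant T W"
 shows "qtr U k b T = qtr U k' b' T"
proof -
 have bW: "b i \<in> W" if "i < k" for i using b that by (simp add: qbasis_def)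
 have b'W: "b' i \<in> W" if "i < k'" for i using b' that by (simp add: qbasis_def)
 have TW: "T x \<in> W" if "x \<in> W" for x using T(3) that by (simp add: invariant_def)
 define M where "M i j = qco U k' b' (b i) j" for i j
 have 1: "qco U k b (T (b i)) i = (\<Sum>j<k'. M i j * qco U k b (T (b' j)) i)" if i: "i < k" for i
 proof -
  have "T (b i - (\<Sum>j<k'. scale (M i j) (b' j))) \<in> U"
   using qco_in[OF b' bW[OF i]] T(2) by (simp add: invariant_def M_def)
  then have d: "T (b i) - (\<Sum>j<k'. scale (M i j) (T (b' j))) \<in> U" by (simp add: linop_simps[OF T(1)])
  have "qco U k b (T (b i)) i = qco U k b (\<Sum>j<k'. scale (M i j) (T (b' j))) i"
   by (rule qco_cong[OF U(1) b TW[OF bW[OF i]] _ d i]) (use W TW b'W in \<open>auto intro!: subspace_sum subspace_scale\<close>)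
  also have "\<dots> = (\<Sum>j<k'. M i j * qco U k b (T (b' j)) i)"
   by (rule qco_sum[OF U(1) W b i]) (use TW b'W in auto)
  finally show ?thesis .
 qed
 have 2: "(\<Sum>i<k. M i j * qco U k b (T (b' j)) i) = qco U k' b' (T (b' j)) j" if j: "j < k'" for j
 proof -
  have "qco U k' b' (T (b' j)) j = qco U k' b' (\<Sum>i<k. scale (qco U k b (T (b' j)) i) (b i)) j"
   by (rule qco_cong[OF U(1) b' TW[OF b'W[OF j]] _ qco_in[OF b TW[OF b'W[OF j]]] j])
    (use W bW in \<open>auto intro!: subspace_sum subspace_scale\<close>)
  also have "\<dots> = (\<Sum>i<k. qco U k b (T (b' j)) i * M i j)"
   unfolding M_def by (rule qco_sum[OF U(1) W b' j]) (use bW in auto)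
  finally show ?thesis by (simp add: mult.commute)
 qed
 have "qtr U k b T = (\<Sum>i<k. \<Sum>j<k'. M i j * qco U k b (T (b' j)) i)" by (simp add: qtr_def 1)
 also have "\<dots> = (\<Sum>j<k'. \<Sum>i<k. M i j * qco U k b (T (b' j)) i)" by (rule sum.swap)
 also have "\<dots> = qtr U k' b' T" by (simp add: qtr_def 2)
 finally show ?thesis .
qed

lemma qtr_add:
 assumes U: "subspace U" and W: "subspace W" and b: "qbasis U W k b" and ST: "invariant S W" "invariant T W"
 shows "qtr U k b (\<lambda>x. S x + T x) = qtr U k b S + qtr U k b T"
proof -
 have "S (b i) \<in> W" "T (b i) \<in> W" if "i < k" for i using b ST that by (auto simp: qbasis_def invariant_def)
 then show ?thesis by (simp add: qtr_def qco_add[OF U W b] sum.distrib)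
qed

lemma qtr_scale:
 assumes U: "subspace U" and W: "subspace W" and b: "qbasis U W k b" and T: "invariant T W"
 shows "qtr U k b (\<lambda>x. scale c (T x)) = c * qtr U k b T"
proof -
 have "T (b i) \<in> W" if "i < k" for i using b T that by (auto simp: qbasis_def invariant_def)
 then show ?thesis by (simp add: qtr_def qco_scale[OF U W b] sum_distrib_left)
qed

lemma qbasis_bound:
 assumes U: "subspace U" and b: "qbasis U W k b" and W: "W \<subseteq> span B0" "finite B0"
 shows "k \<le> card B0"
proof -
 have uniq: "c i = 0" if "(\<Sum>i<k. scale (c i) (b i)) = 0" "i < k" for c i
  by (rule qbasis_unique[OF b _ that(2)]) (use that(1) subspace_0[OF U] in simp)
 have inj: "inj_on b {..<k}"
 proof (rule inj_onI, rule ccontr)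
  fix i j assume ij: "i \<in> {..<k}" "j \<in> {..<k}" "b i = b j" "i \<noteq> j"
  let ?c = "\<lambda>l. if l = i then 1 else if l = j then - 1 else (0::'a)"
  have "(\<Sum>l<k. scale (?c l) (b l)) = (\<Sum>l\<in>{i, j}. scale (?c l) (b l))"
   by (rule sum.mono_neutral_right) (use ij in auto)
  also have "\<dots> = 0" using ij by simp
  finally have "?c i = 0" by (rule uniq[of ?c]) (use ij in simp)
  then show False by simp
 qed
 have "independent (b ` {..<k})"
 proof (rule independent_if_scalars_zero)
  fix f x assume 0: "(\<Sum>x\<in>b ` {..<k}. scale (f x) x) = 0" and "x \<in> b ` {..<k}"
  then obtain i where i: "i < k" "x = b i" by auto
  have "(\<Sum>i<k. scale (f (b i)) (b i)) = 0" using 0 by (simp add: sum.reindex[OF inj])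
  then show "f x = 0" using uniq[of "\<lambda>i. f (b i)" i] i by simp
 qed simp
 then have "card (b ` {..<k}) \<le> card B0"
  using independent_span_bound[OF W(2)] b W(1) by (fastforce simp: qbasis_def)
 then show ?thesis by (simp add: card_image[OF inj])
qed

end

locale closed_vector_space = trace_space scale
 for scale :: "'k::alg_closed_field \<Rightarrow> 'v::ab_group_add \<Rightarrow> 'v"
begin

text \<open>Among nonzero polynomials \<open>p\<close> with \<open>p(T) v\<close> in
  \<open>U\<close> one of least degree is taken. Splitting off a linear factor
  \<open>X - \<mu>\<close> leaves \<open>g\<close>, and \<open>g(T) v\<close> is outside
  \<open>U\<close> by minimality.\<close>

lemma quotient_eigenvector:
 assumes T: "linop T" and U: "subspace U" and S: "subspace S" "invariant T S" "S \<subseteq> span B0" "finite B0"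
  and v: "v \<in> S" "v \<notin> U"
 obtains w \<mu> where "w \<in> S" "w \<notin> U" "T w - scale \<mu> w \<in> U"
proof -
 have TS: "T x \<in> S" if "x \<in> S" for x using S(2) that by (simp add: invariant_def)
 have "(T ^^ n) v \<in> S" for n by (induction n) (use v TS in auto)
 then obtain p0 where p0: "p0 \<noteq> 0" "pev p0 T v = 0"
  using pev_annihilator[OF T S(4), of v] S(3) by blast
 define P where "P n \<longleftrightarrow> (\<exists>p. p \<noteq> 0 \<and> degree p = n \<and> pev p T v \<in> U)" for n
 have "P (degree p0)" using p0 subspace_0[OF U] by (auto simp: P_def)
 define n where "n = (LEAST n. P n)"
 have "P n" unfolding n_def using \<open>P (degree p0)\<close> by (rule LeastI)
 then obtain p where p: "p \<noteq> 0" "degree p = n" "pev p T v \<in> U" by (auto simp: P_def)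
 have "degree p \<noteq> 0"
 proof
  assume "degree p = 0"
  then obtain a where a: "p = [:a:]" by (rule degree_eq_zeroE)
  then have "a \<noteq> 0" using p by simp
  have "scale a v \<in> U" using p a T by (simp add: pev_pCons linop_simps)
  then have "scale (inverse a) (scale a v) \<in> U" by (rule subspace_scale[OF U])
  then show False using v \<open>a \<noteq> 0\<close> by simp
 qed
 then obtain \<mu> where "poly p \<mu> = 0" using alg_closed_imp_poly_has_root[of p] by auto
 then obtain g where g: "p = [:- \<mu>, 1:] * g" by (metis dvdE poly_eq_0_iff_dvd)
 have g0: "g \<noteq> 0" using g p by auto
 have "degree p = Suc (degree g)" unfolding g using g0 by (subst degree_mult_eq) auto
 then have "\<not> P (degree g)" using not_less_Least[of "degree g" P] p(2) unfolding n_def by simp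
 then have "pev g T v \<notin> U" using g0 by (auto simp: P_def)
 moreover have "T (pev g T v) - scale \<mu> (pev g T v) \<in> U" using p(3) pev_root[OF T, of \<mu> g v] g by simp
 moreover have "pev g T v \<in> S" by (rule pev_in[OF T S(1) TS v(1)])
 ultimately show ?thesis using that by blast
qed

text \<open>An eigenvector modulo \<open>U\<close> is adjoined repeatedly. The intermediate space
  \<open>V\<close> at stage \<open>i\<close> lies in the sum of \<open>U\<close> and the span of the
  earlier basis vectors, so \<open>T\<close> is triangular modulo \<open>U\<close> with diagonal
  \<open>z\<close>, and each \<open>z i\<close> is an eigenvalue on a quotient by an invariant
  space.\<close>

lemma flag:
 assumes T: "linop T" and W: "subspace W" "invariant T W" "W \<subseteq> span B0" "finite B0"
  and U: "subspace U" "invariant T U" "U \<subseteq> W"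
 shows "\<exists>k b z. qbasis U W k b \<and> (\<forall>i<k. \<exists>V. subspace V \<and> invariant T V \<and> U \<subseteq> V \<and> V \<subseteq> W \<and> b i \<notin> V
   \<and> T (b i) - scale (z i) (b i) \<in> V \<and> V \<subseteq> {x. \<exists>c u. u \<in> U \<and> x = u + (\<Sum>j<i. scale (c j) (b j))})"
 using U
proof (induction "card B0 - srank U" arbitrary: U rule: less_induct)
 case less
 show ?case
 proof (cases "U = W")
  case True
  then have "qbasis U W 0 b" for b by (simp add: qbasis_def)
  then show ?thesis by (intro exI[of _ 0]) auto
 next
  case False
  then obtain v where v: "v \<in> W" "v \<notin> U" using less.prems by blast
  obtain a \<zeta> where a: "a \<in> W" "a \<notin> U" "T a - scale \<zeta> a \<in> U"
   using quotient_eigenvector[OF T less.prems(1) W v] by blast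
  define U1 where "U1 = span (insert a U)"
  have U1_iff: "x \<in> U1 \<longleftrightarrow> (\<exists>c. x - scale c a \<in> U)" for x
  proof -
   have "span U = U" using less.prems(1) by (simp add: span_eq_iff)
   then show ?thesis unfolding U1_def by (simp only: span_breakdown_eq)
  qed
  have U1: "subspace U1" by (simp add: U1_def)
  have UU1: "U \<subseteq> U1" unfolding U1_def using span_superset by blast
  have aU1: "a \<in> U1" unfolding U1_def by (simp add: span_base)
  have U1W: "U1 \<subseteq> W" unfolding U1_def using a less.prems W(1) by (intro span_minimal) auto
  have TU: "T x \<in> U" if "x \<in> U" for x using less.prems(2) that by (simp add: invariant_def)
  have inv1: "invariant T U1" unfolding invariant_def
  proof
   fix x assume "x \<in> U1"
   then obtain c where c: "x - scale c a \<in> U" using U1_iff by blast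
   have "T (x - scale c a) + scale c (T a - scale \<zeta> a) \<in> U"
    using TU[OF c] a(3) less.prems(1) by (intro subspace_add subspace_scale)
   moreover have "T (x - scale c a) + scale c (T a - scale \<zeta> a) = T x - scale (c * \<zeta>) a"
    by (simp add: linop_simps[OF T] scale_right_diff_distrib)
   ultimately show "T x \<in> U1" unfolding U1_iff by auto
  qed
  have "U \<subset> U1" using UU1 aU1 a by blast
  then have "srank U < srank U1"
   using srank_less[OF W(4), of U1 U] U1W W(3) less.prems(1) by blast
  moreover have "srank U1 \<le> card B0" by (rule srank_le[OF W(4)]) (use U1W W(3) in blast)
  ultimately have "card B0 - srank U1 < card B0 - srank U" by simp
  from less.hyps[OF this U1 inv1 U1W] obtain k b z where qb: "qbasis U1 W k b"
   and fl: "\<And>i. i < k \<Longrightarrow> \<exists>V. subspace V \<and> invariant T V \<and> U1 \<subseteq> V \<and> V \<subseteq> W \<and> b i \<notin> V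
   \<and> T (b i) - scale (z i) (b i) \<in> V \<and> V \<subseteq> {x. \<exists>c u. u \<in> U1 \<and> x = u + (\<Sum>j<i. scale (c j) (b j))}" by blast
  define b' where "b' i = (case i of 0 \<Rightarrow> a | Suc j \<Rightarrow> b j)" for i
  define z' where "z' i = (case i of 0 \<Rightarrow> \<zeta> | Suc j \<Rightarrow> z j)" for i
  have sumS: "(\<Sum>i<Suc n. scale (c i) (b' i)) = scale (c 0) a + (\<Sum>i<n. scale (c (Suc i)) (b i))" for c n
   unfolding sum.lessThan_Suc_shift by (simp add: b'_def)
  have "qbasis U W (Suc k) b'" unfolding qbasis_def
  proof (intro conjI allI impI ballI)
   show "b' i \<in> W" if "i < Suc k" for i
    using that a qb by (cases i) (auto simp: b'_def qbasis_def)
   show "\<exists>c. x - (\<Sum>i<Suc k. scale (c i) (b' i)) \<in> U" if xS: "x \<in> W" for x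
   proof -
    obtain c where "x - (\<Sum>i<k. scale (c i) (b i)) \<in> U1" using qb xS by (auto simp: qbasis_def)
    then obtain c0 where "x - (\<Sum>i<k. scale (c i) (b i)) - scale c0 a \<in> U" using U1_iff by blast
    then show ?thesis
     by (intro exI[of _ "\<lambda>i. case i of 0 \<Rightarrow> c0 | Suc j \<Rightarrow> c j"])
      (unfold sumS, simp add: algebra_simps)
   qed
   fix c i assume 0: "(\<Sum>i<Suc k. scale (c i) (b' i)) \<in> U" and i: "i < Suc k"
   have "(\<Sum>i<k. scale (c (Suc i)) (b i)) - scale (- c 0) a \<in> U" using 0 unfolding sumS by (simp add: algebra_simps)
   then have "(\<Sum>i<k. scale (c (Suc i)) (b i)) \<in> U1" using U1_iff by blast
   then have cz: "c (Suc i) = 0" if "i < k" for i using qbasis_unique[OF qb, of "\<lambda>i. c (Suc i)" i] that by blast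
   then have "(\<Sum>i<k. scale (c (Suc i)) (b i)) = 0" by simp
   then have "scale (c 0) a \<in> U" using 0 unfolding sumS by simp
   then have "scale (inverse (c 0)) (scale (c 0) a) \<in> U" by (rule subspace_scale[OF less.prems(1)])
   then have "c 0 = 0" using a(2) by (cases "c 0 = 0") simp_all
   then show "c i = 0" using cz i by (cases i) auto
  qed
  moreover have "\<exists>V. subspace V \<and> invariant T V \<and> U \<subseteq> V \<and> V \<subseteq> W \<and> b' i \<notin> V
   \<and> T (b' i) - scale (z' i) (b' i) \<in> V \<and> V \<subseteq> {x. \<exists>c u. u \<in> U \<and> x = u + (\<Sum>j<i. scale (c j) (b' j))}"
   if i: "i < Suc k" for i
  proof (cases i)
   case 0
   show ?thesis by (intro exI[of _ U]) (use less.prems a 0 in \<open>auto simp: b'_def z'_def\<close>)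
  next
   case (Suc l)
   obtain V where V: "subspace V" "invariant T V" "U1 \<subseteq> V" "V \<subseteq> W" "b l \<notin> V" "T (b l) - scale (z l) (b l) \<in> V"
    "V \<subseteq> {x. \<exists>c u. u \<in> U1 \<and> x = u + (\<Sum>j<l. scale (c j) (b j))}" using fl[of l] i Suc by auto
   have "V \<subseteq> {x. \<exists>c u. u \<in> U \<and> x = u + (\<Sum>j<i. scale (c j) (b' j))}"
   proof
    fix x assume "x \<in> V"
    then obtain c u where cu: "u \<in> U1" "x = u + (\<Sum>j<l. scale (c j) (b j))" using V(7) by blast
    obtain c0 where c0: "u - scale c0 a \<in> U" using cu(1) U1_iff by blast
    have "x = (u - scale c0 a) + (\<Sum>j<i. scale ((\<lambda>j. case j of 0 \<Rightarrow> c0 | Suc j \<Rightarrow> c j) j) (b' j))"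
     unfolding Suc sumS using cu(2) by simp
    then show "x \<in> {x. \<exists>c u. u \<in> U \<and> x = u + (\<Sum>j<i. scale (c j) (b' j))}" using c0 by blast
   qed
   then show ?thesis by (intro exI[of _ V]) (use V UU1 Suc in \<open>auto simp: b'_def z'_def\<close>)
  qed
  ultimately show ?thesis by blast
 qed
qed

text \<open>In the triangular basis the trace is the sum of the diagonal entries, and basis
  independence transfers this to \<open>b\<close>. The final clause is the nilpotency of a strictly
  triangular operator.\<close>

lemma qtr_flag:
 assumes T: "linop T" and W: "subspace W" "invariant T W" "W \<subseteq> span B0" "finite B0"
  and U: "subspace U" "invariant T U" "U \<subseteq> W" and b: "qbasis U W k b"
 obtains n z where "n \<le> card B0" "qtr U k b T = (\<Sum>i<n. z i)"
  "\<And>i. i < n \<Longrightarrow> \<exists>V x. subspace V \<and> invariant T V \<and> U \<subseteq> V \<and> x \<in> W \<and> x \<notin> V \<and> T x - scale (z i) x \<in> V"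
  "(\<forall>i<n. z i = 0) \<Longrightarrow> \<forall>x\<in>W. (T ^^ n) x \<in> U"
proof -
 obtain n b' z where b': "qbasis U W n b'" and fl: "\<And>i. i < n \<Longrightarrow> \<exists>V. subspace V \<and> invariant T V \<and> U \<subseteq> V \<and> V \<subseteq> W \<and> b' i \<notin> V
   \<and> T (b' i) - scale (z i) (b' i) \<in> V \<and> V \<subseteq> {x. \<exists>c u. u \<in> U \<and> x = u + (\<Sum>j<i. scale (c j) (b' j))}"
  using flag[OF T W U] by blast
 have b'W: "b' i \<in> W" if "i < n" for i using b' that by (simp add: qbasis_def)
 have TW: "T x \<in> W" if "x \<in> W" for x using W(2) that by (simp add: invariant_def)
 have TU: "T x \<in> U" if "x \<in> U" for x using U(2) that by (simp add: invariant_def)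
 have low: "\<exists>c u. u \<in> U \<and> T (b' i) - scale (z i) (b' i) = u + (\<Sum>j<i. scale (c j) (b' j))" if "i < n" for i
  using fl[OF that] by blast
 have diag: "qco U n b' (T (b' i)) i = z i" if i: "i < n" for i
 proof -
  obtain c u where cu: "u \<in> U" "T (b' i) - scale (z i) (b' i) = u + (\<Sum>j<i. scale (c j) (b' j))"
   using low[OF i] by blast
  let ?c = "\<lambda>j. if j < i then c j else if j = i then z i else 0"
  have "(\<Sum>j<n. scale (?c j) (b' j)) = (\<Sum>j<Suc i. scale (?c j) (b' j))"
   by (rule sum.mono_neutral_right) (use i in auto)
  also have "\<dots> = (\<Sum>j<i. scale (c j) (b' j)) + scale (z i) (b' i)" by simp
  finally have "T (b' i) - (\<Sum>j<n. scale (?c j) (b' j)) = u" using cu(2) by (simp add: algebra_simps)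
  then have "qco U n b' (T (b' i)) i = ?c i"
   using cu(1) by (intro qco_eq[OF U(1) b' TW[OF b'W[OF i]] _ i]) simp
  then show ?thesis by simp
 qed
 have 1: "qtr U k b T = (\<Sum>i<n. z i)"
  using qtr_basis_independent[OF U(1,3) W(1) b b' T U(2) W(2)] diag by (simp add: qtr_def)
 have 2: "n \<le> card B0" by (rule qbasis_bound[OF U(1) b' W(3,4)])
 have 3: "\<exists>V x. subspace V \<and> invariant T V \<and> U \<subseteq> V \<and> x \<in> W \<and> x \<notin> V \<and> T x - scale (z i) x \<in> V" if "i < n" for i
  using fl[OF that] b'W[OF that] by blast
 have 4: "\<forall>x\<in>W. (T ^^ n) x \<in> U" if z0: "\<forall>i<n. z i = 0"
 proof -
  have "(T ^^ m) (u + (\<Sum>j<m. scale (c j) (b' j))) \<in> U" if "m \<le> n" "u \<in> U" for m c u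
   using that
  proof (induction m arbitrary: c u)
   case (Suc m)
   obtain c' u' where cu: "u' \<in> U" "T (b' m) = u' + (\<Sum>j<m. scale (c' j) (b' j))"
    using low[of m] Suc.prems z0 by auto
   have lows: "\<exists>c u. u \<in> U \<and> T (\<Sum>j<l. scale (d j) (b' j)) = u + (\<Sum>j<l. scale (c j) (b' j))" if "l \<le> n" for l d
    using that
   proof (induction l)
    case 0
    show ?case using subspace_0[OF U(1)] by (auto simp: linop_simps[OF T])
   next
    case (Suc l)
    obtain c1 u1 where 1: "u1 \<in> U" "T (\<Sum>j<l. scale (d j) (b' j)) = u1 + (\<Sum>j<l. scale (c1 j) (b' j))"
     using Suc by auto
    obtain c2 u2 where 2: "u2 \<in> U" "T (b' l) = u2 + (\<Sum>j<l. scale (c2 j) (b' j))"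
     using low[of l] Suc.prems z0 by auto
    let ?c = "\<lambda>j. if j < l then c1 j + d l * c2 j else 0"
    have "T (\<Sum>j<Suc l. scale (d j) (b' j)) = (u1 + scale (d l) u2) + (\<Sum>j<Suc l. scale (?c j) (b' j))"
     using 1(2) 2(2) by (simp add: linop_simps[OF T] scale_right_distrib scale_sum_right sum.distrib scale_left_distrib algebra_simps)
    moreover have "u1 + scale (d l) u2 \<in> U" using 1 2 U(1) by (intro subspace_add subspace_scale)
    ultimately show ?case by (intro exI[of _ ?c] exI[of _ "u1 + scale (d l) u2"] conjI)
   qed
   obtain c1 u1 where 1: "u1 \<in> U" "T (\<Sum>j<m. scale (c j) (b' j)) = u1 + (\<Sum>j<m. scale (c1 j) (b' j))"
    using lows[of m c] Suc.prems by auto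
   have "T (u + (\<Sum>j<Suc m. scale (c j) (b' j)))
    = (T u + u1 + scale (c m) u') + (\<Sum>j<m. scale (c1 j + c m * c' j) (b' j))"
    using 1(2) cu(2) by (simp add: linop_simps[OF T] scale_right_distrib scale_sum_right sum.distrib scale_left_distrib algebra_simps)
   moreover have "T u + u1 + scale (c m) u' \<in> U" using TU[OF Suc.prems(2)] 1 cu U(1) by (intro subspace_add subspace_scale)
   ultimately show ?case using Suc.IH Suc.prems by (simp add: funpow_swap1)
  qed simp
  note key = this
  show ?thesis
  proof
   fix x assume x: "x \<in> W"
   have "x = (x - (\<Sum>j<n. scale (qco U n b' x j) (b' j))) + (\<Sum>j<n. scale (qco U n b' x j) (b' j))" by simp
   then show "(T ^^ n) x \<in> U" using key[OF le_refl qco_in[OF b' x]] by metis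
  qed
 qed
 show thesis by (rule that[OF 2 1 3 4])
qed

end


subsection \<open>Operator semigroups with constant trace\<close>

context trace_space
begin

inductive_set opspan :: "('b \<Rightarrow> 'b) set \<Rightarrow> ('b \<Rightarrow> 'b) set" for \<T> :: "('b \<Rightarrow> 'b) set" where
 opspan_base: "T \<in> \<T> \<Longrightarrow> T \<in> opspan \<T>"
| opspan_add: "\<lbrakk>S \<in> opspan \<T>; T \<in> opspan \<T>\<rbrakk> \<Longrightarrow> (\<lambda>x. S x + T x) \<in> opspan \<T>"
| opspan_scale: "T \<in> opspan \<T> \<Longrightarrow> (\<lambda>x. scale c (T x)) \<in> opspan \<T>"

lemma opspan_diff:
 assumes "S \<in> opspan \<T>" "T \<in> opspan \<T>"
 shows "(\<lambda>x. S x - scale c (T x)) \<in> opspan \<T>"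
 using opspan_add[OF assms(1) opspan_scale[OF assms(2), of "- c"]] by simp

lemma opspan_linop:
 assumes "\<And>T. T \<in> \<T> \<Longrightarrow> linop T" "T \<in> opspan \<T>"
 shows "linop T"
 using assms(2) by induction (auto intro: assms(1) linop_add linop_scale)

lemma opspan_invariant:
 assumes S: "subspace S" and inv: "\<And>T. T \<in> \<T> \<Longrightarrow> invariant T S" and T: "T \<in> opspan \<T>"
 shows "invariant T S"
 using T
proof induction
 case (opspan_base T)
 then show ?case by (rule inv)
next
 case (opspan_add A B)
 then show ?case using subspace_add[OF S] by (simp add: invariant_def)
next
 case (opspan_scale A c)
 then show ?case using subspace_scale[OF S] by (simp add: invariant_def)
qed

lemma opspan_comp:
 assumes lin: "\<And>T. T \<in> \<T> \<Longrightarrow> linop T"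
  and comp: "\<forall>S\<in>\<T>. \<forall>T\<in>\<T>. (\<lambda>x. S (T x)) \<in> \<T>"
  and S: "S \<in> opspan \<T>" and T: "T \<in> opspan \<T>"
 shows "(\<lambda>x. S (T x)) \<in> opspan \<T>"
 using S
proof induction
 case (opspan_base S)
 note S = opspan_base
 show ?case using T
 proof induction
  case (opspan_base T)
  show ?case by (rule opspan.opspan_base[OF comp[THEN bspec, OF S, THEN bspec, OF opspan_base]])
 next
  case (opspan_add A B)
  then show ?case using opspan.opspan_add by (simp add: linop_simps[OF lin[OF S]])
 next
  case (opspan_scale A c)
  then show ?case using opspan.opspan_scale by (simp add: linop_simps[OF lin[OF S]])
 qed
next
 case (opspan_add A B)
 then show ?case using opspan.opspan_add by simp
next
 case (opspan_scale A c)
 then show ?case using opspan.opspan_scale by simp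
qed

lemma subspace_diff_trans:
 assumes "subspace U" "x - y \<in> U" "y - z \<in> U"
 shows "x - z \<in> U"
 using subspace_add[OF assms] by simp

lemma subspace_diff_sym:
 assumes "subspace U" "x - y \<in> U"
 shows "y - x \<in> U"
 using subspace_neg[OF assms] by simp

lemma subspace_cong_mem:
 assumes "subspace U" "x - y \<in> U" "y \<in> U"
 shows "x \<in> U"
 using subspace_add[OF assms] by simp

lemma invariant_id: "invariant (\<lambda>x. x) S"
 by (simp add: invariant_def)

lemma invariant_cong:
 assumes "linop T" "invariant T U" "x - y \<in> U"
 shows "T x - T y \<in> U"
 using assms by (metis invariant_def linop_simps(4))

end

context closed_vector_space
begin

text \<open>The operators with \<open>tr (T a) = 0\<close> for all \<open>T\<close> form a left ideal. If it were nonzero modulo \<open>U\<close>, then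
 an element \<open>a\<close> of it with maximal kernel would have rank one, and by irreducibility some \<open>b\<^sub>0 a\<close> would be
 a nonzero idempotent of rank one, with trace 1.\<close>
lemma irreducible_constant_trace:
 assumes lin: "\<And>T. T \<in> \<T> \<Longrightarrow> linop T"
  and comp: "\<forall>S\<in>\<T>. \<forall>T\<in>\<T>. (\<lambda>x. S (T x)) \<in> \<T>"
  and one: "(\<lambda>x. x) \<in> \<T>"
  and U: "subspace U" "\<And>T. T \<in> \<T> \<Longrightarrow> invariant T U" and UW: "U \<subseteq> W"
  and W: "subspace W" "\<And>T. T \<in> \<T> \<Longrightarrow> invariant T W" "W \<subseteq> span B0" "finite B0"
  and b: "qbasis U W k b"
  and irr: "\<And>V. \<lbrakk>subspace V; U \<subseteq> V; V \<subseteq> W; \<forall>T\<in>\<T>. invariant T V; V \<noteq> U\<rbrakk> \<Longrightarrow> V = W"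
  and const: "\<And>T. T \<in> \<T> \<Longrightarrow> qtr U k b T = \<kappa>"
  and S0: "S0 \<in> \<T>" and x0: "x0 \<in> W"
 shows "S0 x0 - x0 \<in> U"
proof (rule ccontr)
 assume ne: "S0 x0 - x0 \<notin> U"
 let ?A = "opspan \<T>"
 have A_lin: "linop T" if "T \<in> ?A" for T by (rule opspan_linop[OF lin that])
 have A_U: "invariant T U" if "T \<in> ?A" for T by (rule opspan_invariant[OF U that])
 have A_W: "invariant T W" if "T \<in> ?A" for T by (rule opspan_invariant[OF W(1,2) that])
 have A_Ux: "T x \<in> U" if "T \<in> ?A" "x \<in> U" for T x using A_U[OF that(1)] that(2) by (simp add: invariant_def)
 have A_Wx: "T x \<in> W" if "T \<in> ?A" "x \<in> W" for T x using A_W[OF that(1)] that(2) by (simp add: invariant_def)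
 have A_comp: "(\<lambda>x. S (T x)) \<in> ?A" if "S \<in> ?A" "T \<in> ?A" for S T
  by (rule opspan_comp[OF lin comp that])
 have A_one: "(\<lambda>x. x) \<in> ?A" by (rule opspan_base[OF one])
 have bW: "b i \<in> W" if "i < k" for i using b that by (simp add: qbasis_def)
 note cg = invariant_cong[OF A_lin A_U]
 define I where "I = {a \<in> ?A. \<forall>T\<in>?A. qtr U k b (\<lambda>x. T (a x)) = 0}"
 have I_left: "(\<lambda>x. c (a x)) \<in> I" if a: "a \<in> I" and c: "c \<in> ?A" for a c
 proof -
  have aA: "a \<in> ?A" using a by (simp add: I_def)
  have "qtr U k b (\<lambda>x. T (c (a x))) = 0" if T: "T \<in> ?A" for T
  proof -
   have "\<forall>T\<in>?A. qtr U k b (\<lambda>x. T (a x)) = 0" using a by (simp add: I_def)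
   from bspec[OF this A_comp[OF T c]] show ?thesis .
  qed
  then show ?thesis using A_comp[OF c aA] by (simp add: I_def)
 qed
 define K where "K a = {z \<in> W. a z \<in> U}" for a
 have K_sub: "subspace (K a)" if a: "a \<in> ?A" for a
  by (rule subspaceI)
   (use U(1) W(1) in \<open>auto simp: K_def linop_simps[OF A_lin[OF a]] intro: subspace_0 subspace_add subspace_scale\<close>)
 \<comment> \<open>Constancy of the trace makes the traces of \<open>T S0\<close> and of
   \<open>T\<close> cancel, so \<open>S0 - 1\<close> belongs to the ideal; by assumption it is not
   zero modulo \<open>U\<close>.\<close>
 define a0 where "a0 x = S0 x - scale 1 x" for x
 have a0A: "a0 \<in> ?A" unfolding a0_def by (rule opspan_diff[OF opspan_base[OF S0] A_one])
 have "qtr U k b (\<lambda>x. T (a0 x)) = 0" if "T \<in> ?A" for T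
  using that
 proof induction
  case (opspan_base T)
  have cS: "(\<lambda>x. T (S0 x)) \<in> \<T>" using comp opspan_base S0 by blast
  have "qtr U k b (\<lambda>x. T (S0 x) + scale (- 1) (T x)) = \<kappa> + - 1 * \<kappa>"
   using qtr_add[OF U(1) W(1) b, of "\<lambda>x. T (S0 x)" "\<lambda>x. scale (- 1) (T x)"]
    qtr_scale[OF U(1) W(1) b, of T "- 1"] const[OF cS] const[OF opspan_base]
    W(2)[OF cS] W(2)[OF opspan_base] A_W[OF opspan_scale[OF opspan.opspan_base[OF opspan_base]], of "- 1"]
   by simp
  then show ?case by (simp add: a0_def linop_simps[OF lin[OF opspan_base]])
 next
  case (opspan_add A B)
  then show ?case
   using qtr_add[OF U(1) W(1) b A_W[OF A_comp[OF opspan_add(1) a0A]] A_W[OF A_comp[OF opspan_add(2) a0A]]] by simp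
 next
  case (opspan_scale A c)
  then show ?case using qtr_scale[OF U(1) W(1) b A_W[OF A_comp[OF opspan_scale(1) a0A]]] by simp
 qed
 then have a0I: "a0 \<in> I" using a0A by (simp add: I_def)
 have "x0 \<notin> K a0" using ne by (simp add: K_def a0_def)
 then have P0: "a0 \<in> I \<and> K a0 \<noteq> W" using a0I x0 by blast
 have K_rank: "srank (K a) \<le> card B0" for a
  by (rule srank_le[OF W(4)]) (use W(3) in \<open>auto simp: K_def\<close>)
 have "\<exists>a. (a \<in> I \<and> K a \<noteq> W) \<and> (\<forall>a'. a' \<in> I \<and> K a' \<noteq> W \<longrightarrow> srank (K a') \<le> srank (K a))"
  by (rule Lattices_Big.ex_has_greatest_nat[of "\<lambda>a. a \<in> I \<and> K a \<noteq> W" a0 "\<lambda>a. srank (K a)" "Suc (card B0)", OF P0])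
   (simp add: K_rank less_Suc_eq_le)
 then obtain a where aI: "a \<in> I" and aW: "K a \<noteq> W"
  and max: "\<And>a'. a' \<in> I \<Longrightarrow> K a' \<noteq> W \<Longrightarrow> srank (K a') \<le> srank (K a)" by blast
 have aA: "a \<in> ?A" using aI by (simp add: I_def)
 obtain x where x: "x \<in> W" "a x \<notin> U" using aW by (auto simp: K_def)
 \<comment> \<open>The operator \<open>a c\<close> preserves the image of \<open>a\<close> and has
   an eigenvalue \<open>\<mu>\<close> there modulo \<open>U\<close>. Then
   \<open>a c a - \<mu> a\<close> is in the ideal and has strictly larger kernel than
   \<open>a\<close>, so it vanishes on the section.\<close>
 have scalar: "\<exists>\<mu>. \<forall>z\<in>W. a (c (a z)) - scale \<mu> (a z) \<in> U" if c: "c \<in> ?A" for c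
 proof -
  let ?T = "\<lambda>x. a (c x)"
  have T: "?T \<in> ?A" by (rule A_comp[OF aA c])
  define S where "S = {s \<in> W. \<exists>z\<in>W. s - a z \<in> U}"
  have Ssub: "subspace S"
  proof (rule subspaceI)
   show "0 \<in> S" using subspace_0[OF W(1)] subspace_0[OF U(1)]
    by (auto simp: S_def linop_simps[OF A_lin[OF aA]] intro!: bexI[of _ 0])
   fix s t assume "s \<in> S" "t \<in> S"
   then obtain z z' where z: "s \<in> W" "t \<in> W" "z \<in> W" "z' \<in> W" "s - a z \<in> U" "t - a z' \<in> U" by (auto simp: S_def)
   have "(s + t) - a (z + z') \<in> U" using subspace_add[OF U(1) z(5,6)]
    by (simp add: linop_simps[OF A_lin[OF aA]] algebra_simps)
   then show "s + t \<in> S" using subspace_add[OF W(1)] z unfolding S_def by blast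
  next
   fix c s assume "s \<in> S"
   then obtain z where z: "s \<in> W" "z \<in> W" "s - a z \<in> U" by (auto simp: S_def)
   have "scale c s - a (scale c z) \<in> U" using subspace_scale[OF U(1) z(3), of c]
    by (simp add: linop_simps[OF A_lin[OF aA]] scale_right_diff_distrib)
   then show "scale c s \<in> S" using subspace_scale[OF W(1)] z unfolding S_def by blast
  qed
  have Sinv: "invariant ?T S" unfolding invariant_def
  proof
   fix s assume s: "s \<in> S"
   then have "s \<in> W" by (simp add: S_def)
   then have "c s \<in> W" by (rule A_Wx[OF c])
   then show "a (c s) \<in> S" using A_Wx[OF aA] subspace_0[OF U(1)]
    by (auto simp: S_def intro!: bexI[of _ "c s"])
  qed
  have "a x \<in> S" using x A_Wx[OF aA] subspace_0[OF U(1)] by (auto simp: S_def intro!: bexI[of _ x])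
  moreover have "S \<subseteq> span B0" using W(3) by (auto simp: S_def)
  ultimately obtain w \<mu> where w: "w \<in> S" "w \<notin> U" "a (c w) - scale \<mu> w \<in> U"
   using quotient_eigenvector[OF A_lin[OF T] U(1) Ssub Sinv _ W(4) _ x(2)] by blast
  then obtain z0 where z0: "z0 \<in> W" "w - a z0 \<in> U" by (auto simp: S_def)
  define a' where "a' x = a (c (a x)) - scale \<mu> (a x)" for x
  have "(\<lambda>x. a (c x) - scale \<mu> x) \<in> ?A" by (rule opspan_diff[OF T A_one])
  from I_left[OF aI this] have a'I: "a' \<in> I" by (simp add: a'_def[abs_def])
  then have a'A: "a' \<in> ?A" by (simp add: I_def)
  have "K a \<subseteq> K a'"
   using A_Ux[OF T] subspace_scale[OF U(1)] subspace_diff[OF U(1)] by (auto simp: K_def a'_def)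
  moreover have "z0 \<notin> K a" using subspace_cong_mem[OF U(1) z0(2)] w(2) by (auto simp: K_def)
  moreover have "z0 \<in> K a'"
  proof -
   have "(a (c w) - scale \<mu> w) - (a (c w) - a (c (a z0))) + scale \<mu> (w - a z0) \<in> U"
    by (rule subspace_add[OF U(1) subspace_diff[OF U(1) w(3) cg[OF T T z0(2)]] subspace_scale[OF U(1) z0(2)]])
   then have "a' z0 \<in> U" by (simp add: a'_def scale_right_diff_distrib algebra_simps)
   then show ?thesis using z0 by (simp add: K_def)
  qed
  ultimately have "K a \<subset> K a'" by blast
  then have "srank (K a) < srank (K a')"
   by (intro srank_less[OF W(4)] K_sub[OF aA]) (use W(3) in \<open>auto simp: K_def\<close>)
  then have "K a' = W" using max[OF a'I] by force
  then have "\<forall>z\<in>W. a' z \<in> U" by (auto simp: K_def)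
  then show ?thesis unfolding a'_def by blast
 qed
 \<comment> \<open>The invariant subspace generated by \<open>a x\<close> and \<open>U\<close>;
   irreducibility makes it all of \<open>W\<close>. By \<open>scalar\<close>, the image of
   \<open>a\<close> modulo \<open>U\<close> is then the line through \<open>a x\<close>.\<close>
 define N where "N = {z \<in> W. \<exists>c\<in>?A. z - c (a x) \<in> U}"
 have zeroA: "(\<lambda>x. scale 0 x) \<in> ?A" by (rule opspan_scale[OF A_one])
 have "N = W"
 proof (rule irr)
  show "subspace N"
  proof (rule subspaceI)
   show "0 \<in> N" using subspace_0[OF W(1)] subspace_0[OF U(1)] zeroA
    by (auto simp: N_def intro!: bexI[of _ "\<lambda>x. scale 0 x"])
   fix s t assume "s \<in> N" "t \<in> N"
   then obtain c c' where c: "s \<in> W" "t \<in> W" "c \<in> ?A" "c' \<in> ?A" "s - c (a x) \<in> U" "t - c' (a x) \<in> U"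
    by (auto simp: N_def)
   have "(s + t) - (c (a x) + c' (a x)) \<in> U" using subspace_add[OF U(1) c(5,6)] by (simp add: algebra_simps)
   then show "s + t \<in> N" using subspace_add[OF W(1) c(1,2)] opspan_add[OF c(3,4)]
    by (auto simp: N_def intro!: bexI[of _ "\<lambda>x. c x + c' x"])
  next
   fix r s assume "s \<in> N"
   then obtain c where c: "s \<in> W" "c \<in> ?A" "s - c (a x) \<in> U" by (auto simp: N_def)
   have "scale r s - scale r (c (a x)) \<in> U" using subspace_scale[OF U(1) c(3), of r]
    by (simp add: scale_right_diff_distrib)
   then show "scale r s \<in> N" using subspace_scale[OF W(1) c(1)] opspan_scale[OF c(2), of r]
    by (auto simp: N_def intro!: bexI[of _ "\<lambda>x. scale r (c x)"])
  qed
  show "U \<subseteq> N" using UW zeroA by (auto simp: N_def intro!: bexI[of _ "\<lambda>x. scale 0 x"])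
  show "N \<subseteq> W" by (auto simp: N_def)
  show "\<forall>T\<in>\<T>. invariant T N"
  proof
   fix T assume "T \<in> \<T>"
   then have T: "T \<in> ?A" by (rule opspan_base)
   show "invariant T N" unfolding invariant_def
   proof
    fix z assume "z \<in> N"
    then obtain c where c: "z \<in> W" "c \<in> ?A" "z - c (a x) \<in> U" by (auto simp: N_def)
    have "T z - T (c (a x)) \<in> U" by (rule cg[OF T T c(3)])
    then show "T z \<in> N" using A_Wx[OF T c(1)] A_comp[OF T c(2)]
     by (auto simp: N_def intro!: bexI[of _ "\<lambda>x. T (c x)"])
   qed
  qed
  have "a x \<in> N" using A_Wx[OF aA x(1)] A_one subspace_0[OF U(1)] by (auto simp: N_def intro!: bexI[of _ "\<lambda>x. x"])
  then show "N \<noteq> U" using x(2) by blast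
 qed
 have "\<exists>\<mu>. a z - scale \<mu> (a x) \<in> U" if z: "z \<in> W" for z
 proof -
  obtain c where c: "c \<in> ?A" "z - c (a x) \<in> U" using z \<open>N = W\<close> by (auto simp: N_def)
  obtain \<mu> where "a (c (a x)) - scale \<mu> (a x) \<in> U" using scalar[OF c(1)] x(1) by blast
  then have "a z - scale \<mu> (a x) \<in> U" by (rule subspace_diff_trans[OF U(1) cg[OF aA aA c(2)]])
  then show ?thesis ..
 qed
 then obtain \<eta> where \<eta>: "\<And>z. z \<in> W \<Longrightarrow> a z - scale (\<eta> z) (a x) \<in> U" by metis
 \<comment> \<open>\<open>b0\<close> sends \<open>a x\<close> back to \<open>x\<close>. The trace of
   \<open>b0 a\<close> is the sum of the \<open>\<eta> (b i) * \<xi> i\<close>, which vanishes since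
   \<open>a\<close> is in the ideal; but by linearity the same sum is the factor with which
   \<open>a\<close> maps \<open>x\<close> to a multiple of \<open>a x\<close>, which would put
   \<open>a x\<close> into \<open>U\<close>.\<close>
 obtain b0 where b0: "b0 \<in> ?A" "x - b0 (a x) \<in> U" using x(1) \<open>N = W\<close> by (auto simp: N_def)
 define \<xi> where "\<xi> i = qco U k b x i" for i
 have "qco U k b (b0 (a (b i))) i = \<eta> (b i) * \<xi> i" if i: "i < k" for i
 proof -
  have "b0 (a (b i)) - scale (\<eta> (b i)) (b0 (a x)) \<in> U"
   using cg[OF b0(1) b0(1) \<eta>[OF bW[OF i]]] by (simp add: linop_simps[OF A_lin[OF b0(1)]])
  moreover have "scale (\<eta> (b i)) (b0 (a x)) - scale (\<eta> (b i)) x \<in> U"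
   using subspace_scale[OF U(1) subspace_diff_sym[OF U(1) b0(2)], of "\<eta> (b i)"]
   by (simp add: scale_right_diff_distrib)
  ultimately have "b0 (a (b i)) - scale (\<eta> (b i)) x \<in> U" by (rule subspace_diff_trans[OF U(1)])
  then have "qco U k b (b0 (a (b i))) i = qco U k b (scale (\<eta> (b i)) x) i"
   by (rule qco_cong[OF U(1) b A_Wx[OF b0(1) A_Wx[OF aA bW[OF i]]] subspace_scale[OF W(1) x(1)] _ i])
  then show ?thesis by (simp add: qco_scale[OF U(1) W(1) b x(1) i] \<xi>_def)
 qed
 then have "qtr U k b (\<lambda>x. b0 (a x)) = (\<Sum>i<k. \<eta> (b i) * \<xi> i)" by (simp add: qtr_def)
 moreover have "qtr U k b (\<lambda>x. b0 (a x)) = 0" using aI b0(1) by (auto simp: I_def)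
 ultimately have sum0: "(\<Sum>i<k. \<xi> i * \<eta> (b i)) = 0" by (simp add: mult.commute)
 have "a x - (\<Sum>i<k. scale (\<xi> i) (a (b i))) \<in> U"
  using cg[OF aA aA qco_in[OF b x(1)]] by (simp add: linop_simps[OF A_lin[OF aA]] \<xi>_def)
 moreover have "(\<Sum>i<k. scale (\<xi> i) (a (b i) - scale (\<eta> (b i)) (a x))) \<in> U"
  by (rule subspace_sum[OF U(1)], rule subspace_scale[OF U(1)], rule \<eta>) (use bW in auto)
 then have "(\<Sum>i<k. scale (\<xi> i) (a (b i))) - scale (\<Sum>i<k. \<xi> i * \<eta> (b i)) (a x) \<in> U"
  by (simp add: scale_right_diff_distrib sum_subtractf scale_sum_left)
 then have "(\<Sum>i<k. scale (\<xi> i) (a (b i))) \<in> U" by (simp add: sum0)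
 ultimately have "a x \<in> U" by (rule subspace_cong_mem[OF U(1)])
 then show False using x(2) by simp
qed

text \<open>A minimal invariant \<open>W\<close> above \<open>U\<close> gives an irreducible
  section, on which constant trace forces the trivial action; the construction continues from
  \<open>W\<close>.\<close>

lemma unipotent_chain:
 assumes lin: "\<And>T. T \<in> \<T> \<Longrightarrow> linop T"
  and comp: "\<forall>S\<in>\<T>. \<forall>T\<in>\<T>. (\<lambda>x. S (T x)) \<in> \<T>"
  and one: "(\<lambda>x. x) \<in> \<T>"
  and E: "subspace E" "\<And>T. T \<in> \<T> \<Longrightarrow> invariant T E" "E \<subseteq> span B0" "finite B0"
  and const: "\<And>U W k b. \<lbrakk>subspace U; subspace W; U \<subseteq> W; W \<subseteq> E; \<forall>T\<in>\<T>. invariant T U; \<forall>T\<in>\<T>. invariant T W;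
   qbasis U W k b\<rbrakk> \<Longrightarrow> \<exists>\<kappa>. \<forall>T\<in>\<T>. qtr U k b T = \<kappa>"
  and U: "subspace U" "\<And>T. T \<in> \<T> \<Longrightarrow> invariant T U" "U \<subseteq> E"
 shows "\<exists>n C. C 0 = U \<and> C n = E \<and> (\<forall>i. subspace (C i)) \<and> (\<forall>i<n. \<forall>T\<in>\<T>. \<forall>x\<in>C (Suc i). T x - x \<in> C i)
  \<and> (\<forall>i<n. C i \<subseteq> C (Suc i))"
 using U
proof (induction "card B0 - srank U" arbitrary: U rule: less_induct)
 case less
 show ?case
 proof (cases "U = E")
  case True
  then show ?thesis using less.prems(1) by (intro exI[of _ 0] exI[of _ "\<lambda>_. U"]) auto
 next
  case False
  define P where "P W \<longleftrightarrow> subspace W \<and> (\<forall>T\<in>\<T>. invariant T W) \<and> U \<subset> W \<and> W \<subseteq> E" for W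
  have "P E" using E(1,2) less.prems False by (auto simp: P_def)
  then obtain W where PW: "P W" and minW: "\<And>V. P V \<Longrightarrow> srank W \<le> srank V"
   using ex_has_least_nat[of P E srank] by blast
  have W: "subspace W" "\<And>T. T \<in> \<T> \<Longrightarrow> invariant T W" "U \<subset> W" "W \<subseteq> E" using PW by (auto simp: P_def)
  have WB: "W \<subseteq> span B0" using W(4) E(3) by blast
  obtain k b where b: "qbasis U W k b"
   using flag[OF linop_id W(1) invariant_id WB E(4) less.prems(1) invariant_id] W(3) by blast
  obtain \<kappa> where \<kappa>: "\<And>T. T \<in> \<T> \<Longrightarrow> qtr U k b T = \<kappa>"
   using const[OF less.prems(1) W(1) _ W(4) _ _ b] W(2,3) less.prems(2) by blast
  have triv: "T x - x \<in> U" if T: "T \<in> \<T>" and x: "x \<in> W" for T x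
  proof (rule irreducible_constant_trace[OF lin comp one less.prems(1,2) _ W(1,2) WB E(4) b _ \<kappa> T x])
   show "U \<subseteq> W" using W(3) by blast
   fix V assume V: "subspace V" "U \<subseteq> V" "V \<subseteq> W" "\<forall>T\<in>\<T>. invariant T V" "V \<noteq> U"
   then have "P V" using W(4) by (auto simp: P_def)
   then have "srank W \<le> srank V" by (rule minW)
   then show "V = W" using srank_less[OF E(4) WB V(1)] V(3) by fastforce
  qed
  have "srank U < srank W" by (rule srank_less[OF E(4) WB less.prems(1) W(3)])
  moreover have "srank W \<le> card B0" by (rule srank_le[OF E(4) WB])
  ultimately have "card B0 - srank W < card B0 - srank U" by simp
  from less.hyps[OF this W(1,2,4)] obtain n C where C: "C 0 = W" "C n = E" "\<And>i. subspace (C i)"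
   "\<And>i T x. i < n \<Longrightarrow> T \<in> \<T> \<Longrightarrow> x \<in> C (Suc i) \<Longrightarrow> T x - x \<in> C i" "\<And>i. i < n \<Longrightarrow> C i \<subseteq> C (Suc i)" by blast
  define C' where "C' i = (case i of 0 \<Rightarrow> U | Suc j \<Rightarrow> C j)" for i
  have "C' 0 = U" "C' (Suc n) = E" using C by (auto simp: C'_def)
  moreover have "subspace (C' i)" for i using C(3) less.prems(1) by (cases i) (auto simp: C'_def)
  moreover have "T x - x \<in> C' i" if "i < Suc n" "T \<in> \<T>" "x \<in> C' (Suc i)" for i T x
   using that triv C(1,4) by (cases i) (auto simp: C'_def)
  moreover have "C' i \<subseteq> C' (Suc i)" if "i < Suc n" for i
   using that W(3) C(1,5) by (cases i) (auto simp: C'_def)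
  ultimately show ?thesis by blast
 qed
qed

lemma power_eigen_mod:
 assumes T: "linop T" and V: "subspace V" "invariant T V" and x: "T x - scale c x \<in> V"
 shows "(T ^^ n) x - scale (c ^ n) x \<in> V"
proof (induction n)
 case 0
 show ?case using subspace_0[OF V(1)] by simp
next
 case (Suc n)
 have "T ((T ^^ n) x) - T (scale (c ^ n) x) \<in> V" by (rule invariant_cong[OF T V(2) Suc])
 moreover have "T (scale (c ^ n) x) - scale (c ^ Suc n) x \<in> V"
  using subspace_scale[OF V(1) x, of "c ^ n"]
  by (simp add: linop_simps[OF T] scale_right_diff_distrib mult.commute)
 ultimately show ?case using subspace_diff_trans[OF V(1)] by simp
qed

lemma linop_funpow: "linop T \<Longrightarrow> linop (T ^^ n)"
 by (induction n) (auto simp: linop_def)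

text \<open>Modulo \<open>V\<close>, the vector \<open>x\<close> is an eigenvector of
  \<open>T^e - 1\<close> with eigenvalue \<open>z^e - 1\<close>, and some power of
  \<open>T^e - 1\<close> kills \<open>x\<close>.\<close>

lemma unipotent_power_eigenvalue:
 assumes T: "linop T" and V: "subspace V" "invariant T V" and x: "T x - scale z x \<in> V" "x \<notin> V"
  and nil: "((\<lambda>y. (T ^^ e) y - y) ^^ n) x = 0"
 shows "z ^ e = 1"
proof (rule ccontr)
 assume "z ^ e \<noteq> 1"
 let ?P = "\<lambda>y. (T ^^ e) y - y"
 have P: "linop ?P" using linop_funpow[OF T, of e] by (simp add: linop_def scale_right_diff_distrib algebra_simps)
 have "(T ^^ e) y \<in> V" if "y \<in> V" for y
  by (induction e) (use that V(2) in \<open>auto simp: invariant_def\<close>)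
 then have PV: "invariant ?P V" using subspace_diff[OF V(1)] by (simp add: invariant_def)
 have "?P x - scale (z ^ e - 1) x \<in> V"
  using power_eigen_mod[OF T V x(1), of e] by (simp add: scale_left_diff_distrib)
 from power_eigen_mod[OF P V(1) PV this, of n] have "- scale ((z ^ e - 1) ^ n) x \<in> V" using nil by simp
 then have "scale (- inverse ((z ^ e - 1) ^ n)) (- scale ((z ^ e - 1) ^ n) x) \<in> V" by (rule subspace_scale[OF V(1)])
 then show False using x(2) \<open>z ^ e \<noteq> 1\<close> by simp
qed

text \<open>Coordinates on \<open>W\<close> are extended to a larger space \<open>S\<close>. This is
  needed because \<open>x * b i * y\<close> leaves \<open>W\<close> for general \<open>x\<close> and
  \<open>y\<close> in \<open>R\<close>, although the trace is to be written as a bilinear form in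
  them.\<close>

lemma qbasis_extend:
 assumes U: "subspace U" and W: "subspace W" and UW: "U \<subseteq> W" and S: "subspace S" "W \<subseteq> S" "S \<subseteq> span B0" "finite B0"
  and b: "qbasis U W k b"
 obtains K bb where "qbasis U S K bb" "k \<le> K" "\<And>i. i < k \<Longrightarrow> bb i = b i"
  "\<And>x i. x \<in> W \<Longrightarrow> i < k \<Longrightarrow> qco U K bb x i = qco U k b x i"
proof -
 obtain l b' where b': "qbasis W S l b'"
  using flag[OF linop_id S(1) invariant_id S(3,4) W invariant_id S(2)] by blast
 define bb where "bb i = (if i < k then b i else b' (i - k))" for i
 have split: "(\<Sum>i<k + l. scale (c i) (bb i)) = (\<Sum>i<k. scale (c i) (b i)) + (\<Sum>i<l. scale (c (k + i)) (b' i))" for c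
 proof -
  have "(\<Sum>i<k + l. scale (c i) (bb i)) = (\<Sum>i<k. scale (c i) (bb i)) + (\<Sum>i=k..<k + l. scale (c i) (bb i))"
   by (simp add: lessThan_atLeast0 sum.atLeastLessThan_concat)
  also have "(\<Sum>i=k..<k + l. scale (c i) (bb i)) = (\<Sum>i<l. scale (c (k + i)) (bb (k + i)))"
   using sum.shift_bounds_nat_ivl[of "\<lambda>i. scale (c i) (bb i)" 0 k l] by (simp add: lessThan_atLeast0 add.commute)
  finally show ?thesis by (simp add: bb_def)
 qed
 have bW: "b i \<in> W" if "i < k" for i using b that by (simp add: qbasis_def)
 have qb: "qbasis U S (k + l) bb" unfolding qbasis_def
 proof (intro conjI allI impI ballI)
  show "bb i \<in> S" if "i < k + l" for i
   using that bW S(2) b' by (auto simp: bb_def qbasis_def)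
  show "\<exists>c. x - (\<Sum>i<k + l. scale (c i) (bb i)) \<in> U" if xS: "x \<in> S" for x
  proof -
   obtain c' where c': "x - (\<Sum>i<l. scale (c' i) (b' i)) \<in> W" using b' xS by (auto simp: qbasis_def)
   obtain c where c: "x - (\<Sum>i<l. scale (c' i) (b' i)) - (\<Sum>i<k. scale (c i) (b i)) \<in> U"
    using b c' by (auto simp: qbasis_def)
   have "(\<Sum>i<k + l. scale (if i < k then c i else c' (i - k)) (bb i))
    = (\<Sum>i<k. scale (c i) (b i)) + (\<Sum>i<l. scale (c' i) (b' i))"
    unfolding split by simp
   then show ?thesis using c by (intro exI[of _ "\<lambda>i. if i < k then c i else c' (i - k)"]) (simp add: algebra_simps)
  qed
  fix c i assume 0: "(\<Sum>i<k + l. scale (c i) (bb i)) \<in> U" and i: "i < k + l"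
  have "(\<Sum>i<k. scale (c i) (b i)) \<in> W"
   using bW by (intro subspace_sum[OF W] subspace_scale[OF W]) auto
  moreover have "(\<Sum>i<k + l. scale (c i) (bb i)) \<in> W" using 0 UW by blast
  ultimately have "(\<Sum>i<k + l. scale (c i) (bb i)) - (\<Sum>i<k. scale (c i) (b i)) \<in> W" by (intro subspace_diff[OF W])
  then have "(\<Sum>i<l. scale (c (k + i)) (b' i)) \<in> W" unfolding split by simp
  then have z': "c (k + i) = 0" if "i < l" for i using qbasis_unique[OF b', of "\<lambda>i. c (k + i)" i] that by blast
  then have "(\<Sum>i<l. scale (c (k + i)) (b' i)) = 0" by simp
  then have "(\<Sum>i<k. scale (c i) (b i)) \<in> U" using 0 unfolding split by simp
  then have z: "c i = 0" if "i < k" for i using qbasis_unique[OF b, of c i] that by blast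
  show "c i = 0"
  proof (cases "i < k")
   case False
   then have "c (k + (i - k)) = 0" using i by (intro z') simp
   then show ?thesis using False by simp
  qed (use z in simp)
 qed
 have "qco U (k + l) bb x i = qco U k b x i" if x: "x \<in> W" and i: "i < k" for x i
 proof -
  let ?c = "\<lambda>i. if i < k then qco U k b x i else 0"
  have "(\<Sum>i<k + l. scale (?c i) (bb i)) = (\<Sum>i<k. scale (qco U k b x i) (b i))" unfolding split by simp
  then have "x - (\<Sum>i<k + l. scale (?c i) (bb i)) \<in> U" using qco_in[OF b x] by simp
  then have "qco U (k + l) bb x i = ?c i"
   using x S(2) i by (intro qco_eq[OF U qb]) auto
  then show ?thesis using i by simp
 qed
 then show thesis using that[OF qb] by (simp add: bb_def)
qed

end


subsection \<open>Nilpotency of a connected linear group\<close>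

text \<open>With \<open>N = x - \<nu>\<close>, commutation with \<open>x\<close> sends
  \<open>N^i A N^j\<close> to \<open>N^(i+1) A N^j - N^i A N^(j+1)\<close>. After
  \<open>2 * d\<close> steps one of the two exponents is at least \<open>d\<close> in every
  term.\<close>

lemma (in K_algebra) ad_nilpotent:
 assumes P: "(x - sc \<nu> 1) ^ d * P = 0" "P * x = x * P" and A: "P * A * P = A"
 shows "((\<lambda>B. x * B - B * x) ^^ (2 * d)) A = 0"
proof -
 define N where "N = x - sc \<nu> 1"
 let ?D = "\<lambda>B. x * B - B * x"
 have PN: "P * N ^ j = N ^ j * P" for j
  using aev_commute[OF P(2), of "[:- \<nu>, 1:] ^ j"] by (simp add: N_def)
 have NP: "N ^ j * P = 0" if "d \<le> j" for j
 proof -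
  have "N ^ j = N ^ (j - d) * N ^ d" using that by (simp add: power_add[symmetric])
  then show ?thesis using P(1) by (simp add: N_def mult.assoc)
 qed
 have left: "N ^ j * A = 0" if "d \<le> j" for j
 proof -
  have "N ^ j * A = (N ^ j * P) * A * P" using A by (simp only: mult.assoc)
  then show ?thesis using NP[OF that] by simp
 qed
 have right: "A * N ^ j = 0" if "d \<le> j" for j
 proof -
  have "A * N ^ j = (P * A * P) * N ^ j" by (simp only: A)
  also have "\<dots> = P * A * (P * N ^ j)" by (simp only: mult.assoc)
  finally have "A * N ^ j = P * A * (P * N ^ j)" .
  then show ?thesis using NP[OF that] PN[of j] by simp
 qed
 have D_diff: "(?D ^^ n) (B - C) = (?D ^^ n) B - (?D ^^ n) C" for n B C
  by (induction n) (simp_all only: funpow.simps o_apply id_apply right_diff_distrib left_diff_distrib, simp)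
 have x: "x = N + sc \<nu> 1" by (simp add: N_def)
 have D_step: "?D (N ^ i * A * N ^ j) = N ^ Suc i * A * N ^ j - N ^ i * A * N ^ Suc j" for i j
 proof -
  have "x * (N ^ i * A * N ^ j) = N ^ Suc i * A * N ^ j + sc \<nu> (N ^ i * A * N ^ j)"
   unfolding x by (simp add: distrib_right mult.assoc)
  moreover have "(N ^ i * A * N ^ j) * x = N ^ i * A * N ^ Suc j + sc \<nu> (N ^ i * A * N ^ j)"
   unfolding x by (simp add: distrib_left mult.assoc power_commutes)
  ultimately show ?thesis by simp
 qed
 have "(?D ^^ n) (N ^ i * A * N ^ j) = 0" if "2 * d \<le> n + i + j" for n i j
  using that
 proof (induction n arbitrary: i j)
  case 0
  then consider "d \<le> i" | "d \<le> j" by linarith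
  then show ?case
  proof cases
   case 1
   then show ?thesis using left by simp
  next
   case 2
   then show ?thesis using right by (simp add: mult.assoc)
  qed
 next
  case (Suc n)
  have "(?D ^^ Suc n) (N ^ i * A * N ^ j) = (?D ^^ n) (?D (N ^ i * A * N ^ j))" by (simp only: funpow_Suc_right o_apply)
  also have "\<dots> = (?D ^^ n) (N ^ Suc i * A * N ^ j) - (?D ^^ n) (N ^ i * A * N ^ Suc j)"
   unfolding D_step by (rule D_diff)
  also have "\<dots> = 0" using Suc.IH[of "Suc i" j] Suc.IH[of i "Suc j"] Suc.prems by simp
  finally show ?case .
 qed
 from this[of "2 * d" 0 0] show ?thesis by simp
qed

locale linear_bilinear = linear_connected G H closed sc R d tr \<phi>
 for G :: "('a, 'b) monoid_scheme" (structure) and H closed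
  and sc :: "'k::alg_closed_field \<Rightarrow> 'r::ring_1 \<Rightarrow> 'r" and R d tr \<phi> +
 fixes B0 :: "'r set"
 assumes fin_B0: "finite B0" and R_span: "R \<subseteq> module.span sc B0"
  and \<phi>_inj: "inj_on \<phi> (carrier G)"
  and closed_bilinear: "\<lbrakk>\<And>x y z. \<lbrakk>x \<in> R; y \<in> R; z \<in> R\<rbrakk> \<Longrightarrow> l (x + y) z = l x z + (l y z :: 'k);
    \<And>x y z. \<lbrakk>x \<in> R; y \<in> R; z \<in> R\<rbrakk> \<Longrightarrow> l z (x + y) = l z x + l z y;
    \<And>c x y. \<lbrakk>x \<in> R; y \<in> R\<rbrakk> \<Longrightarrow> l (sc c x) y = c * l x y;
    \<And>c x y. \<lbrakk>x \<in> R; y \<in> R\<rbrakk> \<Longrightarrow> l x (sc c y) = c * l x y\<rbrakk>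
   \<Longrightarrow> closed {v \<in> carrier G. l (\<phi> v) (\<phi> (inv v)) = 0}"
begin

sublocale lv: closed_vector_space sc
 by unfold_locales (simp_all add: sc_add_right sc_add_left)

lemma R_subspace: "lv.subspace R"
 by (rule lv.subspaceI) (auto intro: R_zero R_add R_sc)

definition conjop :: "'a \<Rightarrow> 'r \<Rightarrow> 'r" where
 "conjop w A = \<phi> w * A * \<phi> (inv w)"

lemma conjop_linop: "lv.linop (conjop w)"
 by (simp add: lv.linop_def conjop_def distrib_left distrib_right)

lemma conjop_mult:
 assumes "g \<in> carrier G" "h \<in> carrier G"
 shows "conjop g (conjop h A) = conjop (g \<otimes> h) A"
 using assms by (simp add: conjop_def \<phi>_mult inv_mult_group mult.assoc)

lemma conjop_one [simp]: "conjop \<one> A = A"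
 by (simp add: conjop_def \<phi>_one)

lemma conjop_inv:
 assumes "g \<in> carrier G"
 shows "conjop (inv g) (conjop g A) = A"
 using assms by (simp add: conjop_mult)

lemma conjop_R: "g \<in> carrier G \<Longrightarrow> A \<in> R \<Longrightarrow> conjop g A \<in> R"
 by (simp add: conjop_def R_mult \<phi>_R)

lemma conjop_funpow:
 assumes "w \<in> carrier G"
 shows "(conjop w ^^ n) A = conjop (w [^] n) A"
proof (induction n)
 case (Suc n)
 have "(conjop w ^^ Suc n) A = conjop w (conjop (w [^] n) A)" using Suc by simp
 also have "\<dots> = conjop (w \<otimes> w [^] n) A" using assms by (simp add: conjop_mult)
 also have "w \<otimes> w [^] n = w [^] Suc n" using assms by (simp only: nat_pow_Suc2)
 finally show ?case .
qed simp

text \<open>For \<open>u = w^e\<close>, conjugation by \<open>u\<close> minus the identity is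
  commutation with \<open>u\<close> followed by multiplication by \<open>u^-1\<close>, and these two
  operations commute. So its powers are controlled by \<open>ad_nilpotent\<close> on each
  block.\<close>

lemma conjop_power_unipotent:
 assumes w: "w \<in> carrier G"
  and L: "finite L" "(\<Sum>c\<in>L. p c) = 1" "\<And>c. c \<in> L \<Longrightarrow> p c * p c = p c"
  and p: "\<And>c. c \<in> L \<Longrightarrow> p c * \<phi> w = \<phi> w * p c" "\<And>c. c \<in> L \<Longrightarrow> \<exists>\<nu>. (\<phi> w ^ e - sc \<nu> 1) ^ d * p c = 0"
  and A: "\<And>c. c \<in> L \<Longrightarrow> p c * A = A * p c"
 shows "((\<lambda>B. (conjop w ^^ e) B - B) ^^ (2 * d)) A = 0"
proof -
 define u where "u = w [^] e"
 have u: "u \<in> carrier G" "\<phi> u = \<phi> w ^ e" using w by (simp_all add: u_def \<phi>_pow)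
 let ?P = "\<lambda>B. conjop u B - B" and ?D = "\<lambda>B. \<phi> u * B - B * \<phi> u"
 have PD: "(?P ^^ n) B = (?D ^^ n) B * \<phi> (inv u) ^ n" for n B
 proof (induction n)
  case (Suc n)
  define C where "C = (?D ^^ n) B"
  have "C * \<phi> (inv u) ^ n = C * (\<phi> u * \<phi> (inv u)) * \<phi> (inv u) ^ n" using \<phi>_inv(2)[OF u(1)] by simp
  then have 1: "C * \<phi> (inv u) ^ n = C * \<phi> u * \<phi> (inv u) ^ Suc n" by (simp add: mult.assoc)
  have 2: "conjop u (C * \<phi> (inv u) ^ n) = \<phi> u * C * \<phi> (inv u) ^ Suc n"
   by (simp add: conjop_def mult.assoc power_commutes)
  have "(?P ^^ Suc n) B = conjop u (C * \<phi> (inv u) ^ n) - C * \<phi> (inv u) ^ n" using Suc by (simp add: C_def)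
  also have "\<dots> = ?D C * \<phi> (inv u) ^ Suc n" unfolding 2 by (subst 1) (simp only: left_diff_distrib)
  finally show ?case by (simp add: C_def)
 qed simp
 have P_lin: "lv.linop ?P" using conjop_linop[of u] by (simp add: lv.linop_def sc_diff_right)
 have "(?P ^^ (2 * d)) (p c * A) = 0" if c: "c \<in> L" for c
 proof -
  obtain \<nu> where \<nu>: "(\<phi> u - sc \<nu> 1) ^ d * p c = 0" using p(2)[OF c] u(2) by auto
  have "p c * \<phi> u = \<phi> u * p c" unfolding u(2)
   using aev_commute[OF p(1)[OF c], of "[:0, 1:] ^ e"] by simp
  moreover have "p c * (p c * A) * p c = p c * A"
  proof -
   have "p c * (p c * A) * p c = (p c * p c) * (A * p c)" by (simp only: mult.assoc)
   also have "\<dots> = (p c * p c) * A" unfolding L(3)[OF c] A[OF c, symmetric] by (simp only: mult.assoc[symmetric] L(3)[OF c])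
   finally show ?thesis using L(3)[OF c] by simp
  qed
  ultimately have "(?D ^^ (2 * d)) (p c * A) = 0" using ad_nilpotent[OF \<nu>] by blast
  then show ?thesis unfolding PD by simp
 qed
 then have "(\<Sum>c\<in>L. (?P ^^ (2 * d)) (p c * A)) = 0" by simp
 then have "(?P ^^ (2 * d)) (\<Sum>c\<in>L. p c * A) = 0"
  by (simp only: lv.linop_simps(5)[OF lv.linop_funpow[OF P_lin]])
 moreover have "(\<Sum>c\<in>L. p c * A) = A" using L(2) by (simp add: sum_distrib_right[symmetric])
 ultimately have "(?P ^^ (2 * d)) A = 0" by simp
 moreover have "(\<lambda>B. (conjop w ^^ e) B - B) = ?P" using conjop_funpow[OF w] by (simp add: u_def)
 ultimately show ?thesis by simp
qed

text \<open>The trace of \<open>conjop w\<close> on the section takes finitely many values, being a sum of \<open>e\<close>-th roots of unity,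
 and \<open>H\<close> is irreducible.\<close>
lemma constant_trace:
 assumes E: "E \<subseteq> R" and e: "e > (0::nat)"
  and unip: "\<And>w A. \<lbrakk>w \<in> H; A \<in> E\<rbrakk> \<Longrightarrow> ((\<lambda>B. (conjop w ^^ e) B - B) ^^ (2 * d)) A = 0"
  and U: "lv.subspace U" and W: "lv.subspace W" and UW: "U \<subseteq> W" and WE: "W \<subseteq> E"
  and inv: "\<And>w. w \<in> H \<Longrightarrow> lv.invariant (conjop w) U" "\<And>w. w \<in> H \<Longrightarrow> lv.invariant (conjop w) W"
  and b: "lv.qbasis U W k b"
 shows "\<exists>\<kappa>. \<forall>w\<in>H. lv.qtr U k b (conjop w) = \<kappa>"
proof (cases "k = 0")
 case True
 then show ?thesis by (simp add: lv.qtr_def)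
next
 case False
 define Z where "Z = {z :: 'k. z ^ e = 1}"
 have "finite Z"
 proof -
  have "coeff (monom (1::'k) e - 1) e = 1" using e by (simp add: coeff_1)
  then have "monom (1::'k) e - 1 \<noteq> 0" by (metis coeff_0 zero_neq_one)
  then have "finite {z. poly (monom (1::'k) e - 1) z = 0}" by (rule poly_roots_finite)
  then show ?thesis by (simp add: Z_def poly_monom)
 qed
 \<comment> \<open>The possible traces: sums of at most \<open>card B0\<close> elements of the
   finite set \<open>Z\<close>.\<close>
 define S where "S = sum_list ` {xs. set xs \<subseteq> Z \<and> length xs \<le> card B0}"
 have finS: "finite S" unfolding S_def by (intro finite_imageI finite_lists_length_le \<open>finite Z\<close>)
 have WR: "W \<subseteq> R" using WE E by blast
 have WB: "W \<subseteq> lv.span B0" using WR R_span by blast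
 have val: "lv.qtr U k b (conjop w) \<in> S" if w: "w \<in> H" for w
 proof -
  obtain n z where n: "n \<le> card B0" "lv.qtr U k b (conjop w) = (\<Sum>i<n. z i)"
   and z: "\<And>i. i < n \<Longrightarrow> \<exists>V x. lv.subspace V \<and> lv.invariant (conjop w) V \<and> U \<subseteq> V \<and> x \<in> W \<and> x \<notin> V
    \<and> conjop w x - sc (z i) x \<in> V"
   using lv.qtr_flag[OF conjop_linop W inv(2)[OF w] WB fin_B0 U inv(1)[OF w] UW b] by metis
  have "z i \<in> Z" if i: "i < n" for i
  proof -
   obtain V x where V: "lv.subspace V" "lv.invariant (conjop w) V" "x \<in> W" "x \<notin> V" "conjop w x - sc (z i) x \<in> V"
    using z[OF i] by blast
   have "x \<in> E" using V(3) WE by blast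
   then show ?thesis unfolding Z_def
    using lv.unipotent_power_eigenvalue[OF conjop_linop V(1,2,5,4) unip[OF w]] by blast
  qed
  then have "sum_list (map z [0..<n]) \<in> S" unfolding S_def
   by (intro imageI) (use n(1) in auto)
  moreover have "sum_list (map z [0..<n]) = (\<Sum>i<n. z i)"
   by (simp add: interv_sum_list_conv_sum_set_nat lessThan_atLeast0)
  ultimately show ?thesis using n(2) by simp
 qed
 obtain K bb where bb: "lv.qbasis U R K bb" "k \<le> K" "\<And>i. i < k \<Longrightarrow> bb i = b i"
  "\<And>x i. x \<in> W \<Longrightarrow> i < k \<Longrightarrow> lv.qco U K bb x i = lv.qco U k b x i"
  using lv.qbasis_extend[OF U W UW R_subspace WR R_span fin_B0 b] by blast
 define q where "q x i = lv.qco U K bb x i" for x i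
 have q_add: "q (x + y) i = q x i + q y i" if "x \<in> R" "y \<in> R" "i < k" for x y i
  unfolding q_def by (rule lv.qco_add[OF U R_subspace bb(1) that(1,2)]) (use that bb(2) in simp)
 have q_sc: "q (sc c x) i = c * q x i" if "x \<in> R" "i < k" for c x i
  unfolding q_def by (rule lv.qco_scale[OF U R_subspace bb(1) that(1)]) (use that bb(2) in simp)
 have bW: "b i \<in> W" if "i < k" for i using b that by (simp add: lv.qbasis_def)
 have bR: "b i \<in> R" if "i < k" for i using bW[OF that] WR by blast
 have k0: "0 < k" using False by simp
 \<comment> \<open>The constant \<open>\<kappa>\<close> also has to be written bilinearly:
   \<open>\<phi> v * \<phi> (inv v) * b 0\<close> equals \<open>b 0\<close>, whose coordinate at 0
   is 1. This uses \<open>b 0\<close>, hence the separate treatment of \<open>k = 0\<close>.\<close>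
 define l where "l \<kappa> x y = (\<Sum>i<k. q (x * b i * y) i) - \<kappa> * q (x * y * b 0) 0" for \<kappa> x y
 have "closed {v \<in> carrier G. l \<kappa> (\<phi> v) (\<phi> (inv v)) = 0}" for \<kappa>
 proof (rule closed_bilinear)
  fix x y z assume R: "x \<in> R" "y \<in> R" "z \<in> R"
  have "(\<Sum>i<k. q ((x + y) * b i * z) i) = (\<Sum>i<k. q (x * b i * z) i + q (y * b i * z) i)"
   by (rule sum.cong) (use R bR in \<open>auto simp: distrib_right q_add R_mult\<close>)
  then show "l \<kappa> (x + y) z = l \<kappa> x z + l \<kappa> y z"
   using R bR[OF k0] k0 by (simp add: l_def distrib_right q_add R_mult sum.distrib algebra_simps)
  have "(\<Sum>i<k. q (z * b i * (x + y)) i) = (\<Sum>i<k. q (z * b i * x) i + q (z * b i * y) i)"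
   by (rule sum.cong) (use R bR in \<open>auto simp: distrib_left q_add R_mult\<close>)
  moreover have "q (z * (x + y) * b 0) 0 = q (z * x * b 0) 0 + q (z * y * b 0) 0"
   using R bR[OF k0] k0 by (simp add: distrib_left distrib_right q_add R_mult)
  ultimately show "l \<kappa> z (x + y) = l \<kappa> z x + l \<kappa> z y"
   by (simp add: l_def sum.distrib distrib_left)
 next
  fix c x y assume R: "x \<in> R" "y \<in> R"
  have "(\<Sum>i<k. q (sc c x * b i * y) i) = (\<Sum>i<k. c * q (x * b i * y) i)"
   by (rule sum.cong) (use R bR in \<open>auto simp: q_sc R_mult\<close>)
  then show "l \<kappa> (sc c x) y = c * l \<kappa> x y"
   using R bR[OF k0] k0 by (simp add: l_def q_sc R_mult sum_distrib_left right_diff_distrib mult.left_commute)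
  have "(\<Sum>i<k. q (x * b i * sc c y) i) = (\<Sum>i<k. c * q (x * b i * y) i)"
   by (rule sum.cong) (use R bR in \<open>auto simp: q_sc R_mult\<close>)
  then show "l \<kappa> x (sc c y) = c * l \<kappa> x y"
   using R bR[OF k0] k0 by (simp add: l_def q_sc R_mult sum_distrib_left right_diff_distrib mult.left_commute)
 qed
 moreover have l_H: "l \<kappa> (\<phi> v) (\<phi> (inv v)) = lv.qtr U k b (conjop v) - \<kappa>" if v: "v \<in> H" for v \<kappa>
 proof -
  have "q (\<phi> v * b i * \<phi> (inv v)) i = lv.qco U k b (conjop v (b i)) i" if i: "i < k" for i
  proof -
   have "conjop v (b i) \<in> W" using inv(2)[OF v] bW[OF i] by (simp add: lv.invariant_def)
   then show ?thesis using bb(4)[OF _ i] by (simp add: q_def conjop_def)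
  qed
  moreover have "q (\<phi> v * \<phi> (inv v) * b 0) 0 = 1"
  proof -
   have "lv.qco U k b (b 0) 0 = (if (0::nat) = 0 then 1 else 0)"
    by (rule lv.qco_eq[OF U b bW[OF k0] _ k0, where c = "\<lambda>i. if i = 0 then 1 else 0"])
     (use k0 lv.subspace_0[OF U] in \<open>simp add: if_distrib[of "\<lambda>c. sc c _"] cong: if_cong\<close>)
   then show ?thesis using bb(4)[OF bW[OF k0] k0] \<phi>_inv(2)[of v] v by (simp add: q_def)
  qed
  ultimately show ?thesis by (simp add: l_def lv.qtr_def)
 qed
 ultimately have "\<exists>Y\<in>(\<lambda>\<kappa>. {v \<in> carrier G. l \<kappa> (\<phi> v) (\<phi> (inv v)) = 0}) ` S. H \<subseteq> Y"
  using val by (intro irreducible) (auto intro: finS)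
 then obtain \<kappa> where "H \<subseteq> {v \<in> carrier G. l \<kappa> (\<phi> v) (\<phi> (inv v)) = 0}" by blast
 then have "lv.qtr U k b (conjop w) = \<kappa>" if "w \<in> H" for w using l_H[OF that, of \<kappa>] that by fastforce
 then show ?thesis by blast
qed

text \<open>\<open>C\<close> is a chain of subspaces centralised by \<open>H\<close> factor by factor, so the subgroups acting trivially
 on all \<open>C j / C (j - i)\<close> form a central series of \<open>H\<close>.\<close>
lemma stability_series:
 assumes C0: "C 0 = {0}" and subs: "\<forall>i. lv.subspace (C i)"
  and triv: "\<forall>i<n. \<forall>T\<in>conjop ` H. \<forall>x\<in>C (Suc i). T x - x \<in> C i"
  and mono: "\<forall>i<n. C i \<subseteq> C (Suc i)"
  and H: "\<And>h. h \<in> H \<Longrightarrow> \<phi> h \<in> C n"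
 shows "H \<subseteq> upper_series G H {\<one>} (Suc n)"
proof -
 have sub: "lv.subspace (C i)" for i using subs by blast
 have mono_le: "C i \<subseteq> C j" if "i \<le> j" "j \<le> n" for i j
  using that by (induction j rule: dec_induct) (use mono in \<open>auto simp: Suc_le_eq\<close>)
 have step: "conjop h x - x \<in> C (j - 1)" if "h \<in> H" "j \<le> n" "x \<in> C j" for h x j
 proof (cases j)
  case 0
  then show ?thesis using that C0 by (simp add: conjop_def)
 next
  case (Suc i)
  then show ?thesis using triv that by auto
 qed
 have stable: "conjop h x \<in> C j" if h: "h \<in> H" "j \<le> n" "x \<in> C j" for h x j
 proof -
  have "conjop h x - x \<in> C j" using step[OF h] mono_le[of "j - 1" j] h(2) by auto
  then show ?thesis using lv.subspace_cong_mem[OF sub _ h(3)] by blast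
 qed
 define D where "D i = {g \<in> H. \<forall>j\<le>n. \<forall>x\<in>C j. conjop g x - x \<in> C (j - i)}" for i
 have D0: "H \<subseteq> D 0"
  using stable lv.subspace_diff[OF sub] by (auto simp: D_def)
 have D_comm: "comm G g h \<in> D (Suc i)" if g: "g \<in> D i" and h: "h \<in> H" for g h i
 proof -
  have gH: "g \<in> H" using g by (simp add: D_def)
  have G: "g \<in> carrier G" "h \<in> carrier G" using gH h by blast+
  define f where "f = comm G g h"
  have fH: "f \<in> H" unfolding f_def comm_def using gH h by (simp add: H.m_closed H.m_inv_closed)
  have fG: "f \<in> carrier G" using fH by blast
  have hgf: "h \<otimes> g \<otimes> f = g \<otimes> h"
   unfolding f_def comm_def using G by (simp add: m_assoc[symmetric]) (simp add: m_assoc)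
  have "conjop f x - x \<in> C (j - Suc i)" if j: "j \<le> n" and x: "x \<in> C j" for j x
  proof -
   define a b where "a = conjop g x - x" and "b = conjop h x - x"
   have a: "a \<in> C (j - i)" using g j x by (simp add: D_def a_def)
   have b: "b \<in> C (j - 1)" unfolding b_def by (rule step[OF h j x])
   have "\<forall>j\<le>n. \<forall>x\<in>C j. conjop g x - x \<in> C (j - i)" using g by (simp add: D_def)
   then have ga: "conjop g b - b \<in> C (j - 1 - i)" using b j by (meson diff_le_self le_trans)
   have hb: "conjop h a - a \<in> C (j - i - 1)" by (rule step[OF h _ a]) (use j in simp)
   note lin = lv.linop_simps[OF conjop_linop]
   \<comment> \<open>The operator identity behind this is
     \<open>h g (f - 1) = g h - h g = (g - 1)(h - 1) - (h - 1)(g - 1)\<close> for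
     \<open>f = [g, h]\<close>; each product on the right lowers the filtration by
     \<open>i + 1\<close>.\<close>
   have "conjop (h \<otimes> g) (conjop f x - x) = conjop (g \<otimes> h) x - conjop (h \<otimes> g) x"
    using G fG by (simp add: lin conjop_mult hgf)
   also have "\<dots> = conjop g (conjop h x) - conjop h (conjop g x)" using G by (simp add: conjop_mult)
   also have "\<dots> = conjop g (b + x) - conjop h (a + x)" by (simp add: a_def b_def)
   also have "\<dots> = (conjop g b - b) - (conjop h a - a)"
    unfolding lin(1) by (simp add: a_def b_def)
   finally have fin: "conjop (h \<otimes> g) (conjop f x - x) \<in> C (j - Suc i)"
    using lv.subspace_diff[OF sub[of "j - Suc i"]] ga hb by (simp add: diff_commute)
   have "conjop (inv (h \<otimes> g)) (conjop (h \<otimes> g) (conjop f x - x)) \<in> C (j - Suc i)"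
    by (rule stable[OF _ _ fin]) (use h gH j in \<open>auto simp: H.m_closed H.m_inv_closed\<close>)
   then show ?thesis using G by (simp add: conjop_inv)
  qed
  then show ?thesis using fH by (simp add: D_def f_def)
 qed
 \<comment> \<open>\<open>D n\<close> acts trivially on \<open>C n\<close>, which contains all
   \<open>\<phi> h\<close>, so it centralises \<open>H\<close> and lies in term 1 of the series.
   This explains the shift by one.\<close>
 have "D (n - i) \<subseteq> upper_series G H {\<one>} (Suc i)" if "i \<le> n" for i
  using that
 proof (induction i)
  case 0
  have "comm G g h = \<one>" if g: "g \<in> D n" and h: "h \<in> H" for g h
  proof -
   have gH: "g \<in> H" using g by (simp add: D_def)
   have G: "g \<in> carrier G" "h \<in> carrier G" using gH h by blast+
   have "conjop g (\<phi> h) - \<phi> h \<in> C (n - n)" using g H[OF h] unfolding D_def by blast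
   then have "conjop g (\<phi> h) = \<phi> h" using C0 by simp
   then have "\<phi> (g \<otimes> h \<otimes> inv g) = \<phi> h" using G by (simp add: conjop_def \<phi>_mult)
   then have "g \<otimes> h \<otimes> inv g = h" using \<phi>_inj G by (auto dest: inj_onD)
   then have "g \<otimes> h = h \<otimes> g" using G by (metis inv_solve_right m_closed)
   then show ?thesis using G by (simp add: comm_eq_one_iff)
  qed
  then show ?case by (auto simp: upper_series.simps D_def)
 next
  case (Suc i)
  have eq: "Suc (n - Suc i) = n - i" using Suc.prems by simp
  show ?case
  proof
   fix g assume g: "g \<in> D (n - Suc i)"
   have "comm G g h \<in> upper_series G H {\<one>} (Suc i)" if "h \<in> H" for h
    using D_comm[OF g that] Suc.IH Suc.prems unfolding eq by auto
   moreover have "g \<in> H" using g by (simp add: D_def)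
   ultimately show "g \<in> upper_series G H {\<one>} (Suc (Suc i))" by (subst upper_series.simps(2)) blast
  qed
 qed
 from this[of n] show ?thesis using D0 by auto
qed

theorem nilpotent: "\<exists>c. H \<subseteq> upper_series G H {\<one>} c"
proof (rule central_idempotents)
 fix L :: "'k set" and e :: nat and p
 assume L: "finite L" "e > (0::nat)" "(\<Sum>c\<in>L. p c) = 1"
  "\<And>c. c \<in> L \<Longrightarrow> p c \<in> R" "\<And>c. c \<in> L \<Longrightarrow> p c * p c = p c"
  and orth: "\<And>c c'. \<lbrakk>c \<in> L; c' \<in> L; c \<noteq> c'\<rbrakk> \<Longrightarrow> p c * p c' = 0"
  and Hp: "\<And>w c. \<lbrakk>w \<in> H; c \<in> L\<rbrakk> \<Longrightarrow> \<phi> w * p c = p c * \<phi> w"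
  and nil: "\<And>w c. \<lbrakk>w \<in> H; c \<in> L\<rbrakk> \<Longrightarrow> \<exists>\<nu>. (\<phi> w ^ e - sc \<nu> 1) ^ d * p c = 0"
 \<comment> \<open>On all of \<open>R\<close>, conjugation by \<open>w\<close> also involves ratios
   of eigenvalues from different blocks. The commutant of the idempotents contains
   \<open>\<phi>\<close> of all elements of \<open>H\<close> and sees only ratios within a block,
   which are \<open>e\<close>-th roots of unity.\<close>
 define E where "E = {A \<in> R. \<forall>c\<in>L. p c * A = A * p c}"
 have ER: "E \<subseteq> R" by (auto simp: E_def)
 have E_sub: "lv.subspace E"
  by (rule lv.subspaceI) (auto simp: E_def R_zero R_add R_sc distrib_left distrib_right)
 have E_inv: "lv.invariant (conjop w) E" if w: "w \<in> H" for w
  unfolding lv.invariant_def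
 proof
  fix A assume A: "A \<in> E"
  have wG: "w \<in> carrier G" using w by blast
  have "p c * conjop w A = conjop w A * p c" if c: "c \<in> L" for c
  proof -
   have pc: "p c * \<phi> w = \<phi> w * p c" "p c * \<phi> (inv w) = \<phi> (inv w) * p c"
    using Hp[OF w c] Hp[OF H.m_inv_closed[OF w] c] by simp_all
   have "p c * conjop w A = (p c * \<phi> w) * A * \<phi> (inv w)" by (simp only: conjop_def mult.assoc)
   also have "\<dots> = \<phi> w * (p c * A) * \<phi> (inv w)" unfolding pc(1) by (simp only: mult.assoc)
   also have "p c * A = A * p c" using A c by (simp add: E_def)
   also have "\<phi> w * (A * p c) * \<phi> (inv w) = \<phi> w * A * (p c * \<phi> (inv w))" by (simp only: mult.assoc)
   also have "\<dots> = conjop w A * p c" unfolding pc(2) by (simp only: conjop_def mult.assoc)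
   finally show ?thesis .
  qed
  moreover have "conjop w A \<in> R" using conjop_R[OF wG] A by (auto simp: E_def)
  ultimately show "conjop w A \<in> E" by (simp add: E_def)
 qed
 have unip: "((\<lambda>B. (conjop w ^^ e) B - B) ^^ (2 * d)) A = 0" if w: "w \<in> H" and A: "A \<in> E" for w A
 proof (rule conjop_power_unipotent[OF _ L(1,3,5) _ nil[OF w]])
  show "w \<in> carrier G" using w by blast
  show "p c * \<phi> w = \<phi> w * p c" if "c \<in> L" for c using Hp[OF w that] by simp
  show "p c * A = A * p c" if "c \<in> L" for c using A that by (simp add: E_def)
 qed
 have EB: "E \<subseteq> lv.span B0" using ER R_span by blast
 have "\<exists>n C. C 0 = {0} \<and> C n = E \<and> (\<forall>i. lv.subspace (C i)) \<and> (\<forall>i<n. \<forall>T\<in>conjop ` H. \<forall>x\<in>C (Suc i). T x - x \<in> C i)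
  \<and> (\<forall>i<n. C i \<subseteq> C (Suc i))"
 proof (rule lv.unipotent_chain[OF _ _ _ E_sub _ EB fin_B0])
  show "lv.linop T" if "T \<in> conjop ` H" for T using that conjop_linop by blast
  show "\<forall>S\<in>conjop ` H. \<forall>T\<in>conjop ` H. (\<lambda>x. S (T x)) \<in> conjop ` H"
  proof (intro ballI)
   fix S T assume "S \<in> conjop ` H" "T \<in> conjop ` H"
   then obtain g h where gh: "g \<in> H" "h \<in> H" "S = conjop g" "T = conjop h" by blast
   then have "(\<lambda>x. S (T x)) = conjop (g \<otimes> h)" by (auto simp: conjop_mult)
   then show "(\<lambda>x. S (T x)) \<in> conjop ` H" using gh H.m_closed by blast
  qed
  have "(\<lambda>x. x) = conjop \<one>" by auto
  then show "(\<lambda>x. x) \<in> conjop ` H" using H.one_closed by blast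
  show "lv.invariant T E" if "T \<in> conjop ` H" for T using that E_inv by blast
  show "lv.subspace {0}" by (rule lv.subspaceI) auto
  show "lv.invariant T {0}" if "T \<in> conjop ` H" for T
   using that by (auto simp: lv.invariant_def conjop_def)
  show "{0} \<subseteq> E" using lv.subspace_0[OF E_sub] by blast
  fix U W k b assume *: "lv.subspace U" "lv.subspace W" "U \<subseteq> W" "W \<subseteq> E" "\<forall>T\<in>conjop ` H. lv.invariant T U"
   "\<forall>T\<in>conjop ` H. lv.invariant T W" "lv.qbasis U W k b"
  have "\<exists>\<kappa>. \<forall>w\<in>H. lv.qtr U k b (conjop w) = \<kappa>"
   by (rule constant_trace[OF ER L(2) unip *(1-4) _ _ *(7)]) (use *(5,6) in auto)
  then show "\<exists>\<kappa>. \<forall>T\<in>conjop ` H. lv.qtr U k b T = \<kappa>" by blast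
 qed
 then obtain n C where C: "C 0 = {0}" "C n = E" "\<forall>i. lv.subspace (C i)"
  "\<forall>i<n. \<forall>T\<in>conjop ` H. \<forall>x\<in>C (Suc i). T x - x \<in> C i" "\<forall>i<n. C i \<subseteq> C (Suc i)"
  by (elim exE conjE) (rule that; assumption)
 have "\<phi> h \<in> C n" if h: "h \<in> H" for h
  unfolding C(2) E_def using Hp[OF h] \<phi>_R h by auto
 then have "H \<subseteq> upper_series G H {\<one>} (Suc n)" by (rule stability_series[OF C(1,3,4,5)])
 then show ?thesis by blast
qed

corollary finite_by_hypercentral: "\<exists>N. N \<lhd> G \<and> finite N \<and> hypercentral (G Mod N)"
 using nilpotent nilpotent_imp_finite_by_hypercentral by blast

end


subsection \<open>Matrices as linear operators\<close>

text \<open>A type of class \<open>ring_1\<close> into which the \<open>m \<times> m\<close> matrices embed unitally for every \<open>m > 0\<close>: a matrix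
 acts on each of the consecutive blocks of length \<open>m\<close>.\<close>
typedef (overloaded) 'k lin = "{T :: (nat \<Rightarrow> 'k::field) \<Rightarrow> nat \<Rightarrow> 'k.
  (\<forall>x y. T (x + y) = T x + T y) \<and> (\<forall>c x. T (\<lambda>i. c * x i) = (\<lambda>i. c * T x i))}"
 morphisms app Lin
 by (rule exI[of _ "\<lambda>x. x"]) auto

setup_lifting type_definition_lin

lemma app_add: "app T (x + y) = app T x + app T y"
 using app[of T] by auto

lemma app_scale: "app T (\<lambda>i. c * x i) = (\<lambda>i. c * app T x i)"
 using app[of T] by auto

lemma lin_eqI: "(\<And>x i. app S x i = app T x i) \<Longrightarrow> S = T"
 by (simp add: app_inject[symmetric] fun_eq_iff)

instantiation lin :: (field) ring_1
begin

lift_definition zero_lin :: "'a lin" is "\<lambda>x. 0" by (auto simp: fun_eq_iff)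
lift_definition one_lin :: "'a lin" is "\<lambda>x. x" by auto
lift_definition plus_lin :: "'a lin \<Rightarrow> 'a lin \<Rightarrow> 'a lin" is "\<lambda>S T x. S x + T x"
 by (auto simp: fun_eq_iff algebra_simps)
lift_definition minus_lin :: "'a lin \<Rightarrow> 'a lin \<Rightarrow> 'a lin" is "\<lambda>S T x. S x - T x"
 by (auto simp: fun_eq_iff algebra_simps)
lift_definition uminus_lin :: "'a lin \<Rightarrow> 'a lin" is "\<lambda>T x. - T x"
 by (auto simp: fun_eq_iff algebra_simps)
lift_definition times_lin :: "'a lin \<Rightarrow> 'a lin \<Rightarrow> 'a lin" is "\<lambda>S T x. S (T x)"
 by auto

instance
proof
 show "(0::'a lin) \<noteq> 1"
 proof
  assume "(0::'a lin) = 1"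
  then have "app (0::'a lin) (\<lambda>_. 1) 0 = app 1 (\<lambda>_. 1) 0" by simp
  then show False by (simp add: zero_lin.rep_eq one_lin.rep_eq)
 qed
qed (transfer, auto simp: fun_eq_iff algebra_simps)+

end

lemmas app_simps = zero_lin.rep_eq one_lin.rep_eq plus_lin.rep_eq minus_lin.rep_eq uminus_lin.rep_eq times_lin.rep_eq

lift_definition lsc :: "'k::field \<Rightarrow> 'k lin \<Rightarrow> 'k lin" is "\<lambda>c T x i. c * T x i"
 by (auto simp: fun_eq_iff algebra_simps)

lemma K_algebra_lsc: "K_algebra lsc"
 by standard (rule lin_eqI, simp add: app_simps lsc.rep_eq app_scale algebra_simps)+

lemma app_sum: "app (\<Sum>i\<in>I. f i) x t = (\<Sum>i\<in>I. app (f i) x t)"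
 by (induction I rule: infinite_finite_induct) (auto simp: app_simps)

lemma app_power: "app (T ^ n) x = (app T ^^ n) x"
 by (induction n) (auto simp: app_simps)

lift_definition mlin :: "nat \<Rightarrow> 'k::field mat \<Rightarrow> 'k lin" is
 "\<lambda>m A x i. \<Sum>j<m. A $$ (i mod m, j) * x (m * (i div m) + j)"
 by (auto simp: fun_eq_iff sum.distrib sum_distrib_left algebra_simps)

lemma mlin_mult:
 fixes A :: "'k::field mat"
 assumes A: "A \<in> carrier_mat m m" and B: "B \<in> carrier_mat m m" and m: "0 < m"
 shows "mlin m (A * B) = mlin m A * mlin m B"
proof (rule lin_eqI)
 fix x :: "nat \<Rightarrow> 'k" and i
 let ?y = "\<lambda>j. x (m * (i div m) + j)"
 have r: "i mod m < m" using m by simp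
 have "app (mlin m (A * B)) x i = (\<Sum>j<m. \<Sum>k<m. A $$ (i mod m, k) * (B $$ (k, j) * ?y j))"
  unfolding mlin.rep_eq
  by (rule sum.cong) (use A B r in \<open>auto simp: scalar_prod_def lessThan_atLeast0 sum_distrib_right mult.assoc intro!: sum.cong\<close>)
 also have "\<dots> = (\<Sum>k<m. A $$ (i mod m, k) * (\<Sum>j<m. B $$ (k, j) * ?y j))"
  by (subst sum.swap) (simp add: sum_distrib_left)
 also have "\<dots> = app (mlin m A * mlin m B) x i"
  by (simp add: app_simps mlin.rep_eq)
 finally show "app (mlin m (A * B)) x i = app (mlin m A * mlin m B) x i" .
qed

lemma mlin_one:
 assumes m: "0 < m"
 shows "mlin m (1\<^sub>m m :: 'k::field mat) = 1"
proof (rule lin_eqI)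
 fix x :: "nat \<Rightarrow> 'k" and i
 have "app (mlin m (1\<^sub>m m)) x i = (\<Sum>j<m. if j = i mod m then x (m * (i div m) + j) else 0)"
  unfolding mlin.rep_eq by (rule sum.cong) (use m in auto)
 also have "\<dots> = x i" using m by simp
 finally show "app (mlin m (1\<^sub>m m)) x i = app 1 x i" by (simp add: app_simps)
qed

lemma mlin_add:
 assumes "A \<in> carrier_mat m m" "B \<in> carrier_mat m m" "0 < m"
 shows "mlin m (A + B) = mlin m A + mlin m B"
 using assms by (intro lin_eqI) (simp add: mlin.rep_eq app_simps sum.distrib[symmetric] distrib_right)

lemma mlin_smult:
 assumes "A \<in> carrier_mat m m" "0 < m"
 shows "mlin m (c \<cdot>\<^sub>m A) = lsc c (mlin m A)"
 using assms by (intro lin_eqI) (simp add: mlin.rep_eq lsc.rep_eq sum_distrib_left mult.assoc)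

definition delta :: "'i \<Rightarrow> 'i \<Rightarrow> 'k::field" where
 "delta j i = (if i = j then 1 else 0)"

lemma app_mlin_delta:
 assumes "i < m" "j < m"
 shows "app (mlin m A) (delta j) i = A $$ (i, j)"
 using assms by (simp add: mlin.rep_eq delta_def if_distrib cong: if_cong)

lemma mlin_inj: "inj_on (mlin m) (carrier_mat m m)"
proof (rule inj_onI)
 fix A B :: "'a mat" assume AB: "A \<in> carrier_mat m m" "B \<in> carrier_mat m m" "mlin m A = mlin m B"
 show "A = B"
  by (rule eq_matI) (use AB app_mlin_delta[of _ m _ A] app_mlin_delta[of _ m _ B] in auto)
qed

definition munit :: "nat \<Rightarrow> nat \<times> nat \<Rightarrow> 'k::field lin" where
 "munit m p = mlin m (mat m m (\<lambda>q. if q = p then 1 else 0))"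

lemma mlin_decomp:
 fixes A :: "'k::field mat"
 assumes A: "A \<in> carrier_mat m m" and m: "0 < m"
 shows "mlin m A = (\<Sum>p\<in>{..<m} \<times> {..<m}. lsc (A $$ p) (munit m p))"
proof (rule lin_eqI)
 fix x :: "nat \<Rightarrow> 'k" and t
 let ?y = "\<lambda>j. x (m * (t div m) + j)" and ?r = "t mod m"
 have r: "?r < m" using m by simp
 have un: "app (munit m (i, j)) x t = (if i = ?r then ?y j else 0)" if "j < m" for i j
 proof -
  have "app (munit m (i, j)) x t = (\<Sum>l<m. if l = j then (if i = ?r then ?y l else 0) else 0)"
   unfolding munit_def mlin.rep_eq by (rule sum.cong) (use r in auto)
  then show ?thesis using that by simp
 qed
 have "(\<Sum>i<m. \<Sum>j<m. A $$ (i, j) * app (munit m (i, j)) x t)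
  = (\<Sum>i<m. if i = ?r then (\<Sum>j<m. A $$ (i, j) * ?y j) else 0)"
  by (rule sum.cong[OF refl]) (simp add: un)
 also have "\<dots> = app (mlin m A) x t" using r by (simp add: mlin.rep_eq)
 finally show "app (mlin m A) x t = app (\<Sum>p\<in>{..<m} \<times> {..<m}. lsc (A $$ p) (munit m p)) x t"
  by (simp add: app_sum lsc.rep_eq sum.cartesian_product case_prod_unfold)
qed

definition fscale :: "'k::field \<Rightarrow> ('i \<Rightarrow> 'k) \<Rightarrow> 'i \<Rightarrow> 'k" where
 "fscale c f = (\<lambda>i. c * f i)"

interpretation fv: closed_vector_space "fscale :: 'k::alg_closed_field \<Rightarrow> ('i \<Rightarrow> 'k) \<Rightarrow> 'i \<Rightarrow> 'k"
 by unfold_locales (auto simp: fscale_def fun_eq_iff algebra_simps)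

lemma fun_sum_apply: "(\<Sum>i\<in>I. f i) x = (\<Sum>i\<in>I. f i x)"
 by (induction I rule: infinite_finite_induct) auto

lemma delta_expand:
 assumes "finite T" "\<And>t. t \<notin> T \<Longrightarrow> f t = 0"
 shows "f = (\<Sum>t\<in>T. fscale (f t) (delta t))"
proof
 fix s
 have "(\<Sum>t\<in>T. fscale (f t) (delta t)) s = (\<Sum>t\<in>T. if t = s then f s else 0)"
  unfolding fun_sum_apply by (rule sum.cong) (auto simp: fscale_def delta_def)
 also have "\<dots> = f s" using assms by simp
 finally show "f s = (\<Sum>t\<in>T. fscale (f t) (delta t)) s" by simp
qed

text \<open>The trace is read off the first block of length \<open>m\<close>; the operator repeats
  the same matrix on infinitely many blocks, so the sum over all positions would not be
  finite.\<close>

definition mtr :: "nat \<Rightarrow> 'k::field lin \<Rightarrow> 'k" where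
 "mtr m x = (\<Sum>i<m. app x (delta i) i)"

text \<open>This is \<open>qtr_flag\<close> for the space of sequences supported on the first
  \<open>m\<close> positions, with lower space 0 and the basis \<open>delta\<close>, in which the
  abstract trace is the matrix trace.\<close>

lemma mtr_eigenvalues:
 fixes A :: "'k::alg_closed_field mat"
 assumes m: "0 < m"
 shows "\<exists>n z. mtr m (mlin m A) = (\<Sum>i<n. z i)
  \<and> (\<forall>i<n. \<exists>V y. fv.subspace V \<and> fv.invariant (app (mlin m A)) V \<and> y \<notin> V \<and> app (mlin m A) y - fscale (z i) y \<in> V)
  \<and> ((\<forall>i<n. z i = 0) \<longrightarrow> (\<forall>j<m. (app (mlin m A) ^^ n) (delta j) = 0))"
proof -
 define T where "T = app (mlin m A)"
 have T: "fv.linop T" by (simp add: fv.linop_def T_def app_add app_scale fscale_def)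
 define W where "W = {f :: nat \<Rightarrow> 'k. \<forall>i\<ge>m. f i = 0}"
 have W: "fv.subspace W" by (rule fv.subspaceI) (auto simp: W_def fscale_def)
 have dW: "delta i \<in> W" if "i < m" for i using that by (auto simp: W_def delta_def)
 have expand: "f = (\<Sum>i<m. fscale (f i) (delta i))" if "f \<in> W" for f
  by (rule delta_expand) (use that in \<open>auto simp: W_def not_less\<close>)
 have "T f i = 0" if f: "f \<in> W" and i: "m \<le> i" for f i
 proof -
  have "1 \<le> i div m" using i m by (simp add: Suc_le_eq div_greater_zero_iff)
  then have "m \<le> m * (i div m) + j" for j using m by (metis mult.right_neutral mult_le_mono2 trans_le_add1)
  then show ?thesis using f by (simp add: T_def mlin.rep_eq W_def)
 qed
 then have TW: "fv.invariant T W" by (auto simp: fv.invariant_def W_def)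
 have WB: "W \<subseteq> fv.span (delta ` {..<m})"
 proof
  fix f assume "f \<in> W"
  have "(\<Sum>i<m. fscale (f i) (delta i)) \<in> fv.span (delta ` {..<m})"
   by (intro fv.span_sum fv.span_scale fv.span_base) auto
  then show "f \<in> fv.span (delta ` {..<m})" using expand[OF \<open>f \<in> W\<close>] by simp
 qed
 have zero: "fv.subspace {0}" "fv.invariant T {0}" "{0} \<subseteq> W"
  using fv.linop_simps(3)[OF T] fv.subspace_0[OF W] by (auto simp: fv.subspace_def fv.invariant_def fscale_def fun_eq_iff)
 have b: "fv.qbasis {0} W m delta" unfolding fv.qbasis_def
 proof (intro conjI allI impI ballI)
  show "delta i \<in> W" if "i < m" for i by (rule dW[OF that])
  show "\<exists>c. f - (\<Sum>i<m. fscale (c i) (delta i)) \<in> {0}" if "f \<in> W" for f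
   using expand[OF that] by (intro exI[of _ f]) simp
  fix c :: "nat \<Rightarrow> 'k" and i assume c: "(\<Sum>i<m. fscale (c i) (delta i)) \<in> {0}" and i: "i < m"
  have "(\<Sum>j<m. fscale (c j) (delta j)) i = (\<Sum>j<m. if j = i then c i else 0)"
   unfolding fun_sum_apply by (rule sum.cong) (auto simp: fscale_def delta_def)
  then show "c i = 0" using c i by simp
 qed
 have "fv.qco {0} m delta (T (delta i)) i = T (delta i) i" if i: "i < m" for i
 proof (rule fv.qco_eq[OF zero(1) b _ _ i, where c = "T (delta i)"])
  show TdW: "T (delta i) \<in> W" using TW dW[OF i] by (simp add: fv.invariant_def)
  show "T (delta i) - (\<Sum>j<m. fscale (T (delta i) j) (delta j)) \<in> {0}" using expand[OF TdW] by simp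
 qed
 then have tr: "fv.qtr {0} m delta T = mtr m (mlin m A)" by (simp add: fv.qtr_def mtr_def T_def)
 show ?thesis
 proof (rule fv.qtr_flag[OF T W TW WB _ zero b])
  show "finite (delta ` {..<m})" by simp
  fix n z assume n: "fv.qtr {0} m delta T = (\<Sum>i<n. z i)"
   "\<And>i. i < n \<Longrightarrow> \<exists>V x. fv.subspace V \<and> fv.invariant T V \<and> {0} \<subseteq> V \<and> x \<in> W \<and> x \<notin> V \<and> T x - fscale (z i) x \<in> V"
   "(\<forall>i<n. z i = 0) \<Longrightarrow> \<forall>x\<in>W. (T ^^ n) x \<in> {0}"
  show ?thesis unfolding T_def[symmetric]
  proof (rule exI[of _ n], rule exI[of _ z], intro conjI allI impI)
   show "mtr m (mlin m A) = (\<Sum>i<n. z i)" using n(1) tr by simp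
   show "\<exists>V y. fv.subspace V \<and> fv.invariant T V \<and> y \<notin> V \<and> T y - fscale (z i) y \<in> V" if "i < n" for i
    using n(2)[OF that] by blast
   show "(T ^^ n) (delta j) = 0" if "\<forall>i<n. z i = 0" "j < m" for j
    using n(3)[OF that(1)] dW[OF that(2)] by blast
  qed
 qed
qed

lemma linop_app: "fv.linop (app (x :: 'k::alg_closed_field lin))"
 by (simp add: fv.linop_def app_add app_scale fscale_def)

lemma mtr_nilpotent:
 fixes A :: "'k::alg_closed_field mat"
 assumes m: "0 < m" and nil: "mlin m A ^ n = 0"
 shows "mtr m (mlin m A) = 0"
proof -
 obtain k z where k: "mtr m (mlin m A) = (\<Sum>i<k. z i)"
  and z: "\<forall>i<k. \<exists>V y. fv.subspace V \<and> fv.invariant (app (mlin m A)) V \<and> y \<notin> V \<and> app (mlin m A) y - fscale (z i) y \<in> V"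
  and "(\<forall>i<k. z i = 0) \<longrightarrow> (\<forall>j<m. (app (mlin m A) ^^ k) (delta j) = 0)"
  using mtr_eigenvalues[OF m, of A] by (elim exE conjE) (rule that; assumption)
 have "z i = 0" if i: "i < k" for i
 proof (rule ccontr)
  assume nz: "z i \<noteq> 0"
  obtain V y where V: "fv.subspace V" "fv.invariant (app (mlin m A)) V" "y \<notin> V" "app (mlin m A) y - fscale (z i) y \<in> V"
   using z i by blast
  have "(app (mlin m A) ^^ n) y - fscale (z i ^ n) y \<in> V" by (rule fv.power_eigen_mod[OF linop_app V(1,2,4)])
  moreover have "(app (mlin m A) ^^ n) y = 0" unfolding app_power[symmetric] nil by (simp add: app_simps)
  ultimately have "- fscale (z i ^ n) y \<in> V" by simp
  then have "fscale (- inverse (z i ^ n)) (- fscale (z i ^ n) y) \<in> V" by (rule fv.subspace_scale[OF V(1)])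
  moreover have "fscale (- inverse (z i ^ n)) (- fscale (z i ^ n) y) = y" using nz by (simp add: fscale_def fun_eq_iff)
  ultimately show False using V(3) by simp
 qed
 then show ?thesis unfolding k by simp
qed

text \<open>The eigenvalues of an idempotent on sections are 0 or 1, so its trace counts the ones.
  In characteristic 0 a vanishing trace means there are none; the idempotent is then nilpotent on
  the first block, and the matrix is zero.\<close>

lemma mtr_idempotent:
 fixes A :: "'k::alg_closed_field mat"
 assumes m: "0 < m" and A: "A \<in> carrier_mat m m" and char: "CHAR('k) = 0"
  and idem: "mlin m A * mlin m A = mlin m A" and nz: "mlin m A \<noteq> 0"
 shows "mtr m (mlin m A) \<noteq> 0"
proof
 assume tr0: "mtr m (mlin m A) = 0"
 let ?T = "app (mlin m A)"
 obtain k z where k: "mtr m (mlin m A) = (\<Sum>i<k. z i)"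
  and z: "\<forall>i<k. \<exists>V y. fv.subspace V \<and> fv.invariant ?T V \<and> y \<notin> V \<and> ?T y - fscale (z i) y \<in> V"
  and zero: "(\<forall>i<k. z i = 0) \<longrightarrow> (\<forall>j<m. (?T ^^ k) (delta j) = 0)"
  using mtr_eigenvalues[OF m, of A] by (elim exE conjE) (rule that; assumption)
 have TT: "?T (?T f) = ?T f" for f
  using arg_cong[OF idem, of "\<lambda>x. app x f"] by (simp add: app_simps)
 have z01: "z i = 0 \<or> z i = 1" if i: "i < k" for i
 proof (rule ccontr)
  assume "\<not> ?thesis"
  then have ne: "z i - z i ^ 2 \<noteq> 0" by (simp add: power2_eq_square)
  obtain V y where V: "fv.subspace V" "fv.invariant ?T V" "y \<notin> V" "?T y - fscale (z i) y \<in> V"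
   using z i by blast
  have "(?T ^^ 2) y - fscale (z i ^ 2) y \<in> V" by (rule fv.power_eigen_mod[OF linop_app V(1,2,4)])
  then have "?T y - fscale (z i ^ 2) y \<in> V" by (simp add: numeral_2_eq_2 TT)
  then have "(?T y - fscale (z i ^ 2) y) - (?T y - fscale (z i) y) \<in> V" by (rule fv.subspace_diff[OF V(1) _ V(4)])
  then have "fscale (inverse (z i - z i ^ 2)) ((?T y - fscale (z i ^ 2) y) - (?T y - fscale (z i) y)) \<in> V"
   by (rule fv.subspace_scale[OF V(1)])
  moreover have "fscale (inverse (z i - z i ^ 2)) ((?T y - fscale (z i ^ 2) y) - (?T y - fscale (z i) y))
   = fscale (inverse (z i - z i ^ 2) * (z i - z i ^ 2)) y"
   by (simp add: fscale_def fun_eq_iff algebra_simps)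
  ultimately show False using V(3) ne by simp
 qed
 have "(\<Sum>i<k. z i) = (\<Sum>i<k. if z i = 1 then 1 else 0)" by (rule sum.cong) (use z01 in auto)
 also have "\<dots> = of_nat (card {i \<in> {..<k}. z i = 1})" by (simp add: sum.If_cases Int_def)
 finally have "(of_nat (card {i \<in> {..<k}. z i = 1}) :: 'k) = of_nat 0" using k tr0 by simp
 then have "card {i \<in> {..<k}. z i = 1} = 0" by (rule of_nat_inj_char_0[OF char])
 then have "\<forall>i<k. z i = 0" using z01 by auto
 then have T0: "(?T ^^ k) (delta j) = 0" if "j < m" for j using zero that by blast
 have "?T (delta j) = 0" if j: "j < m" for j
 proof -
  have "(?T ^^ Suc n) f = ?T f" for n f by (induction n) (auto simp: TT)
  then have "?T (delta j) = (?T ^^ Suc k) (delta j)" by simp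
  also have "\<dots> = ?T 0" using T0[OF j] by simp
  also have "\<dots> = 0" by (rule fv.linop_simps(3)[OF linop_app])
  finally show ?thesis .
 qed
 then have "A $$ (i, j) = 0" if "i < m" "j < m" for i j
  using app_mlin_delta[OF that, of A] that by simp
 then have "mlin m A = 0" using m by (intro lin_eqI) (simp add: mlin.rep_eq app_simps)
 then show False using nz by simp
qed

lemma (in K_algebra) prod_mset_dvd_gpoly:
 assumes "finite L" "set_mset A \<subseteq> L"
 shows "(\<Prod>x\<in>#A. [:- x, 1:]) dvd gpoly L ^ size A"
 using assms(2)
proof (induction A)
 case (add x A)
 have "[:- x, 1:] dvd gpoly L" unfolding gpoly_def using assms(1) add.prems by (intro dvd_prodI) auto
 then show ?case using add by (simp del: mult_pCons_left add: mult_dvd_mono)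
qed simp

text \<open>Left multiplication by \<open>x\<close> satisfies a polynomial of degree at most
  \<open>card B0\<close> at 1; it splits, and each root occurs at most that often. The successor
  keeps the bound positive, as \<open>d_pos\<close> requires.\<close>

lemma annihilator_exists:
 fixes sc :: "'k::alg_closed_field \<Rightarrow> 'r::ring_1 \<Rightarrow> 'r"
 assumes "K_algebra sc" and fin: "finite B0" and span: "\<And>n. x ^ n \<in> module.span sc B0"
 shows "\<exists>L. finite L \<and> card L \<le> Suc (card B0) \<and> K_algebra.aev sc (K_algebra.gpoly L ^ Suc (card B0)) x = 0"
proof -
 interpret K_algebra sc by fact
 interpret closed_vector_space sc by unfold_locales (simp_all add: sc_add_right sc_add_left)
 let ?T = "\<lambda>y. x * y"
 have T: "linop ?T" by (simp add: linop_def distrib_left)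
 have Tn: "(?T ^^ n) 1 = x ^ n" for n by (induction n) auto
 obtain p where p: "p \<noteq> 0" "Polynomial.degree p \<le> card B0" "pev p ?T 1 = 0"
  using pev_annihilator[OF T fin, of 1] span unfolding Tn by blast
 have "pev q ?T 1 = aev q x" for q by (induction q) (simp_all add: pev_pCons[OF T])
 then have ax: "aev p x = 0" using p(3) by simp
 obtain A where A: "size A = Polynomial.degree p" "p = Polynomial.smult (lead_coeff p) (\<Prod>x\<in>#A. [:- x, 1:])"
  using alg_closed_imp_factorization[OF p(1)] by blast
 define L where "L = {a. poly p a = 0}"
 have L: "finite L" "card L \<le> Polynomial.degree p"
  unfolding L_def using poly_roots_finite[OF p(1)] card_poly_roots_bound[OF p(1)] by auto
 have "set_mset A \<subseteq> L"
 proof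
  fix a assume a: "a \<in># A"
  have "[:- a, 1:] dvd (\<Prod>x\<in>#A. [:- x, 1:])" by (rule dvd_prod_mset) (use a in auto)
  then have "[:- a, 1:] dvd p" by (subst A(2)) (rule dvd_smult)
  then show "a \<in> L" by (simp add: L_def poly_eq_0_iff_dvd)
 qed
 then have "(\<Prod>x\<in>#A. [:- x, 1:]) dvd gpoly L ^ size A" by (rule prod_mset_dvd_gpoly[OF L(1)])
 also have "\<dots> dvd gpoly L ^ Suc (card B0)" using A(1) p(2) by (intro le_imp_power_dvd) simp
 finally have "p dvd gpoly L ^ Suc (card B0)"
  by (subst A(2)) (use p(1) in \<open>simp add: smult_dvd\<close>)
 then have "aev (gpoly L ^ Suc (card B0)) x = 0" by (rule aev_dvd[OF _ ax])
 then show ?thesis using L p(2) by (intro exI[of _ L]) simp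
qed

subsection \<open>Matrix groups\<close>

text \<open>The left summand indexes the coefficients of the matrix of \<open>v\<close>, the right
  one the products of a coefficient of \<open>v\<close> with a coefficient of its inverse.\<close>

type_synonym idx = "(nat \<times> nat) + (nat \<times> nat) \<times> (nat \<times> nat)"

locale matrix_group = group G for G :: "('a, 'b) monoid_scheme" (structure) +
 fixes M :: "'a \<Rightarrow> 'k::alg_closed_field mat" and m :: nat
 assumes m_pos: "0 < m" and M_carrier: "g \<in> carrier G \<Longrightarrow> M g \<in> carrier_mat m m"
  and M_mult: "\<lbrakk>g \<in> carrier G; h \<in> carrier G\<rbrakk> \<Longrightarrow> M (g \<otimes> h) = M g * M h"
  and M_one: "M \<one> = 1\<^sub>m m" and M_inj: "inj_on M (carrier G)"
  and engel: "g \<in> carrier G \<Longrightarrow> almost_right_engel G g"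
begin

abbreviation P :: "(nat \<times> nat) set" where "P \<equiv> {..<m} \<times> {..<m}"

definition \<rho> :: "'a \<Rightarrow> nat \<times> nat \<Rightarrow> 'k" where
 "\<rho> v p = (if p \<in> P then M v $$ p else 0)"

lemma \<rho>_mult:
 assumes "g \<in> carrier G" "h \<in> carrier G"
 shows "\<rho> (g \<otimes> h) (i, j) = (\<Sum>a<m. \<rho> g (i, a) * \<rho> h (a, j))"
proof (cases "i < m \<and> j < m")
 case True
 then have "\<rho> (g \<otimes> h) (i, j) = (\<Sum>a = 0..<m. M g $$ (i, a) * M h $$ (a, j))"
  using assms M_carrier[of g] M_carrier[of h] by (simp add: \<rho>_def M_mult scalar_prod_def)
 also have "\<dots> = (\<Sum>a<m. \<rho> g (i, a) * \<rho> h (a, j))"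
  by (rule sum.cong) (use True in \<open>auto simp: \<rho>_def\<close>)
 finally show ?thesis .
next
 case False
 then have "\<rho> g (i, a) * \<rho> h (a, j) = 0" for a by (auto simp: \<rho>_def)
 then show ?thesis using False by (auto simp: \<rho>_def)
qed

definition coord :: "'a \<Rightarrow> idx \<Rightarrow> 'k" where
 "coord v t = (case t of Inl p \<Rightarrow> \<rho> v p | Inr (p, q) \<Rightarrow> \<rho> v p * \<rho> (inv v) q)"

text \<open>The linear map on coordinates induced by left translation with \<open>g\<close>. The
  inverse of \<open>g v\<close> is \<open>inv v \<otimes> inv g\<close>, so the coefficients of the
  inverse are multiplied from the opposite side; \<open>ract\<close> is the counterpart for right
  translation.\<close>

definition lact :: "'a \<Rightarrow> (idx \<Rightarrow> 'k) \<Rightarrow> idx \<Rightarrow> 'k" where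
 "lact g f t = (case t of Inl (i, j) \<Rightarrow> \<Sum>a<m. \<rho> g (i, a) * f (Inl (a, j))
   | Inr ((i, j), (k, l)) \<Rightarrow> \<Sum>a<m. \<Sum>b<m. \<rho> g (i, a) * \<rho> (inv g) (b, l) * f (Inr ((a, j), (k, b))))"

definition ract :: "'a \<Rightarrow> (idx \<Rightarrow> 'k) \<Rightarrow> idx \<Rightarrow> 'k" where
 "ract g f t = (case t of Inl (i, j) \<Rightarrow> \<Sum>a<m. \<rho> g (a, j) * f (Inl (i, a))
   | Inr ((i, j), (k, l)) \<Rightarrow> \<Sum>a<m. \<Sum>b<m. \<rho> g (a, j) * \<rho> (inv g) (k, b) * f (Inr ((i, a), (b, l))))"

lemma lact_linear: "Vector_Spaces.linear fscale fscale (lact g)"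
 by unfold_locales (auto simp: fun_eq_iff lact_def fscale_def sum.distrib sum_distrib_left algebra_simps split: sum.split)

lemma ract_linear: "Vector_Spaces.linear fscale fscale (ract g)"
 by unfold_locales (auto simp: fun_eq_iff ract_def fscale_def sum.distrib sum_distrib_left algebra_simps split: sum.split)

lemma coord_lact:
 assumes g: "g \<in> carrier G" and v: "v \<in> carrier G"
 shows "coord (g \<otimes> v) = lact g (coord v)"
proof
 fix t :: idx
 consider i j where "t = Inl (i, j)" | i j k l where "t = Inr ((i, j), (k, l))" by (metis old.prod.exhaust sum.exhaust)
 then show "coord (g \<otimes> v) t = lact g (coord v) t"
 proof cases
  case 1
  then show ?thesis using g v by (simp add: coord_def lact_def \<rho>_mult)
 next
  case 2
  have "coord (g \<otimes> v) t = (\<Sum>a<m. \<rho> g (i, a) * \<rho> v (a, j)) * (\<Sum>b<m. \<rho> (inv v) (k, b) * \<rho> (inv g) (b, l))"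
   using g v 2 by (simp add: coord_def \<rho>_mult inv_mult_group)
  then show ?thesis using 2 by (simp add: coord_def lact_def sum_product mult_ac)
 qed
qed

lemma coord_ract:
 assumes g: "g \<in> carrier G" and v: "v \<in> carrier G"
 shows "coord (v \<otimes> g) = ract g (coord v)"
proof
 fix t :: idx
 consider i j where "t = Inl (i, j)" | i j k l where "t = Inr ((i, j), (k, l))" by (metis old.prod.exhaust sum.exhaust)
 then show "coord (v \<otimes> g) t = ract g (coord v) t"
 proof cases
  case 1
  then show ?thesis using g v by (simp add: coord_def ract_def \<rho>_mult mult.commute)
 next
  case 2
  have "coord (v \<otimes> g) t = (\<Sum>a<m. \<rho> v (i, a) * \<rho> g (a, j)) * (\<Sum>b<m. \<rho> (inv g) (k, b) * \<rho> (inv v) (b, l))"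
   using g v 2 by (simp add: coord_def \<rho>_mult inv_mult_group)
  then show ?thesis using 2 by (simp add: coord_def ract_def sum_product mult_ac)
 qed
qed

definition indices :: "idx set" where
 "indices = Inl ` P \<union> Inr ` (P \<times> P)"

lemma coord_span: "coord ` carrier G \<subseteq> fv.span (delta ` indices)"
proof
 fix f assume "f \<in> coord ` carrier G"
 then obtain v where f: "f = coord v" by blast
 have fin: "finite indices" by (simp add: indices_def)
 have "f = (\<Sum>t\<in>indices. fscale (f t) (delta t))"
  by (rule delta_expand[OF fin]) (auto simp: f coord_def \<rho>_def indices_def image_iff split: sum.splits)
 moreover have "(\<Sum>t\<in>indices. fscale (f t) (delta t)) \<in> fv.span (delta ` indices)"
  by (intro fv.span_sum fv.span_scale fv.span_base) auto
 ultimately show "f \<in> fv.span (delta ` indices)" by simp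
qed

sublocale ts: translation_space G "fscale :: 'k \<Rightarrow> _" coord lact ract "delta ` indices"
proof (intro translation_space.intro translation_space_axioms.intro)
 show "group G" by (rule group_axioms)
 show "vector_space (fscale :: 'k \<Rightarrow> (idx \<Rightarrow> 'k) \<Rightarrow> _)" by unfold_locales
 show "finite (delta ` indices :: (idx \<Rightarrow> 'k) set)" by (simp add: indices_def)
qed (rule coord_span lact_linear ract_linear coord_lact coord_ract; assumption)+

lemma closed_coord:
 assumes "vector_space sm" and T: "finite T"
 shows "ts.closed {v \<in> carrier G. \<forall>l\<in>\<Lambda>. (\<Sum>t\<in>T. sm (coord v t) (w l t)) = (0 :: 'w::ab_group_add)}"
proof -
 interpret sm: vector_space sm by fact
 have "ts.closed {v \<in> carrier G. \<forall>l\<in>(\<lambda>l f. \<Sum>t\<in>T. sm (f t) (w l t)) ` \<Lambda>. l (coord v) = 0}"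
 proof (rule ts.closedI_functionals, clarify, intro conjI allI impI)
  fix l f g
  show "(\<Sum>t\<in>T. sm ((f + g) t) (w l t)) = (\<Sum>t\<in>T. sm (f t) (w l t)) + (\<Sum>t\<in>T. sm (g t) (w l t))"
   by (simp add: sm.scale_left_distrib sum.distrib)
 next
  fix l c f assume "(\<Sum>t\<in>T. sm (f t) (w l t)) = 0"
  moreover have "(\<Sum>t\<in>T. sm (fscale c f t) (w l t)) = sm c (\<Sum>t\<in>T. sm (f t) (w l t))"
   by (simp add: fscale_def sm.scale_sum_right)
  ultimately show "(\<Sum>t\<in>T. sm (fscale c f t) (w l t)) = 0" by simp
 qed
 then show ?thesis by simp
qed

definition \<phi> :: "'a \<Rightarrow> 'k lin" where "\<phi> v = mlin m (M v)"

definition R :: "'k lin set" where "R = mlin m ` carrier_mat m m"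

lemma \<phi>_R: "g \<in> carrier G \<Longrightarrow> \<phi> g \<in> R"
 by (simp add: \<phi>_def R_def M_carrier)

lemma \<phi>_mult: "g \<in> carrier G \<Longrightarrow> h \<in> carrier G \<Longrightarrow> \<phi> (g \<otimes> h) = \<phi> g * \<phi> h"
 by (simp add: \<phi>_def M_mult mlin_mult M_carrier m_pos)

lemma \<phi>_one: "\<phi> \<one> = 1"
 by (simp add: \<phi>_def M_one mlin_one m_pos)

lemma \<phi>_inj: "inj_on \<phi> (carrier G)"
 unfolding \<phi>_def[abs_def] using comp_inj_on[OF M_inj, of "mlin m"] inj_on_subset[OF mlin_inj, of "M ` carrier G" m] M_carrier
 by (auto simp: comp_def)

lemma \<phi>_decomp:
 assumes "v \<in> carrier G"
 shows "\<phi> v = (\<Sum>p\<in>P. lsc (\<rho> v p) (munit m p))"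
 unfolding \<phi>_def mlin_decomp[OF M_carrier[OF assms] m_pos] by (rule sum.cong) (auto simp: \<rho>_def)

lemma munit_R: "munit m p \<in> R"
 by (simp add: munit_def R_def)

lemma R_add: "x \<in> R \<Longrightarrow> y \<in> R \<Longrightarrow> x + y \<in> R"
 by (auto simp: R_def mlin_add[OF _ _ m_pos, symmetric] intro!: imageI)

lemma R_mult: "x \<in> R \<Longrightarrow> y \<in> R \<Longrightarrow> x * y \<in> R"
 by (auto simp: R_def mlin_mult[OF _ _ m_pos, symmetric] intro!: imageI)

lemma R_lsc: "x \<in> R \<Longrightarrow> lsc c x \<in> R"
 by (auto simp: R_def mlin_smult[OF _ m_pos, symmetric] intro!: imageI)

lemma R_one: "1 \<in> R"
 unfolding R_def by (rule image_eqI[of _ _ "1\<^sub>m m"]) (simp_all add: mlin_one m_pos)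

lemma R_zero: "0 \<in> R"
 using R_lsc[OF R_one, of 0] by (simp only: K_algebra.sc_zero_left[OF K_algebra_lsc])

lemma form_decomp:
 assumes add: "\<And>x y. x \<in> R \<Longrightarrow> y \<in> R \<Longrightarrow> l (x + y) = l x + (l y :: 'w::ab_group_add)"
  and scale: "\<And>c x. x \<in> R \<Longrightarrow> l (lsc c x) = sm c (l x)"
  and v: "v \<in> carrier G"
 shows "l (\<phi> v) = (\<Sum>p\<in>P. sm (\<rho> v p) (l (munit m p)))"
proof -
 have l0: "l 0 = 0" using add[OF R_zero R_zero] by simp
 have "l (\<Sum>p\<in>S. lsc (\<rho> v p) (munit m p)) = (\<Sum>p\<in>S. sm (\<rho> v p) (l (munit m p)))
  \<and> (\<Sum>p\<in>S. lsc (\<rho> v p) (munit m p)) \<in> R" if "finite S" for S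
  using that by (induction S rule: finite_induct) (auto simp: l0 R_zero add scale munit_R R_lsc R_add)
 from this[of P] show ?thesis unfolding \<phi>_decomp[OF v] by simp
qed

lemma closed_linear_forms:
 assumes sm: "vector_space sm"
  and add: "\<And>l x y. l \<in> \<Lambda> \<Longrightarrow> x \<in> R \<Longrightarrow> y \<in> R \<Longrightarrow> l (x + y) = l x + (l y :: 'w::ab_group_add)"
  and scale: "\<And>l c x. l \<in> \<Lambda> \<Longrightarrow> x \<in> R \<Longrightarrow> l (lsc c x) = sm c (l x)"
 shows "ts.closed {v \<in> carrier G. \<forall>l\<in>\<Lambda>. l (\<phi> v) = 0}"
proof -
 have cl: "ts.closed {v \<in> carrier G. \<forall>l\<in>\<Lambda>. (\<Sum>t\<in>Inl ` P. sm (coord v t) (case t of Inl p \<Rightarrow> l (munit m p) | Inr _ \<Rightarrow> 0)) = 0}"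
  by (rule closed_coord[OF sm]) simp
 have eq: "(\<Sum>t\<in>Inl ` P. sm (coord v t) (case t of Inl p \<Rightarrow> l (munit m p) | Inr _ \<Rightarrow> 0)) = l (\<phi> v)"
  if "l \<in> \<Lambda>" "v \<in> carrier G" for l v
  using form_decomp[OF add[OF that(1)] scale[OF that(1)] that(2)] by (simp add: sum.reindex coord_def)
 show ?thesis
  by (rule back_subst[of ts.closed, OF cl], rule Collect_cong) (simp only: eq cong: conj_cong ball_cong)
qed

lemma closed_bilinear_forms:
 assumes sm: "vector_space sm"
  and addl: "\<And>l x y z. l \<in> \<Lambda> \<Longrightarrow> x \<in> R \<Longrightarrow> y \<in> R \<Longrightarrow> z \<in> R \<Longrightarrow> l (x + y) z = l x z + (l y z :: 'w::ab_group_add)"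
  and addr: "\<And>l x y z. l \<in> \<Lambda> \<Longrightarrow> x \<in> R \<Longrightarrow> y \<in> R \<Longrightarrow> z \<in> R \<Longrightarrow> l z (x + y) = l z x + l z y"
  and scl: "\<And>l c x y. l \<in> \<Lambda> \<Longrightarrow> x \<in> R \<Longrightarrow> y \<in> R \<Longrightarrow> l (lsc c x) y = sm c (l x y)"
  and scr: "\<And>l c x y. l \<in> \<Lambda> \<Longrightarrow> x \<in> R \<Longrightarrow> y \<in> R \<Longrightarrow> l x (lsc c y) = sm c (l x y)"
 shows "ts.closed {v \<in> carrier G. \<forall>l\<in>\<Lambda>. l (\<phi> v) (\<phi> (inv v)) = 0}"
proof -
 interpret sm: vector_space sm by fact
 have cl: "ts.closed {v \<in> carrier G. \<forall>l\<in>\<Lambda>. (\<Sum>t\<in>Inr ` (P \<times> P). sm (coord v t)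
   (case t of Inl _ \<Rightarrow> 0 | Inr (p, q) \<Rightarrow> l (munit m p) (munit m q))) = 0}"
  by (rule closed_coord[OF sm]) simp
 have eq: "(\<Sum>t\<in>Inr ` (P \<times> P). sm (coord v t) (case t of Inl _ \<Rightarrow> 0 | Inr (p, q) \<Rightarrow> l (munit m p) (munit m q)))
   = l (\<phi> v) (\<phi> (inv v))" if l: "l \<in> \<Lambda>" and v: "v \<in> carrier G" for l v
 proof -
  have v': "\<phi> (inv v) \<in> R" using v by (simp add: \<phi>_R)
  have "l (\<phi> v) (\<phi> (inv v)) = (\<Sum>p\<in>P. sm (\<rho> v p) (l (munit m p) (\<phi> (inv v))))"
   by (rule form_decomp[of "\<lambda>x. l x (\<phi> (inv v))"]) (use addl[OF l] scl[OF l] v v' in auto)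
  also have "\<dots> = (\<Sum>p\<in>P. sm (\<rho> v p) (\<Sum>q\<in>P. sm (\<rho> (inv v) q) (l (munit m p) (munit m q))))"
  proof (rule sum.cong[OF refl])
   fix p
   have "l (munit m p) (\<phi> (inv v)) = (\<Sum>q\<in>P. sm (\<rho> (inv v) q) (l (munit m p) (munit m q)))"
    by (rule form_decomp) (use addr[OF l] scr[OF l] v munit_R in auto)
   then show "sm (\<rho> v p) (l (munit m p) (\<phi> (inv v)))
    = sm (\<rho> v p) (\<Sum>q\<in>P. sm (\<rho> (inv v) q) (l (munit m p) (munit m q)))" by simp
  qed
  also have "\<dots> = (\<Sum>(p, q)\<in>P \<times> P. sm (\<rho> v p * \<rho> (inv v) q) (l (munit m p) (munit m q)))"
   by (simp add: sm.scale_sum_right sum.cartesian_product)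
  finally show ?thesis by (simp add: sum.reindex coord_def case_prod_unfold)
 qed
 show ?thesis
  by (rule back_subst[of ts.closed, OF cl], rule Collect_cong) (simp only: eq cong: conj_cong ball_cong)
qed

lemma vector_space_lsc: "vector_space (lsc :: 'k \<Rightarrow> _)"
proof -
 interpret K_algebra "lsc :: 'k \<Rightarrow> _" by (rule K_algebra_lsc)
 show ?thesis by unfold_locales (simp_all add: sc_add_right sc_add_left)
qed

lemma connected_H0: "connected_subgroup G ts.H0 ts.closed"
proof -
 interpret K_algebra "lsc :: 'k \<Rightarrow> _" by (rule K_algebra_lsc)
 show ?thesis
 proof (intro connected_subgroup.intro connected_subgroup_axioms.intro group_axioms)
  show "ts.H0 \<lhd> G" by (rule ts.H0_normal)
  show "finite (rcosets ts.H0)" by (rule ts.H0_finite_index)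
  show "almost_right_engel G g" if "g \<in> carrier G" for g by (rule engel[OF that])
  show "\<exists>Y\<in>\<A>. ts.H0 \<subseteq> Y" if "finite \<A>" "\<And>Y. Y \<in> \<A> \<Longrightarrow> ts.closed Y" "ts.H0 \<subseteq> \<Union> \<A>" for \<A>
   by (rule ts.H0_irreducible[OF that])
  show "ts.closed {v \<in> carrier G. g \<otimes> v \<in> Y}" if "ts.closed Y" "g \<in> carrier G" for Y g
   by (rule ts.closed_left[OF that])
  show "ts.closed {v \<in> carrier G. h \<otimes> v = v \<otimes> k}" if hk: "h \<in> carrier G" "k \<in> carrier G" for h k
  proof -
   have "ts.closed {v \<in> carrier G. \<forall>l\<in>{\<lambda>x. \<phi> h * x - x * \<phi> k}. l (\<phi> v) = 0}"
    by (rule closed_linear_forms[OF vector_space_lsc]) (auto simp: algebra_simps sc_diff_right)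
   moreover have "\<phi> h * \<phi> v - \<phi> v * \<phi> k = 0 \<longleftrightarrow> h \<otimes> v = v \<otimes> k" if "v \<in> carrier G" for v
    using inj_on_eq_iff[OF \<phi>_inj, of "h \<otimes> v" "v \<otimes> k"] hk that by (simp add: \<phi>_mult)
   ultimately show ?thesis by (simp cong: conj_cong)
  qed
  show "ts.closed {v \<in> carrier G. \<forall>h\<in>Y. comm G h (v \<otimes> x \<otimes> inv v) = s h}"
   if x: "x \<in> carrier G" and Y: "Y \<subseteq> carrier G" "s ` Y \<subseteq> carrier G" for x Y s
  proof -
   \<comment> \<open>For \<open>u = v x v^-1\<close>, the equation \<open>[h, u] = s h\<close> is
     equivalent to \<open>h u = u h (s h)\<close>, which is bilinear in the matrices of
     \<open>v\<close> and of its inverse.\<close>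
   define l where "l h a b = \<phi> h * a * \<phi> x * b - a * \<phi> x * b * (\<phi> h * \<phi> (s h))" for h a b
   have "ts.closed {v \<in> carrier G. \<forall>l\<in>l ` Y. l (\<phi> v) (\<phi> (inv v)) = 0}"
    by (rule closed_bilinear_forms[OF vector_space_lsc]) (auto simp: l_def algebra_simps sc_diff_right)
   moreover have "l h (\<phi> v) (\<phi> (inv v)) = 0 \<longleftrightarrow> comm G h (v \<otimes> x \<otimes> inv v) = s h"
    if h: "h \<in> Y" and v: "v \<in> carrier G" for h v
   proof -
    have G: "h \<in> carrier G" "s h \<in> carrier G" using Y h by auto
    define u where "u = v \<otimes> x \<otimes> inv v"
    have u: "u \<in> carrier G" using v x by (simp add: u_def)
    have "\<phi> h * \<phi> v * \<phi> x * \<phi> (inv v) = \<phi> (h \<otimes> u)" using G v x by (simp add: u_def \<phi>_mult mult.assoc)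
    moreover have "\<phi> v * \<phi> x * \<phi> (inv v) * (\<phi> h * \<phi> (s h)) = \<phi> (u \<otimes> (h \<otimes> s h))"
     using G v x by (simp add: u_def \<phi>_mult mult.assoc)
    ultimately have "l h (\<phi> v) (\<phi> (inv v)) = 0 \<longleftrightarrow> h \<otimes> u = u \<otimes> (h \<otimes> s h)"
     using inj_on_eq_iff[OF \<phi>_inj, of "h \<otimes> u" "u \<otimes> (h \<otimes> s h)"] G u by (simp add: l_def)
    also have "\<dots> \<longleftrightarrow> comm G h u = s h"
    proof -
     have "u \<otimes> (h \<otimes> comm G h u) = h \<otimes> u"
      using G u unfolding comm_def by (simp add: m_assoc[symmetric])
     moreover have "comm G h u \<in> carrier G" using G u by (simp add: comm_def)
     ultimately show ?thesis using G u by (metis l_cancel m_closed)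
    qed
    finally show ?thesis by (simp add: u_def)
   qed
   ultimately show ?thesis by (simp cong: conj_cong ball_cong)
  qed
 qed
qed

theorem finite_by_hypercentral: "\<exists>N. N \<lhd> G \<and> finite N \<and> hypercentral (G Mod N)"
proof -
 interpret A: K_algebra "lsc :: 'k \<Rightarrow> _" by (rule K_algebra_lsc)
 interpret C: connected_subgroup G ts.H0 ts.closed by (rule connected_H0)
 interpret vs: vector_space "lsc :: 'k \<Rightarrow> _" by (rule vector_space_lsc)
 define B0 where "B0 = (munit m ` P :: 'k lin set)"
 have fin: "finite B0" by (simp add: B0_def)
 have span: "R \<subseteq> vs.span B0"
 proof
  fix x assume "x \<in> R"
  then obtain A where A: "A \<in> carrier_mat m m" "x = mlin m A" by (auto simp: R_def)
  show "x \<in> vs.span B0" unfolding A(2) mlin_decomp[OF A(1) m_pos]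
   by (intro vs.span_sum vs.span_scale vs.span_base) (auto simp: B0_def)
 qed
 interpret F: fd_algebra "lsc :: 'k \<Rightarrow> _" R "Suc (card B0)"
 proof unfold_locales
  fix x assume x: "x \<in> R"
  have "x ^ n \<in> R" for n by (induction n) (auto simp: R_one R_mult x)
  then show "\<exists>L. finite L \<and> card L \<le> Suc (card B0) \<and> A.aev (A.gpoly L ^ Suc (card B0)) x = 0"
   using span by (intro annihilator_exists[OF K_algebra_lsc fin]) blast
 qed (auto simp: R_one R_add R_mult R_lsc)
 interpret T: traced_algebra "lsc :: 'k \<Rightarrow> _" R "Suc (card B0)" "mtr m"
 proof unfold_locales
  show "mtr m (x + y) = mtr m x + mtr m y" for x y :: "'k lin" by (simp add: mtr_def app_simps sum.distrib)
  show "mtr m (lsc c x) = c * mtr m x" for c and x :: "'k lin" by (simp add: mtr_def lsc.rep_eq sum_distrib_left)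
  show "mtr m x = 0" if "x \<in> R" "x ^ n = 0" for x n
   using that mtr_nilpotent[OF m_pos] by (auto simp: R_def)
  show "mtr m x \<noteq> 0" if "CHAR('k) = 0" "x \<in> R" "x * x = x" "x \<noteq> 0" for x
   using that mtr_idempotent[OF m_pos] by (auto simp: R_def)
 qed
 interpret linear_bilinear G ts.H0 ts.closed "lsc :: 'k \<Rightarrow> _" R "Suc (card B0)" "mtr m" \<phi> B0
 proof unfold_locales
  show "ts.closed {v \<in> carrier G. \<forall>l\<in>\<Lambda>. l (\<phi> v) = 0}"
   if "\<And>l. l \<in> \<Lambda> \<Longrightarrow> (\<forall>x y. l (x + y) = l x + l y) \<and> (\<forall>c x. l (lsc c x) = lsc c (l x))" for \<Lambda> :: "('k lin \<Rightarrow> 'k lin) set"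
   by (rule closed_linear_forms[OF vector_space_lsc]) (use that in auto)
  show "ts.closed {v \<in> carrier G. l (\<phi> v) (\<phi> (inv v)) = 0}"
   if l: "\<And>x y z. \<lbrakk>x \<in> R; y \<in> R; z \<in> R\<rbrakk> \<Longrightarrow> l (x + y) z = l x z + l y z"
    "\<And>x y z. \<lbrakk>x \<in> R; y \<in> R; z \<in> R\<rbrakk> \<Longrightarrow> l z (x + y) = l z x + l z y"
    "\<And>c x y. \<lbrakk>x \<in> R; y \<in> R\<rbrakk> \<Longrightarrow> l (lsc c x) y = c * l x y"
    "\<And>c x y. \<lbrakk>x \<in> R; y \<in> R\<rbrakk> \<Longrightarrow> l x (lsc c y) = c * l x y" for l :: "'k lin \<Rightarrow> 'k lin \<Rightarrow> 'k"
  proof -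
   have "vector_space ((*) :: 'k \<Rightarrow> 'k \<Rightarrow> 'k)" by unfold_locales (simp_all add: algebra_simps)
   then have "ts.closed {v \<in> carrier G. \<forall>l\<in>{l}. l (\<phi> v) (\<phi> (inv v)) = 0}"
    by (rule closed_bilinear_forms) (use l in auto)
   then show ?thesis by simp
  qed
 qed (use fin span \<phi>_mult \<phi>_one \<phi>_R \<phi>_inj in auto)
 show ?thesis by (rule finite_by_hypercentral)
qed

end

section \<open>The general linear group and extension of scalars to the algebraic closure\<close>

lemma group_GL: "group (GL m)"
proof (rule groupI)
 fix A B C :: "'a mat"
 assume A: "A \<in> carrier (GL m)"
 then have Am: "A \<in> carrier_mat m m" by (simp add: GL_def)
 obtain A' where A': "A * A' = 1\<^sub>m m" "A' * A = 1\<^sub>m (dim_row A')"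
  using A by (auto simp: GL_def invertible_mat_def inverts_mat_def)
 have A'm: "A' \<in> carrier_mat m m"
  using A' Am by (metis carrier_matD(2) carrier_matI index_mult_mat(3) index_one_mat(3))
 have "invertible_mat A'"
  unfolding invertible_mat_def inverts_mat_def using A' A'm Am by (auto intro!: exI[of _ A])
 then show "\<exists>B\<in>carrier (GL m). B \<otimes>\<^bsub>GL m\<^esub> A = \<one>\<^bsub>GL m\<^esub>"
  using A' A'm by (auto simp: GL_def intro!: bexI[of _ A'])
 show "\<one>\<^bsub>GL m\<^esub> \<otimes>\<^bsub>GL m\<^esub> A = A" using Am by (simp add: GL_def)
 assume B: "B \<in> carrier (GL m)"
 then have Bm: "B \<in> carrier_mat m m" by (simp add: GL_def)
 obtain B' where B': "B * B' = 1\<^sub>m m" "B' * B = 1\<^sub>m (dim_row B')"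
  using B by (auto simp: GL_def invertible_mat_def inverts_mat_def)
 have B'm: "B' \<in> carrier_mat m m"
  using B' Bm by (metis carrier_matD(2) carrier_matI index_mult_mat(3) index_one_mat(3))
 have A'A: "A' * A = 1\<^sub>m m" "B' * B = 1\<^sub>m m" using A' B' A'm B'm by auto
 have 1: "A * B * (B' * A') = 1\<^sub>m m"
  unfolding assoc_mult_mat[OF Am Bm mult_carrier_mat[OF B'm A'm]] assoc_mult_mat[OF Bm B'm A'm, symmetric] B'(1)
  using A'm A'(1) by simp
 have 2: "B' * A' * (A * B) = 1\<^sub>m m"
  unfolding assoc_mult_mat[OF B'm A'm mult_carrier_mat[OF Am Bm]] assoc_mult_mat[OF A'm Am Bm, symmetric] A'A(1)
  using Bm A'A(2) by simp
 have "invertible_mat (A * B)" unfolding invertible_mat_def inverts_mat_def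
  using 1 2 Am Bm A'm B'm by (auto intro!: exI[of _ "B' * A'"])
 then show "A \<otimes>\<^bsub>GL m\<^esub> B \<in> carrier (GL m)" using Am Bm by (simp add: GL_def)
 assume "C \<in> carrier (GL m)"
 then have "C \<in> carrier_mat m m" by (simp add: GL_def)
 then show "A \<otimes>\<^bsub>GL m\<^esub> B \<otimes>\<^bsub>GL m\<^esub> C = A \<otimes>\<^bsub>GL m\<^esub> (B \<otimes>\<^bsub>GL m\<^esub> C)"
  using Am Bm by (simp add: GL_def assoc_mult_mat)
next
 have "invertible_mat (1\<^sub>m m :: 'a mat)"
  unfolding invertible_mat_def inverts_mat_def by (auto intro!: exI[of _ "1\<^sub>m m"])
 then show "\<one>\<^bsub>GL m\<^esub> \<in> carrier (GL m :: 'a mat monoid)" by (simp add: GL_def)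
qed

lemma map_mat_to_ac_mult:
 assumes "A \<in> carrier_mat m m" "B \<in> carrier_mat m m"
 shows "map_mat to_ac (A * B) = map_mat to_ac A * map_mat to_ac B"
 using assms by (intro eq_matI) (auto simp: scalar_prod_def to_ac_sum)

lemma inj_map_mat_to_ac: "inj (map_mat to_ac)"
proof (rule injI)
 fix A B :: "'a mat" assume eq: "map_mat to_ac A = map_mat to_ac B"
 have d: "dim_row A = dim_row B" "dim_col A = dim_col B"
  using arg_cong[OF eq, of dim_row] arg_cong[OF eq, of dim_col] by simp_all
 have "to_ac (A $$ (i, j)) = to_ac (B $$ (i, j))" if "i < dim_row B" "j < dim_col B" for i j
  using arg_cong[OF eq, of "\<lambda>C. C $$ (i, j)"] that d by simp
 then show "A = B" using d by (intro eq_matI) auto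
qed

theorem theorem1p1:
  fixes G :: "('a::field) mat set" and m :: nat
  assumes "0 < m"
    and "subgroup G (GL m)"
    and "\<forall>g \<in> G. almost_right_engel ((GL m)\<lparr>carrier := G\<rparr>) g"
  shows "\<exists>N. N \<lhd> (GL m)\<lparr>carrier := G\<rparr> \<and> finite N \<and>
             hypercentral (((GL m)\<lparr>carrier := G\<rparr>) Mod N)"
proof -
  interpret GL: group "GL m :: 'a mat monoid" by (rule group_GL)
  have GG: "g \<in> carrier_mat m m" if "g \<in> G" for g
    using subgroup.subset[OF assms(2)] that by (auto simp: GL_def)
  have grp: "group ((GL m)\<lparr>carrier := G\<rparr>)"
    by (rule subgroup.subgroup_is_group[OF assms(2) GL.group_axioms])
  \<comment> \<open>Eigenvalues call for an algebraically closed field. Extending scalars entrywise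
    changes the matrices but not the abstract group, so the sinks are unaffected.\<close>
  have "matrix_group ((GL m)\<lparr>carrier := G\<rparr>) (map_mat to_ac) m"
    unfolding matrix_group_def matrix_group_axioms_def
  proof (intro conjI grp allI impI)
    show "map_mat to_ac (g \<otimes>\<^bsub>(GL m)\<lparr>carrier := G\<rparr>\<^esub> h) = map_mat to_ac g * map_mat to_ac h"
      if "g \<in> carrier ((GL m)\<lparr>carrier := G\<rparr>)" "h \<in> carrier ((GL m)\<lparr>carrier := G\<rparr>)" for g h
      using that map_mat_to_ac_mult[OF GG GG] by (simp add: GL_def)
    show "map_mat to_ac \<one>\<^bsub>(GL m)\<lparr>carrier := G\<rparr>\<^esub> = 1\<^sub>m m"
      by (rule eq_matI) (auto simp: GL_def)
    show "inj_on (map_mat to_ac) (carrier ((GL m)\<lparr>carrier := G\<rparr>))"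
      by (rule inj_on_subset[OF inj_map_mat_to_ac]) simp
  qed (use assms(1,3) GG in auto)
  then show ?thesis by (rule matrix_group.finite_by_hypercentral)
qed

end
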